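(* Let $(M,g,I,J,K)$ be a strong HKT manifold with closed three-form $H$, and set $\nabla^-=\nabla^L-\frac12g^{-1}H$. Let $K'\in\mathcal{T}=\mathcal{T}(TM,g)$ and let $X_i\in T_{K'}\mathcal{T}$ with $\pi_*X_i=v_i$, $i\in\{1,2,3\}$. Then: 1) $d^cw^{(\nabla^-,I)}(X_1,X_2,X_3)=d^cw^{(\nabla^-,J)}(X_1,X_2,X_3)=d^cw^{(\nabla^-,K)}(X_1,X_2,X_3)$; 2) $d^cw^{(\nabla^-,I)}(X_1,X_2,X_3)=\big\{\mathrm{tr}\big([R^{\nabla^-}(v_1,v_2),K']\,P^{\nabla^-}(X_3)\big)+\mathrm{cyclic}(1,2,3)\big\}-H(v_1,v_2,v_3)$.
   Context: $(M,g,I,J,K)$ is a strong HKT (hyperkähler with torsion) manifold if $g$ is a Riemannian metric and $I,J,K$ are $g$-compatible (integrable) complex structures with $IJ+JI=0$, $K=IJ$, and $\nabla^+I=\nabla^+J=\nabla^+K=0$, where $\nabla^+=\nabla^L+\frac12g^{-1}H$, $\nabla^L$ is the Levi-Civita connection, and $H$ is a closed three-form. Here $g(g^{-1}H_vw,u)=H(v,w,u)$. $\mathcal{T}=\mathcal{T}(TM,g)=\{L\in\mathrm{End}\,TM:L^2=-1,\ g(L\cdot,L\cdot)=g(\cdot,\cdot)\}$ with projection $\pi$ to $M$. Given a connection $\nabla$ on $TM$ with $\nabla g=0$ and a complex structure $I'$ on $M$, $T_L\mathcal{T}=V_L\mathcal{T}\oplus H^\nabla_L\mathcal{T}$, where $V_L\mathcal{T}=\{A\in\mathfrak{o}(T_{\pi(L)}M,g):AL+LA=0\}$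 is the vertical space and $H^\nabla_L\mathcal{T}$ is the set of velocities at $t=0$ of $\nabla$-parallel translates of $L$ along curves in $M$ starting at $\pi(L)$; $v^\nabla$ denotes the horizontal lift of $v\in T_{\pi(L)}M$, and $P^\nabla:T\mathcal{T}\to V\mathcal{T}$ is the projection along $H^\nabla\mathcal{T}$. $\mathcal{J}^{(\nabla,I')}$ is the almost complex structure on $\mathcal{T}$ defined by $\mathcal{J}^{(\nabla,I')}A=LA$ for $A\in V_L\mathcal{T}$ and $\mathcal{J}^{(\nabla,I')}v^\nabla=(I'v)^\nabla$. The metric $g^\nabla=-\mathrm{tr}\oplus\pi^*g$ on $\mathcal{T}$ makes $V\mathcal{T}$ and $H^\nabla\mathcal{T}$ orthogonal, equals $-\mathrm{tr}(AB)$ on $A,B\in V_L\mathcal{T}$, and equals $\pi^*g$ on $H^\nabla\mathcal{T}$. The fundamental form is $w^{(\nabla,I')}(\cdot,\cdot)=g^\nabla(\mathcal{J}^{(\nabla,I')}\cdot,\cdot)$, and $d^c$ in $d^cw^{(\nabla,I')}$ is with respect to $\mathcal{J}^{(\nabla,I')}$: $$d^cw^{(\nabla,I')}(\cdot,\cdot,\cdot)=-dw^{(\nabla,I')}(\mathcal{J}^{(\nabla,I')}\cdot,\mathcal{J}^{(\nabla,I')}\cdot,\mathcal{J}^{(\nabla,I')}\cdot).$$ $R^\nabla(X,Y)=\nabla_X\nabla_Y-\nabla_Y\nabla_X-\nabla_{[X,Y]}$. *)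

theory Defs
  imports "HOL-Analysis.Analysis" "HOL-Library.Function_Algebras"
begin

section \<open>Smooth maps between Euclidean spaces\<close>

text \<open>Used on open sets and finite-dimensional spaces only, where it is the usual C^k notion.\<close>

primrec Ck_on :: "nat \<Rightarrow> 'a set \<Rightarrow> ('a::real_normed_vector \<Rightarrow> 'b::real_normed_vector) \<Rightarrow> bool" where
  "Ck_on 0 S f \<longleftrightarrow> continuous_on S f"
| "Ck_on (Suc k) S f \<longleftrightarrow>
     (\<forall>x\<in>S. f differentiable (at x)) \<and> (\<forall>v. Ck_on k S (\<lambda>x. frechet_derivative f (at x) v))"

definition smooth_on :: "'a set \<Rightarrow> ('a::real_normed_vector \<Rightarrow> 'b::real_normed_vector) \<Rightarrow> bool" where
  "smooth_on S f \<longleftrightarrow> (\<forall>k. Ck_on k S f)"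


section \<open>Manifolds\<close>

text \<open>A chart is a pair of its domain and its coordinate map; values of the map outside the
  domain are irrelevant. A manifold is given by a smooth atlas, not necessarily maximal; its point
  set is the union of the chart domains and its topology is the one induced by the charts.\<close>

type_synonym ('a, 'e) chart = "'a set \<times> ('a \<Rightarrow> 'e)"

abbreviation cdom :: "('a, 'e) chart \<Rightarrow> 'a set" where "cdom c \<equiv> fst c"
abbreviation cmap :: "('a, 'e) chart \<Rightarrow> 'a \<Rightarrow> 'e" where "cmap c \<equiv> snd c"
abbreviation cinv :: "('a, 'e) chart \<Rightarrow> 'e \<Rightarrow> 'a" where "cinv c \<equiv> inv_into (fst c) (snd c)"

definition carrier_of :: "('a, 'e) chart set \<Rightarrow> 'a set" where
  "carrier_of A = (\<Union>c\<in>A. cdom c)"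

definition chart_topology :: "('a, 'e::euclidean_space) chart set \<Rightarrow> 'a topology" where
  "chart_topology A =
     topology (\<lambda>S. S \<subseteq> carrier_of A \<and> (\<forall>c\<in>A. open (cmap c ` (S \<inter> cdom c))))"

definition smooth_manifold :: "('a, 'e::euclidean_space) chart set \<Rightarrow> bool" where
  "smooth_manifold A \<longleftrightarrow>
     (\<forall>c\<in>A. inj_on (cmap c) (cdom c)) \<and>
     (\<forall>c\<in>A. \<forall>d\<in>A. open (cmap c ` (cdom c \<inter> cdom d)) \<and>
        smooth_on (cmap c ` (cdom c \<inter> cdom d)) (cmap d \<circ> cinv c)) \<and>
     Hausdorff_space (chart_topology A) \<and> second_countable (chart_topology A)"

text \<open>An arbitrary chart around a point, for notions that do not depend on this choice.\<close>

definition chart_at :: "('a, 'e) chart set \<Rightarrow> 'a \<Rightarrow> ('a, 'e) chart" where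
  "chart_at A p = (SOME c. c \<in> A \<and> p \<in> cdom c)"

text \<open>A tangent vector at \<open>p\<close> is the family of its components in all charts around \<open>p\<close>, subject to
  the usual transformation law, and by convention 0 at all other charts.
  Addition is the pointwise one.\<close>

type_synonym ('a, 'e) tvec = "('a, 'e) chart \<Rightarrow> 'e"

definition tangent_space :: "('a, 'e::euclidean_space) chart set \<Rightarrow> 'a \<Rightarrow> ('a, 'e) tvec set" where
  "tangent_space A p = {v.
     (\<forall>c\<in>A. \<forall>d\<in>A. p \<in> cdom c \<longrightarrow> p \<in> cdom d \<longrightarrow>
        v d = frechet_derivative (cmap d \<circ> cinv c) (at (cmap c p)) (v c)) \<and>
     (\<forall>c. \<not> (c \<in> A \<and> p \<in> cdom c) \<longrightarrow> v c = 0)}"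

definition tscale :: "real \<Rightarrow> ('a, 'e::real_vector) tvec \<Rightarrow> ('a, 'e) tvec" where
  "tscale r v = (\<lambda>c. r *\<^sub>R v c)"

text \<open>The local vector field on \<open>cdom c\<close> with constant components \<open>x\<close> in the chart \<open>c\<close>.\<close>

definition coord_field ::
  "('a, 'e::euclidean_space) chart set \<Rightarrow> ('a, 'e) chart \<Rightarrow> 'e \<Rightarrow> 'a \<Rightarrow> ('a, 'e) tvec" where
  "coord_field A c x p =
     (\<lambda>d. if d \<in> A \<and> p \<in> cdom d
          then frechet_derivative (cmap d \<circ> cinv c) (at (cmap c p)) x else 0)"

definition smooth_fun ::
  "('a, 'e::euclidean_space) chart set \<Rightarrow> 'a set \<Rightarrow> ('a \<Rightarrow> real) \<Rightarrow> bool" where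
  "smooth_fun A U f \<longleftrightarrow> (\<forall>c\<in>A. smooth_on (cmap c ` (U \<inter> cdom c)) (f \<circ> cinv c))"

definition smooth_field ::
  "('a, 'e::euclidean_space) chart set \<Rightarrow> 'a set \<Rightarrow> ('a \<Rightarrow> ('a, 'e) tvec) \<Rightarrow> bool" where
  "smooth_field A U X \<longleftrightarrow> (\<forall>p\<in>U. X p \<in> tangent_space A p) \<and>
     (\<forall>c\<in>A. smooth_on (cmap c ` (U \<inter> cdom c)) (\<lambda>z. X (cinv c z) c))"

definition dir_deriv ::
  "('a, 'e::euclidean_space) chart set \<Rightarrow> 'a \<Rightarrow> ('a, 'e) tvec \<Rightarrow> ('a \<Rightarrow> real) \<Rightarrow> real" where
  "dir_deriv A p v f =
     (let c = chart_at A p in frechet_derivative (f \<circ> cinv c) (at (cmap c p)) (v c))"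

definition pushforward ::
  "('a, 'e::euclidean_space) chart set \<Rightarrow> ('b, 'f::euclidean_space) chart set \<Rightarrow> ('a \<Rightarrow> 'b) \<Rightarrow> 'a \<Rightarrow>
     ('a, 'e) tvec \<Rightarrow> ('b, 'f) tvec" where
  "pushforward A B f p v = (\<lambda>d. if d \<in> B \<and> f p \<in> cdom d
     then (let c = chart_at A p in frechet_derivative (cmap d \<circ> f \<circ> cinv c) (at (cmap c p)) (v c))
     else 0)"

definition lie_bracket ::
  "('a, 'e::euclidean_space) chart set \<Rightarrow> ('a \<Rightarrow> ('a, 'e) tvec) \<Rightarrow> ('a \<Rightarrow> ('a, 'e) tvec) \<Rightarrow>
     'a \<Rightarrow> ('a, 'e) tvec" where
  "lie_bracket A X Y p = (\<lambda>c. if c \<in> A \<and> p \<in> cdom c then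
       frechet_derivative (\<lambda>z. Y (cinv c z) c) (at (cmap c p)) (X p c)
     - frechet_derivative (\<lambda>z. X (cinv c z) c) (at (cmap c p)) (Y p c) else 0)"

definition smooth_curve :: "('a, 'e::euclidean_space) chart set \<Rightarrow> real \<Rightarrow> (real \<Rightarrow> 'a) \<Rightarrow> bool" where
  "smooth_curve A \<epsilon> \<gamma> \<longleftrightarrow> \<epsilon> > 0 \<and> (\<forall>t\<in>{-\<epsilon><..<\<epsilon>}. \<gamma> t \<in> carrier_of A) \<and>
     (\<forall>c\<in>A. open {t\<in>{-\<epsilon><..<\<epsilon>}. \<gamma> t \<in> cdom c} \<and>
        smooth_on {t\<in>{-\<epsilon><..<\<epsilon>}. \<gamma> t \<in> cdom c} (cmap c \<circ> \<gamma>))"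

definition velocity ::
  "('a, 'e::euclidean_space) chart set \<Rightarrow> (real \<Rightarrow> 'a) \<Rightarrow> real \<Rightarrow> ('a, 'e) tvec" where
  "velocity A \<gamma> t =
     (\<lambda>c. if c \<in> A \<and> \<gamma> t \<in> cdom c then vector_derivative (cmap c \<circ> \<gamma>) (at t) else 0)"


section \<open>Differential forms\<close>

text \<open>A k-form takes a point and a list of k tangent vectors. The exterior derivative carries no
  normalising factor: \<open>d\<omega>(v\<^sub>0,\<dots>,v\<^sub>k) = \<Sum>\<^sub>i (-1)\<^sup>i \<partial>\<^bsub>v\<^sub>i\<^esub> \<omega>(\<dots>,v\<^sub>i omitted,\<dots>)\<close> in coordinates.\<close>

definition diff_form ::
  "('a, 'e::euclidean_space) chart set \<Rightarrow> nat \<Rightarrow> 'a set \<Rightarrow> ('a \<Rightarrow> ('a, 'e) tvec list \<Rightarrow> real) \<Rightarrow> bool"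
  where
  "diff_form A k U \<omega> \<longleftrightarrow>
     (\<forall>p\<in>U. \<forall>vs. length vs = k \<and> set vs \<subseteq> tangent_space A p \<longrightarrow>
        (\<forall>i<k. \<forall>u\<in>tangent_space A p. \<forall>v\<in>tangent_space A p. \<forall>a b.
           \<omega> p (vs[i := tscale a u + tscale b v]) = a * \<omega> p (vs[i := u]) + b * \<omega> p (vs[i := v])) \<and>
        (\<not> distinct vs \<longrightarrow> \<omega> p vs = 0)) \<and>
     (\<forall>c\<in>A. \<forall>xs. length xs = k \<longrightarrow>
        smooth_fun A (U \<inter> cdom c) (\<lambda>p. \<omega> p (map (\<lambda>x. coord_field A c x p) xs)))"

definition ext_deriv ::
  "('a, 'e::euclidean_space) chart set \<Rightarrow> ('a \<Rightarrow> ('a, 'e) tvec list \<Rightarrow> real) \<Rightarrow>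
     'a \<Rightarrow> ('a, 'e) tvec list \<Rightarrow> real" where
  "ext_deriv A \<omega> p vs = (let c = chart_at A p in
     \<Sum>i<length vs. (-1) ^ i *
       dir_deriv A p (vs ! i)
         (\<lambda>q. \<omega> q (map (\<lambda>v. coord_field A c (v c) q) (take i vs @ drop (Suc i) vs))))"

definition closed_form ::
  "('a, 'e::euclidean_space) chart set \<Rightarrow> nat \<Rightarrow> ('a \<Rightarrow> ('a, 'e) tvec list \<Rightarrow> real) \<Rightarrow> bool" where
  "closed_form A k \<omega> \<longleftrightarrow> (\<forall>p\<in>carrier_of A. \<forall>vs. length vs = Suc k \<and> set vs \<subseteq> tangent_space A p \<longrightarrow>
     ext_deriv A \<omega> p vs = 0)"

text \<open>For a submanifold \<open>N\<close> of the manifold with atlas \<open>A\<close>, tangent vectors to \<open>N\<close> are the velocities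
  of curves in \<open>N\<close>. A form on \<open>N\<close> is smooth iff near each point it is the restriction of a smooth
  form \<open>\<eta>\<close> on an open subset of the ambient manifold, and its exterior derivative is then the
  restriction of \<open>d\<eta>\<close>, independently of \<open>\<eta>\<close>.\<close>

definition tangent_sub ::
  "('a, 'e::euclidean_space) chart set \<Rightarrow> 'a set \<Rightarrow> 'a \<Rightarrow> ('a, 'e) tvec set" where
  "tangent_sub A N q = {velocity A \<gamma> 0 | \<gamma> \<epsilon>.
     smooth_curve A \<epsilon> \<gamma> \<and> (\<forall>t\<in>{-\<epsilon><..<\<epsilon>}. \<gamma> t \<in> N) \<and> \<gamma> 0 = q}"

definition sub_ext_deriv ::
  "('a, 'e::euclidean_space) chart set \<Rightarrow> 'a set \<Rightarrow> nat \<Rightarrow> ('a \<Rightarrow> ('a, 'e) tvec list \<Rightarrow> real) \<Rightarrow>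
     'a \<Rightarrow> ('a, 'e) tvec list \<Rightarrow> real" where
  "sub_ext_deriv A N k \<omega> q vs = (THE r. \<exists>U \<eta>.
     openin (chart_topology A) U \<and> q \<in> U \<and> diff_form A k U \<eta> \<and>
     (\<forall>q'\<in>U \<inter> N. \<forall>ws. length ws = k \<and> set ws \<subseteq> tangent_sub A N q' \<longrightarrow> \<eta> q' ws = \<omega> q' ws) \<and>
     r = ext_deriv A \<eta> q vs)"


section \<open>Endomorphisms, metrics and connections\<close>

text \<open>Endomorphisms of a tangent space vanish by convention outside of it, so that equality of
  endomorphisms is equality of functions.\<close>

type_synonym ('a, 'e) tend = "('a, 'e) tvec \<Rightarrow> ('a, 'e) tvec"

definition tangent_end :: "('a, 'e::euclidean_space) chart set \<Rightarrow> 'a \<Rightarrow> ('a, 'e) tend set" where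
  "tangent_end A p = {L.
     (\<forall>v\<in>tangent_space A p. L v \<in> tangent_space A p) \<and>
     (\<forall>u\<in>tangent_space A p. \<forall>v\<in>tangent_space A p. \<forall>a b.
        L (tscale a u + tscale b v) = tscale a (L u) + tscale b (L v)) \<and>
     (\<forall>v. v \<notin> tangent_space A p \<longrightarrow> L v = 0)}"

definition end_field :: "('a, 'e::euclidean_space) chart set \<Rightarrow> ('a \<Rightarrow> ('a, 'e) tend) \<Rightarrow> bool" where
  "end_field A I \<longleftrightarrow> (\<forall>p\<in>carrier_of A. I p \<in> tangent_end A p) \<and>
     (\<forall>c\<in>A. \<forall>x. smooth_field A (cdom c) (\<lambda>p. I p (coord_field A c x p)))"

definition riemannian_metric ::
  "('a, 'e::euclidean_space) chart set \<Rightarrow> ('a \<Rightarrow> ('a, 'e) tvec \<Rightarrow> ('a, 'e) tvec \<Rightarrow> real) \<Rightarrow> bool" where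
  "riemannian_metric A g \<longleftrightarrow>
     (\<forall>p\<in>carrier_of A. \<forall>u\<in>tangent_space A p. \<forall>v\<in>tangent_space A p.
        g p u v = g p v u \<and> (u \<noteq> 0 \<longrightarrow> g p u u > 0) \<and>
        (\<forall>w\<in>tangent_space A p. \<forall>a b.
           g p (tscale a u + tscale b v) w = a * g p u w + b * g p v w)) \<and>
     (\<forall>c\<in>A. \<forall>x y. smooth_fun A (cdom c) (\<lambda>p. g p (coord_field A c x p) (coord_field A c y p)))"

text \<open>A connection on the tangent bundle is a covariant derivative: \<open>D p v Y\<close> is the derivative at
  \<open>p\<close>, in direction \<open>v\<close>, of a vector field \<open>Y\<close> defined and smooth near \<open>p\<close>.\<close>

type_synonym ('a, 'e) conn = "'a \<Rightarrow> ('a, 'e) tvec \<Rightarrow> ('a \<Rightarrow> ('a, 'e) tvec) \<Rightarrow> ('a, 'e) tvec"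

definition connection :: "('a, 'e::euclidean_space) chart set \<Rightarrow> ('a, 'e) conn \<Rightarrow> bool" where
  "connection A D \<longleftrightarrow> (\<forall>U Y. openin (chart_topology A) U \<and> smooth_field A U Y \<longrightarrow>
     (\<forall>p\<in>U. \<forall>v\<in>tangent_space A p.
        D p v Y \<in> tangent_space A p \<and>
        (\<forall>u\<in>tangent_space A p. \<forall>a b.
           D p (tscale a u + tscale b v) Y = tscale a (D p u Y) + tscale b (D p v Y)) \<and>
        (\<forall>Z. smooth_field A U Z \<longrightarrow> D p v (\<lambda>q. Y q + Z q) = D p v Y + D p v Z) \<and>
        (\<forall>f. smooth_fun A U f \<longrightarrow>
           D p v (\<lambda>q. tscale (f q) (Y q)) = tscale (dir_deriv A p v f) (Y p) + tscale (f p) (D p v Y)) \<and>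
        (\<forall>Z. (\<forall>q\<in>U. Z q = Y q) \<longrightarrow> D p v Z = D p v Y)) \<and>
     (\<forall>X. smooth_field A U X \<longrightarrow> smooth_field A U (\<lambda>p. D p (X p) Y)))"

definition levi_civita ::
  "('a, 'e::euclidean_space) chart set \<Rightarrow> ('a \<Rightarrow> ('a, 'e) tvec \<Rightarrow> ('a, 'e) tvec \<Rightarrow> real) \<Rightarrow>
     ('a, 'e) conn \<Rightarrow> bool" where
  "levi_civita A g D \<longleftrightarrow> connection A D \<and>
     (\<forall>U X Y. openin (chart_topology A) U \<and> smooth_field A U X \<and> smooth_field A U Y \<longrightarrow>
        (\<forall>p\<in>U. D p (X p) Y - D p (Y p) X = lie_bracket A X Y p \<and>
           (\<forall>v\<in>tangent_space A p.
              dir_deriv A p v (\<lambda>q. g q (X q) (Y q)) = g p (D p v X) (Y p) + g p (X p) (D p v Y))))"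

text \<open>\<open>sharp A g p \<alpha>\<close> is the vector \<open>g\<^sup>-\<^sup>1\<alpha>\<close> dual to the covector \<open>\<alpha>\<close>;
  \<open>torsion_conn A g D s H\<close> is \<open>D + s g\<^sup>-\<^sup>1H\<close>.\<close>

definition sharp ::
  "('a, 'e::euclidean_space) chart set \<Rightarrow> ('a \<Rightarrow> ('a, 'e) tvec \<Rightarrow> ('a, 'e) tvec \<Rightarrow> real) \<Rightarrow> 'a \<Rightarrow>
     (('a, 'e) tvec \<Rightarrow> real) \<Rightarrow> ('a, 'e) tvec" where
  "sharp A g p \<alpha> = (THE w. w \<in> tangent_space A p \<and> (\<forall>u\<in>tangent_space A p. g p w u = \<alpha> u))"

definition torsion_conn ::
  "('a, 'e::euclidean_space) chart set \<Rightarrow> ('a \<Rightarrow> ('a, 'e) tvec \<Rightarrow> ('a, 'e) tvec \<Rightarrow> real) \<Rightarrow>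
     ('a, 'e) conn \<Rightarrow> real \<Rightarrow> ('a \<Rightarrow> ('a, 'e) tvec list \<Rightarrow> real) \<Rightarrow> ('a, 'e) conn" where
  "torsion_conn A g D s H p v Y = D p v Y + tscale s (sharp A g p (\<lambda>u. H p [v, Y p, u]))"

text \<open>Curvature is tensorial, so the vectors may be extended to vector fields in any way; we use
  constant coefficients in a chart.\<close>

definition curvature_fields ::
  "('a, 'e::euclidean_space) chart set \<Rightarrow> ('a, 'e) conn \<Rightarrow> ('a \<Rightarrow> ('a, 'e) tvec) \<Rightarrow>
     ('a \<Rightarrow> ('a, 'e) tvec) \<Rightarrow> ('a \<Rightarrow> ('a, 'e) tvec) \<Rightarrow> 'a \<Rightarrow> ('a, 'e) tvec" where
  "curvature_fields A D X Y Z p =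
     D p (X p) (\<lambda>q. D q (Y q) Z) - D p (Y p) (\<lambda>q. D q (X q) Z) - D p (lie_bracket A X Y p) Z"

definition curvature ::
  "('a, 'e::euclidean_space) chart set \<Rightarrow> ('a, 'e) conn \<Rightarrow> 'a \<Rightarrow>
     ('a, 'e) tvec \<Rightarrow> ('a, 'e) tvec \<Rightarrow> ('a, 'e) tend" where
  "curvature A D p u v w = (if w \<in> tangent_space A p then
     (let c = chart_at A p in
      curvature_fields A D (coord_field A c (u c)) (coord_field A c (v c)) (coord_field A c (w c)) p)
     else 0)"

definition parallel_end :: "('a, 'e::euclidean_space) chart set \<Rightarrow> ('a, 'e) conn \<Rightarrow>
     ('a \<Rightarrow> ('a, 'e) tend) \<Rightarrow> bool" where
  "parallel_end A D I \<longleftrightarrow> (\<forall>U Y. openin (chart_topology A) U \<and> smooth_field A U Y \<longrightarrow>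
     (\<forall>p\<in>U. \<forall>v\<in>tangent_space A p. D p v (\<lambda>q. I q (Y q)) = I p (D p v Y)))"


section \<open>Strong HKT manifolds\<close>

definition compatible_complex_structure ::
  "('a, 'e::euclidean_space) chart set \<Rightarrow> ('a \<Rightarrow> ('a, 'e) tvec \<Rightarrow> ('a, 'e) tvec \<Rightarrow> real) \<Rightarrow>
     ('a \<Rightarrow> ('a, 'e) tend) \<Rightarrow> bool" where
  "compatible_complex_structure A g I \<longleftrightarrow> end_field A I \<and>
     (\<forall>p\<in>carrier_of A. \<forall>u\<in>tangent_space A p. \<forall>v\<in>tangent_space A p.
        I p (I p v) = - v \<and> g p (I p u) (I p v) = g p u v) \<and>
     \<comment> \<open>integrability: vanishing of the Nijenhuis tensor\<close>
     (\<forall>U X Y. openin (chart_topology A) U \<and> smooth_field A U X \<and> smooth_field A U Y \<longrightarrow>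
        (\<forall>p\<in>U. lie_bracket A (\<lambda>q. I q (X q)) (\<lambda>q. I q (Y q)) p
               - I p (lie_bracket A (\<lambda>q. I q (X q)) Y p)
               - I p (lie_bracket A X (\<lambda>q. I q (Y q)) p)
               - lie_bracket A X Y p = 0))"

definition strong_HKT ::
  "('a, 'e::euclidean_space) chart set \<Rightarrow> ('a \<Rightarrow> ('a, 'e) tvec \<Rightarrow> ('a, 'e) tvec \<Rightarrow> real) \<Rightarrow>
     ('a \<Rightarrow> ('a, 'e) tend) \<Rightarrow> ('a \<Rightarrow> ('a, 'e) tend) \<Rightarrow> ('a \<Rightarrow> ('a, 'e) tend) \<Rightarrow>
     ('a \<Rightarrow> ('a, 'e) tvec list \<Rightarrow> real) \<Rightarrow> ('a, 'e) conn \<Rightarrow> bool" where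
  "strong_HKT A g I J K H nablaL \<longleftrightarrow>
     smooth_manifold A \<and> riemannian_metric A g \<and> levi_civita A g nablaL \<and>
     compatible_complex_structure A g I \<and> compatible_complex_structure A g J \<and>
     compatible_complex_structure A g K \<and>
     (\<forall>p\<in>carrier_of A. \<forall>v\<in>tangent_space A p. I p (J p v) + J p (I p v) = 0 \<and> K p v = I p (J p v)) \<and>
     diff_form A 3 (carrier_of A) H \<and> closed_form A 3 H \<and>
     parallel_end A (torsion_conn A g nablaL (1/2) H) I \<and>
     parallel_end A (torsion_conn A g nablaL (1/2) H) J \<and>
     parallel_end A (torsion_conn A g nablaL (1/2) H) K"


section \<open>The bundle of endomorphisms of the tangent bundle\<close>

definition end_coord ::
  "('a, real^'n) chart set \<Rightarrow> ('a, real^'n) chart \<Rightarrow> 'a \<Rightarrow> ('a, real^'n) tend \<Rightarrow> real^'n^'n" where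
  "end_coord A c p L = matrix (\<lambda>x. L (coord_field A c x p) c)"

definition end_trace :: "('a, real^'n) chart set \<Rightarrow> 'a \<Rightarrow> ('a, real^'n) tend \<Rightarrow> real" where
  "end_trace A p L = trace (end_coord A (chart_at A p) p L)"

definition commutator :: "('a, 'e::euclidean_space) tend \<Rightarrow> ('a, 'e) tend \<Rightarrow> ('a, 'e) tend" where
  "commutator L B = (\<lambda>v. L (B v) - B (L v))"

type_synonym ('a, 'n) endpt = "'a \<times> ('a, real^'n) tend"
type_synonym ('a, 'n) endvec = "(('a, 'n) endpt, (real^'n) \<times> (real^'n^'n)) tvec"

definition end_chart ::
  "('a, real^'n) chart set \<Rightarrow> ('a, real^'n) chart \<Rightarrow>
     (('a, 'n) endpt, (real^'n) \<times> (real^'n^'n)) chart" where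
  "end_chart A c = ({(p, L). p \<in> cdom c \<and> L \<in> tangent_end A p},
                    \<lambda>(p, L). (cmap c p, end_coord A c p L))"

definition end_bundle ::
  "('a, real^'n) chart set \<Rightarrow> (('a, 'n) endpt, (real^'n) \<times> (real^'n^'n)) chart set" where
  "end_bundle A = end_chart A ` A"

definition end_proj :: "('a, real^'n) chart set \<Rightarrow> ('a, 'n) endpt \<Rightarrow> ('a, 'n) endvec \<Rightarrow>
     ('a, real^'n) tvec" where
  "end_proj A q = pushforward (end_bundle A) A fst q"

text \<open>The identification of \<open>End T\<^sub>pM\<close> with the tangent space at \<open>q = (p, L)\<close> of the fibre.\<close>

definition fibre_vec :: "('a, real^'n) chart set \<Rightarrow> ('a, 'n) endpt \<Rightarrow> ('a, real^'n) tend \<Rightarrow>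
     ('a, 'n) endvec" where
  "fibre_vec A q B = velocity (end_bundle A) (\<lambda>t. (fst q, \<lambda>v. snd q v + tscale t (B v))) 0"

text \<open>The covariant derivative along \<open>\<gamma>\<close> of a vector field \<open>V\<close> along \<open>\<gamma>\<close>, in a chart:
  \<open>D/dt (\<Sum> V\<^sup>i \<partial>\<^sub>i) = \<Sum> (dV\<^sup>i/dt \<partial>\<^sub>i + V\<^sup>i D\<^bsub>\<gamma>'\<^esub> \<partial>\<^sub>i)\<close>.\<close>

definition cov_deriv_along ::
  "('a, 'e::euclidean_space) chart set \<Rightarrow> ('a, 'e) conn \<Rightarrow> (real \<Rightarrow> 'a) \<Rightarrow> (real \<Rightarrow> ('a, 'e) tvec) \<Rightarrow>
     real \<Rightarrow> ('a, 'e) tvec" where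
  "cov_deriv_along A D \<gamma> V t = (\<lambda>c. if c \<in> A \<and> \<gamma> t \<in> cdom c then
     vector_derivative (\<lambda>s. V s c) (at t) + D (\<gamma> t) (velocity A \<gamma> t) (coord_field A c (V t c)) c
     else 0)"

text \<open>Endomorphisms \<open>L t\<close> along \<open>\<gamma>\<close> are parallel for the connection induced on \<open>End TM\<close> if
  \<open>(DL/dt) V = D(L V)/dt - L (DV/dt)\<close> vanishes for every differentiable vector field along \<open>\<gamma>\<close>.\<close>

definition parallel_along ::
  "('a, 'e::euclidean_space) chart set \<Rightarrow> ('a, 'e) conn \<Rightarrow> real \<Rightarrow> (real \<Rightarrow> 'a) \<Rightarrow>
     (real \<Rightarrow> ('a, 'e) tend) \<Rightarrow> bool" where
  "parallel_along A D \<epsilon> \<gamma> L \<longleftrightarrow> (\<forall>t\<in>{-\<epsilon><..<\<epsilon>}. \<forall>V.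
     (\<forall>s\<in>{-\<epsilon><..<\<epsilon>}. V s \<in> tangent_space A (\<gamma> s)) \<and>
     (\<forall>c\<in>A. \<gamma> t \<in> cdom c \<longrightarrow> (\<lambda>s. V s c) differentiable (at t)) \<longrightarrow>
     cov_deriv_along A D \<gamma> (\<lambda>s. L s (V s)) t = L t (cov_deriv_along A D \<gamma> V t))"


section \<open>The twistor space\<close>

definition twistor_space ::
  "('a, real^'n) chart set \<Rightarrow> ('a \<Rightarrow> ('a, real^'n) tvec \<Rightarrow> ('a, real^'n) tvec \<Rightarrow> real) \<Rightarrow>
     ('a, 'n) endpt set" where
  "twistor_space A g = {(p, L). p \<in> carrier_of A \<and> L \<in> tangent_end A p \<and>
     (\<forall>v\<in>tangent_space A p. L (L v) = - v) \<and>
     (\<forall>u\<in>tangent_space A p. \<forall>v\<in>tangent_space A p. g p (L u) (L v) = g p u v)}"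

definition twistor_tangent ::
  "('a, real^'n) chart set \<Rightarrow> ('a \<Rightarrow> ('a, real^'n) tvec \<Rightarrow> ('a, real^'n) tvec \<Rightarrow> real) \<Rightarrow>
     ('a, 'n) endpt \<Rightarrow> ('a, 'n) endvec set" where
  "twistor_tangent A g = tangent_sub (end_bundle A) (twistor_space A g)"

definition vertical_space ::
  "('a, real^'n) chart set \<Rightarrow> ('a \<Rightarrow> ('a, real^'n) tvec \<Rightarrow> ('a, real^'n) tvec \<Rightarrow> real) \<Rightarrow>
     ('a, 'n) endpt \<Rightarrow> ('a, real^'n) tend set" where
  "vertical_space A g = (\<lambda>(p, L). {B \<in> tangent_end A p.
     (\<forall>u\<in>tangent_space A p. \<forall>v\<in>tangent_space A p. g p (B u) v = - g p u (B v)) \<and>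
     (\<forall>v\<in>tangent_space A p. B (L v) + L (B v) = 0)})"

definition horizontal_space ::
  "('a, real^'n) chart set \<Rightarrow> ('a, real^'n) conn \<Rightarrow> ('a, 'n) endpt \<Rightarrow> ('a, 'n) endvec set" where
  "horizontal_space A D q = {velocity (end_bundle A) \<Gamma> 0 | \<Gamma> \<epsilon>.
     smooth_curve (end_bundle A) \<epsilon> \<Gamma> \<and> \<Gamma> 0 = q \<and>
     parallel_along A D \<epsilon> (\<lambda>t. fst (\<Gamma> t)) (\<lambda>t. snd (\<Gamma> t))}"

definition horizontal_lift ::
  "('a, real^'n) chart set \<Rightarrow> ('a, real^'n) conn \<Rightarrow> ('a, 'n) endpt \<Rightarrow> ('a, real^'n) tvec \<Rightarrow>
     ('a, 'n) endvec" where
  "horizontal_lift A D q v = (THE X. X \<in> horizontal_space A D q \<and> end_proj A q X = v)"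

definition vertical_proj ::
  "('a, real^'n) chart set \<Rightarrow> ('a \<Rightarrow> ('a, real^'n) tvec \<Rightarrow> ('a, real^'n) tvec \<Rightarrow> real) \<Rightarrow>
     ('a, real^'n) conn \<Rightarrow> ('a, 'n) endpt \<Rightarrow> ('a, 'n) endvec \<Rightarrow> ('a, real^'n) tend" where
  "vertical_proj A g D q X =
     (THE B. B \<in> vertical_space A g q \<and> X - fibre_vec A q B \<in> horizontal_space A D q)"

definition twistor_J ::
  "('a, real^'n) chart set \<Rightarrow> ('a \<Rightarrow> ('a, real^'n) tvec \<Rightarrow> ('a, real^'n) tvec \<Rightarrow> real) \<Rightarrow>
     ('a, real^'n) conn \<Rightarrow> ('a \<Rightarrow> ('a, real^'n) tend) \<Rightarrow> ('a, 'n) endpt \<Rightarrow>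
     ('a, 'n) endvec \<Rightarrow> ('a, 'n) endvec" where
  "twistor_J A g D I q X =
     fibre_vec A q (snd q \<circ> vertical_proj A g D q X) +
     horizontal_lift A D q (I (fst q) (end_proj A q X))"

definition twistor_metric ::
  "('a, real^'n) chart set \<Rightarrow> ('a \<Rightarrow> ('a, real^'n) tvec \<Rightarrow> ('a, real^'n) tvec \<Rightarrow> real) \<Rightarrow>
     ('a, real^'n) conn \<Rightarrow> ('a, 'n) endpt \<Rightarrow> ('a, 'n) endvec \<Rightarrow> ('a, 'n) endvec \<Rightarrow> real" where
  "twistor_metric A g D q X Y =
     - end_trace A (fst q) (vertical_proj A g D q X \<circ> vertical_proj A g D q Y) +
     g (fst q) (end_proj A q X) (end_proj A q Y)"

definition twistor_form ::
  "('a, real^'n) chart set \<Rightarrow> ('a \<Rightarrow> ('a, real^'n) tvec \<Rightarrow> ('a, real^'n) tvec \<Rightarrow> real) \<Rightarrow>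
     ('a, real^'n) conn \<Rightarrow> ('a \<Rightarrow> ('a, real^'n) tend) \<Rightarrow> ('a, 'n) endpt \<Rightarrow>
     ('a, 'n) endvec list \<Rightarrow> real" where
  "twistor_form A g D I q Xs = twistor_metric A g D q (twistor_J A g D I q (Xs ! 0)) (Xs ! 1)"

definition twistor_dc_form ::
  "('a, real^'n) chart set \<Rightarrow> ('a \<Rightarrow> ('a, real^'n) tvec \<Rightarrow> ('a, real^'n) tvec \<Rightarrow> real) \<Rightarrow>
     ('a, real^'n) conn \<Rightarrow> ('a \<Rightarrow> ('a, real^'n) tend) \<Rightarrow> ('a, 'n) endpt \<Rightarrow>
     ('a, 'n) endvec \<Rightarrow> ('a, 'n) endvec \<Rightarrow> ('a, 'n) endvec \<Rightarrow> real" where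
  "twistor_dc_form A g D I q X1 X2 X3 =
     - sub_ext_deriv (end_bundle A) (twistor_space A g) 2 (twistor_form A g D I) q
         [twistor_J A g D I q X1, twistor_J A g D I q X2, twistor_J A g D I q X3]"

end

theory Submission
  imports Defs
begin

text \<open>
  Split a tangent vector of the twistor space at \<open>L\<close> into the horizontal lift of a vector \<open>v\<close> and a
  vertical vector \<open>B\<close>. The fundamental form is \<open>-tr (L B B') + \<omega>(v, v')\<close>, where \<open>\<omega> = g(I \<cdot>, \<cdot>)\<close>
  lives on the manifold. The two summands are differentiated separately.

  The form \<open>\<omega>\<close> is \<open>\<nabla>\<^sup>+\<close>-parallel, so \<open>d\<omega>\<close> is its contraction with the torsion \<open>H\<close>. Integrability of
  \<open>I\<close> says that \<open>H(u, v, w)\<close> is the sum of the three terms obtained by applying \<open>I\<close> to two of the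
  arguments (\<open>hh_type\<close>), and this turns \<open>d\<omega>(I \<cdot>, I \<cdot>, I \<cdot>)\<close> into \<open>H\<close> (\<open>dc_om\<close>).

  The vertical summand contributes \<open>-tr (L [R(v\<^sub>1, v\<^sub>2), L] B\<^sub>3)\<close> and its cyclic permutations, where \<open>R\<close> is
  the curvature of \<open>\<nabla>\<^sup>-\<close> (\<open>exterior_derivative_on_twistor\<close>). When \<open>\<J>X\<^sub>i\<close> is inserted, \<open>B\<^sub>3\<close> becomes
  \<open>L B\<^sub>3\<close>, the two factors \<open>L\<close> cancel, and \<open>R(I v\<^sub>1, I v\<^sub>2) = R(v\<^sub>1, v\<^sub>2)\<close> (\<open>curv_minus_type\<close>) removes \<open>I\<close>.
  That identity holds because the curvature of \<open>\<nabla>\<^sup>+\<close> commutes with \<open>I\<close> and, \<open>H\<close> being closed, the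
  curvatures of \<open>\<nabla>\<^sup>+\<close> and \<open>\<nabla>\<^sup>-\<close> are related by interchanging the two pairs of arguments
  (\<open>curv_pair_symmetry\<close>). The resulting expression does not mention \<open>I\<close>, so \<open>J\<close> and \<open>K\<close> give the same one.

  The exterior derivative on the twistor space is that of an ambient form \<open>\<eta>\<close> which restricts to the
  fundamental form. To evaluate \<open>d\<eta>\<close> on tangent vectors \<open>X\<^sub>i\<close> for every such \<open>\<eta>\<close> at once, take curves in
  the twistor space with velocities \<open>X\<^sub>i\<close> and, along the \<open>i\<close>-th curve, tangent fields \<open>Y\<^sub>i\<^sub>j\<close> starting at
  \<open>X\<^sub>j\<close> whose derivatives in a chart satisfy \<open>Y\<^sub>i\<^sub>j' = Y\<^sub>j\<^sub>i'\<close>. Then \<open>d\<eta>(X\<^sub>1, X\<^sub>2, X\<^sub>3)\<close> is the cyclic sum of the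
  derivatives of \<open>\<eta>(Y\<^sub>i\<^sub>j, Y\<^sub>i\<^sub>k)\<close> along these curves, and only values of the fundamental form occur. The
  curves are \<open>F L F\<^sup>-\<^sup>1\<close>, where \<open>F\<close> is a \<open>\<nabla>\<^sup>-\<close>-parallel frame followed by a rotation; the vertical part of
  \<open>Y\<^sub>i\<^sub>j\<close> is \<open>F (B\<^sub>j + t D\<^sub>i\<^sub>j) F\<^sup>-\<^sup>1\<close>. The symmetry condition forces the antisymmetric part of \<open>D\<^sub>i\<^sub>j\<close> to be
  half the commutator \<open>[R(v\<^sub>i, v\<^sub>j), L]\<close> (\<open>second_jet_symmetric\<close>), and this is how curvature enters. An
  explicit extension shows that \<open>\<eta>\<close> exists (\<open>diff_form_ambient_form\<close>).
\<close>

section \<open>Calculus of smooth maps\<close>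

lemma frechet_derivative_eqI:
  "(f has_derivative f') (at x) \<Longrightarrow> frechet_derivative f (at x) = f'"
  using frechet_derivative_at by metis

lemma has_derivative_frechet:
  "f differentiable (at x) \<Longrightarrow> (f has_derivative frechet_derivative f (at x)) (at x)"
  by (simp add: frechet_derivative_works)

lemma Ck_on_cong_imp:
  assumes "open S" "\<And>x. x \<in> S \<Longrightarrow> f x = g x" "Ck_on k S f"
  shows "Ck_on k S g"
  using assms(2,3)
proof (induction k arbitrary: f g)
  case 0
  then show ?case by (metis Ck_on.simps(1) continuous_on_cong)
next
  case (Suc k)
  have d: "(g has_derivative frechet_derivative f (at x)) (at x)" if "x \<in> S" for x
    using Suc.prems that assms(1)
    by (auto intro!: has_derivative_transform_within_open[OF has_derivative_frechet])
  then show ?case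
    using Suc.prems Suc.IH[of "\<lambda>x. frechet_derivative f (at x) v" "\<lambda>x. frechet_derivative g (at x) v" for v]
    by (auto simp: frechet_derivative_eqI[OF d] intro: differentiableI)
qed

lemma Ck_on_subset: "Ck_on k S f \<Longrightarrow> T \<subseteq> S \<Longrightarrow> Ck_on k T f"
  by (induction k arbitrary: f) (auto intro: continuous_on_subset)

lemma Ck_on_Suc_imp: "Ck_on (Suc k) S f \<Longrightarrow> Ck_on k S f"
proof (induction k arbitrary: f)
  case 0
  then show ?case
    by (auto intro!: continuous_at_imp_continuous_on differentiable_imp_continuous_within)
qed auto

lemma Ck_on_Suc_deriv:
  assumes "open S" "\<And>x. x \<in> S \<Longrightarrow> (f has_derivative f' x) (at x)" "\<And>v. Ck_on k S (\<lambda>x. f' x v)"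
  shows "Ck_on (Suc k) S f"
proof -
  have "Ck_on k S (\<lambda>x. frechet_derivative f (at x) v)" for v
    by (rule Ck_on_cong_imp[OF assms(1) _ assms(3)[of v]]) (simp add: frechet_derivative_eqI[OF assms(2)])
  with assms show ?thesis by (auto intro: differentiableI)
qed

lemma Ck_on_SucE:
  assumes "Ck_on (Suc k) S f"
  shows "\<And>x. x \<in> S \<Longrightarrow> (f has_derivative frechet_derivative f (at x)) (at x)"
    and "\<And>v. Ck_on k S (\<lambda>x. frechet_derivative f (at x) v)" and "Ck_on k S f"
  using assms Ck_on_Suc_imp[OF assms] by (auto intro: has_derivative_frechet)

declare Ck_on.simps(2) [simp del]

lemma Ck_on_const: "open S \<Longrightarrow> Ck_on k S (\<lambda>x. c)"
  by (induction k arbitrary: c) (auto intro: Ck_on_Suc_deriv[OF _ has_derivative_const])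

lemma Ck_on_bounded_linear:
  assumes "open S" "bounded_linear h" "Ck_on k S f"
  shows "Ck_on k S (\<lambda>x. h (f x))"
  using assms(3)
proof (induction k arbitrary: f)
  case 0
  then show ?case by (simp add: assms(2) bounded_linear.continuous_on)
next
  case (Suc k)
  show ?case
    by (rule Ck_on_Suc_deriv[OF assms(1) bounded_linear.has_derivative[OF assms(2) Ck_on_SucE(1)[OF Suc.prems]]])
      (use Suc.IH Ck_on_SucE(2)[OF Suc.prems] in auto)
qed

lemma Ck_on_add:
  assumes "open S" "Ck_on k S f" "Ck_on k S g"
  shows "Ck_on k S (\<lambda>x. f x + g x)"
  using assms(2,3)
proof (induction k arbitrary: f g)
  case 0
  then show ?case by (simp add: continuous_on_add)
next
  case (Suc k)
  show ?case
    by (rule Ck_on_Suc_deriv[OF assms(1) has_derivative_add[OF Ck_on_SucE(1)[OF Suc.prems(1)] Ck_on_SucE(1)[OF Suc.prems(2)]]])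
      (auto intro!: Suc.IH Ck_on_SucE(2)[OF Suc.prems(1)] Ck_on_SucE(2)[OF Suc.prems(2)])
qed

lemma Ck_on_bilinear:
  assumes "open S" "bounded_bilinear mul" "Ck_on k S f" "Ck_on k S g"
  shows "Ck_on k S (\<lambda>x. mul (f x) (g x))"
  using assms(3,4)
proof (induction k arbitrary: f g)
  case 0
  then show ?case by (simp add: assms(2) bounded_bilinear.continuous_on)
next
  case (Suc k)
  show ?case
    by (rule Ck_on_Suc_deriv[OF assms(1) bounded_bilinear.FDERIV[OF assms(2) Ck_on_SucE(1)[OF Suc.prems(1)] Ck_on_SucE(1)[OF Suc.prems(2)]]])
      (auto intro!: Ck_on_add assms(1) Suc.IH Ck_on_SucE(2,3)[OF Suc.prems(1)] Ck_on_SucE(2,3)[OF Suc.prems(2)])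
qed

lemma Ck_on_sum:
  assumes "open S" "\<And>i. i \<in> I \<Longrightarrow> Ck_on k S (f i)"
  shows "Ck_on k S (\<lambda>x. \<Sum>i\<in>I. f i x)"
  using assms(2)
  by (induction I rule: infinite_finite_induct) (auto intro!: Ck_on_add assms(1) Ck_on_const)

lemma linear_combinationI:
  fixes f :: "'x::real_vector \<Rightarrow> 'y::real_vector"
  assumes "\<And>a b u v. f (a *\<^sub>R u + b *\<^sub>R v) = a *\<^sub>R f u + b *\<^sub>R f v"
  shows "linear f"
  using assms[of 1 _ 1] assms[of _ _ 0] by (intro linearI) auto

lemma linear_basis_expansion:
  fixes f :: "'a::euclidean_space \<Rightarrow> 'b::real_vector"
  assumes "linear f"
  shows "f u = (\<Sum>b\<in>Basis. (u \<bullet> b) *\<^sub>R f b)"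
proof -
  have "f u = f (\<Sum>b\<in>Basis. (u \<bullet> b) *\<^sub>R b)" by (simp add: euclidean_representation)
  also have "\<dots> = (\<Sum>b\<in>Basis. (u \<bullet> b) *\<^sub>R f b)"
    using assms by (simp add: linear_sum linear_scale o_def)
  finally show ?thesis .
qed

text \<open>By the chain rule the derivative of \<open>f \<circ> g\<close> is a finite sum of products of a partial derivative of \<open>f\<close>
  along \<open>g\<close> with a component of the derivative of \<open>g\<close>; the induction hypothesis applies to the former.\<close>

lemma Ck_on_compose:
  fixes f :: "'b::euclidean_space \<Rightarrow> 'c::real_normed_vector"
  assumes "open S" "Ck_on k T f" "Ck_on k S g" "g ` S \<subseteq> T"
  shows "Ck_on k S (\<lambda>x. f (g x))"
  using assms(2,3)
proof (induction k arbitrary: f)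
  case 0
  then show ?case by (simp add: assms(4) continuous_on_compose2)
next
  case (Suc k)
  have d: "((\<lambda>x. f (g x)) has_derivative (\<lambda>v. \<Sum>b\<in>Basis.
      (frechet_derivative g (at x) v \<bullet> b) *\<^sub>R frechet_derivative f (at (g x)) b)) (at x)"
    if x: "x \<in> S" for x
  proof -
    have f: "(f has_derivative frechet_derivative f (at (g x))) (at (g x))"
      using Ck_on_SucE(1)[OF Suc.prems(1)] assms(4) x by auto
    have "((\<lambda>x. f (g x)) has_derivative (\<lambda>v. frechet_derivative f (at (g x)) (frechet_derivative g (at x) v))) (at x)"
      using diff_chain_at[OF Ck_on_SucE(1)[OF Suc.prems(2) x] f] by (simp add: o_def)
    moreover have "linear (frechet_derivative f (at (g x)))"
      using f has_derivative_linear by blast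
    ultimately show ?thesis by (simp add: linear_basis_expansion[symmetric])
  qed
  show ?case
    by (rule Ck_on_Suc_deriv[OF assms(1) d])
      (auto intro!: Ck_on_sum assms(1) Ck_on_bilinear[OF assms(1) bounded_bilinear_scaleR]
        Ck_on_bounded_linear[OF assms(1) bounded_linear_inner_left] Ck_on_SucE(2)[OF Suc.prems(2)]
        Suc.IH Ck_on_SucE(2)[OF Suc.prems(1)] Ck_on_SucE(3)[OF Suc.prems(2)])
qed

lemma Ck_on_inverse:
  fixes f :: "'a::real_normed_vector \<Rightarrow> real"
  assumes "open S" "Ck_on k S f" "\<And>x. x \<in> S \<Longrightarrow> f x \<noteq> 0"
  shows "Ck_on k S (\<lambda>x. inverse (f x))"
  using assms(2)
proof (induction k)
  case 0
  then show ?case using assms(3) by (auto intro: continuous_intros)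
next
  case (Suc k)
  have d: "((\<lambda>x. inverse (f x)) has_derivative
      (\<lambda>h. - (inverse (f x) * frechet_derivative f (at x) h * inverse (f x)))) (at x)" if "x \<in> S" for x
    by (rule Deriv.has_derivative_inverse[OF assms(3)[OF that] Ck_on_SucE(1)[OF Suc.prems that]])
  show ?case
    by (rule Ck_on_Suc_deriv[OF assms(1) d])
      (auto intro!: Ck_on_bounded_linear[OF assms(1) bounded_linear_minus[OF bounded_linear_ident]]
        Ck_on_bilinear[OF assms(1) bounded_bilinear_mult] Suc.IH Ck_on_SucE(2,3)[OF Suc.prems])
qed

lemma smooth_onD_Ck: "smooth_on S f \<Longrightarrow> Ck_on k S f"
  by (simp add: smooth_on_def)

lemma smooth_on_cong: "open S \<Longrightarrow> (\<And>x. x \<in> S \<Longrightarrow> f x = g x) \<Longrightarrow> smooth_on S f \<Longrightarrow> smooth_on S g"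
  unfolding smooth_on_def using Ck_on_cong_imp by blast

lemma smooth_on_subset: "smooth_on S f \<Longrightarrow> T \<subseteq> S \<Longrightarrow> smooth_on T f"
  unfolding smooth_on_def using Ck_on_subset by blast

lemma smooth_on_const: "open S \<Longrightarrow> smooth_on S (\<lambda>x. c)"
  by (simp add: smooth_on_def Ck_on_const)

lemma smooth_on_bounded_linear:
  "open S \<Longrightarrow> bounded_linear h \<Longrightarrow> smooth_on S f \<Longrightarrow> smooth_on S (\<lambda>x. h (f x))"
  by (simp add: smooth_on_def Ck_on_bounded_linear)

lemma smooth_on_add:
  "open S \<Longrightarrow> smooth_on S f \<Longrightarrow> smooth_on S g \<Longrightarrow> smooth_on S (\<lambda>x. f x + g x)"
  by (simp add: smooth_on_def Ck_on_add)

lemma smooth_on_bilinear: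
  "open S \<Longrightarrow> bounded_bilinear mul \<Longrightarrow> smooth_on S f \<Longrightarrow> smooth_on S g
    \<Longrightarrow> smooth_on S (\<lambda>x. mul (f x) (g x))"
  by (simp add: smooth_on_def Ck_on_bilinear)

lemma smooth_on_mult:
  fixes f g :: "_ \<Rightarrow> real"
  shows "open S \<Longrightarrow> smooth_on S f \<Longrightarrow> smooth_on S g \<Longrightarrow> smooth_on S (\<lambda>x. f x * g x)"
  by (rule smooth_on_bilinear[OF _ bounded_bilinear_mult])

lemma smooth_on_scaleR:
  "open S \<Longrightarrow> smooth_on S f \<Longrightarrow> smooth_on S g \<Longrightarrow> smooth_on S (\<lambda>x. f x *\<^sub>R g x)"
  by (rule smooth_on_bilinear[OF _ bounded_bilinear_scaleR])

lemma smooth_on_uminus: "open S \<Longrightarrow> smooth_on S f \<Longrightarrow> smooth_on S (\<lambda>x. - f x)"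
  by (rule smooth_on_bounded_linear[OF _ bounded_linear_minus[OF bounded_linear_ident]])

lemma smooth_on_diff:
  "open S \<Longrightarrow> smooth_on S f \<Longrightarrow> smooth_on S g \<Longrightarrow> smooth_on S (\<lambda>x. f x - g x)"
  using smooth_on_add[OF _ _ smooth_on_uminus] by fastforce

lemma smooth_on_sum:
  "open S \<Longrightarrow> (\<And>i. i \<in> I \<Longrightarrow> smooth_on S (f i)) \<Longrightarrow> smooth_on S (\<lambda>x. \<Sum>i\<in>I. f i x)"
  by (simp add: smooth_on_def Ck_on_sum)

lemma smooth_on_prod:
  fixes f :: "_ \<Rightarrow> _ \<Rightarrow> real"
  assumes "open S" "\<And>i. i \<in> I \<Longrightarrow> smooth_on S (f i)"
  shows "smooth_on S (\<lambda>x. \<Prod>i\<in>I. f i x)"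
  using assms(2)
  by (induction I rule: infinite_finite_induct)
    (auto intro!: smooth_on_mult assms(1) smooth_on_const[of S "1::real"])

lemma smooth_on_compose:
  fixes f :: "'b::euclidean_space \<Rightarrow> 'c::real_normed_vector"
  shows "open S \<Longrightarrow> smooth_on T f \<Longrightarrow> smooth_on S g \<Longrightarrow> g ` S \<subseteq> T \<Longrightarrow> smooth_on S (\<lambda>x. f (g x))"
  unfolding smooth_on_def using Ck_on_compose by blast

lemma smooth_on_inverse:
  fixes f :: "'a::real_normed_vector \<Rightarrow> real"
  shows "open S \<Longrightarrow> smooth_on S f \<Longrightarrow> (\<And>x. x \<in> S \<Longrightarrow> f x \<noteq> 0) \<Longrightarrow> smooth_on S (\<lambda>x. inverse (f x))"
  by (simp add: smooth_on_def Ck_on_inverse)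

lemma smooth_on_has_derivative:
  "smooth_on S f \<Longrightarrow> x \<in> S \<Longrightarrow> (f has_derivative frechet_derivative f (at x)) (at x)"
  using Ck_on_SucE(1) smooth_onD_Ck by blast

lemma smooth_on_frechet: "smooth_on S f \<Longrightarrow> smooth_on S (\<lambda>x. frechet_derivative f (at x) v)"
  using Ck_on_SucE(2) unfolding smooth_on_def by blast

lemma smooth_on_linear_frechet: "smooth_on S f \<Longrightarrow> x \<in> S \<Longrightarrow> linear (frechet_derivative f (at x))"
  using smooth_on_has_derivative has_derivative_linear by blast

lemma smooth_on_imp_continuous_on: "smooth_on S f \<Longrightarrow> continuous_on S f"
  unfolding smooth_on_def using Ck_on.simps(1) by blast

lemma smooth_on_id: "open S \<Longrightarrow> smooth_on S (\<lambda>x. x)"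
  unfolding smooth_on_def
proof
  fix k assume S: "open S"
  show "Ck_on k S (\<lambda>x. x)"
    by (cases k) (use S in \<open>auto intro!: Ck_on_Suc_deriv[OF _ has_derivative_ident] Ck_on_const\<close>)
qed

lemma smooth_on_linear:
  fixes h :: "'a::euclidean_space \<Rightarrow> 'b::real_normed_vector"
  shows "open S \<Longrightarrow> linear h \<Longrightarrow> smooth_on S h"
  using smooth_on_bounded_linear[OF _ _ smooth_on_id] linear_conv_bounded_linear by blast

lemma smooth_on_Pair:
  assumes "open S" "smooth_on S f" "smooth_on S g"
  shows "smooth_on S (\<lambda>x. (f x, g x))"
proof -
  have "smooth_on S (\<lambda>x. (f x, 0) + (0, g x))"
    by (intro smooth_on_add assms
        smooth_on_bounded_linear[OF assms(1) bounded_linear_Pair[OF bounded_linear_ident bounded_linear_zero]]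
        smooth_on_bounded_linear[OF assms(1) bounded_linear_Pair[OF bounded_linear_zero bounded_linear_ident]])
  then show ?thesis by simp
qed

lemma smooth_on_vec_lambda:
  fixes f :: "'a::real_normed_vector \<Rightarrow> 'n::finite \<Rightarrow> 'b::euclidean_space"
  assumes "open S" "\<And>i. smooth_on S (\<lambda>x. f x i)"
  shows "smooth_on S (\<lambda>x. \<chi> i. f x i)"
proof -
  have *: "bounded_linear (\<lambda>y. axis i y :: 'b ^ 'n)" for i
    by (intro linear_conv_bounded_linear[THEN iffD1] linearI) (auto simp: axis_def vec_eq_iff)
  have "smooth_on S (\<lambda>x. \<Sum>i\<in>UNIV. axis i (f x i))"
    by (intro smooth_on_sum smooth_on_bounded_linear[OF assms(1) *] assms)
  moreover have "(\<chi> i. f x i) = (\<Sum>i\<in>UNIV. axis i (f x i))" for x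
    by (simp add: vec_eq_iff axis_def)
  ultimately show ?thesis by simp
qed

lemma smooth_on_nth: "open S \<Longrightarrow> smooth_on S f \<Longrightarrow> smooth_on S (\<lambda>x. f x $ i)"
  by (rule smooth_on_bounded_linear[OF _ bounded_linear_vec_nth])

text \<open>Tensor fields in coordinates are families of linear maps; only their values on constant
  arguments are known to be smooth, and the expansion in a basis reduces the general case to this.\<close>

lemma smooth_on_linear_apply:
  fixes f :: "'a::real_normed_vector \<Rightarrow> 'b::euclidean_space \<Rightarrow> 'c::real_normed_vector"
  assumes "open S" "\<And>x. x \<in> S \<Longrightarrow> linear (f x)" "\<And>u. smooth_on S (\<lambda>x. f x u)" "smooth_on S Y"
  shows "smooth_on S (\<lambda>x. f x (Y x))"
proof -
  have "smooth_on S (\<lambda>x. \<Sum>b\<in>Basis. (Y x \<bullet> b) *\<^sub>R f x b)"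
    by (intro smooth_on_sum smooth_on_scaleR assms smooth_on_bounded_linear[OF assms(1) bounded_linear_inner_left])
  then show ?thesis
    by (rule smooth_on_cong[OF assms(1), rotated]) (simp add: linear_basis_expansion[OF assms(2), symmetric])
qed

text \<open>The Leibniz rule for a tensor field evaluated on a vector field, in the form used for every
  covariant derivative below.\<close>

lemma has_derivative_linear_apply:
  fixes f :: "'a::real_normed_vector \<Rightarrow> 'b::euclidean_space \<Rightarrow> 'c::real_normed_vector"
  assumes S: "open S" "x \<in> S" and lin: "\<And>y. y \<in> S \<Longrightarrow> linear (f y)"
    and f: "\<And>u. ((\<lambda>y. f y u) has_derivative (\<lambda>h. f' h u)) (at x)"
    and Y: "(Y has_derivative Y') (at x)"
  shows "((\<lambda>y. f y (Y y)) has_derivative (\<lambda>h. f' h (Y x) + f x (Y' h))) (at x)"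
proof -
  have 1: "((\<lambda>y. \<Sum>b\<in>Basis. (Y y \<bullet> b) *\<^sub>R f y b) has_derivative
     (\<lambda>h. \<Sum>b\<in>Basis. (Y x \<bullet> b) *\<^sub>R f' h b + (Y' h \<bullet> b) *\<^sub>R f x b)) (at x)"
    by (intro has_derivative_sum has_derivative_scaleR f bounded_linear.has_derivative[OF bounded_linear_inner_left Y])
  have "((\<lambda>y. \<Sum>b\<in>Basis. (Y x \<bullet> b) *\<^sub>R f y b) has_derivative
     (\<lambda>h. \<Sum>b\<in>Basis. (Y x \<bullet> b) *\<^sub>R f' h b)) (at x)"
    by (intro has_derivative_sum has_derivative_scaleR_right f)
  then have "((\<lambda>y. f y (Y x)) has_derivative (\<lambda>h. \<Sum>b\<in>Basis. (Y x \<bullet> b) *\<^sub>R f' h b)) (at x)"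
    by (rule has_derivative_transform_within_open[OF _ S]) (simp add: linear_basis_expansion[OF lin, symmetric])
  then have "(\<Sum>b\<in>Basis. (Y x \<bullet> b) *\<^sub>R f' h b) = f' h (Y x)" for h
    using has_derivative_unique[OF f[of "Y x"]] by metis
  then have "(\<Sum>b\<in>Basis. (Y x \<bullet> b) *\<^sub>R f' h b + (Y' h \<bullet> b) *\<^sub>R f x b) = f' h (Y x) + f x (Y' h)" for h
    by (simp add: sum.distrib linear_basis_expansion[OF lin[OF S(2)], symmetric])
  with 1 have "((\<lambda>y. \<Sum>b\<in>Basis. (Y y \<bullet> b) *\<^sub>R f y b) has_derivative (\<lambda>h. f' h (Y x) + f x (Y' h))) (at x)"
    by simp
  then show ?thesis
    by (rule has_derivative_transform_within_open[OF _ S]) (simp add: linear_basis_expansion[OF lin, symmetric])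
qed

subsection \<open>Symmetry of second derivatives\<close>

text \<open>The mean value theorem, applied first in the direction \<open>u\<close> and then in the direction \<open>v\<close>.\<close>

lemma second_difference_mvt:
  fixes f :: "'a::real_normed_vector \<Rightarrow> real"
  assumes f: "Ck_on 2 S f" and h: "0 < h"
    and sub: "\<And>s t. 0 \<le> s \<Longrightarrow> s \<le> h \<Longrightarrow> 0 \<le> t \<Longrightarrow> t \<le> h \<Longrightarrow> x + s *\<^sub>R u + t *\<^sub>R v \<in> S"
  shows "\<exists>s t. 0 \<le> s \<and> s \<le> h \<and> 0 \<le> t \<and> t \<le> h \<and>
    f (x + h *\<^sub>R u + h *\<^sub>R v) - f (x + h *\<^sub>R u) - f (x + h *\<^sub>R v) + f x =
    h * h * frechet_derivative (\<lambda>y. frechet_derivative f (at y) u) (at (x + s *\<^sub>R u + t *\<^sub>R v)) v"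
proof -
  define fu where "fu y = frechet_derivative f (at y) u" for y
  have f1: "Ck_on (Suc (Suc 0)) S f" using f by (simp add: numeral_2_eq_2)
  have fu: "Ck_on (Suc 0) S fu" unfolding fu_def by (rule Ck_on_SucE(2)[OF f1])
  have d1: "((\<lambda>s. f (x + s *\<^sub>R u + t *\<^sub>R v)) has_real_derivative fu (x + s *\<^sub>R u + t *\<^sub>R v)) (at s)"
    if "0 \<le> s" "s \<le> h" "0 \<le> t" "t \<le> h" for s t
  proof -
    have D: "(f has_derivative frechet_derivative f (at (x + s *\<^sub>R u + t *\<^sub>R v))) (at (x + s *\<^sub>R u + t *\<^sub>R v))"
      by (rule Ck_on_SucE(1)[OF f1 sub[OF that]])
    have "((\<lambda>s. x + s *\<^sub>R u + t *\<^sub>R v) has_derivative (\<lambda>r. r *\<^sub>R u)) (at s)"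
      by (auto intro!: derivative_eq_intros)
    from diff_chain_at[OF this D]
    show ?thesis
      by (simp add: has_field_derivative_def o_def fu_def has_derivative_linear[OF D] linear_scale mult_commute_abs)
  qed
  obtain s where s: "0 < s" "s < h" and
    s2: "(f (x + h *\<^sub>R u + h *\<^sub>R v) - f (x + h *\<^sub>R u + 0 *\<^sub>R v)) - (f (x + 0 *\<^sub>R u + h *\<^sub>R v) - f (x + 0 *\<^sub>R u + 0 *\<^sub>R v))
      = (h - 0) * (fu (x + s *\<^sub>R u + h *\<^sub>R v) - fu (x + s *\<^sub>R u + 0 *\<^sub>R v))"
  proof -
    have "((\<lambda>s. f (x + s *\<^sub>R u + h *\<^sub>R v) - f (x + s *\<^sub>R u + 0 *\<^sub>R v)) has_real_derivative
        fu (x + s *\<^sub>R u + h *\<^sub>R v) - fu (x + s *\<^sub>R u + 0 *\<^sub>R v)) (at s)" if "0 \<le> s" "s \<le> h" for s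
      using that h by (intro DERIV_diff d1) auto
    from MVT2[OF h this] that show ?thesis by blast
  qed
  have d2: "((\<lambda>t. fu (x + s *\<^sub>R u + t *\<^sub>R v)) has_real_derivative
      frechet_derivative fu (at (x + s *\<^sub>R u + t *\<^sub>R v)) v) (at t)"
    if "0 \<le> t" "t \<le> h" for t
  proof -
    have D: "(fu has_derivative frechet_derivative fu (at (x + s *\<^sub>R u + t *\<^sub>R v))) (at (x + s *\<^sub>R u + t *\<^sub>R v))"
      by (rule Ck_on_SucE(1)[OF fu sub]) (use s that in auto)
    have "((\<lambda>t. x + s *\<^sub>R u + t *\<^sub>R v) has_derivative (\<lambda>r. r *\<^sub>R v)) (at t)"
      by (auto intro!: derivative_eq_intros)
    from diff_chain_at[OF this D]
    show ?thesis
      by (simp add: has_field_derivative_def o_def has_derivative_linear[OF D] linear_scale mult_commute_abs)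
  qed
  obtain t where t: "0 < t" "t < h" and
    "fu (x + s *\<^sub>R u + h *\<^sub>R v) - fu (x + s *\<^sub>R u + 0 *\<^sub>R v) = (h - 0) * frechet_derivative fu (at (x + s *\<^sub>R u + t *\<^sub>R v)) v"
    using MVT2[OF h d2] by blast
  with s2 have "f (x + h *\<^sub>R u + h *\<^sub>R v) - f (x + h *\<^sub>R u) - f (x + h *\<^sub>R v) + f x
    = h * h * frechet_derivative fu (at (x + s *\<^sub>R u + t *\<^sub>R v)) v" by simp
  with s t show ?thesis unfolding fu_def by (intro exI[of _ s] exI[of _ t]) auto
qed

text \<open>The second difference is symmetric in the two directions, so the two iterated derivatives agree at
  two points arbitrarily close to \<open>x\<close>; both are continuous.\<close>

lemma second_derivative_symmetric_real:
  fixes f :: "'a::real_normed_vector \<Rightarrow> real"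
  assumes S: "open S" "x \<in> S" and f: "Ck_on 2 S f"
  shows "frechet_derivative (\<lambda>y. frechet_derivative f (at y) u) (at x) v
       = frechet_derivative (\<lambda>y. frechet_derivative f (at y) v) (at x) u"
proof -
  define P where "P u v y = frechet_derivative (\<lambda>y. frechet_derivative f (at y) u) (at y) v" for u v y
  have cont: "continuous_on S (P u v)" for u v
    using f unfolding P_def by (simp add: numeral_2_eq_2 Ck_on.simps(2))
  have "\<bar>P u v x - P v u x\<bar> \<le> e" if e: "e > 0" for e
  proof -
    have "\<exists>d>0. ball x d \<subseteq> S \<and> (\<forall>y\<in>ball x d. \<bar>P u v y - P u v x\<bar> < e/2)" for u v
    proof -
      obtain d1 where d1: "d1 > 0" "ball x d1 \<subseteq> S" using S by (meson openE)
      have "isCont (P u v) x" using cont S by (simp add: continuous_on_eq_continuous_at)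
      then obtain d2 where "d2 > 0" "\<forall>y. dist y x < d2 \<longrightarrow> dist (P u v y) (P u v x) < e/2"
        using e unfolding continuous_at_eps_delta by (meson half_gt_zero)
      with d1 show ?thesis
        by (intro exI[of _ "min d1 d2"]) (auto simp: dist_real_def dist_commute)
    qed
    then obtain d d' where d: "d > 0" "ball x d \<subseteq> S" "\<And>y. y \<in> ball x d \<Longrightarrow> \<bar>P u v y - P u v x\<bar> < e/2"
      and d': "d' > 0" "\<And>y. y \<in> ball x d' \<Longrightarrow> \<bar>P v u y - P v u x\<bar> < e/2"
      by metis
    \<comment> \<open>The parallelogram with sides \<open>h u\<close> and \<open>h v\<close> has to lie in both balls.\<close>
    define h where "h = min d d' / (2 * (norm u + norm v + 1))"
    have h: "h > 0" using d d' by (simp add: h_def add_nonneg_pos)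
    have "h * (norm u + norm v) \<le> min d d' / 2"
    proof -
      have "(norm u + norm v) / (norm u + norm v + 1) \<le> 1" by (simp add: divide_le_eq add_nonneg_pos)
      then have "min d d' / 2 * ((norm u + norm v) / (norm u + norm v + 1)) \<le> min d d' / 2 * 1"
        using d d' by (intro mult_left_mono) auto
      then show ?thesis by (simp add: h_def field_simps)
    qed
    moreover have "s * norm u + t * norm v \<le> h * (norm u + norm v)" if "s \<le> h" "t \<le> h" for s t
      using that by (simp add: distrib_left add_mono mult_right_mono)
    moreover have "norm (s *\<^sub>R u + t *\<^sub>R v) \<le> s * norm u + t * norm v" if "0 \<le> s" "0 \<le> t" for s t
      using norm_triangle_ineq[of "s *\<^sub>R u" "t *\<^sub>R v"] that by simp
    moreover have "min d d' / 2 < min d d'" using d(1) d'(1) by (auto simp: min_def)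
    ultimately have near: "dist x (x + s *\<^sub>R u + t *\<^sub>R v) < min d d'"
      if "0 \<le> s" "s \<le> h" "0 \<le> t" "t \<le> h" for s t
      using that by (smt (verit) add.assoc add_diff_cancel_left' dist_commute dist_norm)
    have near': "dist x (x + s *\<^sub>R v + t *\<^sub>R u) < min d d'"
      if "0 \<le> s" "s \<le> h" "0 \<le> t" "t \<le> h" for s t
      using near[of t s] that by (simp add: algebra_simps)
    obtain s t where st: "0 \<le> s" "s \<le> h" "0 \<le> t" "t \<le> h" and 1:
      "f (x + h *\<^sub>R u + h *\<^sub>R v) - f (x + h *\<^sub>R u) - f (x + h *\<^sub>R v) + f x = h * h * P u v (x + s *\<^sub>R u + t *\<^sub>R v)"
      using second_difference_mvt[OF f h, of x u v] near d(2) unfolding P_def by (force simp: subset_iff)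
    obtain s' t' where st': "0 \<le> s'" "s' \<le> h" "0 \<le> t'" "t' \<le> h" and 2:
      "f (x + h *\<^sub>R v + h *\<^sub>R u) - f (x + h *\<^sub>R v) - f (x + h *\<^sub>R u) + f x = h * h * P v u (x + s' *\<^sub>R v + t' *\<^sub>R u)"
      using second_difference_mvt[OF f h, of x v u] near' d(2) unfolding P_def by (force simp: subset_iff)
    have "h * h * P u v (x + s *\<^sub>R u + t *\<^sub>R v) = h * h * P v u (x + s' *\<^sub>R v + t' *\<^sub>R u)"
      using 1 2 by (simp add: algebra_simps)
    then have "P u v (x + s *\<^sub>R u + t *\<^sub>R v) = P v u (x + s' *\<^sub>R v + t' *\<^sub>R u)" using h by simp
    moreover have "\<bar>P u v (x + s *\<^sub>R u + t *\<^sub>R v) - P u v x\<bar> < e/2" by (rule d(3)) (use near[OF st] in auto)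
    moreover have "\<bar>P v u (x + s' *\<^sub>R v + t' *\<^sub>R u) - P v u x\<bar> < e/2" by (rule d'(2)) (use near'[OF st'] in auto)
    ultimately show ?thesis by argo
  qed
  then have "\<bar>P u v x - P v u x\<bar> \<le> 0" by (rule field_le_epsilon[of _ 0, simplified]) 
  then show ?thesis by (simp add: P_def)
qed

lemma second_derivative_symmetric:
  fixes f :: "'a::real_normed_vector \<Rightarrow> 'b::euclidean_space"
  assumes S: "open S" "x \<in> S" and f: "smooth_on S f"
  shows "frechet_derivative (\<lambda>y. frechet_derivative f (at y) u) (at x) v
       = frechet_derivative (\<lambda>y. frechet_derivative f (at y) v) (at x) u"
proof (rule euclidean_eqI)
  fix b :: 'b assume "b \<in> Basis"
  define g where "g y = f y \<bullet> b" for y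
  have g: "smooth_on S g"
    unfolding g_def by (rule smooth_on_bounded_linear[OF S(1) bounded_linear_inner_left f])
  have 1: "frechet_derivative g (at y) w = frechet_derivative f (at y) w \<bullet> b" if "y \<in> S" for y w
    unfolding g_def
    by (subst frechet_derivative_eqI[OF bounded_linear.has_derivative[OF bounded_linear_inner_left smooth_on_has_derivative[OF f that]]]) simp
  have 2: "frechet_derivative (\<lambda>y. frechet_derivative g (at y) u) (at x) v
     = frechet_derivative (\<lambda>y. frechet_derivative f (at y) u) (at x) v \<bullet> b" for u v
  proof -
    have "((\<lambda>y. frechet_derivative f (at y) u \<bullet> b) has_derivative
       (\<lambda>v. frechet_derivative (\<lambda>y. frechet_derivative f (at y) u) (at x) v \<bullet> b)) (at x)"
      by (rule bounded_linear.has_derivative[OF bounded_linear_inner_left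
            smooth_on_has_derivative[OF smooth_on_frechet[OF f] S(2)]])
    then have "((\<lambda>y. frechet_derivative g (at y) u) has_derivative
       (\<lambda>v. frechet_derivative (\<lambda>y. frechet_derivative f (at y) u) (at x) v \<bullet> b)) (at x)"
      by (rule has_derivative_transform_within_open[OF _ S]) (simp add: 1)
    then show ?thesis by (simp add: frechet_derivative_eqI)
  qed
  show "frechet_derivative (\<lambda>y. frechet_derivative f (at y) u) (at x) v \<bullet> b
       = frechet_derivative (\<lambda>y. frechet_derivative f (at y) v) (at x) u \<bullet> b"
    using second_derivative_symmetric_real[OF S smooth_onD_Ck[OF g], of u v] by (simp add: 2)
qed

subsection \<open>Linear ordinary differential equations\<close>

text \<open>Banach's fixed point theorem for the associated integral equation.\<close>

lemma linear_ode_local_solution: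
  fixes a :: "real \<Rightarrow> 'a::banach" and mul :: "'a \<Rightarrow> 'b::banach \<Rightarrow> 'b"
  assumes prod: "bounded_bilinear mul" and r: "r > 0" and a: "continuous_on {-r..r} a"
  shows "\<exists>\<epsilon> y. 0 < \<epsilon> \<and> \<epsilon> \<le> r \<and> y 0 = y0 \<and>
    (\<forall>t\<in>{-\<epsilon><..<\<epsilon>}. (y has_vector_derivative mul (a t) (y t)) (at t))"
proof -
  interpret bounded_bilinear mul by fact
  have "bounded (a ` {-r..r})" by (intro compact_imp_bounded compact_continuous_image a compact_Icc)
  then obtain C where C: "C > 0" "\<And>t. t \<in> {-r..r} \<Longrightarrow> norm (a t) \<le> C"
    unfolding bounded_pos by blast
  obtain k where k: "k > 0" "\<And>x y. norm (mul x y) \<le> norm x * norm y * k" using pos_bounded by blast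
  \<comment> \<open>With this length the integral operator contracts distances by the factor \<open>1/2\<close>.\<close>
  define \<epsilon> where "\<epsilon> = min r (1 / (8 * C * k))"
  have \<epsilon>: "0 < \<epsilon>" "\<epsilon> \<le> r" "4 * \<epsilon> * C * k \<le> 1/2"
  proof -
    show "0 < \<epsilon>" "\<epsilon> \<le> r" using C k r by (auto simp: \<epsilon>_def)
    have "\<epsilon> \<le> 1 / (8 * C * k)" by (simp add: \<epsilon>_def)
    then have "\<epsilon> * (8 * C * k) \<le> 1" using C k by (simp add: pos_le_divide_eq)
    then show "4 * \<epsilon> * C * k \<le> 1/2" by (simp add: algebra_simps)
  qed
  \<comment> \<open>Clamping the time makes the operator act on bounded continuous functions on the real line.\<close>
  define cl where "cl t = max (-\<epsilon>) (min \<epsilon> t)" for t :: real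
  have cl: "cl t \<in> {-\<epsilon>..\<epsilon>}" for t using \<epsilon> by (auto simp: cl_def)
  define F where "F f t = integral {-\<epsilon>..t} (\<lambda>s. mul (a s) (f s))" for f :: "real \<Rightarrow> 'b" and t
  define \<Phi> where "\<Phi> f t = y0 + (F f (cl t) - F f 0)" for f t
  have conti: "continuous_on {-\<epsilon>..\<epsilon>} (\<lambda>s. mul (a s) (f s))" if "continuous_on {-\<epsilon>..\<epsilon>} f" for f
    by (rule continuous_on[OF continuous_on_subset[OF a] that]) (use \<epsilon> in auto)
  have Fd: "((F f) has_vector_derivative mul (a t) (f t)) (at t within {-\<epsilon>..\<epsilon>})"
    if "continuous_on {-\<epsilon>..\<epsilon>} f" "t \<in> {-\<epsilon>..\<epsilon>}" for f t
    unfolding F_def by (rule integral_has_vector_derivative[OF conti[OF that(1)] that(2)])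
  have Fc: "continuous_on {-\<epsilon>..\<epsilon>} (F f)" if "continuous_on {-\<epsilon>..\<epsilon>} f" for f
    by (rule continuous_on_vector_derivative[OF Fd[OF that]])
  have \<Phi>_bcont: "\<Phi> f \<in> bcontfun" if "continuous_on UNIV f" for f
  proof -
    have f: "continuous_on {-\<epsilon>..\<epsilon>} f" using that continuous_on_subset by blast
    have "continuous_on UNIV cl" unfolding cl_def by (intro continuous_intros)
    then have "continuous_on UNIV (\<lambda>t. F f (cl t))"
      by (rule continuous_on_compose2[OF Fc[OF f]]) (use cl in blast)
    then have 1: "continuous_on UNIV (\<Phi> f)" unfolding \<Phi>_def by (intro continuous_intros)
    have "bounded (F f ` {-\<epsilon>..\<epsilon>})" by (intro compact_imp_bounded compact_continuous_image Fc f compact_Icc)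
    then obtain B where B: "\<And>t. t \<in> {-\<epsilon>..\<epsilon>} \<Longrightarrow> norm (F f t) \<le> B" unfolding bounded_iff by blast
    have "norm (\<Phi> f t) \<le> norm y0 + (B + B)" for t
      unfolding \<Phi>_def
      by (intro norm_triangle_le add_left_mono norm_triangle_le_diff add_mono B cl) (use \<epsilon> in auto)
    then have "bounded (range (\<Phi> f))" unfolding bounded_iff by blast
    with 1 show ?thesis by (simp add: bcontfun_def)
  qed
  have Fbound: "norm (F f t - F g t) \<le> 2 * \<epsilon> * C * k * d"
    if f: "continuous_on {-\<epsilon>..\<epsilon>} f" and g: "continuous_on {-\<epsilon>..\<epsilon>} g" and t: "t \<in> {-\<epsilon>..\<epsilon>}"
      and d: "\<And>s. norm (f s - g s) \<le> d" for f g t d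
  proof -
    have sub: "{-\<epsilon>..t} \<subseteq> {-\<epsilon>..\<epsilon>}" using t by auto
    have d0: "0 \<le> d" using d[of 0] norm_ge_zero order_trans by blast
    have fg: "continuous_on {-\<epsilon>..\<epsilon>} (\<lambda>s. f s - g s)" by (intro continuous_intros f g)
    have "F f t - F g t = integral {-\<epsilon>..t} (\<lambda>s. mul (a s) (f s - g s))"
      unfolding F_def diff_right
      by (rule integral_diff[symmetric]; rule integrable_continuous_real; rule continuous_on_subset[OF conti sub]; fact)
    also have "norm \<dots> \<le> C * d * k * (t - (-\<epsilon>))"
    proof (rule integral_bound)
      show "continuous_on {-\<epsilon>..t} (\<lambda>s. mul (a s) (f s - g s))"
        by (rule continuous_on_subset[OF conti[OF fg] sub])
      show "norm (mul (a s) (f s - g s)) \<le> C * d * k" if "s \<in> {-\<epsilon>..t}" for s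
      proof -
        have "norm (a s) \<le> C" using that t \<epsilon> by (intro C) auto
        then show ?thesis
          using k C d[of s] by (intro order_trans[OF k(2)] mult_right_mono mult_mono) auto
      qed
    qed (use t in auto)
    also have "\<dots> \<le> C * d * k * (2 * \<epsilon>)" using t C k d0 by (intro mult_left_mono) auto
    finally show ?thesis by (simp add: mult_ac)
  qed
  define T where "T f = Bcontfun (\<Phi> (apply_bcontfun f))" for f :: "real \<Rightarrow>\<^sub>C 'b"
  have T: "apply_bcontfun (T f) = \<Phi> (apply_bcontfun f)" for f
    unfolding T_def by (rule Bcontfun_inverse[OF \<Phi>_bcont]) simp
  have "dist (T f) (T g) \<le> 1/2 * dist f g" for f g
  proof (rule dist_bound)
    fix t
    have c: "continuous_on {-\<epsilon>..\<epsilon>} (apply_bcontfun f)" "continuous_on {-\<epsilon>..\<epsilon>} (apply_bcontfun g)"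
      by (auto intro: continuous_on_subset[OF continuous_on_apply_bcontfun])
    have d: "norm (f s - g s) \<le> dist f g" for s using dist_bounded[of f s g] by (simp add: dist_norm)
    have "dist (T f t) (T g t) = norm ((F f (cl t) - F g (cl t)) - (F f 0 - F g 0))"
      by (simp add: T \<Phi>_def dist_norm algebra_simps)
    also have "\<dots> \<le> 2 * \<epsilon> * C * k * dist f g + 2 * \<epsilon> * C * k * dist f g"
      using \<epsilon> by (intro order_trans[OF norm_triangle_ineq4] add_mono Fbound c d cl) auto
    also have "\<dots> = (4 * \<epsilon> * C * k) * dist f g" by simp
    also have "\<dots> \<le> 1/2 * dist f g" using \<epsilon>(3) by (intro mult_right_mono) auto
    finally show "dist (T f t) (T g t) \<le> 1/2 * dist f g" .
  qed
  then obtain f where f: "T f = f"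
    using banach_fix_type[of "1/2" T] by auto
  define y where "y = apply_bcontfun f"
  have y: "y t = \<Phi> y t" for t using f T[of f] by (simp add: y_def)
  have yc: "continuous_on {-\<epsilon>..\<epsilon>} y"
    unfolding y_def by (auto intro: continuous_on_subset[OF continuous_on_apply_bcontfun])
  have "(y has_vector_derivative mul (a t) (y t)) (at t)" if t: "t \<in> {-\<epsilon><..<\<epsilon>}" for t
  proof -
    have "(F y has_vector_derivative mul (a t) (y t)) (at t)"
      using Fd[OF yc, of t] t by (simp add: at_within_Icc_at)
    then have "((\<lambda>t. y0 + (F y t - F y 0)) has_vector_derivative mul (a t) (y t)) (at t)"
      by (auto intro!: derivative_eq_intros)
    then show ?thesis
      by (rule has_vector_derivative_transform_within_open[of _ _ _ "{-\<epsilon><..<\<epsilon>}"])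
        (use t in \<open>auto simp: y[of s for s] \<Phi>_def cl_def\<close>)
  qed
  moreover have "y 0 = y0" using \<epsilon> by (simp add: y \<Phi>_def cl_def)
  ultimately show ?thesis using \<epsilon> by blast
qed

text \<open>The equation expresses the derivative of \<open>y\<close> by \<open>a\<close> and \<open>y\<close>, so each order of differentiability yields
  the next one.\<close>

lemma linear_ode_smooth:
  assumes S: "open S" and prod: "bounded_bilinear mul" and a: "smooth_on S a"
    and y: "\<And>t. t \<in> S \<Longrightarrow> (y has_vector_derivative mul (a t) (y t)) (at t)"
  shows "smooth_on S y"
  unfolding smooth_on_def
proof
  fix k show "Ck_on k S y"
  proof (induction k)
    case 0
    show ?case
      using y by (auto intro!: continuous_at_imp_continuous_on has_vector_derivative_continuous)
  next
    case (Suc k)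
    show ?case
      by (rule Ck_on_Suc_deriv[OF S y[unfolded has_vector_derivative_def]])
        (auto intro!: Ck_on_bilinear[OF S bounded_bilinear_scaleR] Ck_on_const S
          Ck_on_bilinear[OF S prod] smooth_onD_Ck[OF a] Suc.IH)
  qed
qed

section \<open>Metric connections with skew torsion in coordinates\<close>

text \<open>The curvature of the connection with Christoffel symbols \<open>\<Gamma> z u v = \<nabla>\<^sub>u \<partial>\<^sub>v\<close>, evaluated on fields with
  constant components.\<close>

definition curv_coord :: "('e::real_normed_vector \<Rightarrow> 'e \<Rightarrow> 'e \<Rightarrow> 'e) \<Rightarrow> 'e \<Rightarrow> 'e \<Rightarrow> 'e \<Rightarrow> 'e \<Rightarrow> 'e" where
  "curv_coord \<Gamma> z u v w =
     frechet_derivative (\<lambda>y. \<Gamma> y v w) (at z) u - frechet_derivative (\<lambda>y. \<Gamma> y u w) (at z) v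
     + \<Gamma> z u (\<Gamma> z v w) - \<Gamma> z v (\<Gamma> z u w)"

text \<open>On an open set of a vector space: a metric \<open>gg\<close>, the Christoffel symbols \<open>\<Gamma>L\<close> of its Levi-Civita
  connection, a closed three-form \<open>hh\<close>, and \<open>hs z u v\<close>, the vector dual to \<open>hh z u v\<close>. The first argument
  is always the point.\<close>

locale coord_geometry =
  fixes \<Omega> :: "'e::euclidean_space set"
    and gg :: "'e \<Rightarrow> 'e \<Rightarrow> 'e \<Rightarrow> real"
    and \<Gamma>L :: "'e \<Rightarrow> 'e \<Rightarrow> 'e \<Rightarrow> 'e"
    and hh :: "'e \<Rightarrow> 'e \<Rightarrow> 'e \<Rightarrow> 'e \<Rightarrow> real"
    and hs :: "'e \<Rightarrow> 'e \<Rightarrow> 'e \<Rightarrow> 'e"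
  assumes open_\<Omega>: "open \<Omega>"
    and gg_smooth: "smooth_on \<Omega> (\<lambda>z. gg z u v)"
    and gg_linear: "z \<in> \<Omega> \<Longrightarrow> linear (gg z u)"
    and gg_sym: "z \<in> \<Omega> \<Longrightarrow> gg z u v = gg z v u"
    and gg_pos: "z \<in> \<Omega> \<Longrightarrow> u \<noteq> 0 \<Longrightarrow> gg z u u > 0"
    and \<Gamma>L_smooth: "smooth_on \<Omega> (\<lambda>z. \<Gamma>L z u v)"
    and \<Gamma>L_linear: "z \<in> \<Omega> \<Longrightarrow> linear (\<Gamma>L z u)"
    and \<Gamma>L_sym: "z \<in> \<Omega> \<Longrightarrow> \<Gamma>L z u v = \<Gamma>L z v u"
    and \<Gamma>L_metric: "z \<in> \<Omega> \<Longrightarrow> frechet_derivative (\<lambda>y. gg y u v) (at z) w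
          = gg z (\<Gamma>L z w u) v + gg z u (\<Gamma>L z w v)"
    and hh_smooth: "smooth_on \<Omega> (\<lambda>z. hh z u v w)"
    and hh_linear: "z \<in> \<Omega> \<Longrightarrow> linear (\<lambda>u. hh z u v w)"
    and hh_skew: "z \<in> \<Omega> \<Longrightarrow> hh z u v w = - hh z v u w"
    and hh_cyclic: "z \<in> \<Omega> \<Longrightarrow> hh z u v w = hh z v w u"
    and hh_closed: "z \<in> \<Omega> \<Longrightarrow>
          frechet_derivative (\<lambda>y. hh y b c d) (at z) a - frechet_derivative (\<lambda>y. hh y a c d) (at z) b
        + frechet_derivative (\<lambda>y. hh y a b d) (at z) c - frechet_derivative (\<lambda>y. hh y a b c) (at z) d = 0"
    and hs_smooth: "smooth_on \<Omega> (\<lambda>z. hs z u v)"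
    and hs: "z \<in> \<Omega> \<Longrightarrow> gg z (hs z u v) w = hh z u v w"
begin

lemma gg_left_linear: "z \<in> \<Omega> \<Longrightarrow> linear (\<lambda>u. gg z u v)"
proof -
  assume z: "z \<in> \<Omega>"
  have "(\<lambda>u. gg z u v) = gg z v" using gg_sym[OF z] by blast
  then show ?thesis using gg_linear[OF z] by simp
qed

lemma gg_simps:
  assumes "z \<in> \<Omega>"
  shows "gg z u (v + w) = gg z u v + gg z u w" "gg z (u + v) w = gg z u w + gg z v w"
    "gg z u (v - w) = gg z u v - gg z u w" "gg z (u - v) w = gg z u w - gg z v w"
    "gg z u (r *\<^sub>R v) = r * gg z u v" "gg z (r *\<^sub>R u) v = r * gg z u v"
    "gg z u (- v) = - gg z u v" "gg z (- u) v = - gg z u v"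
    "gg z 0 v = 0" "gg z u 0 = 0"
  using linear_add[OF gg_left_linear[OF assms]] linear_diff[OF gg_left_linear[OF assms]]
    linear_scale[OF gg_left_linear[OF assms]] linear_neg[OF gg_left_linear[OF assms]]
    linear_0[OF gg_left_linear[OF assms]] gg_linear[OF assms, of u]
  by (simp_all add: linear_add linear_diff linear_scale linear_neg linear_0)

lemma gg_eqI:
  assumes z: "z \<in> \<Omega>" and eq: "\<And>w. gg z u w = gg z v w" shows "u = v"
  using gg_pos[OF z, of "u - v"] eq[of "u - v"] by (fastforce simp: gg_simps[OF z])

lemma hh_simps:
  assumes z: "z \<in> \<Omega>"
  shows "hh z (u + u') v w = hh z u v w + hh z u' v w" "hh z u (v + v') w = hh z u v w + hh z u v' w"
    "hh z u v (w + w') = hh z u v w + hh z u v w'"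
    "hh z (r *\<^sub>R u) v w = r * hh z u v w" "hh z u (r *\<^sub>R v) w = r * hh z u v w"
    "hh z u v (r *\<^sub>R w) = r * hh z u v w"
    "hh z (- u) v w = - hh z u v w" "hh z u (- v) w = - hh z u v w" "hh z u v (- w) = - hh z u v w"
proof -
  note l = hh_linear[OF z]
  show "hh z (u + u') v w = hh z u v w + hh z u' v w" "hh z (r *\<^sub>R u) v w = r * hh z u v w"
    "hh z (- u) v w = - hh z u v w"
    using linear_add[OF l] linear_scale[OF l] linear_neg[OF l] by auto
  show "hh z u (v + v') w = hh z u v w + hh z u v' w" "hh z u (r *\<^sub>R v) w = r * hh z u v w"
    "hh z u (- v) w = - hh z u v w"
    using linear_add[OF l] linear_scale[OF l] linear_neg[OF l] by (auto simp: hh_cyclic[OF z, of u])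
  show "hh z u v (w + w') = hh z u v w + hh z u v w'" "hh z u v (r *\<^sub>R w) = r * hh z u v w"
    "hh z u v (- w) = - hh z u v w"
    using linear_add[OF l] linear_scale[OF l] linear_neg[OF l] by (simp_all add: hh_cyclic[OF z, of _ u v, symmetric])
qed

lemma hh_skew23: "z \<in> \<Omega> \<Longrightarrow> hh z u v w = - hh z u w v"
  using hh_skew[of z v w u] by (simp add: hh_cyclic[of z u])

lemma hs_linear: assumes z: "z \<in> \<Omega>" shows "linear (hs z u)"
  by (rule linearI; rule gg_eqI[OF z]) (simp_all add: gg_simps hs hh_simps z)

lemma hs_skew: assumes z: "z \<in> \<Omega>" shows "hs z u v = - hs z v u"
  by (rule gg_eqI[OF z]) (simp add: gg_simps hs z hh_skew[of z v u])

text \<open>The Christoffel symbols of \<open>\<nabla>\<^sup>L + s g\<^sup>-\<^sup>1H\<close>.\<close>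

definition \<Gamma>s :: "real \<Rightarrow> 'e \<Rightarrow> 'e \<Rightarrow> 'e \<Rightarrow> 'e" where
  "\<Gamma>s s z u v = \<Gamma>L z u v + s *\<^sub>R hs z u v"

lemma \<Gamma>s_smooth: "smooth_on \<Omega> (\<lambda>z. \<Gamma>s s z u v)"
  unfolding \<Gamma>s_def
  by (intro smooth_on_add smooth_on_scaleR smooth_on_const open_\<Omega> \<Gamma>L_smooth hs_smooth)

lemma \<Gamma>s_linear: "z \<in> \<Omega> \<Longrightarrow> linear (\<Gamma>s s z u)"
  unfolding \<Gamma>s_def[abs_def]
  by (intro linear_compose_add \<Gamma>L_linear linear_compose_scale_right hs_linear)

text \<open>Interchanging the arguments of the Christoffel symbols changes the sign of the torsion.\<close>

lemma \<Gamma>s_swap: "z \<in> \<Omega> \<Longrightarrow> \<Gamma>s s z u v = \<Gamma>s (- s) z v u"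
  unfolding \<Gamma>s_def by (simp add: \<Gamma>L_sym[of z u v] hs_skew[of z u v])

lemma \<Gamma>s_left_linear: "z \<in> \<Omega> \<Longrightarrow> linear (\<lambda>u. \<Gamma>s s z u v)"
  using \<Gamma>s_linear[of z "- s" v] by (simp add: \<Gamma>s_swap[of z s])

lemma \<Gamma>s_simps:
  assumes "z \<in> \<Omega>"
  shows "\<Gamma>s s z u (v + w) = \<Gamma>s s z u v + \<Gamma>s s z u w" "\<Gamma>s s z (u + v) w = \<Gamma>s s z u w + \<Gamma>s s z v w"
    "\<Gamma>s s z u (v - w) = \<Gamma>s s z u v - \<Gamma>s s z u w" "\<Gamma>s s z (u - v) w = \<Gamma>s s z u w - \<Gamma>s s z v w"
    "\<Gamma>s s z u (r *\<^sub>R v) = r *\<^sub>R \<Gamma>s s z u v" "\<Gamma>s s z (r *\<^sub>R u) v = r *\<^sub>R \<Gamma>s s z u v"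
    "\<Gamma>s s z u (- v) = - \<Gamma>s s z u v" "\<Gamma>s s z (- u) v = - \<Gamma>s s z u v"
    "\<Gamma>s s z 0 v = 0" "\<Gamma>s s z u 0 = 0"
  using linear_add[OF \<Gamma>s_left_linear[OF assms]] linear_diff[OF \<Gamma>s_left_linear[OF assms]]
    linear_scale[OF \<Gamma>s_left_linear[OF assms]] linear_neg[OF \<Gamma>s_left_linear[OF assms]]
    linear_0[OF \<Gamma>s_left_linear[OF assms]] \<Gamma>s_linear[OF assms, of s u]
  by (simp_all add: linear_add linear_diff linear_scale linear_neg linear_0)

text \<open>Skew torsion preserves metricity, since \<open>H(w, u, v) + H(w, v, u) = 0\<close>.\<close>

lemma \<Gamma>s_metric: "z \<in> \<Omega> \<Longrightarrow> frechet_derivative (\<lambda>y. gg y u v) (at z) w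
    = gg z (\<Gamma>s s z w u) v + gg z u (\<Gamma>s s z w v)"
  unfolding \<Gamma>s_def \<Gamma>L_metric
  by (simp add: gg_simps hs gg_sym[of z u "hs z w v"] hh_skew23[of z w v u])

lemma \<Gamma>L_koszul:
  assumes z: "z \<in> \<Omega>"
  shows "gg z (\<Gamma>L z u v) w = (frechet_derivative (\<lambda>y. gg y v w) (at z) u
     + frechet_derivative (\<lambda>y. gg y u w) (at z) v - frechet_derivative (\<lambda>y. gg y u v) (at z) w) / 2"
  unfolding \<Gamma>L_metric[OF z]
  using \<Gamma>L_sym[OF z, of u v] \<Gamma>L_sym[OF z, of u w] \<Gamma>L_sym[OF z, of v w]
  by (simp add: gg_sym[OF z, of v "\<Gamma>L z w u"] gg_sym[OF z, of u "\<Gamma>L z w v"])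

lemma frechet_derivative_cong\<Omega>:
  assumes "smooth_on \<Omega> f" "\<And>y. y \<in> \<Omega> \<Longrightarrow> f y = f' y" "z \<in> \<Omega>"
  shows "frechet_derivative f (at z) = frechet_derivative f' (at z)"
  by (rule frechet_derivative_transform_within_open[OF _ open_\<Omega> assms(3,2)])
    (use smooth_on_has_derivative[OF assms(1,3)] in \<open>auto intro: differentiableI\<close>)

text \<open>Metricity turns the second covariant derivative into derivatives of the lowered Christoffel symbols,
  which have simple symmetries.\<close>

lemma curv_lowered:
  assumes z: "z \<in> \<Omega>"
  shows "gg z (curv_coord (\<Gamma>s s) z u v w) x =
      frechet_derivative (\<lambda>y. gg y (\<Gamma>s s y v w) x) (at z) u
    - frechet_derivative (\<lambda>y. gg y (\<Gamma>s s y u w) x) (at z) v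
    - gg z (\<Gamma>s s z v w) (\<Gamma>s s z u x) + gg z (\<Gamma>s s z u w) (\<Gamma>s s z v x)"
proof -
  have "frechet_derivative (\<lambda>y. gg y (\<Gamma>s s y v w) x) (at z) u
      = gg z (\<Gamma>s s z u (\<Gamma>s s z v w)) x + gg z (\<Gamma>s s z v w) (\<Gamma>s s z u x)
        + gg z (frechet_derivative (\<lambda>y. \<Gamma>s s y v w) (at z) u) x" for u v
  proof -
    have "((\<lambda>y. gg y (\<Gamma>s s y v w) x) has_derivative
        (\<lambda>h. frechet_derivative (\<lambda>y. gg y (\<Gamma>s s z v w) x) (at z) h
           + gg z (frechet_derivative (\<lambda>y. \<Gamma>s s y v w) (at z) h) x)) (at z)"
      by (rule has_derivative_linear_apply[OF open_\<Omega> z])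
        (auto intro: gg_left_linear smooth_on_has_derivative[OF gg_smooth z] smooth_on_has_derivative[OF \<Gamma>s_smooth z])
    then show ?thesis by (simp add: frechet_derivative_eqI \<Gamma>s_metric[OF z, of _ _ _ s])
  qed
  then show ?thesis by (simp add: curv_coord_def gg_simps[OF z])
qed

text \<open>Interchanging the two pairs of arguments turns \<open>\<nabla>\<^sup>L + s g\<^sup>-\<^sup>1H\<close> into \<open>\<nabla>\<^sup>L - s g\<^sup>-\<^sup>1H\<close>: the
  quadratic terms match because the two connections differ by interchanging the arguments of the
  Christoffel symbols, the second derivatives of the metric match by Koszul's formula, and the
  derivatives of the torsion cancel because it is closed.\<close>

lemma curv_pair_symmetry:
  assumes z: "z \<in> \<Omega>"
  shows "gg z (curv_coord (\<Gamma>s s) z u v w) x = gg z (curv_coord (\<Gamma>s (- s)) z w x u) v"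
proof -
  define g2 where "g2 a b c d = frechet_derivative (\<lambda>y. frechet_derivative (\<lambda>y. gg y c d) (at y) b) (at z) a" for a b c d
  define h1 where "h1 a b c d = frechet_derivative (\<lambda>y. hh y b c d) (at z) a" for a b c d
  have g2_sym: "g2 a b c d = g2 b a c d" for a b c d
    unfolding g2_def by (rule second_derivative_symmetric[OF open_\<Omega> z gg_smooth])
  have g2_sym': "g2 a b c d = g2 a b d c" for a b c d
  proof -
    have "frechet_derivative (\<lambda>y. gg y c d) (at y) b = frechet_derivative (\<lambda>y. gg y d c) (at y) b" if "y \<in> \<Omega>" for y
      by (rule fun_cong[OF frechet_derivative_cong\<Omega>[OF gg_smooth gg_sym that]])
    then show ?thesis
      unfolding g2_def by (intro fun_cong[OF frechet_derivative_cong\<Omega>[OF smooth_on_frechet[OF gg_smooth] _ z]]) auto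
  qed
  have h1_skew: "h1 a b c d = - h1 a c b d" for a b c d
  proof -
    have "h1 a b c d = frechet_derivative (\<lambda>y. - hh y c b d) (at z) a"
      unfolding h1_def by (rule fun_cong[OF frechet_derivative_cong\<Omega>[OF hh_smooth hh_skew z]])
    also have "\<dots> = - h1 a c b d"
      unfolding h1_def
      by (simp add: frechet_derivative_eqI[OF has_derivative_minus[OF smooth_on_has_derivative[OF hh_smooth z]]])
    finally show ?thesis .
  qed
  have h1_cyclic: "h1 a b c d = h1 a c d b" for a b c d
    unfolding h1_def by (rule fun_cong[OF frechet_derivative_cong\<Omega>[OF hh_smooth hh_cyclic z]])
  have L: "frechet_derivative (\<lambda>y. gg y (\<Gamma>s s y b c) d) (at z) a
      = (g2 a b c d + g2 a c b d - g2 a d b c) / 2 + s * h1 a b c d" for s a b c d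
  proof -
    let ?D = "\<lambda>c d b y. frechet_derivative (\<lambda>y. gg y c d) (at y) b"
    have "((\<lambda>y. (?D c d b y + ?D b d c y - ?D b c d y) * (1/2) + s * hh y b c d) has_derivative
        (\<lambda>a. (g2 a b c d + g2 a c b d - g2 a d b c) * (1/2) + s * h1 a b c d)) (at z)"
      unfolding g2_def h1_def
      by (intro has_derivative_add has_derivative_diff has_derivative_mult_right has_derivative_mult_left
          smooth_on_has_derivative[OF smooth_on_frechet[OF gg_smooth] z] smooth_on_has_derivative[OF hh_smooth z])
    then have "((\<lambda>y. gg y (\<Gamma>s s y b c) d) has_derivative
        (\<lambda>a. (g2 a b c d + g2 a c b d - g2 a d b c) * (1/2) + s * h1 a b c d)) (at z)"
      by (rule has_derivative_transform_within_open[OF _ open_\<Omega> z])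
        (simp add: \<Gamma>s_def gg_simps hs \<Gamma>L_koszul)
    then show ?thesis by (simp add: frechet_derivative_eqI)
  qed
  have cl: "h1 u v w x - h1 v u w x + h1 w u v x - h1 x u v w = 0"
    unfolding h1_def by (rule hh_closed[OF z])
  have lin: "s * h1 u v w x - s * h1 v u w x = - s * h1 w x u v - - s * h1 x w u v"
  proof -
    have "s * h1 u v w x - s * h1 v u w x = s * (h1 x u v w - h1 w u v x)"
      using cl by (simp flip: right_diff_distrib)
    moreover have "h1 w x u v = h1 w u v x" "h1 x w u v = h1 x u v w"
      by (rule h1_cyclic)+
    ultimately show ?thesis by (simp add: algebra_simps)
  qed
  have "gg z (\<Gamma>s s z v w) (\<Gamma>s s z u x) = gg z (\<Gamma>s (- s) z x u) (\<Gamma>s (- s) z w v)"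
    "gg z (\<Gamma>s s z u w) (\<Gamma>s s z v x) = gg z (\<Gamma>s (- s) z w u) (\<Gamma>s (- s) z x v)"
    using \<Gamma>s_swap[OF z, of s v w] \<Gamma>s_swap[OF z, of s u x] \<Gamma>s_swap[OF z, of s u w] \<Gamma>s_swap[OF z, of s v x]
      gg_sym[OF z] by metis+
  moreover have "g2 u v w x = g2 v u w x" "g2 u w v x = g2 w u x v" "g2 v w u x = g2 w v u x"
     "g2 u x v w = g2 x u w v" "g2 v x u w = g2 x v w u" "g2 w x u v = g2 x w u v" "g2 w v x u = g2 w v u x"
     "g2 x v w u = g2 x v u w"
    using g2_sym g2_sym' by metis+
  ultimately show ?thesis
    unfolding curv_lowered[OF z] L using lin g2_sym' by (simp add: field_simps)
qed

end

text \<open>A compatible complex structure \<open>ii\<close> that is parallel for \<open>\<nabla>\<^sup>+\<close>, that is \<open>\<partial>\<^sub>u ii = [ii, \<Gamma>\<^sup>+\<^sub>u]\<close>, and whose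
  Nijenhuis tensor vanishes on fields with constant components.\<close>

locale coord_complex = coord_geometry +
  fixes ii :: "'a \<Rightarrow> 'a \<Rightarrow> 'a"
  assumes ii_smooth: "smooth_on \<Omega> (\<lambda>z. ii z u)"
    and ii_linear: "z \<in> \<Omega> \<Longrightarrow> linear (ii z)"
    and ii_square: "z \<in> \<Omega> \<Longrightarrow> ii z (ii z u) = - u"
    and ii_gg: "z \<in> \<Omega> \<Longrightarrow> gg z (ii z u) (ii z v) = gg z u v"
    and ii_parallel: "z \<in> \<Omega> \<Longrightarrow> frechet_derivative (\<lambda>y. ii y w) (at z) u
          = ii z (\<Gamma>s (1/2) z u w) - \<Gamma>s (1/2) z u (ii z w)"
    and ii_integrable: "z \<in> \<Omega> \<Longrightarrow>
          frechet_derivative (\<lambda>y. ii y v) (at z) (ii z u) - frechet_derivative (\<lambda>y. ii y u) (at z) (ii z v)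
        + ii z (frechet_derivative (\<lambda>y. ii y u) (at z) v) - ii z (frechet_derivative (\<lambda>y. ii y v) (at z) u) = 0"
begin

abbreviation "\<Gamma>p \<equiv> \<Gamma>s (1/2)"
abbreviation "\<Gamma>m \<equiv> \<Gamma>s (- 1/2)"

definition om :: "'a \<Rightarrow> 'a \<Rightarrow> 'a \<Rightarrow> real" where
  "om z u v = gg z (ii z u) v"

lemma ii_simps:
  assumes "z \<in> \<Omega>"
  shows "ii z (u + v) = ii z u + ii z v" "ii z (u - v) = ii z u - ii z v" "ii z (- u) = - ii z u"
    "ii z (r *\<^sub>R u) = r *\<^sub>R ii z u" "ii z 0 = 0"
  using ii_linear[OF assms] by (auto simp: linear_add linear_diff linear_scale linear_neg linear_0)

lemma ii_gg_swap: "z \<in> \<Omega> \<Longrightarrow> gg z (ii z u) v = - gg z u (ii z v)"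
  using ii_gg[of z u "ii z v"] by (simp add: ii_square gg_simps)

lemma torsion: "z \<in> \<Omega> \<Longrightarrow> \<Gamma>p z u v - \<Gamma>p z v u = hs z u v"
  using hs_skew[of z v u] by (simp add: \<Gamma>s_def \<Gamma>L_sym[of z u v] flip: scaleR_left_distrib)

text \<open>Since \<open>\<nabla>\<^sup>+I = 0\<close>, the Nijenhuis tensor of \<open>I\<close> only involves the torsion; its vanishing says
  that \<open>H\<close> has no component of type (3,0) or (0,3).\<close>

lemma hh_type:
  assumes z: "z \<in> \<Omega>"
  shows "hh z (ii z u) (ii z v) w + hh z (ii z u) v (ii z w) + hh z u (ii z v) (ii z w) = hh z u v w"
proof -
  have "0 = ii z (\<Gamma>p z (ii z u) v) - \<Gamma>p z (ii z u) (ii z v) - (ii z (\<Gamma>p z (ii z v) u) - \<Gamma>p z (ii z v) (ii z u))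
     + ii z (ii z (\<Gamma>p z v u) - \<Gamma>p z v (ii z u)) - ii z (ii z (\<Gamma>p z u v) - \<Gamma>p z u (ii z v))"
    using ii_integrable[OF z, of v u] unfolding ii_parallel[OF z] by simp
  also have "\<dots> = ii z (\<Gamma>p z (ii z u) v - \<Gamma>p z v (ii z u)) + ii z (\<Gamma>p z u (ii z v) - \<Gamma>p z (ii z v) u)
     - (\<Gamma>p z (ii z u) (ii z v) - \<Gamma>p z (ii z v) (ii z u)) + (\<Gamma>p z u v - \<Gamma>p z v u)"
    by (simp add: ii_simps[OF z] ii_square[OF z])
  also have "\<dots> = ii z (hs z (ii z u) v) + ii z (hs z u (ii z v)) - hs z (ii z u) (ii z v) + hs z u v"
    by (simp only: torsion[OF z])
  finally have "gg z (ii z (hs z (ii z u) v) + ii z (hs z u (ii z v)) - hs z (ii z u) (ii z v) + hs z u v) w = gg z 0 w"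
    by simp
  then show ?thesis by (simp add: gg_simps[OF z] ii_gg_swap[OF z] hs[OF z])
qed

lemma om_derivative:
  assumes z: "z \<in> \<Omega>"
  shows "((\<lambda>y. om y u v) has_derivative (\<lambda>w. om z (\<Gamma>p z w u) v + om z u (\<Gamma>p z w v))) (at z)"
proof -
  have "((\<lambda>y. gg y (ii y u) v) has_derivative
      (\<lambda>h. frechet_derivative (\<lambda>y. gg y (ii z u) v) (at z) h + gg z (frechet_derivative (\<lambda>y. ii y u) (at z) h) v)) (at z)"
    by (rule has_derivative_linear_apply[OF open_\<Omega> z])
      (auto intro: gg_left_linear smooth_on_has_derivative[OF gg_smooth z] smooth_on_has_derivative[OF ii_smooth z])
  then show ?thesis
    by (simp add: om_def \<Gamma>s_metric[OF z, of _ _ _ "1/2"] ii_parallel[OF z] gg_simps[OF z] add.commute)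
qed

lemma om_skew: "z \<in> \<Omega> \<Longrightarrow> om z u v = - om z v u"
  by (simp add: om_def ii_gg_swap[of z u v] gg_sym[of z u "ii z v"])

lemma om_smooth: "smooth_on \<Omega> (\<lambda>z. om z u v)"
  unfolding om_def
  by (rule smooth_on_linear_apply[OF open_\<Omega> gg_left_linear gg_smooth ii_smooth])

lemma om_linear: "z \<in> \<Omega> \<Longrightarrow> linear (om z u)"
  unfolding om_def[abs_def] by (rule gg_linear)

text \<open>As \<open>\<omega>\<close> is \<open>\<nabla>\<^sup>+\<close>-parallel, \<open>d\<omega>\<close> is the contraction of \<open>\<omega>\<close> with the torsion.\<close>

lemma d_om:
  assumes z: "z \<in> \<Omega>"
  shows "frechet_derivative (\<lambda>y. om y v w) (at z) u + frechet_derivative (\<lambda>y. om y w u) (at z) v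
       + frechet_derivative (\<lambda>y. om y u v) (at z) w
     = - (hh z u v (ii z w) + hh z v w (ii z u) + hh z w u (ii z v))"
proof -
  have "om z (\<Gamma>p z u v) w + om z v (\<Gamma>p z u w) + (om z (\<Gamma>p z v w) u + om z w (\<Gamma>p z v u))
      + (om z (\<Gamma>p z w u) v + om z u (\<Gamma>p z w v))
    = om z (\<Gamma>p z u v) w - om z (\<Gamma>p z v u) w + (om z (\<Gamma>p z v w) u - om z (\<Gamma>p z w v) u)
      + (om z (\<Gamma>p z w u) v - om z (\<Gamma>p z u w) v)"
    using om_skew[OF z, of v] om_skew[OF z, of w] om_skew[OF z, of u] by simp
  also have "\<dots> = om z (hs z u v) w + om z (hs z v w) u + om z (hs z w u) v"
    unfolding torsion[OF z, symmetric] by (simp add: om_def ii_simps[OF z] gg_simps[OF z])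
  finally show ?thesis
    unfolding frechet_derivative_eqI[OF om_derivative[OF z]]
    by (simp add: om_def ii_gg_swap[OF z] hs[OF z])
qed

text \<open>Since \<open>I\<^sup>2 = -1\<close>, inserting \<open>I\<close> into all arguments of \<open>d\<omega>\<close> leaves a sum of terms of \<open>H\<close> with two
  factors \<open>I\<close>, to which the type condition applies.\<close>

lemma dc_om:
  fixes u v w :: 'a
  assumes z: "z \<in> \<Omega>"
  defines "u' \<equiv> ii z u" and "v' \<equiv> ii z v" and "w' \<equiv> ii z w"
  shows "frechet_derivative (\<lambda>y. om y v' w') (at z) u' + frechet_derivative (\<lambda>y. om y w' u') (at z) v'
       + frechet_derivative (\<lambda>y. om y u' v') (at z) w' = hh z u v w"
  unfolding d_om[OF z] unfolding u'_def v'_def w'_def ii_square[OF z] hh_simps[OF z]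
  using hh_type[OF z, of u v w] hh_cyclic[OF z, of "ii z v" "ii z w" u] hh_cyclic[OF z, of "ii z w" "ii z u" v]
    hh_cyclic[OF z, of u "ii z v" "ii z w"] hh_cyclic[OF z, of v "ii z w" "ii z u"] by simp

text \<open>The integrability condition of the equation \<open>\<partial>\<^sub>u ii = [ii, \<Gamma>\<^sup>+\<^sub>u]\<close>: the second derivatives of \<open>ii\<close> are symmetric.\<close>

lemma curv_ii:
  assumes z: "z \<in> \<Omega>"
  shows "curv_coord \<Gamma>p z u v (ii z w) = ii z (curv_coord \<Gamma>p z u v w)"
proof -
  have *: "frechet_derivative (\<lambda>y. frechet_derivative (\<lambda>y. ii y w) (at y) h) (at z) k
    = ii z (\<Gamma>p z k (\<Gamma>p z h w)) - \<Gamma>p z k (ii z (\<Gamma>p z h w)) + ii z (frechet_derivative (\<lambda>y. \<Gamma>p y h w) (at z) k)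
      - (frechet_derivative (\<lambda>y. \<Gamma>p y h (ii z w)) (at z) k + \<Gamma>p z h (ii z (\<Gamma>p z k w) - \<Gamma>p z k (ii z w)))" for h k
  proof -
    have 1: "((\<lambda>y. ii y (\<Gamma>p y h w)) has_derivative
        (\<lambda>k. frechet_derivative (\<lambda>y. ii y (\<Gamma>p z h w)) (at z) k + ii z (frechet_derivative (\<lambda>y. \<Gamma>p y h w) (at z) k))) (at z)"
      by (rule has_derivative_linear_apply[OF open_\<Omega> z])
        (auto intro: ii_linear smooth_on_has_derivative[OF \<Gamma>s_smooth z] smooth_on_has_derivative[OF ii_smooth z])
    have 2: "((\<lambda>y. \<Gamma>p y h (ii y w)) has_derivative
        (\<lambda>k. frechet_derivative (\<lambda>y. \<Gamma>p y h (ii z w)) (at z) k + \<Gamma>p z h (frechet_derivative (\<lambda>y. ii y w) (at z) k))) (at z)"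
      by (rule has_derivative_linear_apply[OF open_\<Omega> z])
        (auto intro: \<Gamma>s_linear smooth_on_has_derivative[OF \<Gamma>s_smooth z] smooth_on_has_derivative[OF ii_smooth z])
    have "((\<lambda>y. frechet_derivative (\<lambda>y. ii y w) (at y) h) has_derivative
       (\<lambda>k. frechet_derivative (\<lambda>y. ii y (\<Gamma>p z h w)) (at z) k + ii z (frechet_derivative (\<lambda>y. \<Gamma>p y h w) (at z) k)
          - (frechet_derivative (\<lambda>y. \<Gamma>p y h (ii z w)) (at z) k + \<Gamma>p z h (frechet_derivative (\<lambda>y. ii y w) (at z) k)))) (at z)"
      by (rule has_derivative_transform_within_open[OF has_derivative_diff[OF 1 2] open_\<Omega> z]) (simp add: ii_parallel)
    then show ?thesis by (simp add: frechet_derivative_eqI ii_parallel[OF z])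
  qed
  have "frechet_derivative (\<lambda>y. frechet_derivative (\<lambda>y. ii y w) (at y) v) (at z) u
      = frechet_derivative (\<lambda>y. frechet_derivative (\<lambda>y. ii y w) (at y) u) (at z) v"
    by (rule second_derivative_symmetric[OF open_\<Omega> z ii_smooth])
  then show ?thesis
    unfolding * by (simp add: curv_coord_def ii_simps[OF z] \<Gamma>s_simps[OF z] algebra_simps)
qed

text \<open>\<open>R\<^sup>-\<close> is of type (1,1) in its first two arguments, by pair symmetry and because \<open>R\<^sup>+\<close> commutes
  with \<open>I\<close>.\<close>

lemma curv_minus_type:
  assumes z: "z \<in> \<Omega>"
  shows "curv_coord \<Gamma>m z (ii z u) (ii z v) w = curv_coord \<Gamma>m z u v w"
proof (rule gg_eqI[OF z])
  fix x
  have "gg z (curv_coord \<Gamma>m z (ii z u) (ii z v) w) x = gg z (curv_coord \<Gamma>p z w x (ii z u)) (ii z v)"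
    using curv_pair_symmetry[OF z, of "- 1/2"] by simp
  also have "\<dots> = gg z (curv_coord \<Gamma>p z w x u) v" by (simp add: curv_ii[OF z] ii_gg[OF z])
  also have "\<dots> = gg z (curv_coord \<Gamma>m z u v w) x"
    using curv_pair_symmetry[OF z, of "- 1/2"] by simp
  finally show "gg z (curv_coord \<Gamma>m z (ii z u) (ii z v) w) x = gg z (curv_coord \<Gamma>m z u v w) x" .
qed

end

section \<open>Matrices\<close>

lemma matrix_apply: "linear (f :: real^'n \<Rightarrow> real^'n) \<Longrightarrow> matrix f *v x = f x"
  by (rule matrix_works) (simp add: linear_def scalar_mult_eq_scaleR)

lemma bounded_bilinear_matrix_mult: "bounded_bilinear ((**) :: real^'n^'n \<Rightarrow> real^'n^'n \<Rightarrow> real^'n^'n)"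
  unfolding bilinear_conv_bounded_bilinear[symmetric] bilinear_def
  by (auto intro!: linearI
    simp: matrix_add_ldistrib matrix_matrix_mult_def sum.distrib algebra_simps sum_distrib_left vec_eq_iff)

lemma bounded_bilinear_matrix_vector_mult: "bounded_bilinear ((*v) :: real^'n^'n \<Rightarrow> real^'n \<Rightarrow> real^'n)"
  unfolding bilinear_conv_bounded_bilinear[symmetric] bilinear_def
  by (auto intro!: linearI simp: algebra_simps scaleR_matrix_vector_assoc)

interpretation mm: bounded_bilinear "(**) :: real^'n^'n \<Rightarrow> real^'n^'n \<Rightarrow> real^'n^'n"
  by (rule bounded_bilinear_matrix_mult)

interpretation mv: bounded_bilinear "(*v) :: real^'n^'n \<Rightarrow> real^'n \<Rightarrow> real^'n"
  by (rule bounded_bilinear_matrix_vector_mult)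

lemmas mat_simps = mm.add_left mm.add_right mm.diff_left mm.diff_right mm.minus_left mm.minus_right
  mm.scaleR_left mm.scaleR_right matrix_mul_assoc[symmetric]

lemmas mat_vec_simps = mv.add_left mv.add_right mv.diff_left mv.diff_right mv.minus_left mv.minus_right
  mv.scaleR_left mv.scaleR_right matrix_vector_mul_assoc[symmetric]

lemma matrix_eqI: "(\<And>x. A *v x = B *v (x :: real^'n)) \<Longrightarrow> A = (B :: real^'n^'n)"
  by (simp add: matrix_eq)

lemma linear_trace: "linear (trace :: real^'n^'n \<Rightarrow> real)"
  by (rule linearI) (simp_all add: trace_def sum.distrib sum_distrib_left)

lemmas trace_simps = linear_add[OF linear_trace] linear_diff[OF linear_trace]
  linear_scale[OF linear_trace] linear_neg[OF linear_trace] linear_0[OF linear_trace]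

lemma smooth_on_matrix_mult:
  fixes f g :: "'a::real_normed_vector \<Rightarrow> real^'n^'n"
  shows "open S \<Longrightarrow> smooth_on S f \<Longrightarrow> smooth_on S g \<Longrightarrow> smooth_on S (\<lambda>x. f x ** g x)"
  by (rule smooth_on_bilinear[OF _ bounded_bilinear_matrix_mult])

lemma smooth_on_matrix:
  fixes f :: "'a::real_normed_vector \<Rightarrow> real^'n \<Rightarrow> real^'n"
  assumes "open S" "\<And>u. smooth_on S (\<lambda>x. f x u)"
  shows "smooth_on S (\<lambda>x. matrix (f x))"
  unfolding matrix_def by (intro smooth_on_vec_lambda smooth_on_nth assms)

lemma smooth_on_det:
  fixes f :: "'x::real_normed_vector \<Rightarrow> real^'k^'k"
  assumes "open S" "\<And>i j. smooth_on S (\<lambda>x. f x $ i $ j)"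
  shows "smooth_on S (\<lambda>x. det (f x))"
  unfolding det_def by (intro smooth_on_sum smooth_on_mult smooth_on_const smooth_on_prod assms)

lemma smooth_on_trace: "open S \<Longrightarrow> smooth_on S f \<Longrightarrow> smooth_on S (\<lambda>x. trace (f x :: real^'k^'k))"
  by (rule smooth_on_bounded_linear[OF _ linear_conv_bounded_linear[THEN iffD1, OF linear_trace]])

lemma sum_Basis_vec: "(\<Sum>b\<in>(Basis :: (real^'k) set). f b) = (\<Sum>i\<in>UNIV. f (axis i 1))"
proof -
  have B: "(Basis :: (real^'k) set) = range (\<lambda>i. axis i 1)" by (auto simp: Basis_vec_def)
  show ?thesis unfolding B by (subst sum.reindex) (auto simp: inj_on_def axis_eq_axis)
qed

section \<open>Fundamental solutions of linear systems\<close>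

lemma vector_derivative_zero_constant:
  fixes f :: "real \<Rightarrow> 'a::real_normed_vector"
  assumes "\<And>t. t \<in> {a<..<b} \<Longrightarrow> (f has_vector_derivative 0) (at t)" "s \<in> {a<..<b}" "t \<in> {a<..<b}"
  shows "f s = f t"
  by (rule has_derivative_zero_unique_connected[of "{a<..<b}"])
    (use assms in \<open>auto simp: has_vector_derivative_def\<close>)

text \<open>The inverse of the fundamental solution is obtained as the solution of the adjoint equation, which
  also shows that it is smooth.\<close>

lemma matrix_ode_solution:
  fixes a :: "real \<Rightarrow> real^'n^'n"
  assumes r: "r > 0" and a: "smooth_on {-r<..<r} a"
  shows "\<exists>\<epsilon> E Z. 0 < \<epsilon> \<and> \<epsilon> < r \<and> E 0 = mat 1 \<and> Z 0 = mat 1 \<and>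
    smooth_on {-\<epsilon><..<\<epsilon>} E \<and> smooth_on {-\<epsilon><..<\<epsilon>} Z \<and>
    (\<forall>t\<in>{-\<epsilon><..<\<epsilon>}. (E has_vector_derivative a t ** E t) (at t) \<and>
       (Z has_vector_derivative - (Z t ** a t)) (at t) \<and> Z t ** E t = mat 1 \<and> E t ** Z t = mat 1)"
proof -
  have c: "continuous_on {-(r/2)..r/2} a"
    by (rule continuous_on_subset[OF smooth_on_imp_continuous_on[OF a]]) (use r in auto)
  \<comment> \<open>The adjoint equation \<open>Z' = - Z a\<close> is linear with coefficients acting from the right.\<close>
  have flip: "bounded_bilinear (\<lambda>(a::real^'n^'n) (y::real^'n^'n). - (y ** a))"
    using bounded_bilinear.flip[OF mm.comp[OF bounded_linear_minus[OF bounded_linear_ident] bounded_linear_ident]]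
    by (simp add: mm.minus_left)
  obtain e1 E where e1: "0 < e1" "e1 \<le> r/2" "E 0 = mat 1"
    and E: "\<And>t. t \<in> {-e1<..<e1} \<Longrightarrow> (E has_vector_derivative a t ** E t) (at t)"
    using linear_ode_local_solution[OF bounded_bilinear_matrix_mult _ c, of "mat 1"] r by auto
  obtain e2 Z where e2: "0 < e2" "e2 \<le> r/2" "Z 0 = mat 1"
    and Z: "\<And>t. t \<in> {-e2<..<e2} \<Longrightarrow> (Z has_vector_derivative - (Z t ** a t)) (at t)"
    using linear_ode_local_solution[OF flip _ c, of "mat 1"] r by auto
  define e where "e = min e1 e2"
  have e: "0 < e" "e < r" and sub: "{-e<..<e} \<subseteq> {-e1<..<e1}" "{-e<..<e} \<subseteq> {-e2<..<e2}" "{-e<..<e} \<subseteq> {-r<..<r}"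
    using e1 e2 r by (auto simp: e_def)
  have "Z t ** E t = mat 1" if t: "t \<in> {-e<..<e}" for t
  proof -
    have d: "((\<lambda>t. Z t ** E t) has_vector_derivative 0) (at t)" if "t \<in> {-e<..<e}" for t
    proof -
      have "((\<lambda>t. Z t ** E t) has_vector_derivative (Z t ** (a t ** E t) + - (Z t ** a t) ** E t)) (at t)"
        by (rule mm.has_vector_derivative) (use that sub in \<open>auto intro: E Z\<close>)
      then show ?thesis by (simp add: mat_simps)
    qed
    have "Z t ** E t = Z 0 ** E 0"
      by (rule vector_derivative_zero_constant[OF d t]) (use e in auto)
    then show ?thesis by (simp add: e1 e2)
  qed
  moreover have "smooth_on {-e<..<e} E"
    by (rule linear_ode_smooth[OF _ bounded_bilinear_matrix_mult smooth_on_subset[OF a sub(3)]])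
      (use E sub in auto)
  moreover have "smooth_on {-e<..<e} Z"
    by (rule linear_ode_smooth[OF _ flip smooth_on_subset[OF a sub(3)]]) (use Z sub in auto)
  ultimately show ?thesis
    using e e1(3) e2(3) E Z sub matrix_left_right_inverse[of "Z t" "E t" for t]
    by (intro exI[of _ e] exI[of _ E] exI[of _ Z]) (auto simp: subset_iff)
qed

section \<open>The twistor space in coordinates\<close>

locale coord_twistor = coord_complex \<Omega> gg \<Gamma>L hh hs ii
  for \<Omega> :: "(real^'n) set" and gg \<Gamma>L hh hs ii
begin

text \<open>The Christoffel symbols and the curvature of \<open>\<nabla>\<^sup>-\<close> as matrices.\<close>

definition gam :: "real^'n \<Rightarrow> real^'n \<Rightarrow> real^'n^'n" where "gam z v = matrix (\<Gamma>m z v)"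

definition Rmat :: "real^'n \<Rightarrow> real^'n \<Rightarrow> real^'n \<Rightarrow> real^'n^'n" where
  "Rmat z u v = matrix (curv_coord \<Gamma>m z u v)"

text \<open>The fibre of the twistor space over \<open>z\<close>, and the vertical space at a point \<open>M\<close> of it.\<close>

definition tw :: "real^'n \<Rightarrow> (real^'n^'n) set" where
  "tw z = {M. M ** M = - mat 1 \<and> (\<forall>u w. gg z (M *v u) (M *v w) = gg z u w)}"

definition vert :: "real^'n \<Rightarrow> real^'n^'n \<Rightarrow> (real^'n^'n) set" where
  "vert z M = {B. (\<forall>u w. gg z (B *v u) w = - gg z u (B *v w)) \<and> B ** M + M ** B = 0}"

text \<open>The matrix component of the horizontal lift of \<open>v\<close> to the endomorphism \<open>M\<close>: along a curve with
  velocity \<open>v\<close>, parallel endomorphisms satisfy \<open>M' = - [\<Gamma>\<^sub>v, M]\<close>.\<close>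

definition hor :: "real^'n \<Rightarrow> real^'n \<Rightarrow> real^'n^'n \<Rightarrow> real^'n^'n" where
  "hor z v M = M ** gam z v - gam z v ** M"

lemma gam_apply: "z \<in> \<Omega> \<Longrightarrow> gam z v *v w = \<Gamma>m z v w"
  unfolding gam_def by (rule matrix_apply[OF \<Gamma>s_linear])

lemma gam_smooth: "smooth_on \<Omega> (\<lambda>z. gam z v)"
  unfolding gam_def by (rule smooth_on_matrix[OF open_\<Omega> \<Gamma>s_smooth])

lemma gam_linear: "z \<in> \<Omega> \<Longrightarrow> linear (gam z)"
  by (rule linearI; rule matrix_eqI) (simp_all add: mat_vec_simps gam_apply \<Gamma>s_simps)

lemma Rmat_eq:
  assumes z: "z \<in> \<Omega>"
  shows "Rmat z u v = frechet_derivative (\<lambda>y. gam y v) (at z) u - frechet_derivative (\<lambda>y. gam y u) (at z) v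
     + gam z u ** gam z v - gam z v ** gam z u" (is "_ = ?R")
    and Rmat_apply: "Rmat z u v *v w = curv_coord \<Gamma>m z u v w"
proof -
  have "frechet_derivative (\<lambda>y. \<Gamma>m y v w) (at z) u = frechet_derivative (\<lambda>y. gam y v) (at z) u *v w" for u v w
  proof -
    have "((\<lambda>y. gam y v *v w) has_derivative (\<lambda>u. frechet_derivative (\<lambda>y. gam y v) (at z) u *v w)) (at z)"
      by (rule bounded_linear.has_derivative[OF mv.bounded_linear_left smooth_on_has_derivative[OF gam_smooth z]])
    then have "((\<lambda>y. \<Gamma>m y v w) has_derivative (\<lambda>u. frechet_derivative (\<lambda>y. gam y v) (at z) u *v w)) (at z)"
      by (rule has_derivative_transform_within_open[OF _ open_\<Omega> z]) (simp add: gam_apply)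
    then show ?thesis by (simp add: frechet_derivative_eqI)
  qed
  then have *: "curv_coord \<Gamma>m z u v = (*v) ?R"
    by (simp add: fun_eq_iff curv_coord_def mat_vec_simps gam_apply[OF z])
  show 1: "Rmat z u v = ?R" unfolding Rmat_def * by simp
  show "Rmat z u v *v w = curv_coord \<Gamma>m z u v w" unfolding 1 * ..
qed

lemma Rmat_anti: "z \<in> \<Omega> \<Longrightarrow> Rmat z u v = - Rmat z v u"
  by (simp add: Rmat_eq)

text \<open>Pair symmetry moves \<open>w\<close> and \<open>x\<close> into the first two arguments, where curvature is alternating.\<close>

lemma Rmat_skew:
  assumes z: "z \<in> \<Omega>"
  shows "gg z (Rmat z u v *v w) x = - gg z w (Rmat z u v *v x)"
proof -
  have "gg z (Rmat z u v *v w) x = gg z (curv_coord \<Gamma>p z w x u) v"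
    "gg z (Rmat z u v *v x) w = gg z (curv_coord \<Gamma>p z x w u) v"
    using curv_pair_symmetry[OF z, of "- 1/2"] by (simp_all add: Rmat_apply z)
  moreover have "curv_coord \<Gamma>p z w x u = - curv_coord \<Gamma>p z x w u" by (simp add: curv_coord_def)
  ultimately show ?thesis by (simp add: gg_simps z gg_sym[OF z, of w])
qed

lemma Rmat_ii: assumes z: "z \<in> \<Omega>" shows "Rmat z (ii z u) (ii z v) = Rmat z u v"
  by (rule matrix_eqI) (simp only: Rmat_apply[OF z] curv_minus_type[OF z])

lemma tw_gg_swap:
  assumes z: "z \<in> \<Omega>" and M: "M \<in> tw z"
  shows "gg z (M *v u) w = - gg z u (M *v w)"
proof -
  have "M *v (M *v w) = - w" using M by (simp add: tw_def matrix_vector_mul_assoc mat_vec_simps(5))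
  then have "gg z (M *v u) w = - gg z (M *v u) (M *v (M *v w))" by (simp add: gg_simps z)
  then show ?thesis using M by (simp add: tw_def)
qed

lemma vert_anticommute:
  fixes X :: "real^'n^'n"
  assumes "M \<in> tw z" "B \<in> vert z M"
  shows "B ** M = - (M ** B)" "B ** (M ** X) = - (M ** (B ** X))"
    "M ** M = - mat 1" "M ** (M ** X) = - X"
proof -
  show 1: "B ** M = - (M ** B)" "M ** M = - mat 1"
    using assms by (auto simp: tw_def vert_def eq_neg_iff_add_eq_0)
  show "B ** (M ** X) = - (M ** (B ** X))" "M ** (M ** X) = - X"
    by (simp_all add: 1 matrix_mul_assoc mm.minus_left)
qed

lemma vert_add: "z \<in> \<Omega> \<Longrightarrow> B \<in> vert z M \<Longrightarrow> C \<in> vert z M \<Longrightarrow> B + C \<in> vert z M"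
  by (simp add: vert_def mat_vec_simps gg_simps mat_simps) (metis (no_types, lifting) add.assoc add.commute add.right_neutral)

lemma vert_scaleR: "z \<in> \<Omega> \<Longrightarrow> B \<in> vert z M \<Longrightarrow> r *\<^sub>R B \<in> vert z M"
  by (simp add: vert_def mat_vec_simps gg_simps mat_simps flip: scaleR_right_distrib)

lemma vert_tw_mult:
  assumes z: "z \<in> \<Omega>" and M: "M \<in> tw z" and B: "B \<in> vert z M"
  shows "M ** B \<in> vert z M"
proof -
  have "gg z ((M ** B) *v u) w = - gg z u ((M ** B) *v w)" for u w
  proof -
    have "gg z ((M ** B) *v u) w = gg z u (B *v (M *v w))"
      using B by (simp add: matrix_vector_mul_assoc[symmetric] tw_gg_swap[OF z M] vert_def)
    also have "B *v (M *v w) = - ((M ** B) *v w)"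
      by (simp add: matrix_vector_mul_assoc vert_anticommute[OF M B] mv.minus_left)
    finally show ?thesis by (simp add: gg_simps z)
  qed
  then show ?thesis by (simp add: vert_def mat_simps vert_anticommute[OF M B])
qed

text \<open>The commutator of a skew endomorphism with \<open>M\<close> is vertical at \<open>M\<close>.\<close>

lemma commutator_vert:
  assumes z: "z \<in> \<Omega>" and M: "M \<in> tw z" and R: "\<And>u w. gg z (R *v u) w = - gg z u (R *v w)"
  shows "R ** M - M ** R \<in> vert z M"
proof -
  have M2: "M ** M = - mat 1" "M ** (M ** X) = - X" for X :: "real^'n^'n"
    using M by (simp_all add: tw_def matrix_mul_assoc mm.minus_left)
  show ?thesis
    by (simp add: vert_def mat_vec_simps gg_simps z R tw_gg_swap[OF z M] mat_simps M2)
qed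

text \<open>Metricity of \<open>\<nabla>\<^sup>-\<close> along a curve.\<close>

lemma gg_curve_derivative:
  assumes S: "open S" "t \<in> S" and \<gamma>: "\<And>s. s \<in> S \<Longrightarrow> \<gamma> s \<in> \<Omega>" and d\<gamma>: "(\<gamma> has_vector_derivative \<gamma>') (at t)"
    and p: "(p has_vector_derivative p') (at t)" and q: "(q has_vector_derivative q') (at t)"
  shows "((\<lambda>s. gg (\<gamma> s) (p s) (q s)) has_vector_derivative
     gg (\<gamma> t) (p' + gam (\<gamma> t) \<gamma>' *v p t) (q t) + gg (\<gamma> t) (p t) (q' + gam (\<gamma> t) \<gamma>' *v q t)) (at t)"
proof -
  have z: "\<gamma> t \<in> \<Omega>" by (rule \<gamma>[OF S(2)])
  have 1: "((\<lambda>s. gg (\<gamma> s) u w) has_derivative (\<lambda>h. frechet_derivative (\<lambda>y. gg y u w) (at (\<gamma> t)) (h *\<^sub>R \<gamma>'))) (at t)" for u w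
    using diff_chain_at[OF d\<gamma>[unfolded has_vector_derivative_def] smooth_on_has_derivative[OF gg_smooth z]]
    by (simp add: o_def)
  have 2: "((\<lambda>s. gg (\<gamma> s) u (q s)) has_derivative
      (\<lambda>h. frechet_derivative (\<lambda>y. gg y u (q t)) (at (\<gamma> t)) (h *\<^sub>R \<gamma>') + gg (\<gamma> t) u (h *\<^sub>R q'))) (at t)" for u
    by (rule has_derivative_linear_apply[OF S gg_linear[OF \<gamma>] 1 q[unfolded has_vector_derivative_def]])
  have "((\<lambda>s. gg (\<gamma> s) (p s) (q s)) has_derivative
      (\<lambda>h. frechet_derivative (\<lambda>y. gg y (p t) (q t)) (at (\<gamma> t)) (h *\<^sub>R \<gamma>') + gg (\<gamma> t) (p t) (h *\<^sub>R q')
         + gg (\<gamma> t) (h *\<^sub>R p') (q t))) (at t)"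
    by (rule has_derivative_linear_apply[OF S gg_left_linear[OF \<gamma>] 2 p[unfolded has_vector_derivative_def]])
  then show ?thesis
    unfolding has_vector_derivative_def
    by (simp add: \<Gamma>s_metric[OF z, of _ _ _ "- 1/2"] gg_simps[OF z] gam_apply[OF z] \<Gamma>s_simps[OF z] algebra_simps)
qed

text \<open>Differentiating the equations of the twistor space: the velocity of a curve in it differs from
  the horizontal lift of the velocity of its projection by a vertical vector.\<close>

lemma velocity_vertical_part:
  assumes S: "open S" "t \<in> S" and \<gamma>: "\<And>s. s \<in> S \<Longrightarrow> \<gamma> s \<in> \<Omega>" and d\<gamma>: "(\<gamma> has_vector_derivative \<gamma>') (at t)"
    and L: "\<And>s. s \<in> S \<Longrightarrow> L s \<in> tw (\<gamma> s)" and dL: "(L has_vector_derivative L') (at t)"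
  shows "L' - hor (\<gamma> t) \<gamma>' (L t) \<in> vert (\<gamma> t) (L t)"
proof -
  define z where "z = \<gamma> t"
  define M where "M = L t"
  define c where "c = gam z \<gamma>'"
  define B where "B = L' - hor z \<gamma>' M"
  have z: "z \<in> \<Omega>" and M: "M \<in> tw z" using \<gamma> L S by (auto simp: z_def M_def)
  have M2: "M ** M = - mat 1" "M ** (M ** X) = - X" for X :: "real^'n^'n"
    using M by (simp_all add: tw_def matrix_mul_assoc mm.minus_left)
  have "((\<lambda>s. L s ** L s) has_vector_derivative (M ** L' + L' ** M)) (at t)"
    unfolding M_def by (rule mm.has_vector_derivative[OF dL dL])
  moreover have "((\<lambda>s. L s ** L s) has_vector_derivative 0) (at t)"
    by (rule has_vector_derivative_transform_within_open[OF has_vector_derivative_const[of "- mat 1"] S])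
      (use L in \<open>auto simp: tw_def\<close>)
  ultimately have "M ** L' + L' ** M = 0" using vector_derivative_unique_at by blast
  then have anti: "B ** M + M ** B = 0"
    by (simp add: B_def hor_def mat_simps M2 add.commute)
  have "gg z (B *v a) (M *v b) + gg z (M *v a) (B *v b) = 0" for a b
  proof -
    have dLa: "((\<lambda>s. L s *v a) has_vector_derivative L' *v a) (at t)" for a
      by (rule bounded_linear.has_vector_derivative[OF mv.bounded_linear_left dL])
    have 1: "((\<lambda>s. gg (\<gamma> s) (L s *v a) (L s *v b)) has_vector_derivative
       gg z (L' *v a + c *v (M *v a)) (M *v b) + gg z (M *v a) (L' *v b + c *v (M *v b))) (at t)"
      unfolding z_def M_def c_def by (rule gg_curve_derivative[OF S \<gamma> d\<gamma> dLa dLa])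
    have "((\<lambda>s. gg (\<gamma> s) a b) has_vector_derivative
       gg z (0 + c *v a) b + gg z a (0 + c *v b)) (at t)"
      unfolding z_def c_def by (rule gg_curve_derivative[OF S \<gamma> d\<gamma>]) (auto intro: has_vector_derivative_const)
    then have "((\<lambda>s. gg (\<gamma> s) a b) has_vector_derivative gg z (c *v a) b + gg z a (c *v b)) (at t)"
      by simp
    then have 2: "((\<lambda>s. gg (\<gamma> s) (L s *v a) (L s *v b)) has_vector_derivative
       gg z (c *v a) b + gg z a (c *v b)) (at t)"
      by (rule has_vector_derivative_transform_within_open[OF _ S]) (use L in \<open>auto simp: tw_def\<close>)
    have "L' *v a + c *v (M *v a) = B *v a + M *v (c *v a)" for a
      by (simp add: B_def hor_def c_def mat_vec_simps)
    with vector_derivative_unique_at[OF 1 2] show ?thesis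
      using M by (simp add: gg_simps z tw_def)
  qed
  note skew = this
  have "gg z (B *v a) b = - gg z a (B *v b)" for a b
  proof -
    have "M *v (M *v b) = - b" using M2 by (simp add: matrix_vector_mul_assoc mat_vec_simps(5))
    then have "gg z (B *v a) b = - gg z (B *v a) (M *v (M *v b))" by (simp add: gg_simps z)
    also have "\<dots> = gg z (M *v a) (B *v (M *v b))" using skew[of a "M *v b"] by simp
    also have "B *v (M *v b) = - (M *v (B *v b))"
      using anti by (simp add: matrix_vector_mul_assoc eq_neg_iff_add_eq_0 flip: mv.add_left)
    also have "gg z (M *v a) (- (M *v (B *v b))) = - gg z a (B *v b)"
      using M by (simp add: gg_simps z tw_def)
    finally show ?thesis .
  qed
  then show ?thesis using anti by (simp add: vert_def flip: B_def z_def M_def)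
qed

text \<open>An isometry between tangent spaces at two points carries twistor fibres to twistor fibres.\<close>

lemma isometry_conjugate:
  assumes iso: "\<And>a b. gg z' (F *v a) (F *v b) = gg z a b" and inv: "Fi ** F = mat 1" "F ** Fi = mat 1"
    and M: "M \<in> tw z"
  shows "F ** M ** Fi \<in> tw z'" and "C \<in> vert z M \<Longrightarrow> F ** C ** Fi \<in> vert z' (F ** M ** Fi)"
proof -
  have i: "Fi ** (F ** X) = X" for X :: "real^'n^'n" by (simp add: matrix_mul_assoc inv)
  have v: "F *v (Fi *v x) = x" for x by (simp add: matrix_vector_mul_assoc inv)
  have iso': "gg z' (F *v a) b = gg z a (Fi *v b)" "gg z' a (F *v b) = gg z (Fi *v a) b" for a b
    using iso[of a "Fi *v b"] iso[of "Fi *v a" b] by (simp_all add: v)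
  have v': "Fi *v (F *v x) = x" for x by (simp add: matrix_vector_mul_assoc inv)
  have "(F ** M ** Fi) ** (F ** M ** Fi) = F ** (M ** M) ** Fi"
    by (simp add: matrix_mul_assoc[symmetric] i)
  also have "\<dots> = - mat 1" using M by (simp add: tw_def mm.minus_left mm.minus_right inv)
  finally show "F ** M ** Fi \<in> tw z'"
    using M iso'(1)[of "Fi *v a" b for a b]
    by (auto simp: tw_def matrix_vector_mul_assoc[symmetric] iso) (metis iso v)
  show "F ** C ** Fi \<in> vert z' (F ** M ** Fi)" if C: "C \<in> vert z M"
  proof -
    have "(F ** C ** Fi) ** (F ** M ** Fi) + (F ** M ** Fi) ** (F ** C ** Fi) = F ** (C ** M + M ** C) ** Fi"
      by (simp add: mat_simps i)
    also have "\<dots> = 0" using C by (simp add: vert_def)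
    finally show ?thesis
      using C by (auto simp: vert_def matrix_vector_mul_assoc[symmetric] iso' v')
  qed
qed

lemma line_in_domain:
  assumes z: "z \<in> \<Omega>" shows "\<exists>r>0. \<forall>t\<in>{-r<..<r}. z + t *\<^sub>R v \<in> \<Omega>"
proof -
  have "open ((\<lambda>t. z + t *\<^sub>R v) -` \<Omega>)" by (intro open_vimage open_\<Omega> continuous_intros)
  then obtain r where "r > 0" "ball 0 r \<subseteq> (\<lambda>t. z + t *\<^sub>R v) -` \<Omega>"
    using z openE[of _ "0::real"] by (metis (no_types, lifting) add.right_neutral scaleR_zero_left vimageI)
  then show ?thesis by (intro exI[of _ r]) (auto simp: subset_iff dist_real_def)
qed

lemma line_derivative: "((\<lambda>t. z + t *\<^sub>R v) has_vector_derivative v) (at t)"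
  by (auto intro!: derivative_eq_intros)

lemma smooth_on_line: "open S \<Longrightarrow> smooth_on S (\<lambda>t::real. z + t *\<^sub>R (v::real^'n))"
  by (intro smooth_on_add smooth_on_const smooth_on_scaleR smooth_on_id)

text \<open>A \<open>\<nabla>\<^sup>-\<close>-parallel frame along a coordinate line is isometric.\<close>

lemma parallel_frame:
  assumes z: "z \<in> \<Omega>"
  shows "\<exists>\<epsilon> E Z. 0 < \<epsilon> \<and> E 0 = mat 1 \<and> Z 0 = mat 1 \<and>
    smooth_on {-\<epsilon><..<\<epsilon>} E \<and> smooth_on {-\<epsilon><..<\<epsilon>} Z \<and>
    (\<forall>t\<in>{-\<epsilon><..<\<epsilon>}. z + t *\<^sub>R v \<in> \<Omega> \<and>
       (E has_vector_derivative - (gam (z + t *\<^sub>R v) v ** E t)) (at t) \<and>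
       (Z has_vector_derivative Z t ** gam (z + t *\<^sub>R v) v) (at t) \<and> Z t ** E t = mat 1 \<and> E t ** Z t = mat 1 \<and>
       (\<forall>a b. gg (z + t *\<^sub>R v) (E t *v a) (E t *v b) = gg z a b))"
proof -
  obtain r where r: "r > 0" "\<And>t. t \<in> {-r<..<r} \<Longrightarrow> z + t *\<^sub>R v \<in> \<Omega>" using line_in_domain[OF z] by blast
  have sm: "smooth_on {-r<..<r} (\<lambda>t. - gam (z + t *\<^sub>R v) v)"
    by (intro smooth_on_uminus smooth_on_compose[OF _ gam_smooth smooth_on_line]) (use r in auto)
  obtain e E Z where e: "0 < e" "e < r" and E0: "E 0 = mat 1" "Z 0 = mat 1"
    and smE: "smooth_on {-e<..<e} E" "smooth_on {-e<..<e} Z"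
    and EZ: "\<And>t. t \<in> {-e<..<e} \<Longrightarrow> (E has_vector_derivative - gam (z + t *\<^sub>R v) v ** E t) (at t) \<and>
       (Z has_vector_derivative - (Z t ** - gam (z + t *\<^sub>R v) v)) (at t) \<and> Z t ** E t = mat 1 \<and> E t ** Z t = mat 1"
    using matrix_ode_solution[OF r(1) sm] by blast
  have dom: "z + t *\<^sub>R v \<in> \<Omega>" if "t \<in> {-e<..<e}" for t using that e r by auto
  have iso: "gg (z + t *\<^sub>R v) (E t *v a) (E t *v b) = gg z a b" if t: "t \<in> {-e<..<e}" for t a b
  proof -
    have d: "((\<lambda>s. gg (z + s *\<^sub>R v) (E s *v a) (E s *v b)) has_vector_derivative 0) (at t)" if t: "t \<in> {-e<..<e}" for t
    proof -
      have dE: "((\<lambda>s. E s *v a) has_vector_derivative - gam (z + t *\<^sub>R v) v ** E t *v a) (at t)" for a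
        using EZ[OF t] by (intro bounded_linear.has_vector_derivative[OF mv.bounded_linear_left]) auto
      from gg_curve_derivative[OF _ t dom line_derivative dE dE, simplified, of a b]
      show ?thesis by (simp add: mat_vec_simps gg_simps(9,10)[OF dom[OF t]])
    qed
    have "gg (z + t *\<^sub>R v) (E t *v a) (E t *v b) = gg (z + 0 *\<^sub>R v) (E 0 *v a) (E 0 *v b)"
      by (rule vector_derivative_zero_constant[OF d t]) (use e in auto)
    then show ?thesis by (simp add: E0)
  qed
  show ?thesis
    by (intro exI[of _ e] exI[of _ E] exI[of _ Z]) (use e E0 smE EZ dom iso in \<open>auto simp: mat_simps\<close>)
qed

text \<open>Combining a parallel frame with a rotation that moves \<open>M\<close> in the vertical direction \<open>B\<close>: since
  \<open>B M = - M B\<close>, the commutator of \<open>- B M / 2\<close> with \<open>M\<close> is \<open>B\<close>.\<close>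

lemma twistor_frame:
  assumes z: "z \<in> \<Omega>" and M: "M \<in> tw z" and B: "B \<in> vert z M"
  shows "\<exists>\<epsilon> F Fi. 0 < \<epsilon> \<and> F 0 = mat 1 \<and> Fi 0 = mat 1 \<and>
    smooth_on {-\<epsilon><..<\<epsilon>} F \<and> smooth_on {-\<epsilon><..<\<epsilon>} Fi \<and>
    (\<forall>t\<in>{-\<epsilon><..<\<epsilon>}. z + t *\<^sub>R v \<in> \<Omega> \<and> Fi t ** F t = mat 1 \<and> F t ** Fi t = mat 1 \<and>
       (\<forall>a b. gg (z + t *\<^sub>R v) (F t *v a) (F t *v b) = gg z a b)) \<and>
    (F has_vector_derivative - gam z v - (1/2) *\<^sub>R (B ** M)) (at 0) \<and>
    (Fi has_vector_derivative gam z v + (1/2) *\<^sub>R (B ** M)) (at 0)"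
proof -
  define u where "u = - ((1/2) *\<^sub>R (B ** M))"
  have u: "gg z (u *v a) b + gg z a (u *v b) = 0" for a b
  proof -
    have "gg z (B *v (M *v a)) b = - gg z (M *v a) (B *v b)" using B by (simp add: vert_def)
    also have "\<dots> = gg z a ((M ** B) *v b)"
      by (simp add: tw_gg_swap[OF z M] matrix_vector_mul_assoc)
    also have "M ** B = - (B ** M)" by (simp add: vert_anticommute[OF M B])
    finally show ?thesis by (simp add: u_def mat_vec_simps gg_simps z)
  qed
  obtain e1 E Z where e1: "0 < e1" and E0: "E 0 = mat 1" "Z 0 = mat 1"
    and smE: "smooth_on {-e1<..<e1} E" "smooth_on {-e1<..<e1} Z"
    and E: "\<And>t. t \<in> {-e1<..<e1} \<Longrightarrow> z + t *\<^sub>R v \<in> \<Omega> \<and>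
       (E has_vector_derivative - (gam (z + t *\<^sub>R v) v ** E t)) (at t) \<and>
       (Z has_vector_derivative Z t ** gam (z + t *\<^sub>R v) v) (at t) \<and> Z t ** E t = mat 1 \<and> E t ** Z t = mat 1 \<and>
       (\<forall>a b. gg (z + t *\<^sub>R v) (E t *v a) (E t *v b) = gg z a b)"
    using parallel_frame[OF z, of v] by blast
  have smu: "smooth_on {-1<..<1::real} (\<lambda>_. u)" by (rule smooth_on_const) simp
  obtain e2 U V where e2: "0 < e2" and U0: "U 0 = mat 1" "V 0 = mat 1"
    and smU: "smooth_on {-e2<..<e2} U" "smooth_on {-e2<..<e2} V"
    and U: "\<And>t. t \<in> {-e2<..<e2} \<Longrightarrow> (U has_vector_derivative u ** U t) (at t) \<and>
       (V has_vector_derivative - (V t ** u)) (at t) \<and> V t ** U t = mat 1 \<and> U t ** V t = mat 1"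
    using matrix_ode_solution[OF zero_less_one smu] by blast
  have isoU: "gg z (U t *v a) (U t *v b) = gg z a b" if t: "t \<in> {-e2<..<e2}" for t a b
  proof -
    have d: "((\<lambda>s. gg z (U s *v a) (U s *v b)) has_vector_derivative 0) (at t)" if t: "t \<in> {-e2<..<e2}" for t
    proof -
      have dU: "((\<lambda>s. U s *v a) has_vector_derivative u ** U t *v a) (at t)" for a
        using U[OF t] by (intro bounded_linear.has_vector_derivative[OF mv.bounded_linear_left]) auto
      from gg_curve_derivative[OF _ t z has_vector_derivative_const dU dU, simplified, of a b]
      show ?thesis by (simp add: linear_0[OF gam_linear[OF z]] u flip: matrix_vector_mul_assoc)
    qed
    have "gg z (U t *v a) (U t *v b) = gg z (U 0 *v a) (U 0 *v b)"
      by (rule vector_derivative_zero_constant[OF d t]) (use e2 in auto)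
    then show ?thesis by (simp add: U0)
  qed
  define e where "e = min e1 e2"
  have e: "0 < e" and sub: "{-e<..<e} \<subseteq> {-e1<..<e1}" "{-e<..<e} \<subseteq> {-e2<..<e2}"
    using e1 e2 by (auto simp: e_def)
  define F where "F t = E t ** U t" for t
  define Fi where "Fi t = V t ** Z t" for t
  have "(F has_vector_derivative - gam z v - (1/2) *\<^sub>R (B ** M)) (at 0)"
  proof -
    have "(F has_vector_derivative (E 0 ** (u ** U 0) + - (gam (z + 0 *\<^sub>R v) v ** E 0) ** U 0)) (at 0)"
      unfolding F_def[abs_def] by (rule mm.has_vector_derivative) (use E[of 0] U[of 0] e1 e2 in auto)
    then show ?thesis by (simp add: E0 U0 u_def minus_diff_commute)
  qed
  moreover have "(Fi has_vector_derivative gam z v + (1/2) *\<^sub>R (B ** M)) (at 0)"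
  proof -
    have "(Fi has_vector_derivative (V 0 ** (Z 0 ** gam (z + 0 *\<^sub>R v) v) + - (V 0 ** u) ** Z 0)) (at 0)"
      unfolding Fi_def[abs_def] by (rule mm.has_vector_derivative) (use E[of 0] U[of 0] e1 e2 in auto)
    then show ?thesis by (simp add: E0 U0 u_def mm.minus_left)
  qed
  moreover have "Fi t ** F t = mat 1 \<and> F t ** Fi t = mat 1" if "t \<in> {-e<..<e}" for t
  proof -
    have *: "V t ** U t = mat 1" "U t ** V t = mat 1" "Z t ** E t = mat 1" "E t ** Z t = mat 1"
      using E[of t] U[of t] that sub by auto
    have "Fi t ** F t = V t ** (Z t ** E t) ** U t" "F t ** Fi t = E t ** (U t ** V t) ** Z t"
      by (simp_all add: F_def Fi_def matrix_mul_assoc)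
    then show ?thesis by (simp add: *)
  qed
  moreover have "gg (z + t *\<^sub>R v) (F t *v a) (F t *v b) = gg z a b" if "t \<in> {-e<..<e}" for t a b
  proof -
    have "t \<in> {-e1<..<e1}" "t \<in> {-e2<..<e2}" using that sub by auto
    then show ?thesis using E[of t] isoU[of t] by (simp add: F_def matrix_vector_mul_assoc[symmetric])
  qed
  moreover have "smooth_on {-e<..<e} F" "smooth_on {-e<..<e} Fi"
    unfolding F_def Fi_def
    using smooth_on_subset[OF smE(1) sub(1)] smooth_on_subset[OF smE(2) sub(1)]
      smooth_on_subset[OF smU(1) sub(2)] smooth_on_subset[OF smU(2) sub(2)]
    by (auto intro!: smooth_on_matrix_mult)
  ultimately show ?thesis
    using e E sub by (intro exI[of _ e] exI[of _ F] exI[of _ Fi]) (auto simp: F_def Fi_def E0 U0 subset_iff)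
qed

text \<open>The frame of the preceding lemma moves \<open>M\<close> along a curve in the twistor space with prescribed
  horizontal and vertical velocity.\<close>

lemma conjugate_derivative:
  assumes M: "M \<in> tw z" and B: "B \<in> vert z M" and F0: "F 0 = mat 1" "Fi 0 = mat 1"
    and dF: "(F has_vector_derivative - gam z v - (1/2) *\<^sub>R (B ** M)) (at 0)"
      "(Fi has_vector_derivative gam z v + (1/2) *\<^sub>R (B ** M)) (at 0)"
  shows "((\<lambda>t. F t ** M ** Fi t) has_vector_derivative hor z v M + B) (at 0)"
proof -
  define f where "f = gam z v + (1/2) *\<^sub>R (B ** M)"
  have dF': "(F has_vector_derivative - f) (at 0)" using dF(1) by (simp add: f_def)
  have "((\<lambda>t. F t ** M) has_vector_derivative - f ** M) (at 0)"
    by (rule bounded_linear.has_vector_derivative[OF mm.bounded_linear_left dF'])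
  from mm.has_vector_derivative[OF this dF(2)]
  have 1: "((\<lambda>t. F t ** M ** Fi t) has_vector_derivative (F 0 ** M) ** f + (- f ** M) ** Fi 0) (at 0)"
    by (simp add: f_def)
  have B2: "B = (1/2) *\<^sub>R B + (1/2) *\<^sub>R B" by (simp flip: scaleR_left_distrib)
  have "(F 0 ** M) ** f + (- f ** M) ** Fi 0 = hor z v M + ((1/2) *\<^sub>R B + (1/2) *\<^sub>R B)"
    by (simp add: F0 f_def hor_def mat_simps vert_anticommute[OF M B])
  with 1 B2 show ?thesis by metis
qed

text \<open>The derivative at \<open>t = 0\<close> of the matrix component of a tangent field along the twistor curve with
  velocity \<open>(v, hor z v M + B)\<close>. The field has horizontal part the lift of \<open>w\<close> and vertical part the conjugate of
  \<open>C + t D\<close> by the frame that generates the curve.\<close>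

definition second_jet :: "real^'n \<Rightarrow> real^'n^'n \<Rightarrow> real^'n \<Rightarrow> real^'n^'n \<Rightarrow> real^'n \<Rightarrow> real^'n^'n \<Rightarrow> real^'n^'n \<Rightarrow> real^'n^'n" where
  "second_jet z M v B w C D =
     M ** frechet_derivative (\<lambda>y. gam y w) (at z) v - frechet_derivative (\<lambda>y. gam y w) (at z) v ** M
      + ((hor z v M + B) ** gam z w - gam z w ** (hor z v M + B))
      + (C ** (gam z v + (1/2) *\<^sub>R (B ** M)) - (gam z v + (1/2) *\<^sub>R (B ** M)) ** C) + D"

text \<open>One summand of the exterior derivative: \<open>\<beta>\<close> is differentiated along a twistor curve on two tangent
  fields of the kind described above. The values of \<open>\<beta>\<close> on these fields are known, and conjugation by the
  frame drops out of the trace. The terms with \<open>second_jet\<close> account for the change of the fields.\<close>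

lemma derivative_along_twistor_curve:
  assumes W: "open W" "(z, M) \<in> W" "W \<subseteq> \<Omega> \<times> UNIV"
    and lin: "\<And>q X. q \<in> W \<Longrightarrow> linear (\<beta> q X)" "\<And>q Y. q \<in> W \<Longrightarrow> linear (\<lambda>X. \<beta> q X Y)"
    and diff: "\<And>X Y. (\<lambda>q. \<beta> q X Y) differentiable (at (z, M))"
    and restr: "\<And>z M v v' B B'. (z, M) \<in> W \<Longrightarrow> M \<in> tw z \<Longrightarrow> B \<in> vert z M \<Longrightarrow> B' \<in> vert z M \<Longrightarrow>
        \<beta> (z, M) (v, hor z v M + B) (v', hor z v' M + B') = - trace (M ** B ** B') + om z v v'"
    and M: "M \<in> tw z" and B: "B \<in> vert z M" and C: "C1 \<in> vert z M" "C2 \<in> vert z M"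
    and D: "D1 \<in> vert z M" "D2 \<in> vert z M"
  shows "frechet_derivative (\<lambda>q. \<beta> q (w1, hor z w1 M + C1) (w2, hor z w2 M + C2)) (at (z, M)) (v, hor z v M + B)
      + \<beta> (z, M) (0, second_jet z M v B w1 C1 D1) (w2, hor z w2 M + C2) + \<beta> (z, M) (w1, hor z w1 M + C1) (0, second_jet z M v B w2 C2 D2)
    = - trace (M ** D1 ** C2) - trace (M ** C1 ** D2) + frechet_derivative (\<lambda>y. om y w1 w2) (at z) v"
proof -
  have z: "z \<in> \<Omega>" using W by auto
  define f where "f = gam z v + (1/2) *\<^sub>R (B ** M)"
  obtain e F Fi where e: "0 < e" and F0: "F 0 = mat 1" "Fi 0 = mat 1"
    and sm: "smooth_on {-e<..<e} F" "smooth_on {-e<..<e} Fi"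
    and F: "\<And>t. t \<in> {-e<..<e} \<Longrightarrow> z + t *\<^sub>R v \<in> \<Omega> \<and> Fi t ** F t = mat 1 \<and> F t ** Fi t = mat 1 \<and>
       (\<forall>a b. gg (z + t *\<^sub>R v) (F t *v a) (F t *v b) = gg z a b)"
    and dF: "(F has_vector_derivative - gam z v - (1/2) *\<^sub>R (B ** M)) (at 0)" "(Fi has_vector_derivative f) (at 0)"
    using twistor_frame[OF z M B, of v] unfolding f_def by blast
  have dF': "(F has_vector_derivative - f) (at 0)" using dF(1) by (simp add: f_def)
  define L where "L t = F t ** M ** Fi t" for t
  define q where "q t = (z + t *\<^sub>R v, L t)" for t
  define Y where "Y w C D t = (w, hor (z + t *\<^sub>R v) w (L t) + F t ** (C + t *\<^sub>R D) ** Fi t)" for w C D t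
  have L0: "L 0 = M" by (simp add: L_def F0)
  have q0: "q 0 = (z, M)" by (simp add: q_def L0)
  have Y0: "Y w C D 0 = (w, hor z w M + C)" for w C D by (simp add: Y_def L0 F0)
  have smL: "smooth_on {-e<..<e} L" unfolding L_def
    by (intro smooth_on_matrix_mult sm smooth_on_const) auto
  \<comment> \<open>The times at which the curve stays in the domain of \<open>\<beta>\<close>.\<close>
  define T where "T = {-e<..<e} \<inter> q -` W"
  have T: "open T" "0 \<in> T"
  proof -
    have "continuous_on {-e<..<e} q"
      unfolding q_def by (intro continuous_intros smooth_on_imp_continuous_on[OF smL])
    then show "open T" unfolding T_def by (intro continuous_open_preimage W) auto
    show "0 \<in> T" using e W by (simp add: T_def q0)
  qed
  have dL: "(L has_vector_derivative hor z v M + B) (at 0)"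
    unfolding L_def[abs_def] by (rule conjugate_derivative[OF M B F0 dF[unfolded f_def]])
  have dq: "(q has_vector_derivative (v, hor z v M + B)) (at 0)"
    unfolding q_def by (intro has_vector_derivative_Pair line_derivative dL)
  have dgam: "((\<lambda>t. gam (z + t *\<^sub>R v) w) has_vector_derivative frechet_derivative (\<lambda>y. gam y w) (at z) v) (at 0)" for w
  proof -
    have "(gam' has_derivative D) (at (z + 0 *\<^sub>R v)) \<Longrightarrow> ((\<lambda>t. gam' (z + t *\<^sub>R v)) has_vector_derivative D v) (at 0)"
      for gam' :: "real^'n \<Rightarrow> real^'n^'n" and D
      using diff_chain_at[OF line_derivative[unfolded has_vector_derivative_def], of gam' D z 0 v]
        has_derivative_linear[of gam' D]
      by (simp add: o_def has_vector_derivative_def linear_scale)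
    then show ?thesis using smooth_on_has_derivative[OF gam_smooth z, of w] by simp
  qed
  have dY: "(Y w C D has_vector_derivative (0, second_jet z M v B w C D)) (at 0)" for w C D
  proof -
    have 1: "((\<lambda>t. hor (z + t *\<^sub>R v) w (L t)) has_vector_derivative
       (L 0 ** frechet_derivative (\<lambda>y. gam y w) (at z) v + (hor z v M + B) ** gam (z + 0 *\<^sub>R v) w)
       - (gam (z + 0 *\<^sub>R v) w ** (hor z v M + B) + frechet_derivative (\<lambda>y. gam y w) (at z) v ** L 0)) (at 0)"
      unfolding hor_def[of _ w]
      by (intro has_vector_derivative_diff mm.has_vector_derivative dL dgam)
    have "((\<lambda>t. C + t *\<^sub>R D) has_vector_derivative D) (at 0)" by (auto intro!: derivative_eq_intros)
    from mm.has_vector_derivative[OF mm.has_vector_derivative[OF dF' this] dF(2)]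
    have 2: "((\<lambda>t. F t ** (C + t *\<^sub>R D) ** Fi t) has_vector_derivative
       ((F 0 ** (C + 0 *\<^sub>R D)) ** f + (F 0 ** D + - f ** (C + 0 *\<^sub>R D)) ** Fi 0)) (at 0)" .
    have "((\<lambda>t. hor (z + t *\<^sub>R v) w (L t) + F t ** (C + t *\<^sub>R D) ** Fi t) has_vector_derivative second_jet z M v B w C D) (at 0)"
      by (rule has_vector_derivative_eq_rhs[OF has_vector_derivative_add[OF 1 2]])
        (simp add: second_jet_def F0 L0 flip: f_def, simp add: mat_simps)
    then show ?thesis unfolding Y_def by (intro has_vector_derivative_Pair has_vector_derivative_const)
  qed
  define X1 where "X1 = (w1, hor z w1 M + C1)"
  define X2 where "X2 = (w2, hor z w2 M + C2)"
  have Y0': "Y w1 C1 D1 0 = X1" "Y w2 C2 D2 0 = X2" by (simp_all add: Y0 X1_def X2_def)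
  have inW: "q t \<in> W" if "t \<in> T" for t using that by (simp add: T_def)
  have dq': "((\<lambda>t. \<beta> (q t) X Y) has_derivative
      (\<lambda>h. frechet_derivative (\<lambda>q. \<beta> q X Y) (at (z, M)) (h *\<^sub>R (v, hor z v M + B)))) (at 0)" for X Y
    using diff_chain_at[OF dq[unfolded has_vector_derivative_def], of "\<lambda>q. \<beta> q X Y"]
      has_derivative_frechet[OF diff, of X Y] by (simp add: o_def q0)
  have 1: "((\<lambda>t. \<beta> (q t) X (Y w2 C2 D2 t)) has_derivative
      (\<lambda>h. frechet_derivative (\<lambda>q. \<beta> q X (Y w2 C2 D2 0)) (at (z, M)) (h *\<^sub>R (v, hor z v M + B))
         + \<beta> (q 0) X (h *\<^sub>R (0, second_jet z M v B w2 C2 D2)))) (at 0)" for X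
    by (rule has_derivative_linear_apply[OF T lin(1)[OF inW] dq' dY[unfolded has_vector_derivative_def]])
  have 2: "((\<lambda>t. \<beta> (q t) (Y w1 C1 D1 t) (Y w2 C2 D2 t)) has_derivative
      (\<lambda>h. (frechet_derivative (\<lambda>q. \<beta> q (Y w1 C1 D1 0) (Y w2 C2 D2 0)) (at (z, M)) (h *\<^sub>R (v, hor z v M + B))
         + \<beta> (q 0) (Y w1 C1 D1 0) (h *\<^sub>R (0, second_jet z M v B w2 C2 D2)))
         + \<beta> (q 0) (h *\<^sub>R (0, second_jet z M v B w1 C1 D1)) (Y w2 C2 D2 0))) (at 0)"
    by (rule has_derivative_linear_apply[OF T lin(2)[OF inW] 1 dY[unfolded has_vector_derivative_def]])
  have d1: "((\<lambda>t. \<beta> (q t) (Y w1 C1 D1 t) (Y w2 C2 D2 t)) has_real_derivative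
      (frechet_derivative (\<lambda>q. \<beta> q X1 X2) (at (z, M)) (v, hor z v M + B)
         + \<beta> (z, M) X1 (0, second_jet z M v B w2 C2 D2) + \<beta> (z, M) (0, second_jet z M v B w1 C1 D1) X2)) (at 0)"
  proof -
    note sc = linear_scale[OF has_derivative_linear[OF has_derivative_frechet[OF diff, of X1 X2]]]
      linear_scale[OF lin(1)[OF W(2)]] linear_scale[OF lin(2)[OF W(2)]]
    show ?thesis
      unfolding has_real_derivative_iff_has_vector_derivative has_vector_derivative_def
      by (rule has_derivative_eq_rhs[OF 2[unfolded Y0' q0]]) (simp only: sc real_scaleR_def distrib_left)
  qed
  have val: "\<beta> (q t) (Y w1 C1 D1 t) (Y w2 C2 D2 t) =
      - trace (M ** C1 ** C2) - t * (trace (M ** D1 ** C2) + trace (M ** C1 ** D2)) - t * t * trace (M ** D1 ** D2)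
      + om (z + t *\<^sub>R v) w1 w2" if t: "t \<in> T" for t
  proof -
    have te: "t \<in> {-e<..<e}" using t by (simp add: T_def)
    note Ft = F[OF te]
    have iso: "\<And>a b. gg (z + t *\<^sub>R v) (F t *v a) (F t *v b) = gg z a b" and inv: "Fi t ** F t = mat 1" "F t ** Fi t = mat 1"
      using Ft by auto
    have v: "C1 + t *\<^sub>R D1 \<in> vert z M" "C2 + t *\<^sub>R D2 \<in> vert z M"
      by (auto intro!: vert_add vert_scaleR z C D)
    have i: "Fi t ** (F t ** X) = X" for X :: "real^'n^'n" by (simp add: matrix_mul_assoc inv)
    have "\<beta> (q t) (Y w1 C1 D1 t) (Y w2 C2 D2 t) =
      - trace (L t ** (F t ** (C1 + t *\<^sub>R D1) ** Fi t) ** (F t ** (C2 + t *\<^sub>R D2) ** Fi t)) + om (z + t *\<^sub>R v) w1 w2"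
      using inW[OF t] isometry_conjugate[OF iso inv M] v unfolding q_def Y_def L_def by (intro restr) auto
    also have "L t ** (F t ** (C1 + t *\<^sub>R D1) ** Fi t) ** (F t ** (C2 + t *\<^sub>R D2) ** Fi t)
        = F t ** (M ** (C1 + t *\<^sub>R D1) ** (C2 + t *\<^sub>R D2)) ** Fi t"
      by (simp add: L_def matrix_mul_assoc[symmetric] i)
    also have "trace \<dots> = trace (M ** (C1 + t *\<^sub>R D1) ** (C2 + t *\<^sub>R D2))"
      by (subst trace_mul_sym) (simp add: matrix_mul_assoc[symmetric] i)
    finally show ?thesis by (simp add: mat_simps trace_simps algebra_simps)
  qed
  have dom: "((\<lambda>t. om (z + t *\<^sub>R v) w1 w2) has_real_derivative frechet_derivative (\<lambda>y. om y w1 w2) (at z) v) (at 0)"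
  proof -
    have "(om' has_derivative D) (at (z + 0 *\<^sub>R v)) \<Longrightarrow> ((\<lambda>t. om' (z + t *\<^sub>R v)) has_vector_derivative D v) (at 0)"
      for om' :: "real^'n \<Rightarrow> real" and D
      using diff_chain_at[OF line_derivative[unfolded has_vector_derivative_def], of om' D z 0 v]
        has_derivative_linear[of om' D]
      by (simp add: o_def has_vector_derivative_def linear_scale)
    then show ?thesis
      using smooth_on_has_derivative[OF om_smooth z, of w1 w2]
      by (simp add: has_real_derivative_iff_has_vector_derivative)
  qed
  have "((\<lambda>t. - trace (M ** C1 ** C2) - t * (trace (M ** D1 ** C2) + trace (M ** C1 ** D2)) - t * t * trace (M ** D1 ** D2)
      + om (z + t *\<^sub>R v) w1 w2) has_real_derivative
      0 - (trace (M ** D1 ** C2) + trace (M ** C1 ** D2)) + frechet_derivative (\<lambda>y. om y w1 w2) (at z) v) (at 0)"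
    by (auto intro!: derivative_eq_intros dom)
  then have d2: "((\<lambda>t. \<beta> (q t) (Y w1 C1 D1 t) (Y w2 C2 D2 t)) has_real_derivative
      0 - (trace (M ** D1 ** C2) + trace (M ** C1 ** D2)) + frechet_derivative (\<lambda>y. om y w1 w2) (at z) v) (at 0)"
    by (rule has_field_derivative_transform_within_open[OF _ T]) (simp add: val)
  show ?thesis using DERIV_unique[OF d1 d2] by (simp add: X1_def X2_def)
qed

subsection \<open>The exterior derivative of an extension of the fundamental form\<close>

text \<open>Exchanging the roles of the two directions changes the derivative of the horizontal part by the
  commutator of \<open>M\<close> with the curvature, which the choice of the vertical part compensates.\<close>

lemma second_jet_symmetric:
  assumes z: "z \<in> \<Omega>" and M: "M \<in> tw z" and B: "B1 \<in> vert z M" "B2 \<in> vert z M"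
  shows "second_jet z M v1 B1 v2 B2 ((1/2) *\<^sub>R (Rmat z v1 v2 ** M - M ** Rmat z v1 v2))
       = second_jet z M v2 B2 v1 B1 ((1/2) *\<^sub>R (Rmat z v2 v1 ** M - M ** Rmat z v2 v1))" (is "?l = ?r")
proof -
  \<comment> \<open>Doubling both sides clears the factors \<open>1/2\<close>.\<close>
  have "2 *\<^sub>R ?l = 2 *\<^sub>R ?r"
    unfolding second_jet_def hor_def Rmat_eq[OF z]
    by (simp add: scaleR_right_distrib scaleR_right_diff_distrib mat_simps vert_anticommute[OF M B(1)]
        vert_anticommute[OF M B(2)]) (simp add: scaleR_2 algebra_simps)
  then show ?thesis by simp
qed

text \<open>In the cyclic sum of the three derivatives along twistor curves, the terms with \<open>second_jet\<close> cancel in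
  pairs by symmetry, because \<open>\<beta>\<close> is alternating. Each commutator with the curvature occurs twice with
  factor \<open>1/2\<close>, since vertical endomorphisms anticommute with \<open>M\<close>.\<close>

lemma exterior_derivative_on_twistor:
  assumes W: "open W" "(z, M) \<in> W" "W \<subseteq> \<Omega> \<times> UNIV"
    and lin: "\<And>q X. q \<in> W \<Longrightarrow> linear (\<beta> q X)"
    and skew: "\<And>q X Y. q \<in> W \<Longrightarrow> \<beta> q X Y = - \<beta> q Y X"
    and diff: "\<And>X Y. (\<lambda>q. \<beta> q X Y) differentiable (at (z, M))"
    and restr: "\<And>z M v v' B B'. (z, M) \<in> W \<Longrightarrow> M \<in> tw z \<Longrightarrow> B \<in> vert z M \<Longrightarrow> B' \<in> vert z M \<Longrightarrow>
        \<beta> (z, M) (v, hor z v M + B) (v', hor z v' M + B') = - trace (M ** B ** B') + om z v v'"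
    and M: "M \<in> tw z" and B: "B1 \<in> vert z M" "B2 \<in> vert z M" "B3 \<in> vert z M"
  defines "X \<equiv> \<lambda>v B. (v, hor z v M + B)"
  defines "K \<equiv> \<lambda>u v. Rmat z u v ** M - M ** Rmat z u v"
  shows "frechet_derivative (\<lambda>q. \<beta> q (X v2 B2) (X v3 B3)) (at (z, M)) (X v1 B1)
       - frechet_derivative (\<lambda>q. \<beta> q (X v1 B1) (X v3 B3)) (at (z, M)) (X v2 B2)
       + frechet_derivative (\<lambda>q. \<beta> q (X v1 B1) (X v2 B2)) (at (z, M)) (X v3 B3)
     = - (trace (M ** K v1 v2 ** B3) + trace (M ** K v2 v3 ** B1) + trace (M ** K v3 v1 ** B2))
       + (frechet_derivative (\<lambda>y. om y v2 v3) (at z) v1 + frechet_derivative (\<lambda>y. om y v3 v1) (at z) v2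
        + frechet_derivative (\<lambda>y. om y v1 v2) (at z) v3)"
proof -
  have z: "z \<in> \<Omega>" using W by auto
  define D where "D u v = (1/2) *\<^sub>R K u v" for u v
  have Kv: "K u v \<in> vert z M" for u v
    unfolding K_def by (rule commutator_vert[OF z M Rmat_skew[OF z]])
  have Dv: "D u v \<in> vert z M" for u v unfolding D_def by (rule vert_scaleR[OF z Kv])
  have K_anti: "K u v = - K v u" for u v
    unfolding K_def using Rmat_anti[OF z, of u v] by (simp add: mat_simps)
  have lin2: "linear (\<lambda>X. \<beta> q X Y)" if "q \<in> W" for q Y
  proof -
    have "(\<lambda>X. \<beta> q X Y) = (\<lambda>X. - \<beta> q Y X)" using skew[OF that] by blast
    then show ?thesis using linear_compose_neg[OF lin[OF that]] by simp
  qed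
  define S where "S v B w C = (0::real^'n, second_jet z M v B w C (D v w))" for v B w C
  have 1: "frechet_derivative (\<lambda>q. \<beta> q (X v2 B2) (X v3 B3)) (at (z, M)) (X v1 B1)
     + \<beta> (z, M) (S v1 B1 v2 B2) (X v3 B3) + \<beta> (z, M) (X v2 B2) (S v1 B1 v3 B3)
     = - trace (M ** D v1 v2 ** B3) - trace (M ** B2 ** D v1 v3) + frechet_derivative (\<lambda>y. om y v2 v3) (at z) v1"
    unfolding X_def S_def
    by (rule derivative_along_twistor_curve[where \<beta> = \<beta>, OF W lin lin2 diff restr M B(1,2,3) Dv Dv])
  have 2: "frechet_derivative (\<lambda>q. \<beta> q (X v3 B3) (X v1 B1)) (at (z, M)) (X v2 B2)
     + \<beta> (z, M) (S v2 B2 v3 B3) (X v1 B1) + \<beta> (z, M) (X v3 B3) (S v2 B2 v1 B1)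
     = - trace (M ** D v2 v3 ** B1) - trace (M ** B3 ** D v2 v1) + frechet_derivative (\<lambda>y. om y v3 v1) (at z) v2"
    unfolding X_def S_def
    by (rule derivative_along_twistor_curve[where \<beta> = \<beta>, OF W lin lin2 diff restr M B(2,3,1) Dv Dv])
  have 3: "frechet_derivative (\<lambda>q. \<beta> q (X v1 B1) (X v2 B2)) (at (z, M)) (X v3 B3)
     + \<beta> (z, M) (S v3 B3 v1 B1) (X v2 B2) + \<beta> (z, M) (X v1 B1) (S v3 B3 v2 B2)
     = - trace (M ** D v3 v1 ** B2) - trace (M ** B1 ** D v3 v2) + frechet_derivative (\<lambda>y. om y v1 v2) (at z) v3"
    unfolding X_def S_def
    by (rule derivative_along_twistor_curve[where \<beta> = \<beta>, OF W lin lin2 diff restr M B(3,1,2) Dv Dv])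
  have S: "S v1 B1 v2 B2 = S v2 B2 v1 B1" "S v2 B2 v3 B3 = S v3 B3 v2 B2" "S v3 B3 v1 B1 = S v1 B1 v3 B3"
    unfolding S_def D_def K_def using second_jet_symmetric[OF z M] B by simp_all
  have cancel: "\<beta> (z, M) (S v1 B1 v2 B2) (X v3 B3) = - \<beta> (z, M) (X v3 B3) (S v2 B2 v1 B1)"
    "\<beta> (z, M) (S v2 B2 v3 B3) (X v1 B1) = - \<beta> (z, M) (X v1 B1) (S v3 B3 v2 B2)"
    "\<beta> (z, M) (S v3 B3 v1 B1) (X v2 B2) = - \<beta> (z, M) (X v2 B2) (S v1 B1 v3 B3)"
    unfolding S by (rule skew[OF W(2)])+
  have tr1: "trace (M ** B ** D u v) = trace (M ** D v u ** B)" if B: "B \<in> vert z M" for B u v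
  proof -
    have "trace (M ** B ** D u v) = - trace (B ** (M ** D u v))"
      by (simp add: vert_anticommute[OF M B] mat_simps trace_simps)
    also have "\<dots> = - trace (M ** D u v ** B)" by (simp add: trace_mul_sym[of B])
    also have "\<dots> = trace (M ** D v u ** B)"
      unfolding D_def by (subst K_anti) (simp add: mat_simps trace_simps)
    finally show ?thesis .
  qed
  have tr2: "trace (M ** D u v ** B) + trace (M ** D u v ** B) = trace (M ** K u v ** B)" for u v B
    by (simp add: D_def mat_simps trace_simps)
  have sk: "frechet_derivative (\<lambda>q. \<beta> q (X v3 B3) (X v1 B1)) (at (z, M)) (X v2 B2)
     = - frechet_derivative (\<lambda>q. \<beta> q (X v1 B1) (X v3 B3)) (at (z, M)) (X v2 B2)"
  proof -
    have "((\<lambda>q. \<beta> q (X v3 B3) (X v1 B1)) has_derivative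
        (\<lambda>h. - frechet_derivative (\<lambda>q. \<beta> q (X v1 B1) (X v3 B3)) (at (z, M)) h)) (at (z, M))"
      by (rule has_derivative_transform_within_open[OF has_derivative_minus[OF has_derivative_frechet[OF diff]] W(1,2)])
        (simp add: skew[of _ "X v3 B3"])
    then show ?thesis by (simp add: frechet_derivative_eqI)
  qed
  show ?thesis
    using 1 2 3 tr2[of v1 v2 B3] tr2[of v2 v3 B1] tr2[of v3 v1 B2]
    unfolding sk cancel tr1[OF B(1)] tr1[OF B(2)] tr1[OF B(3)] by linarith
qed

text \<open>Applying the previous formula to \<open>\<J>X\<^sub>i\<close>: the type (1,1) curvature absorbs \<open>I\<close>, and the two
  factors \<open>M\<close> cancel against the commutators.\<close>

lemma dc_on_twistor:
  assumes W: "open W" "(z, M) \<in> W" "W \<subseteq> \<Omega> \<times> UNIV"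
    and lin: "\<And>q X. q \<in> W \<Longrightarrow> linear (\<beta> q X)"
    and skew: "\<And>q X Y. q \<in> W \<Longrightarrow> \<beta> q X Y = - \<beta> q Y X"
    and diff: "\<And>X Y. (\<lambda>q. \<beta> q X Y) differentiable (at (z, M))"
    and restr: "\<And>z M v v' B B'. (z, M) \<in> W \<Longrightarrow> M \<in> tw z \<Longrightarrow> B \<in> vert z M \<Longrightarrow> B' \<in> vert z M \<Longrightarrow>
        \<beta> (z, M) (v, hor z v M + B) (v', hor z v' M + B') = - trace (M ** B ** B') + om z v v'"
    and M: "M \<in> tw z" and B: "B1 \<in> vert z M" "B2 \<in> vert z M" "B3 \<in> vert z M"
  defines "JX \<equiv> \<lambda>v B. (ii z v, hor z (ii z v) M + M ** B)"
  defines "K \<equiv> \<lambda>u v. Rmat z u v ** M - M ** Rmat z u v"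
  shows "- (frechet_derivative (\<lambda>q. \<beta> q (JX v2 B2) (JX v3 B3)) (at (z, M)) (JX v1 B1)
       - frechet_derivative (\<lambda>q. \<beta> q (JX v1 B1) (JX v3 B3)) (at (z, M)) (JX v2 B2)
       + frechet_derivative (\<lambda>q. \<beta> q (JX v1 B1) (JX v2 B2)) (at (z, M)) (JX v3 B3))
     = trace (K v1 v2 ** B3) + trace (K v2 v3 ** B1) + trace (K v3 v1 ** B2) - hh z v1 v2 v3"
proof -
  have z: "z \<in> \<Omega>" using W by auto
  have MM: "M ** M = - mat 1" "M ** (M ** X) = - X" for X :: "real^'n^'n"
    using M by (simp_all add: tw_def matrix_mul_assoc mm.minus_left)
  have t: "trace (M ** (Rmat z (ii z u) (ii z v) ** M - M ** Rmat z (ii z u) (ii z v)) ** (M ** B)) = trace (K u v ** B)" for u v B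
    by (simp add: Rmat_ii[OF z] K_def mat_simps MM trace_simps)
  show ?thesis
    unfolding JX_def
    by (subst exterior_derivative_on_twistor[where \<beta> = \<beta>, OF W lin skew diff restr M
        vert_tw_mult[OF z M B(1)] vert_tw_mult[OF z M B(2)] vert_tw_mult[OF z M B(3)]])
      (simp_all add: t dc_om[OF z])
qed

end

section \<open>Atlases and tangent vectors\<close>

lemma tvec_apply [simp]: "(u + v) c = u c + v c" "(u - v) c = u c - v c" "(- u) c = - u c"
    "tscale r u c = r *\<^sub>R u c" "(0 :: _ \<Rightarrow> _) c = 0"
  for u v :: "('a, 'e::euclidean_space) tvec"
  by (simp_all add: tscale_def)

text \<open>The conditions on the charts of a manifold apart from separation and countability. They hold for the
  endomorphism bundle as well, whose charts are treated by the same lemmas.\<close>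

locale atlas =
  fixes A :: "('a, 'e::euclidean_space) chart set"
  assumes chart_inj: "c \<in> A \<Longrightarrow> inj_on (cmap c) (cdom c)"
    and overlap_open: "c \<in> A \<Longrightarrow> d \<in> A \<Longrightarrow> open (cmap c ` (cdom c \<inter> cdom d))"
    and transition_smooth: "c \<in> A \<Longrightarrow> d \<in> A \<Longrightarrow> smooth_on (cmap c ` (cdom c \<inter> cdom d)) (cmap d \<circ> cinv c)"
begin

lemma cinv_cmap [simp]: "c \<in> A \<Longrightarrow> p \<in> cdom c \<Longrightarrow> cinv c (cmap c p) = p"
  by (simp add: chart_inj)

lemma chart_image:
  assumes "c \<in> A" "U \<subseteq> cdom c" "z \<in> cmap c ` U"
  shows "cinv c z \<in> U" "cinv c z \<in> cdom c" "cmap c (cinv c z) = z"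
  using assms by (auto simp: subset_iff)

lemma chart_image_iff: "c \<in> A \<Longrightarrow> U \<subseteq> cdom c \<Longrightarrow> p \<in> cdom c \<Longrightarrow> cmap c p \<in> cmap c ` U \<longleftrightarrow> p \<in> U"
  by (meson chart_inj inj_on_image_mem_iff)

lemma chart_dom_open: "c \<in> A \<Longrightarrow> open (cmap c ` cdom c)"
  using overlap_open[of c c] by simp

lemma openin_chart_topology:
  "openin (chart_topology A) U \<longleftrightarrow> U \<subseteq> carrier_of A \<and> (\<forall>c\<in>A. open (cmap c ` (U \<inter> cdom c)))"
proof -
  have "istopology (\<lambda>S. S \<subseteq> carrier_of A \<and> (\<forall>c\<in>A. open (cmap c ` (S \<inter> cdom c))))"
    unfolding istopology_def
  proof (intro conjI allI impI ballI)
    fix S T c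
    assume S: "S \<subseteq> carrier_of A \<and> (\<forall>c\<in>A. open (cmap c ` (S \<inter> cdom c)))"
      and T: "T \<subseteq> carrier_of A \<and> (\<forall>c\<in>A. open (cmap c ` (T \<inter> cdom c)))" and c: "c \<in> A"
    have "cmap c ` (S \<inter> T \<inter> cdom c) = cmap c ` (S \<inter> cdom c) \<inter> cmap c ` (T \<inter> cdom c)"
      using inj_on_image_Int[OF chart_inj[OF c], of "S \<inter> cdom c" "T \<inter> cdom c"] by (simp add: Int_ac)
    then show "open (cmap c ` (S \<inter> T \<inter> cdom c))" using S T c by auto
  next
    fix K c
    assume K: "\<forall>S\<in>K. S \<subseteq> carrier_of A \<and> (\<forall>c\<in>A. open (cmap c ` (S \<inter> cdom c)))" and c: "c \<in> A"
    have "cmap c ` (\<Union>K \<inter> cdom c) = (\<Union>S\<in>K. cmap c ` (S \<inter> cdom c))" by blast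
    then show "open (cmap c ` (\<Union>K \<inter> cdom c))" using K c by auto
  qed blast+
  then show ?thesis unfolding chart_topology_def by (simp add: topology_inverse')
qed

lemma openin_cdom: "c \<in> A \<Longrightarrow> openin (chart_topology A) (cdom c)"
  unfolding openin_chart_topology
  using overlap_open by (auto simp: carrier_of_def Int_commute)

lemma openin_Int_cdom: "openin (chart_topology A) U \<Longrightarrow> c \<in> A \<Longrightarrow> openin (chart_topology A) (U \<inter> cdom c)"
  by (intro openin_Int openin_cdom)

lemma openin_image: "openin (chart_topology A) U \<Longrightarrow> c \<in> A \<Longrightarrow> open (cmap c ` (U \<inter> cdom c))"
  by (simp add: openin_chart_topology)

lemma chart_at: "p \<in> carrier_of A \<Longrightarrow> chart_at A p \<in> A \<and> p \<in> cdom (chart_at A p)"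
  unfolding chart_at_def carrier_of_def by (rule someI_ex) auto

text \<open>Smoothness of a function or of a component may be checked in a single chart.\<close>

lemma smooth_transport:
  assumes c: "c \<in> A" "d \<in> A" and U: "openin (chart_topology A) U" "U \<subseteq> cdom c"
    and f: "smooth_on (cmap c ` U) (\<lambda>z. f (cinv c z))"
  shows "smooth_on (cmap d ` (U \<inter> cdom d)) (\<lambda>z. f (cinv d z))"
proof -
  have op: "open (cmap d ` (U \<inter> cdom d))" by (rule openin_image[OF U(1) c(2)])
  have "smooth_on (cmap d ` (U \<inter> cdom d)) (\<lambda>z. f (cinv c ((cmap c \<circ> cinv d) z)))"
  proof (rule smooth_on_compose[OF op f])
    show "smooth_on (cmap d ` (U \<inter> cdom d)) (cmap c \<circ> cinv d)"
      by (rule smooth_on_subset[OF transition_smooth]) (use c U in auto)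
    show "(cmap c \<circ> cinv d) ` cmap d ` (U \<inter> cdom d) \<subseteq> cmap c ` U" using c U by auto
  qed
  then show ?thesis
    by (rule smooth_on_cong[OF op, rotated]) (use c U in auto)
qed

subsection \<open>Coordinate changes\<close>

text \<open>The differential at \<open>p\<close> of the coordinate change from \<open>c\<close> to \<open>d\<close>.\<close>

definition dtr :: "('a, 'e) chart \<Rightarrow> ('a, 'e) chart \<Rightarrow> 'a \<Rightarrow> 'e \<Rightarrow> 'e" where
  "dtr c d p = frechet_derivative (cmap d \<circ> cinv c) (at (cmap c p))"

lemma dtr_has_derivative:
  assumes "c \<in> A" "d \<in> A" "p \<in> cdom c" "p \<in> cdom d"
  shows "((cmap d \<circ> cinv c) has_derivative dtr c d p) (at (cmap c p))"
  unfolding dtr_def by (rule smooth_on_has_derivative[OF transition_smooth]) (use assms in auto)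

lemma dtr_linear: "c \<in> A \<Longrightarrow> d \<in> A \<Longrightarrow> p \<in> cdom c \<Longrightarrow> p \<in> cdom d \<Longrightarrow> linear (dtr c d p)"
  using dtr_has_derivative has_derivative_linear by blast

lemma dtr_same: assumes "c \<in> A" "p \<in> cdom c" shows "dtr c c p x = x"
proof -
  have "((\<lambda>z. z) has_derivative (\<lambda>x. x)) (at (cmap c p))" by (rule has_derivative_ident)
  then have "((cmap c \<circ> cinv c) has_derivative (\<lambda>x. x)) (at (cmap c p))"
    by (rule has_derivative_transform_within_open[OF _ chart_dom_open[OF assms(1)]])
      (use assms in \<open>auto simp: chart_image\<close>)
  then show ?thesis by (simp add: dtr_def frechet_derivative_eqI)
qed

lemma dtr_dtr:
  assumes A: "c \<in> A" "d \<in> A" "e \<in> A" and p: "p \<in> cdom c" "p \<in> cdom d" "p \<in> cdom e"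
  shows "dtr d e p (dtr c d p x) = dtr c e p x"
proof -
  have op: "open (cmap c ` (cdom c \<inter> cdom d))" by (rule overlap_open[OF A(1,2)])
  have "((cmap e \<circ> cinv d) \<circ> (cmap d \<circ> cinv c) has_derivative dtr d e p \<circ> dtr c d p) (at (cmap c p))"
    by (rule diff_chain_at[OF dtr_has_derivative]) (use A p dtr_has_derivative[of d e p] in auto)
  then have "((cmap e \<circ> cinv c) has_derivative dtr d e p \<circ> dtr c d p) (at (cmap c p))"
    by (rule has_derivative_transform_within_open[OF _ op]) (use A p in auto)
  then show ?thesis by (simp add: dtr_def[of c e] frechet_derivative_eqI)
qed

subsection \<open>Tangent spaces\<close>

lemma tangent_space_iff:
  "v \<in> tangent_space A p \<longleftrightarrow>
     (\<forall>c\<in>A. \<forall>d\<in>A. p \<in> cdom c \<longrightarrow> p \<in> cdom d \<longrightarrow> v d = dtr c d p (v c)) \<and>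
     (\<forall>c. \<not> (c \<in> A \<and> p \<in> cdom c) \<longrightarrow> v c = 0)"
  by (simp add: tangent_space_def dtr_def)

lemma tangent_transform:
  "v \<in> tangent_space A p \<Longrightarrow> c \<in> A \<Longrightarrow> d \<in> A \<Longrightarrow> p \<in> cdom c \<Longrightarrow> p \<in> cdom d \<Longrightarrow> v d = dtr c d p (v c)"
  unfolding tangent_space_iff by blast

lemma tangent_outside:
  assumes "v \<in> tangent_space A p" "\<not> (c \<in> A \<and> p \<in> cdom c)"
  shows "v c = 0"
proof -
  have "\<forall>c. \<not> (c \<in> A \<and> p \<in> cdom c) \<longrightarrow> v c = 0"
    using assms(1) unfolding tangent_space_iff by (rule conjunct2)
  then have "\<not> (c \<in> A \<and> p \<in> cdom c) \<longrightarrow> v c = 0" by (rule spec)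
  then show ?thesis using assms(2) by (rule mp)
qed

lemma tangent_space_combination:
  assumes u: "u \<in> tangent_space A p" and v: "v \<in> tangent_space A p"
  shows "tscale a u + tscale b v \<in> tangent_space A p"
  unfolding tangent_space_iff
proof (intro conjI ballI allI impI)
  fix c d assume c: "c \<in> A" "d \<in> A" "p \<in> cdom c" "p \<in> cdom d"
  show "(tscale a u + tscale b v) d = dtr c d p ((tscale a u + tscale b v) c)"
    using tangent_transform[OF u c] tangent_transform[OF v c]
    by (simp add: linear_add[OF dtr_linear[OF c]] linear_scale[OF dtr_linear[OF c]])
next
  fix c assume "\<not> (c \<in> A \<and> p \<in> cdom c)"
  then have "u c = 0" "v c = 0" using tangent_outside[OF u] tangent_outside[OF v] by simp_all
  then show "(tscale a u + tscale b v) c = 0" by simp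
qed

lemma tangent_space_simps [simp]:
  "0 \<in> tangent_space A p"
  "u \<in> tangent_space A p \<Longrightarrow> v \<in> tangent_space A p \<Longrightarrow> u + v \<in> tangent_space A p"
  "u \<in> tangent_space A p \<Longrightarrow> v \<in> tangent_space A p \<Longrightarrow> u - v \<in> tangent_space A p"
  "u \<in> tangent_space A p \<Longrightarrow> - u \<in> tangent_space A p"
  "u \<in> tangent_space A p \<Longrightarrow> tscale r u \<in> tangent_space A p"
proof -
  show "0 \<in> tangent_space A p"
    unfolding tangent_space_iff
  proof (intro conjI ballI allI impI)
    fix c d assume "c \<in> A" "d \<in> A" "p \<in> cdom c" "p \<in> cdom d"
    from linear_0[OF dtr_linear[OF this]] show "(0 :: ('a, 'e) tvec) d = dtr c d p ((0 :: ('a, 'e) tvec) c)" by simp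
  qed simp
  have e: "u + v = tscale 1 u + tscale 1 v" "u - v = tscale 1 u + tscale (-1) v"
    "- u = tscale (-1) u + tscale 0 u" "tscale r u = tscale r u + tscale 0 u" for u v :: "('a, 'e) tvec" and r
    by (rule ext; simp)+
  assume u: "u \<in> tangent_space A p"
  show "- u \<in> tangent_space A p" by (subst e(3)) (rule tangent_space_combination[OF u u])
  show "tscale r u \<in> tangent_space A p" by (subst e(4)) (rule tangent_space_combination[OF u u])
  assume v: "v \<in> tangent_space A p"
  show "u + v \<in> tangent_space A p" by (subst e(1)) (rule tangent_space_combination[OF u v])
  show "u - v \<in> tangent_space A p" by (subst e(2)) (rule tangent_space_combination[OF u v])
qed

lemma coord_field_apply: "d \<in> A \<Longrightarrow> p \<in> cdom d \<Longrightarrow> coord_field A c x p d = dtr c d p x"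
  by (simp add: coord_field_def dtr_def)

lemma coord_field_same [simp]: "c \<in> A \<Longrightarrow> p \<in> cdom c \<Longrightarrow> coord_field A c x p c = x"
  by (simp add: coord_field_apply dtr_same)

lemma coord_field_tangent [simp]: "c \<in> A \<Longrightarrow> p \<in> cdom c \<Longrightarrow> coord_field A c x p \<in> tangent_space A p"
  unfolding tangent_space_iff by (simp add: coord_field_apply dtr_dtr) (simp add: coord_field_def)

lemma tangent_eqI:
  assumes "u \<in> tangent_space A p" "v \<in> tangent_space A p" "c \<in> A" "p \<in> cdom c" "u c = v c"
  shows "u = v"
proof
  fix d
  show "u d = v d"
  proof (cases "d \<in> A \<and> p \<in> cdom d")
    case True
    then have d: "d \<in> A" "p \<in> cdom d" by simp_all
    show ?thesis
      unfolding tangent_transform[OF assms(1,3) d(1) assms(4) d(2)] tangent_transform[OF assms(2,3) d(1) assms(4) d(2)]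
        assms(5) ..
  next
    case False
    then have "u d = 0" "v d = 0" using tangent_outside[OF assms(1)] tangent_outside[OF assms(2)] by simp_all
    then show ?thesis by simp
  qed
qed

lemma coord_field_tvec [simp]:
  "v \<in> tangent_space A p \<Longrightarrow> c \<in> A \<Longrightarrow> p \<in> cdom c \<Longrightarrow> coord_field A c (v c) p = v"
  by (rule tangent_eqI[of _ p _ c]) auto

lemma coord_field_linear:
  assumes "c \<in> A" "p \<in> cdom c"
  shows "coord_field A c (a *\<^sub>R x + b *\<^sub>R y) p = tscale a (coord_field A c x p) + tscale b (coord_field A c y p)"
  by (rule tangent_eqI[of _ p _ c]) (use assms in auto)

lemma smooth_fieldI:
  assumes c: "c \<in> A" and U: "openin (chart_topology A) U" "U \<subseteq> cdom c"
    and X: "\<And>p. p \<in> U \<Longrightarrow> X p \<in> tangent_space A p" and sm: "smooth_on (cmap c ` U) (\<lambda>z. X (cinv c z) c)"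
  shows "smooth_field A U X"
  unfolding smooth_field_def
proof (intro conjI ballI X)
  fix d assume d: "d \<in> A"
  have op: "open (cmap d ` (U \<inter> cdom d))" by (rule openin_image[OF U(1) d])
  have "smooth_on (cmap d ` (U \<inter> cdom d)) (\<lambda>z. dtr c d (cinv d z) (X (cinv d z) c))"
  proof (rule smooth_on_linear_apply[OF op, where f = "\<lambda>z. dtr c d (cinv d z)" and Y = "\<lambda>z. X (cinv d z) c"])
    show "linear (dtr c d (cinv d z))" if "z \<in> cmap d ` (U \<inter> cdom d)" for z
      using that c d U by (auto intro!: dtr_linear)
    show "smooth_on (cmap d ` (U \<inter> cdom d)) (\<lambda>z. X (cinv d z) c)"
      by (rule smooth_transport[OF c d U, where f = "\<lambda>p. X p c", OF sm])
    have "smooth_on (cmap c ` (cdom c \<inter> cdom d)) (\<lambda>z. frechet_derivative (cmap d \<circ> cinv c) (at z) u)" for u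
      by (rule smooth_on_frechet[OF transition_smooth[OF c d]])
    then have "smooth_on (cmap c ` (cdom c \<inter> cdom d)) (\<lambda>z. dtr c d (cinv c z) u)" for u
      by (rule smooth_on_cong[OF overlap_open[OF c d], rotated]) (use c in \<open>auto simp: dtr_def\<close>)
    from smooth_transport[OF c d openin_Int_cdom[OF openin_cdom[OF c] d] _, where f = "\<lambda>p. dtr c d p u" for u, OF _ this]
    show "smooth_on (cmap d ` (U \<inter> cdom d)) (\<lambda>z. dtr c d (cinv d z) u)" for u
      by (rule smooth_on_subset) (use U in auto)
  qed
  then show "smooth_on (cmap d ` (U \<inter> cdom d)) (\<lambda>z. X (cinv d z) d)"
    by (rule smooth_on_cong[OF op, rotated]) (use c d U X tangent_transform[OF X c d] in auto)
qed

lemma coord_field_smooth: "c \<in> A \<Longrightarrow> smooth_field A (cdom c) (coord_field A c x)"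
  by (rule smooth_fieldI[of c]) (auto intro!: openin_cdom smooth_on_cong[OF chart_dom_open _ smooth_on_const[OF chart_dom_open]])

lemma smooth_field_subset: "smooth_field A U X \<Longrightarrow> V \<subseteq> U \<Longrightarrow> smooth_field A V X"
  unfolding smooth_field_def by (auto intro: smooth_on_subset)

lemma smooth_fieldD:
  assumes "smooth_field A U X"
  shows "p \<in> U \<Longrightarrow> X p \<in> tangent_space A p" "c \<in> A \<Longrightarrow> smooth_on (cmap c ` (U \<inter> cdom c)) (\<lambda>z. X (cinv c z) c)"
  using assms by (auto simp: smooth_field_def)

lemma smooth_funI:
  assumes c: "c \<in> A" and U: "openin (chart_topology A) U" "U \<subseteq> cdom c"
    and f: "smooth_on (cmap c ` U) (\<lambda>z. f (cinv c z))"
  shows "smooth_fun A U f"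
  unfolding smooth_fun_def using smooth_transport[OF c _ U f] by (auto simp: o_def)

lemma dir_deriv_chart:
  assumes f: "smooth_fun A U f" and U: "openin (chart_topology A) U" "p \<in> U" and v: "v \<in> tangent_space A p"
    and c: "c \<in> A" "p \<in> cdom c"
  shows "dir_deriv A p v f = frechet_derivative (f \<circ> cinv c) (at (cmap c p)) (v c)"
proof -
  define d where "d = chart_at A p"
  have "p \<in> carrier_of A" using U openin_subset[of "chart_topology A" U] c by (auto simp: carrier_of_def)
  then have d: "d \<in> A" "p \<in> cdom d" using chart_at d_def by auto
  have fd: "(f \<circ> cinv c has_derivative frechet_derivative (f \<circ> cinv c) (at (cmap c p))) (at (cmap c p))"
    if "c \<in> A" "p \<in> cdom c" for c
    by (rule smooth_on_has_derivative[of "cmap c ` (U \<inter> cdom c)"]) (use f U that in \<open>auto simp: smooth_fun_def\<close>)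
  have "((f \<circ> cinv c) \<circ> (cmap c \<circ> cinv d) has_derivative
      frechet_derivative (f \<circ> cinv c) (at (cmap c p)) \<circ> dtr d c p) (at (cmap d p))"
    by (rule diff_chain_at[OF dtr_has_derivative]) (use c d fd[OF c] in auto)
  then have "(f \<circ> cinv d has_derivative
      frechet_derivative (f \<circ> cinv c) (at (cmap c p)) \<circ> dtr d c p) (at (cmap d p))"
    by (rule has_derivative_transform_within_open[OF _ overlap_open[OF d(1) c(1)]]) (use c d in auto)
  then show ?thesis
    unfolding dir_deriv_def d_def[symmetric] Let_def
    by (simp add: frechet_derivative_eqI tangent_transform[OF v d(1) c(1) d(2) c(2)])
qed

subsection \<open>Curves\<close>

lemma smooth_curveI:
  assumes c: "c \<in> A" and e: "e > 0" and \<gamma>: "\<And>t. t \<in> {-e<..<e} \<Longrightarrow> \<gamma> t \<in> cdom c"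
    and sm: "smooth_on {-e<..<e} (\<lambda>t. cmap c (\<gamma> t))"
  shows "smooth_curve A e \<gamma>"
  unfolding smooth_curve_def
proof (intro conjI ballI e)
  show "\<gamma> t \<in> carrier_of A" if "t \<in> {-e<..<e}" for t using \<gamma>[OF that] c by (auto simp: carrier_of_def)
  fix d assume d: "d \<in> A"
  let ?T = "{t \<in> {-e<..<e}. \<gamma> t \<in> cdom d}"
  have T: "?T = {-e<..<e} \<inter> (\<lambda>t. cmap c (\<gamma> t)) -` (cmap c ` (cdom c \<inter> cdom d))"
  proof (rule set_eqI)
    fix t
    have "cmap c (\<gamma> t) \<in> cmap c ` (cdom c \<inter> cdom d) \<longleftrightarrow> \<gamma> t \<in> cdom d" if "t \<in> {-e<..<e}"
      using chart_image_iff[OF c Int_lower1 \<gamma>[OF that]] \<gamma>[OF that] by simp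
    then show "t \<in> ?T \<longleftrightarrow> t \<in> {-e<..<e} \<inter> (\<lambda>t. cmap c (\<gamma> t)) -` (cmap c ` (cdom c \<inter> cdom d))"
      by (simp cong: conj_cong)
  qed
  show op: "open ?T"
    unfolding T by (intro continuous_open_preimage smooth_on_imp_continuous_on[OF sm] overlap_open c d) auto
  have "smooth_on ?T (\<lambda>t. (cmap d \<circ> cinv c) (cmap c (\<gamma> t)))"
    by (rule smooth_on_compose[OF op transition_smooth[OF c d] smooth_on_subset[OF sm]]) (use \<gamma> in auto)
  then show "smooth_on ?T (cmap d \<circ> \<gamma>)"
    by (rule smooth_on_cong[OF op, rotated]) (use c \<gamma> in auto)
qed

lemma smooth_curve_derivative:
  assumes "smooth_curve A e \<gamma>" "t \<in> {-e<..<e}" "c \<in> A" "\<gamma> t \<in> cdom c"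
  shows "((\<lambda>s. cmap c (\<gamma> s)) has_vector_derivative velocity A \<gamma> t c) (at t)"
proof -
  have "smooth_on {t\<in>{-e<..<e}. \<gamma> t \<in> cdom c} (cmap c \<circ> \<gamma>)" using assms by (auto simp: smooth_curve_def)
  from smooth_on_has_derivative[OF this, of t] have "(cmap c \<circ> \<gamma>) differentiable (at t)"
    using assms by (auto intro: differentiableI)
  then show ?thesis using assms by (simp add: velocity_def vector_derivative_works o_def)
qed

text \<open>The transformation law is the chain rule.\<close>

lemma velocity_tangent:
  assumes \<gamma>: "smooth_curve A e \<gamma>" "t \<in> {-e<..<e}"
  shows "velocity A \<gamma> t \<in> tangent_space A (\<gamma> t)"
  unfolding tangent_space_iff
proof (intro conjI ballI allI impI)
  show "velocity A \<gamma> t c = 0" if "\<not> (c \<in> A \<and> \<gamma> t \<in> cdom c)" for c by (simp only: velocity_def that if_False)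
  fix c d assume c: "c \<in> A" "d \<in> A" "\<gamma> t \<in> cdom c" "\<gamma> t \<in> cdom d"
  have T: "open {t \<in> {-e<..<e}. \<gamma> t \<in> cdom c}" "t \<in> {t \<in> {-e<..<e}. \<gamma> t \<in> cdom c}"
    using \<gamma> c by (auto simp: smooth_curve_def)
  have "((cmap d \<circ> cinv c) \<circ> (\<lambda>s. cmap c (\<gamma> s)) has_derivative
      dtr c d (\<gamma> t) \<circ> (\<lambda>h. h *\<^sub>R velocity A \<gamma> t c)) (at t)"
    by (rule diff_chain_at[OF smooth_curve_derivative[OF \<gamma> c(1,3), unfolded has_vector_derivative_def]])
      (rule dtr_has_derivative[OF c])
  then have "((\<lambda>s. cmap d (\<gamma> s)) has_derivative dtr c d (\<gamma> t) \<circ> (\<lambda>h. h *\<^sub>R velocity A \<gamma> t c)) (at t)"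
    by (rule has_derivative_transform_within_open[OF _ T]) (use c in auto)
  then have "((\<lambda>s. cmap d (\<gamma> s)) has_vector_derivative dtr c d (\<gamma> t) (velocity A \<gamma> t c)) (at t)"
    unfolding has_vector_derivative_def
    by (simp add: o_def linear_scale[OF dtr_linear[OF c]])
  with smooth_curve_derivative[OF \<gamma> c(2,4)] show "velocity A \<gamma> t d = dtr c d (\<gamma> t) (velocity A \<gamma> t c)"
    using vector_derivative_unique_at by blast
qed

lemma velocity_apply:
  assumes "c \<in> A" "\<gamma> t \<in> cdom c" "((\<lambda>s. cmap c (\<gamma> s)) has_vector_derivative v) (at t)"
  shows "velocity A \<gamma> t c = v"
  using assms by (simp add: velocity_def o_def vector_derivative_at)

subsection \<open>Connections\<close>

definition christoffel :: "('a, 'e) conn \<Rightarrow> ('a, 'e) chart \<Rightarrow> 'a \<Rightarrow> 'e \<Rightarrow> 'e \<Rightarrow> 'e" where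
  "christoffel D c p u w = D p (coord_field A c u p) (coord_field A c w) c"

lemma connectionD:
  assumes "connection A D" "openin (chart_topology A) U" "smooth_field A U Y"
  shows "p \<in> U \<Longrightarrow> v \<in> tangent_space A p \<Longrightarrow> D p v Y \<in> tangent_space A p"
    "p \<in> U \<Longrightarrow> v \<in> tangent_space A p \<Longrightarrow> u \<in> tangent_space A p \<Longrightarrow>
      D p (tscale a u + tscale b v) Y = tscale a (D p u Y) + tscale b (D p v Y)"
    "p \<in> U \<Longrightarrow> v \<in> tangent_space A p \<Longrightarrow> smooth_field A U Z \<Longrightarrow> D p v (\<lambda>q. Y q + Z q) = D p v Y + D p v Z"
    "p \<in> U \<Longrightarrow> v \<in> tangent_space A p \<Longrightarrow> smooth_fun A U f \<Longrightarrow>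
      D p v (\<lambda>q. tscale (f q) (Y q)) = tscale (dir_deriv A p v f) (Y p) + tscale (f p) (D p v Y)"
    "p \<in> U \<Longrightarrow> v \<in> tangent_space A p \<Longrightarrow> (\<And>q. q \<in> U \<Longrightarrow> Z q = Y q) \<Longrightarrow> D p v Z = D p v Y"
    "smooth_field A U X \<Longrightarrow> smooth_field A U (\<lambda>p. D p (X p) Y)"
proof -
  have "openin (chart_topology A) U \<and> smooth_field A U Y" using assms(2,3) by (rule conjI)
  note * = assms(1)[unfolded connection_def, THEN spec, THEN spec, THEN mp, OF this]
  show "smooth_field A U (\<lambda>p. D p (X p) Y)" if "smooth_field A U X"
    by (rule *[THEN conjunct2, THEN spec, THEN mp, OF that])
  note ** = *[THEN conjunct1, THEN bspec, THEN bspec]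
  assume p: "p \<in> U" "v \<in> tangent_space A p"
  note D = **[OF p]
  show "D p v Y \<in> tangent_space A p" by (rule D[THEN conjunct1])
  show "D p (tscale a u + tscale b v) Y = tscale a (D p u Y) + tscale b (D p v Y)"
    if "u \<in> tangent_space A p"
    by (rule D[THEN conjunct2, THEN conjunct1, THEN bspec, THEN spec, THEN spec, OF that])
  show "D p v (\<lambda>q. Y q + Z q) = D p v Y + D p v Z" if "smooth_field A U Z"
    by (rule D[THEN conjunct2, THEN conjunct2, THEN conjunct1, THEN spec, THEN mp, OF that])
  show "D p v (\<lambda>q. tscale (f q) (Y q)) = tscale (dir_deriv A p v f) (Y p) + tscale (f p) (D p v Y)"
    if "smooth_fun A U f"
    by (rule D[THEN conjunct2, THEN conjunct2, THEN conjunct2, THEN conjunct1, THEN spec, THEN mp, OF that])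
  show "D p v Z = D p v Y" if "\<And>q. q \<in> U \<Longrightarrow> Z q = Y q"
    by (rule D[THEN conjunct2, THEN conjunct2, THEN conjunct2, THEN conjunct2, THEN spec, THEN mp, OF ballI[OF that]])
qed

text \<open>A field is expanded in the coordinate frame of \<open>c\<close>, one basis vector at a time, so that additivity, the
  Leibniz rule and locality of the connection apply.\<close>

lemma connection_expand:
  assumes D: "connection A D" and U: "openin (chart_topology A) U" "p \<in> U" "U \<subseteq> cdom c" and c: "c \<in> A"
    and y: "smooth_on (cmap c ` U) (\<lambda>z. y (cinv c z))" and v: "v \<in> tangent_space A p"
  shows "D p v (\<lambda>q. coord_field A c (y q) q) c =
     frechet_derivative (\<lambda>z. y (cinv c z)) (at (cmap c p)) (v c)
     + (\<Sum>b\<in>Basis. (y p \<bullet> b) *\<^sub>R D p v (coord_field A c b) c)"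
proof -
  have pc: "p \<in> cdom c" using U by auto
  have opU: "open (cmap c ` U)" using openin_image[OF U(1) c] U(3) by (simp add: Int_absorb2)
  define Y where "Y B q = (\<Sum>b\<in>B. tscale (y q \<bullet> b) (coord_field A c b q))" for B q
  have Y_insert: "Y (insert b B) = (\<lambda>q. tscale (y q \<bullet> b) (coord_field A c b q) + Y B q)" if "finite B" "b \<notin> B" for b B
    using that by (simp add: Y_def fun_eq_iff)
  have cf: "smooth_field A U (coord_field A c b)" for b
    by (rule smooth_field_subset[OF coord_field_smooth[OF c] U(3)])
  have yb: "smooth_on (cmap c ` U) (\<lambda>z. y (cinv c z) \<bullet> b)" for b
    by (rule smooth_on_bounded_linear[OF opU bounded_linear_inner_left y])
  have fb: "smooth_fun A U (\<lambda>q. y q \<bullet> b)" for b by (rule smooth_funI[OF c U(1,3) yb])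
  have fY: "smooth_field A U (\<lambda>q. tscale (y q \<bullet> b) (coord_field A c b q))" for b
  proof (rule smooth_fieldI[OF c U(1,3)])
    show "tscale (y p \<bullet> b) (coord_field A c b p) \<in> tangent_space A p" if "p \<in> U" for p
      using that U c by auto
    have "smooth_on (cmap c ` U) (\<lambda>z. (y (cinv c z) \<bullet> b) *\<^sub>R b)"
      by (intro smooth_on_scaleR opU yb smooth_on_const)
    then show "smooth_on (cmap c ` U) (\<lambda>z. tscale (y (cinv c z) \<bullet> b) (coord_field A c b (cinv c z)) c)"
      by (rule smooth_on_cong[OF opU, rotated]) (use U c in \<open>auto simp: subset_iff\<close>)
  qed
  have dir: "dir_deriv A p v (\<lambda>q. y q \<bullet> b) = frechet_derivative (\<lambda>z. y (cinv c z)) (at (cmap c p)) (v c) \<bullet> b" for b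
  proof -
    have "((\<lambda>z. y (cinv c z) \<bullet> b) has_derivative (\<lambda>h. frechet_derivative (\<lambda>z. y (cinv c z)) (at (cmap c p)) h \<bullet> b)) (at (cmap c p))"
      by (rule bounded_linear.has_derivative[OF bounded_linear_inner_left smooth_on_has_derivative[OF y]]) (use U in auto)
    then show ?thesis using dir_deriv_chart[OF fb U(1,2) v c pc] by (simp add: o_def frechet_derivative_eqI)
  qed
  have "smooth_field A U (Y B) \<and> D p v (Y B) c =
     (\<Sum>b\<in>B. (frechet_derivative (\<lambda>z. y (cinv c z)) (at (cmap c p)) (v c) \<bullet> b) *\<^sub>R b + (y p \<bullet> b) *\<^sub>R D p v (coord_field A c b) c)"
    if "finite B" for B
    using that
  proof (induction B rule: finite_induct)
    case empty
    have 0: "smooth_field A U (\<lambda>q. 0)"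
      by (rule smooth_fieldI[OF c U(1,3)]) (auto intro: smooth_on_const opU)
    have "D p v (\<lambda>q. 0 + 0) = D p v (\<lambda>q. 0) + D p v (\<lambda>q. 0)"
      by (rule connectionD(3)[OF D U(1) 0 U(2) v 0])
    then have D0: "D p v (\<lambda>q. 0) = 0" by simp
    have Y0: "Y {} = (\<lambda>q. 0)" by (rule ext) (simp only: Y_def sum.empty)
    have "D p v (Y {}) = 0" by (simp only: Y0 D0)
    from fun_cong[OF this, of c] have "D p v (Y {}) c = 0" by simp
    moreover have "smooth_field A U (Y {})" unfolding Y0 by (rule 0)
    ultimately show ?case by simp
  next
    case (insert b B)
    have "D p v (Y (insert b B)) = D p v (\<lambda>q. tscale (y q \<bullet> b) (coord_field A c b q)) + D p v (Y B)"
      unfolding Y_insert[OF insert(1,2)]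
      by (rule connectionD(3)[OF D U(1) fY U(2) v]) (use insert.IH in blast)
    also have "D p v (\<lambda>q. tscale (y q \<bullet> b) (coord_field A c b q)) =
        tscale (dir_deriv A p v (\<lambda>q. y q \<bullet> b)) (coord_field A c b p) + tscale (y p \<bullet> b) (D p v (coord_field A c b))"
      by (rule connectionD(4)[OF D U(1) cf U(2) v fb])
    finally have 1: "D p v (Y (insert b B)) c = (frechet_derivative (\<lambda>z. y (cinv c z)) (at (cmap c p)) (v c) \<bullet> b) *\<^sub>R b
       + (y p \<bullet> b) *\<^sub>R D p v (coord_field A c b) c + D p v (Y B) c"
      using c pc by (simp add: dir)
    have "smooth_field A U (Y (insert b B))"
    proof (rule smooth_fieldI[OF c U(1,3)])
      have YB: "smooth_field A U (Y B)" using insert.IH by blast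
      show "Y (insert b B) p \<in> tangent_space A p" if "p \<in> U" for p
        using smooth_fieldD(1)[OF fY that] smooth_fieldD(1)[OF YB that] by (simp add: Y_insert[OF insert(1,2)])
      have "smooth_on (cmap c ` U) (\<lambda>z. tscale (y (cinv c z) \<bullet> b) (coord_field A c b (cinv c z)) c + Y B (cinv c z) c)"
        using smooth_fieldD(2)[OF fY c, of b] smooth_fieldD(2)[OF YB c] U(3) opU
        by (intro smooth_on_add) (auto simp: Int_absorb2)
      then show "smooth_on (cmap c ` U) (\<lambda>z. Y (insert b B) (cinv c z) c)"
        by (simp add: Y_insert[OF insert(1,2)])
    qed
    then show ?case using insert 1 by (simp add: add.assoc)
  qed
  from this[OF finite_Basis] have Y: "smooth_field A U (Y Basis)"
    and DY: "D p v (Y Basis) c = (\<Sum>b\<in>Basis. (frechet_derivative (\<lambda>z. y (cinv c z)) (at (cmap c p)) (v c) \<bullet> b) *\<^sub>R b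
      + (y p \<bullet> b) *\<^sub>R D p v (coord_field A c b) c)" by auto
  have YB: "coord_field A c (y q) q = Y Basis q" if q: "q \<in> U" for q
  proof (rule tangent_eqI[OF _ smooth_fieldD(1)[OF Y q] c])
    have "Y B q c = (\<Sum>b\<in>B. (y q \<bullet> b) *\<^sub>R b)" if "finite B" for B
      using that
    proof (induction B rule: finite_induct)
      case (insert b B)
      then show ?case using U q c by (simp add: Y_insert subset_iff)
    qed (simp add: Y_def)
    from this[OF finite_Basis] show "coord_field A c (y q) q c = Y Basis q c"
      using q U c by (auto simp: euclidean_representation)
  qed (use q U c in auto)
  have "D p v (\<lambda>q. coord_field A c (y q) q) = D p v (Y Basis)"
    by (rule connectionD(5)[OF D U(1) Y U(2) v YB])
  then show ?thesis by (simp add: DY sum.distrib euclidean_representation)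
qed

text \<open>The Leibniz rule determines a connection by its Christoffel symbols.\<close>

lemma connection_coord_linear:
  assumes D: "connection A D" and c: "c \<in> A" "p \<in> cdom c" and v: "v \<in> tangent_space A p"
  shows "D p v (coord_field A c w) c = (\<Sum>b\<in>Basis. (w \<bullet> b) *\<^sub>R D p v (coord_field A c b) c)"
  using connection_expand[OF D openin_cdom[OF c(1)] c(2) order_refl c(1)
      smooth_on_const[OF chart_dom_open[OF c(1)]] v, of w]
  by simp

lemma connection_local:
  assumes D: "connection A D" and U: "openin (chart_topology A) U" "p \<in> U" and Y: "smooth_field A U Y"
    and v: "v \<in> tangent_space A p" and c: "c \<in> A" "p \<in> cdom c"
  shows "D p v Y c = frechet_derivative (\<lambda>z. Y (cinv c z) c) (at (cmap c p)) (v c) + christoffel D c p (v c) (Y p c)"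
proof -
  let ?V = "U \<inter> cdom c"
  have V: "openin (chart_topology A) ?V" "p \<in> ?V" "?V \<subseteq> cdom c"
    using openin_Int_cdom[OF U(1) c(1)] U c by auto
  have YV: "smooth_field A ?V Y" by (rule smooth_field_subset[OF Y]) auto
  have "D p v (\<lambda>q. coord_field A c (Y q c) q) = D p v Y"
    by (rule connectionD(5)[OF D V(1) YV V(2) v]) (use smooth_fieldD(1)[OF YV] c in auto)
  then have "D p v Y c = D p v (\<lambda>q. coord_field A c (Y q c) q) c" by simp
  also have "\<dots> = frechet_derivative (\<lambda>z. Y (cinv c z) c) (at (cmap c p)) (v c)
     + (\<Sum>b\<in>Basis. (Y p c \<bullet> b) *\<^sub>R D p v (coord_field A c b) c)"
    by (rule connection_expand[OF D V c(1) smooth_fieldD(2)[OF Y c(1)] v])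
  also have "\<dots> = frechet_derivative (\<lambda>z. Y (cinv c z) c) (at (cmap c p)) (v c) + christoffel D c p (v c) (Y p c)"
    unfolding christoffel_def by (simp add: connection_coord_linear[OF D c v, of "Y p c"] v c)
  finally show ?thesis .
qed

lemma christoffel_linear:
  assumes D: "connection A D" and c: "c \<in> A" "p \<in> cdom c"
  shows "linear (christoffel D c p u)" "linear (\<lambda>u. christoffel D c p u w)"
proof -
  have "christoffel D c p u w = (\<Sum>b\<in>Basis. (w \<bullet> b) *\<^sub>R D p (coord_field A c u p) (coord_field A c b) c)" for w
    unfolding christoffel_def by (rule connection_coord_linear[OF D c]) (use c in simp)
  then show "linear (christoffel D c p u)"
    by (intro linearI) (simp_all add: inner_left_distrib scaleR_left_distrib sum.distrib scaleR_sum_right)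
  have "christoffel D c p (a *\<^sub>R u + b *\<^sub>R v) w = a *\<^sub>R christoffel D c p u w + b *\<^sub>R christoffel D c p v w" for a b u v
    unfolding christoffel_def coord_field_linear[OF c]
    by (subst connectionD(2)[OF D openin_cdom[OF c(1)] coord_field_smooth[OF c(1)] c(2)]) (use c in auto)
  from this[of 1 _ 1] this[of _ _ 0] show "linear (\<lambda>u. christoffel D c p u w)"
    by (intro linearI) auto
qed

lemma christoffel_smooth:
  assumes D: "connection A D" and c: "c \<in> A"
  shows "smooth_on (cmap c ` cdom c) (\<lambda>z. christoffel D c (cinv c z) u w)"
  unfolding christoffel_def
  using smooth_fieldD(2)[OF connectionD(6)[OF D openin_cdom[OF c] coord_field_smooth[OF c] coord_field_smooth[OF c]] c]
  by simp

end

section \<open>Closedness in any chart\<close>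

text \<open>The exterior derivative of a three-form in coordinates.\<close>

definition ext3 :: "('e::real_normed_vector \<Rightarrow> 'e \<Rightarrow> 'e \<Rightarrow> 'e \<Rightarrow> real) \<Rightarrow> 'e \<Rightarrow> 'e \<Rightarrow> 'e \<Rightarrow> 'e \<Rightarrow> 'e \<Rightarrow> real" where
  "ext3 h z a b c d =
     frechet_derivative (\<lambda>y. h y b c d) (at z) a - frechet_derivative (\<lambda>y. h y a c d) (at z) b
   + frechet_derivative (\<lambda>y. h y a b d) (at z) c - frechet_derivative (\<lambda>y. h y a b c) (at z) d"

lemma ext3_cong:
  assumes S: "open S" "z \<in> S" and eq: "\<And>y u v w. y \<in> S \<Longrightarrow> h y u v w = h' y u v w"
    and sm: "\<And>u v w. smooth_on S (\<lambda>y. h y u v w)"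
  shows "ext3 h z a b d e = ext3 h' z a b d e"
proof -
  have "frechet_derivative (\<lambda>y. h y u v w) (at z) = frechet_derivative (\<lambda>y. h' y u v w) (at z)" for u v w
    by (rule frechet_derivative_transform_within_open[OF _ S eq])
      (use smooth_on_has_derivative[OF sm S(2)] in \<open>auto intro: differentiableI\<close>)
  then show ?thesis by (simp add: ext3_def)
qed

text \<open>The exterior derivative commutes with coordinate changes, because the second derivatives of
  the change of coordinates are symmetric.\<close>

lemma ext3_pullback:
  fixes \<tau> :: "'e::euclidean_space \<Rightarrow> 'e"
  assumes S: "open S" "z \<in> S" and \<tau>: "smooth_on S \<tau>" and T: "open T" "\<tau> ` S \<subseteq> T"
    and sm: "\<And>u v w. smooth_on T (\<lambda>y. h y u v w)"
    and lin: "\<And>y v w. y \<in> T \<Longrightarrow> linear (\<lambda>u. h y u v w)"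
    and skew: "\<And>y u v w. y \<in> T \<Longrightarrow> h y u v w = - h y v u w"
    and cyc: "\<And>y u v w. y \<in> T \<Longrightarrow> h y u v w = h y v w u"
  defines "D \<equiv> \<lambda>z. frechet_derivative \<tau> (at z)"
  shows "ext3 (\<lambda>y u v w. h (\<tau> y) (D y u) (D y v) (D y w)) z a b c d
       = ext3 h (\<tau> z) (D z a) (D z b) (D z c) (D z d)"
proof -
  define s where "s a b = frechet_derivative (\<lambda>y. D y b) (at z) a" for a b
  have s: "s a b = s b a" for a b
    unfolding s_def D_def by (rule second_derivative_symmetric[OF S \<tau>])
  have lin2: "linear (\<lambda>v. h y u v w)" "linear (\<lambda>w. h y u v w)" if y: "y \<in> T" for y u v w
  proof -
    have "(\<lambda>v. h y u v w) = (\<lambda>v. h y v w u)" "(\<lambda>w. h y u v w) = (\<lambda>w. h y w u v)"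
      by (rule ext, metis cyc[OF y])+
    then show "linear (\<lambda>v. h y u v w)" "linear (\<lambda>w. h y u v w)" using lin[OF y] by simp_all
  qed
  have in_T: "\<tau> y \<in> T" if "y \<in> S" for y using that T by auto
  have D: "((\<lambda>y. D y b) has_derivative (\<lambda>a. s a b)) (at z)" for b
    unfolding s_def D_def by (rule smooth_on_has_derivative[OF smooth_on_frechet[OF \<tau>] S(2)])
  have G: "frechet_derivative (\<lambda>y. h (\<tau> y) (D y b) (D y c) (D y d)) (at z) a =
     frechet_derivative (\<lambda>y. h y (D z b) (D z c) (D z d)) (at (\<tau> z)) (D z a)
     + h (\<tau> z) (D z b) (D z c) (s a d) + h (\<tau> z) (D z b) (s a c) (D z d) + h (\<tau> z) (s a b) (D z c) (D z d)"
    for a b c d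
  proof -
    have 0: "((\<lambda>y. h (\<tau> y) u v w) has_derivative (\<lambda>a. frechet_derivative (\<lambda>y. h y u v w) (at (\<tau> z)) (D z a))) (at z)" for u v w
      using diff_chain_at[OF smooth_on_has_derivative[OF \<tau> S(2)] smooth_on_has_derivative[OF sm in_T[OF S(2)]], of u v w]
      by (simp add: o_def D_def)
    have 1: "((\<lambda>y. h (\<tau> y) u v (D y d)) has_derivative
       (\<lambda>a. frechet_derivative (\<lambda>y. h y u v (D z d)) (at (\<tau> z)) (D z a) + h (\<tau> z) u v (s a d))) (at z)" for u v
      by (rule has_derivative_linear_apply[where f = "\<lambda>y w. h (\<tau> y) u v w", OF S lin2(2)[OF in_T] 0 D])
    have 2: "((\<lambda>y. h (\<tau> y) u (D y c) (D y d)) has_derivative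
       (\<lambda>a. (frechet_derivative (\<lambda>y. h y u (D z c) (D z d)) (at (\<tau> z)) (D z a) + h (\<tau> z) u (D z c) (s a d))
         + h (\<tau> z) u (s a c) (D z d))) (at z)" for u
      by (rule has_derivative_linear_apply[where f = "\<lambda>y v. h (\<tau> y) u v (D y d)", OF S lin2(1)[OF in_T] 1 D])
    have 3: "((\<lambda>y. h (\<tau> y) (D y b) (D y c) (D y d)) has_derivative
       (\<lambda>a. ((frechet_derivative (\<lambda>y. h y (D z b) (D z c) (D z d)) (at (\<tau> z)) (D z a) + h (\<tau> z) (D z b) (D z c) (s a d))
         + h (\<tau> z) (D z b) (s a c) (D z d)) + h (\<tau> z) (s a b) (D z c) (D z d))) (at z)"
      by (rule has_derivative_linear_apply[where f = "\<lambda>y u. h (\<tau> y) u (D y c) (D y d)", OF S lin[OF in_T] 2 D])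
    then show ?thesis by (simp add: frechet_derivative_eqI)
  qed
  define k where "k = h (\<tau> z)"
  have sk: "k u v w = - k v u w" and cy: "k u v w = k v w u" for u v w
    unfolding k_def using skew[OF in_T[OF S(2)]] cyc[OF in_T[OF S(2)]] by blast+
  have sk': "k u v w = - k u w v" for u v w
    using cy[of u v w] sk[of v w u] cy[of w v u] cy[of v u w] by simp
  have "k (s a b) (D z c) (D z d) = k (s b a) (D z c) (D z d)"
    "k (D z b) (s a c) (D z d) = - k (s c a) (D z b) (D z d)"
    "k (D z b) (D z c) (s a d) = k (s d a) (D z b) (D z c)"
    "k (D z a) (s b c) (D z d) = k (D z a) (s c b) (D z d)"
    "k (D z a) (D z c) (s b d) = - k (D z a) (s d b) (D z c)"
    "k (D z a) (D z b) (s c d) = k (D z a) (D z b) (s d c)"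
    using sk[of "D z b" "s a c" "D z d"] cy[of "s a d" "D z b" "D z c"] sk'[of "D z a" "D z c" "s b d"]
    by (simp_all add: s[of c a] s[of d a] s[of b a] s[of d b] s[of c b] s[of d c])
  then show ?thesis unfolding ext3_def G by (simp flip: k_def)
qed

section \<open>A strong HKT structure in a chart\<close>

text \<open>The part of a strong HKT structure that involves one of the three complex structures.\<close>

locale hkt =
  fixes A :: "('m, real^'n) chart set"
    and g :: "'m \<Rightarrow> ('m, real^'n) tvec \<Rightarrow> ('m, real^'n) tvec \<Rightarrow> real"
    and I :: "'m \<Rightarrow> ('m, real^'n) tend"
    and H :: "'m \<Rightarrow> ('m, real^'n) tvec list \<Rightarrow> real"
    and nablaL :: "('m, real^'n) conn"
  assumes manifold: "smooth_manifold A" and metric: "riemannian_metric A g"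
    and lc: "levi_civita A g nablaL" and complex: "compatible_complex_structure A g I"
    and form: "diff_form A 3 (carrier_of A) H" and closed: "closed_form A 3 H"
    and parallel: "parallel_end A (torsion_conn A g nablaL (1/2) H) I"

sublocale hkt \<subseteq> atlas A
  using manifold by unfold_locales (auto simp: smooth_manifold_def)

context hkt
begin

lemma nablaL_connection: "connection A nablaL"
  using lc by (simp add: levi_civita_def)

text \<open>Torsion-freeness expresses the bracket by covariant derivatives; hence it is a tangent vector.\<close>

lemma lie_bracket_eq:
  assumes "openin (chart_topology A) U" "smooth_field A U X" "smooth_field A U Y" "p \<in> U"
  shows "lie_bracket A X Y p = nablaL p (X p) Y - nablaL p (Y p) X"
    and "lie_bracket A X Y p \<in> tangent_space A p"
proof -
  show "lie_bracket A X Y p = nablaL p (X p) Y - nablaL p (Y p) X"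
    using lc assms unfolding levi_civita_def by metis
  then show "lie_bracket A X Y p \<in> tangent_space A p"
    using connectionD(1)[OF nablaL_connection assms(1,3,4)] connectionD(1)[OF nablaL_connection assms(1,2,4)]
      smooth_fieldD(1)[OF assms(2,4)] smooth_fieldD(1)[OF assms(3,4)] by simp
qed

lemma metric_simps:
  assumes "p \<in> carrier_of A" "u \<in> tangent_space A p" "v \<in> tangent_space A p"
  shows "g p u v = g p v u"
    "w \<in> tangent_space A p \<Longrightarrow> g p (tscale a u + tscale b v) w = a * g p u w + b * g p v w"
  using metric assms unfolding riemannian_metric_def by blast+

lemma metric_pos: "p \<in> carrier_of A \<Longrightarrow> u \<in> tangent_space A p \<Longrightarrow> u \<noteq> 0 \<Longrightarrow> g p u u > 0"
  using metric unfolding riemannian_metric_def by blast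

lemma H_linear:
  assumes "p \<in> carrier_of A" "u \<in> tangent_space A p" "v \<in> tangent_space A p" "x \<in> tangent_space A p" "y \<in> tangent_space A p"
  shows "H p [tscale a u + tscale b v, x, y] = a * H p [u, x, y] + b * H p [v, x, y]"
    "H p [x, tscale a u + tscale b v, y] = a * H p [x, u, y] + b * H p [x, v, y]"
    "H p [x, y, tscale a u + tscale b v] = a * H p [x, y, u] + b * H p [x, y, v]"
    "H p [x, x, y] = 0" "H p [x, y, x] = 0" "H p [x, y, y] = 0"
proof -
  have *: "(\<forall>i<3. \<forall>u\<in>tangent_space A p. \<forall>v\<in>tangent_space A p. \<forall>a b.
           H p (vs[i := tscale a u + tscale b v]) = a * H p (vs[i := u]) + b * H p (vs[i := v])) \<and>
        (\<not> distinct vs \<longrightarrow> H p vs = 0)" if "length vs = 3" "set vs \<subseteq> tangent_space A p" for vs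
    using form assms(1) that unfolding diff_form_def by blast
  show "H p [tscale a u + tscale b v, x, y] = a * H p [u, x, y] + b * H p [v, x, y]"
    using *[of "[x, x, y]", THEN conjunct1, rule_format, of 0 u v a b] assms by simp
  show "H p [x, tscale a u + tscale b v, y] = a * H p [x, u, y] + b * H p [x, v, y]"
    using *[of "[x, x, y]", THEN conjunct1, rule_format, of 1 u v a b] assms by simp
  show "H p [x, y, tscale a u + tscale b v] = a * H p [x, y, u] + b * H p [x, y, v]"
    using *[of "[x, y, y]", THEN conjunct1, rule_format, of 2 u v a b] assms by (simp add: numeral_2_eq_2)
  show "H p [x, x, y] = 0" "H p [x, y, x] = 0" "H p [x, y, y] = 0"
    using *[of "[x, x, y]"] *[of "[x, y, x]"] *[of "[x, y, y]"] assms by simp_all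
qed

lemma I_tangent_end: "p \<in> carrier_of A \<Longrightarrow> I p \<in> tangent_end A p"
  using complex by (simp add: compatible_complex_structure_def end_field_def)

lemma I_tangent: "p \<in> carrier_of A \<Longrightarrow> v \<in> tangent_space A p \<Longrightarrow> I p v \<in> tangent_space A p"
  using I_tangent_end[of p] by (simp add: tangent_end_def)

lemma I_linear: "p \<in> carrier_of A \<Longrightarrow> u \<in> tangent_space A p \<Longrightarrow> v \<in> tangent_space A p \<Longrightarrow>
    I p (tscale a u + tscale b v) = tscale a (I p u) + tscale b (I p v)"
  using I_tangent_end[of p] by (simp add: tangent_end_def)

lemma I_compatible:
  assumes "p \<in> carrier_of A" "u \<in> tangent_space A p" "v \<in> tangent_space A p"
  shows "I p (I p v) = - v" "g p (I p u) (I p v) = g p u v"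
  using complex assms unfolding compatible_complex_structure_def by blast+

lemma I_smooth: "c \<in> A \<Longrightarrow> smooth_field A (cdom c) (\<lambda>p. I p (coord_field A c x p))"
  using complex by (simp add: compatible_complex_structure_def end_field_def)

lemma I_nijenhuis:
  assumes "openin (chart_topology A) U" "smooth_field A U X" "smooth_field A U Y" "p \<in> U"
  shows "lie_bracket A (\<lambda>q. I q (X q)) (\<lambda>q. I q (Y q)) p - I p (lie_bracket A (\<lambda>q. I q (X q)) Y p)
       - I p (lie_bracket A X (\<lambda>q. I q (Y q)) p) - lie_bracket A X Y p = 0"
  using complex assms unfolding compatible_complex_structure_def by blast

lemma parallelD:
  assumes "openin (chart_topology A) U" "smooth_field A U Y" "p \<in> U" "v \<in> tangent_space A p"
  shows "torsion_conn A g nablaL (1/2) H p v (\<lambda>q. I q (Y q)) = I p (torsion_conn A g nablaL (1/2) H p v Y)"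
  using parallel assms unfolding parallel_end_def by blast

end

locale hkt_chart = hkt A g I H nablaL
  for A :: "('m, real^'n) chart set" and g I H nablaL +
  fixes c :: "('m, real^'n) chart"
  assumes c: "c \<in> A"
begin

definition "Om = cmap c ` cdom c"
definition ev :: "real^'n \<Rightarrow> real^'n \<Rightarrow> ('m, real^'n) tvec" where "ev z u = coord_field A c u (cinv c z)"
definition gc :: "real^'n \<Rightarrow> real^'n \<Rightarrow> real^'n \<Rightarrow> real" where "gc z u v = g (cinv c z) (ev z u) (ev z v)"
definition Gc :: "real^'n \<Rightarrow> real^'n \<Rightarrow> real^'n \<Rightarrow> real^'n" where "Gc z u v = christoffel nablaL c (cinv c z) u v"
definition hc :: "real^'n \<Rightarrow> real^'n \<Rightarrow> real^'n \<Rightarrow> real^'n \<Rightarrow> real" where "hc z u v w = H (cinv c z) [ev z u, ev z v, ev z w]"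
definition sc :: "real^'n \<Rightarrow> real^'n \<Rightarrow> real^'n \<Rightarrow> real^'n" where
  "sc z u v = sharp A g (cinv c z) (\<lambda>x. H (cinv c z) [ev z u, ev z v, x]) c"
definition ic :: "real^'n \<Rightarrow> real^'n \<Rightarrow> real^'n" where "ic z u = I (cinv c z) (ev z u) c"

lemma Om: "z \<in> Om \<Longrightarrow> cinv c z \<in> cdom c" "z \<in> Om \<Longrightarrow> cmap c (cinv c z) = z" "z \<in> Om \<Longrightarrow> cinv c z \<in> carrier_of A"
  "p \<in> cdom c \<Longrightarrow> cmap c p \<in> Om" "p \<in> cdom c \<Longrightarrow> p \<in> carrier_of A"
  using c by (auto simp: Om_def carrier_of_def)

lemma open_Om: "open Om"
  unfolding Om_def by (rule chart_dom_open[OF c])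

lemma ev_tangent: "z \<in> Om \<Longrightarrow> ev z u \<in> tangent_space A (cinv c z)"
  by (simp add: ev_def c Om)

lemma ev_apply: "z \<in> Om \<Longrightarrow> ev z u c = u"
  by (simp add: ev_def c Om)

lemma ev_tvec: "z \<in> Om \<Longrightarrow> v \<in> tangent_space A (cinv c z) \<Longrightarrow> ev z (v c) = v"
  by (simp add: ev_def c Om)

lemma ev_linear: "z \<in> Om \<Longrightarrow> ev z (a *\<^sub>R u + b *\<^sub>R v) = tscale a (ev z u) + tscale b (ev z v)"
  unfolding ev_def by (rule coord_field_linear[OF c]) (rule Om)

lemma ev_simps:
  assumes z: "z \<in> Om"
  shows "ev z (u + v) = ev z u + ev z v" "ev z (r *\<^sub>R u) = tscale r (ev z u)" "ev z (- u) = - ev z u"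
proof -
  show "ev z (u + v) = ev z u + ev z v" "ev z (r *\<^sub>R u) = tscale r (ev z u)" "ev z (- u) = - ev z u"
    using ev_linear[OF z, of 1 u 1 v] ev_linear[OF z, of r u 0 u] ev_linear[OF z, of "-1" u 0 u]
    by (auto simp: fun_eq_iff)
qed

lemma gc_smooth: "smooth_on Om (\<lambda>z. gc z u v)"
proof -
  have "smooth_fun A (cdom c) (\<lambda>p. g p (coord_field A c u p) (coord_field A c v p))"
    using metric c by (simp add: riemannian_metric_def)
  from this[unfolded smooth_fun_def, THEN bspec, OF c] show ?thesis by (simp add: Om_def gc_def ev_def o_def)
qed

lemma gc_sym: "z \<in> Om \<Longrightarrow> gc z u v = gc z v u"
  unfolding gc_def by (intro metric_simps Om ev_tangent)

lemma gc_linear: assumes z: "z \<in> Om" shows "linear (gc z u)"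
proof (rule linear_combinationI)
  fix a b v w
  have "gc z (a *\<^sub>R v + b *\<^sub>R w) u = a * gc z v u + b * gc z w u"
    unfolding gc_def ev_linear[OF z] by (intro metric_simps Om ev_tangent z)
  then show "gc z u (a *\<^sub>R v + b *\<^sub>R w) = a *\<^sub>R gc z u v + b *\<^sub>R gc z u w"
    by (simp add: gc_sym[OF z, of u])
qed

lemma gc_pos: assumes z: "z \<in> Om" and u: "u \<noteq> 0" shows "gc z u u > 0"
proof -
  have "ev z u \<noteq> 0" using ev_apply[OF z, of u] u by auto
  then show ?thesis unfolding gc_def by (intro metric_pos Om ev_tangent z)
qed

lemma hc_linear: assumes z: "z \<in> Om" shows "linear (\<lambda>u. hc z u v w)"
  by (rule linear_combinationI)
    (simp add: hc_def ev_linear[OF z] H_linear(1)[OF Om(3)[OF z] ev_tangent[OF z] ev_tangent[OF z] ev_tangent[OF z] ev_tangent[OF z]])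

lemma hc_alternating:
  assumes z: "z \<in> Om"
  shows "hc z u v w = - hc z v u w" "hc z u v w = - hc z u w v"
proof -
  note e = Om(3)[OF z] ev_tangent[OF z] ev_tangent[OF z] ev_tangent[OF z] ev_tangent[OF z]
  have 1: "H (cinv c z) [ev z (u + v), x, y] = H (cinv c z) [ev z u, x, y] + H (cinv c z) [ev z v, x, y]"
    "H (cinv c z) [x, ev z (u + v), y] = H (cinv c z) [x, ev z u, y] + H (cinv c z) [x, ev z v, y]"
    "H (cinv c z) [x, y, ev z (u + v)] = H (cinv c z) [x, y, ev z u] + H (cinv c z) [x, y, ev z v]"
    if "x \<in> range (ev z)" "y \<in> range (ev z)" for u v x y
    using ev_linear[OF z, of 1 u 1 v] H_linear(1-3)[OF e(1), of "ev z u" "ev z v" x y 1 1] that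
    by (auto simp: ev_tangent[OF z])
  have 0: "hc z u u w = 0" "hc z w u u = 0" for u w unfolding hc_def by (rule H_linear(4,6)[OF e])+
  have "hc z (u + v) (u + v) w = 0" "hc z u (v + w) (v + w) = 0" by (rule 0)+
  then show "hc z u v w = - hc z v u w" "hc z u v w = - hc z u w v"
    using 0[of u] 0[of v] 0[of w] by (simp_all add: hc_def 1)
qed

lemma hc_smooth: "smooth_on Om (\<lambda>z. hc z u v w)"
proof -
  have "smooth_fun A (carrier_of A \<inter> cdom c) (\<lambda>p. H p (map (\<lambda>x. coord_field A c x p) [u, v, w]))"
    by (rule form[unfolded diff_form_def, THEN conjunct2, THEN bspec, OF c, THEN spec, THEN mp]) simp
  moreover have "carrier_of A \<inter> cdom c = cdom c" using Om(5) by blast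
  ultimately have "smooth_fun A (cdom c) (\<lambda>p. H p (map (\<lambda>x. coord_field A c x p) [u, v, w]))"
    by (simp only:)
  from this[unfolded smooth_fun_def, THEN bspec, OF c] show ?thesis by (simp add: Om_def hc_def ev_def o_def)
qed

lemma coord_field_ev: "z \<in> Om \<Longrightarrow> coord_field A c u (cinv c z) = ev z u"
  by (simp add: ev_def)

lemma frechet_const_on_Om: "z \<in> Om \<Longrightarrow> frechet_derivative (\<lambda>z. coord_field A c u (cinv c z) c) (at z) = (\<lambda>x. 0)"
  by (rule frechet_derivative_eqI, rule has_derivative_transform_within_open[OF has_derivative_const[of u] open_Om])
    (simp_all add: Om c)

lemma nablaL_local:
  assumes "openin (chart_topology A) U" "cinv c z \<in> U" "smooth_field A U Y" "v \<in> tangent_space A (cinv c z)" "z \<in> Om"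
  shows "nablaL (cinv c z) v Y c = frechet_derivative (\<lambda>z. Y (cinv c z) c) (at z) (v c) + Gc z (v c) (Y (cinv c z) c)"
  using connection_local[OF nablaL_connection assms(1-4) c Om(1)[OF assms(5)]] by (simp add: Om assms(5) Gc_def)

lemma nablaL_coord: "z \<in> Om \<Longrightarrow> nablaL (cinv c z) (ev z u) (coord_field A c v) = ev z (Gc z u v)"
proof -
  assume z: "z \<in> Om"
  have "nablaL (cinv c z) (ev z u) (coord_field A c v) \<in> tangent_space A (cinv c z)"
    by (rule connectionD(1)[OF nablaL_connection openin_cdom[OF c] coord_field_smooth[OF c] Om(1)[OF z] ev_tangent[OF z]])
  from ev_tvec[OF z this] show ?thesis by (simp add: Gc_def christoffel_def ev_def)
qed

lemma Gc_sym: assumes z: "z \<in> Om" shows "Gc z u v = Gc z v u"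
proof -
  have "lie_bracket A (coord_field A c u) (coord_field A c v) (cinv c z) c = 0"
    using z by (simp add: lie_bracket_def Om frechet_const_on_Om)
  moreover have "lie_bracket A (coord_field A c u) (coord_field A c v) (cinv c z) = ev z (Gc z u v) - ev z (Gc z v u)"
    using lie_bracket_eq(1)[OF openin_cdom[OF c] coord_field_smooth[OF c] coord_field_smooth[OF c] Om(1)[OF z]]
    by (simp add: nablaL_coord[OF z] coord_field_ev[OF z])
  ultimately show ?thesis by (simp add: ev_apply[OF z])
qed

lemma Gc_metric:
  assumes z: "z \<in> Om"
  shows "frechet_derivative (\<lambda>y. gc y u v) (at z) w = gc z (Gc z w u) v + gc z u (Gc z w v)"
proof -
  let ?f = "\<lambda>q. g q (coord_field A c u q) (coord_field A c v q)"
  have "smooth_fun A (cdom c) ?f" using metric c by (simp add: riemannian_metric_def)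
  from dir_deriv_chart[OF this openin_cdom[OF c] Om(1)[OF z] ev_tangent[OF z] c Om(1)[OF z], of w]
  have "dir_deriv A (cinv c z) (ev z w) ?f = frechet_derivative (\<lambda>y. gc y u v) (at z) w"
    using z by (simp add: o_def gc_def ev_def[symmetric] Om ev_apply)
  moreover have "dir_deriv A (cinv c z) (ev z w) ?f = g (cinv c z) (nablaL (cinv c z) (ev z w) (coord_field A c u)) (coord_field A c v (cinv c z))
     + g (cinv c z) (coord_field A c u (cinv c z)) (nablaL (cinv c z) (ev z w) (coord_field A c v))"
    using lc openin_cdom[OF c] coord_field_smooth[OF c] Om(1)[OF z] ev_tangent[OF z]
    unfolding levi_civita_def by blast
  ultimately show ?thesis by (simp add: nablaL_coord[OF z] coord_field_ev[OF z] gc_def)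
qed

subsection \<open>The dual vector of a covector\<close>

definition gram :: "real^'n \<Rightarrow> real^'n^'n" where "gram z = (\<chi> i j. gc z (axis i 1) (axis j 1))"

lemma gram_apply: assumes z: "z \<in> Om" shows "(gram z *v x) $ i = gc z x (axis i 1)"
proof -
  have "gc z (axis i 1) x = (\<Sum>b\<in>Basis. (x \<bullet> b) *\<^sub>R gc z (axis i 1) b)"
    by (rule linear_basis_expansion[OF gc_linear[OF z]])
  also have "\<dots> = (\<Sum>j\<in>UNIV. x $ j * gc z (axis i 1) (axis j 1))"
    by (simp add: sum_Basis_vec inner_axis)
  finally show ?thesis
    by (simp add: gram_def matrix_vector_mult_def gc_sym[OF z, of x] mult.commute)
qed

lemma gram_det: assumes z: "z \<in> Om" shows "det (gram z) \<noteq> 0"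
proof -
  have "x = 0" if "gram z *v x = 0" for x
  proof (rule ccontr)
    assume "x \<noteq> 0"
    have l: "linear (\<lambda>y. gc z x y)" by (rule gc_linear[OF z])
    have "gc z x x = (\<Sum>b\<in>Basis. (x \<bullet> b) *\<^sub>R gc z x b)" by (rule linear_basis_expansion[OF l])
    also have "\<dots> = 0"
      using gram_apply[OF z, of x] that by (simp add: sum_Basis_vec)
    finally show False using gc_pos[OF z \<open>x \<noteq> 0\<close>] by simp
  qed
  then have "invertible (gram z)"
    using matrix_left_invertible_ker[of "gram z"] invertible_left_inverse by blast
  then show ?thesis by (simp add: invertible_det_nz)
qed

text \<open>Cramer's rule for the Gram matrix of the coordinate frame; the same formula gives smoothness in
  \<open>sc_smooth\<close>.\<close>

lemma sharp_exists:
  assumes z: "z \<in> Om" and \<alpha>: "linear (\<lambda>x. \<alpha> (ev z x))"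
  shows "sharp A g (cinv c z) \<alpha> \<in> tangent_space A (cinv c z)"
    and "gc z (sharp A g (cinv c z) \<alpha> c) x = \<alpha> (ev z x)"
proof -
  define w where "w = (\<chi> k. det (\<chi> i j. if j = k then (\<chi> i. \<alpha> (ev z (axis i 1))) $ i else gram z $ i $ j) / det (gram z))"
  have "gram z *v w = (\<chi> i. \<alpha> (ev z (axis i 1)))"
    using cramer[OF gram_det[OF z], of w "\<chi> i. \<alpha> (ev z (axis i 1))"] by (simp add: w_def)
  then have w: "gc z w (axis i 1) = \<alpha> (ev z (axis i 1))" for i
    using gram_apply[OF z, of w i] by simp
  have gw: "gc z w x = \<alpha> (ev z x)" for x
    using linear_basis_expansion[OF gc_linear[OF z], of w x] linear_basis_expansion[OF \<alpha>, of x] w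
    by (simp add: sum_Basis_vec)
  have ex: "ev z w \<in> tangent_space A (cinv c z) \<and> (\<forall>u\<in>tangent_space A (cinv c z). g (cinv c z) (ev z w) u = \<alpha> u)"
  proof (intro conjI ballI ev_tangent z)
    fix u assume u: "u \<in> tangent_space A (cinv c z)"
    show "g (cinv c z) (ev z w) u = \<alpha> u" using gw[of "u c"] by (simp add: gc_def ev_tvec[OF z u])
  qed
  have un: "w' = ev z w" if w': "w' \<in> tangent_space A (cinv c z) \<and> (\<forall>u\<in>tangent_space A (cinv c z). g (cinv c z) w' u = \<alpha> u)" for w'
  proof (rule ccontr)
    assume ne: "w' \<noteq> ev z w"
    define d where "d = tscale 1 w' + tscale (-1) (ev z w)"
    have d: "d \<in> tangent_space A (cinv c z)" unfolding d_def using w' ex by (intro tangent_space_combination) auto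
    have "d \<noteq> 0" using ne by (auto simp: d_def fun_eq_iff)
    then have "g (cinv c z) d d > 0" by (intro metric_pos Om z d)
    moreover have "g (cinv c z) (tscale 1 w' + tscale (-1) (ev z w)) d
        = 1 * g (cinv c z) w' d + (-1) * g (cinv c z) (ev z w) d"
      by (rule metric_simps(2)) (use w' ex d z in \<open>auto intro: Om\<close>)
    then have "g (cinv c z) d d = 1 * g (cinv c z) w' d + (-1) * g (cinv c z) (ev z w) d"
      by (simp only: d_def[symmetric])
    ultimately show False using w' ex d by simp
  qed
  have "sharp A g (cinv c z) \<alpha> = ev z w"
    unfolding sharp_def by (rule the_equality, rule ex, rule un)
  then show "sharp A g (cinv c z) \<alpha> \<in> tangent_space A (cinv c z)"
    "gc z (sharp A g (cinv c z) \<alpha> c) x = \<alpha> (ev z x)"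
    using ex gw by (simp_all add: ev_apply[OF z])
qed

lemma H_third_linear: "z \<in> Om \<Longrightarrow> linear (\<lambda>x. H (cinv c z) [ev z u, ev z v, ev z x])"
  by (rule linear_combinationI)
    (simp add: ev_linear H_linear(3)[OF Om(3) ev_tangent ev_tangent ev_tangent ev_tangent])

lemma sc: "z \<in> Om \<Longrightarrow> gc z (sc z u v) w = hc z u v w"
  unfolding sc_def hc_def by (rule sharp_exists(2)[OF _ H_third_linear])

lemma sharp_eq_sc: "z \<in> Om \<Longrightarrow> sharp A g (cinv c z) (\<lambda>x. H (cinv c z) [ev z u, ev z v, x]) = ev z (sc z u v)"
  unfolding sc_def by (rule ev_tvec[symmetric, OF _ sharp_exists(1)[OF _ H_third_linear]])

lemma sc_smooth: "smooth_on Om (\<lambda>z. sc z u v)"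
proof -
  let ?b = "\<lambda>z. \<chi> i. hc z u v (axis i 1)"
  let ?M = "\<lambda>z k. \<chi> i j. if j = k then ?b z $ i else gram z $ i $ j"
  have "smooth_on Om (\<lambda>z. \<chi> k. det (?M z k) * inverse (det (gram z)))"
  proof (intro smooth_on_vec_lambda smooth_on_mult smooth_on_det smooth_on_inverse open_Om gram_det)
    show "smooth_on Om (\<lambda>z. ?M z k $ i $ j)" for k i j
      by (cases "j = k") (simp_all add: hc_smooth gram_def gc_smooth)
    show "smooth_on Om (\<lambda>z. gram z $ i $ j)" for i j by (simp add: gram_def gc_smooth)
  qed
  then show ?thesis
  proof (rule smooth_on_cong[OF open_Om, rotated])
    fix z assume z: "z \<in> Om"
    have "gram z *v sc z u v = ?b z" by (simp add: vec_eq_iff gram_apply[OF z] sc[OF z])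
    then show "(\<chi> k. det (?M z k) * inverse (det (gram z))) = sc z u v"
      using cramer[OF gram_det[OF z], of "sc z u v" "?b z"] by (simp add: divide_inverse)
  qed
qed

lemma hc_cyclic: assumes z: "z \<in> Om" shows "hc z u v w = hc z v w u"
  using hc_alternating[OF z, of u v w] hc_alternating[OF z, of v u w] by simp

text \<open>Closedness is stated in an arbitrarily chosen chart at each point and has to be transferred to \<open>c\<close>.\<close>

lemma hc_closed:
  assumes z: "z \<in> Om" shows "ext3 hc z a b d e = 0"
proof -
  define p where "p = cinv c z"
  define c0 where "c0 = chart_at A p"
  have p: "p \<in> cdom c" "p \<in> carrier_of A" "cmap c p = z" using z by (simp_all add: p_def Om)
  have c0: "c0 \<in> A" "p \<in> cdom c0" using chart_at[OF p(2)] by (simp_all add: c0_def)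
  interpret c0: hkt_chart A g I H nablaL c0 by unfold_locales (rule c0)
  define S where "S = cmap c ` (cdom c \<inter> cdom c0)"
  define \<tau> where "\<tau> = cmap c0 \<circ> cinv c"
  have S: "open S" "z \<in> S" "S \<subseteq> Om"
    using overlap_open[OF c c0(1)] p c0 by (auto simp: S_def Om_def)
  have \<tau>: "smooth_on S \<tau>" unfolding S_def \<tau>_def by (rule transition_smooth[OF c c0(1)])
  have \<tau>_in: "\<tau> y \<in> c0.Om" "cinv c0 (\<tau> y) = cinv c y" "cinv c y \<in> cdom c" "cinv c y \<in> cdom c0"
    if "y \<in> S" for y
    using that c c0 by (auto simp: S_def \<tau>_def c0.Om_def)
  have ev: "ev y u = c0.ev (\<tau> y) (frechet_derivative \<tau> (at y) u)" if y: "y \<in> S" for y u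
  proof -
    have "y \<in> Om" using y S by auto
    then have "frechet_derivative \<tau> (at y) u = ev y u c0"
      using \<tau>_in[OF y] c c0 by (simp add: ev_def coord_field_apply dtr_def \<tau>_def Om)
    moreover have "c0.ev (\<tau> y) (ev y u c0) = ev y u"
      by (rule c0.ev_tvec) (use \<tau>_in[OF y] ev_tangent[OF \<open>y \<in> Om\<close>] in simp_all)
    ultimately show ?thesis by simp
  qed
  have "ext3 hc z a b d e = ext3 (\<lambda>y u v w. c0.hc (\<tau> y) (frechet_derivative \<tau> (at y) u)
      (frechet_derivative \<tau> (at y) v) (frechet_derivative \<tau> (at y) w)) z a b d e"
    by (rule ext3_cong[OF S(1,2) _ smooth_on_subset[OF hc_smooth S(3)]])
      (simp add: hc_def c0.hc_def \<tau>_in ev)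
  also have "\<dots> = ext3 c0.hc (\<tau> z) (frechet_derivative \<tau> (at z) a) (frechet_derivative \<tau> (at z) b)
      (frechet_derivative \<tau> (at z) d) (frechet_derivative \<tau> (at z) e)"
    by (rule ext3_pullback[OF S(1,2) \<tau> c0.open_Om _ c0.hc_smooth c0.hc_linear c0.hc_alternating(1) c0.hc_cyclic])
      (use \<tau>_in in auto)
  also have "\<dots> = ext_deriv A H p [ev z a, ev z b, ev z d, ev z e]"
  proof -
    have e: "frechet_derivative \<tau> (at z) u = ev z u c0" for u
      using c c0 p by (simp add: ev_def coord_field_apply dtr_def \<tau>_def flip: p_def)
    have t: "\<tau> z = cmap c0 p" by (simp add: \<tau>_def p_def)
    have n4: "{..<4::nat} = {0, 1, 2, 3}" by auto
    show ?thesis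
      unfolding ext_deriv_def Let_def c0_def[symmetric] dir_deriv_def e t ext3_def
      by (simp add: n4 c0.hc_def c0.ev_def o_def numeral_2_eq_2 numeral_3_eq_3)
  qed
  also have "\<dots> = 0"
    using closed p ev_tangent[OF z] unfolding closed_form_def p_def[symmetric] by (auto simp: p_def)
  finally show ?thesis .
qed

end

sublocale hkt_chart \<subseteq> coord_geometry Om gc Gc hc sc
proof (rule coord_geometry.intro)
  show "open Om" by (rule open_Om)
  show "smooth_on Om (\<lambda>z. gc z u v)" for u v by (rule gc_smooth)
  show "smooth_on Om (\<lambda>z. Gc z u v)" for u v
    unfolding Gc_def Om_def by (rule christoffel_smooth[OF nablaL_connection c])
  show "smooth_on Om (\<lambda>z. hc z u v w)" for u v w by (rule hc_smooth)
  show "smooth_on Om (\<lambda>z. sc z u v)" for u v by (rule sc_smooth)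
  fix z assume z: "z \<in> Om"
  show "linear (gc z u)" for u by (rule gc_linear[OF z])
  show "gc z u v = gc z v u" for u v by (rule gc_sym[OF z])
  show "u \<noteq> 0 \<Longrightarrow> gc z u u > 0" for u by (rule gc_pos[OF z])
  show "linear (Gc z u)" for u
    unfolding Gc_def[abs_def] by (rule christoffel_linear(1)[OF nablaL_connection c Om(1)[OF z]])
  show "Gc z u v = Gc z v u" for u v by (rule Gc_sym[OF z])
  show "frechet_derivative (\<lambda>y. gc y u v) (at z) w = gc z (Gc z w u) v + gc z u (Gc z w v)" for u v w
    by (rule Gc_metric[OF z])
  show "linear (\<lambda>u. hc z u v w)" for v w by (rule hc_linear[OF z])
  show "hc z u v w = - hc z v u w" for u v w by (rule hc_alternating[OF z])
  show "hc z u v w = hc z v w u" for u v w by (rule hc_cyclic[OF z])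
  show "frechet_derivative (\<lambda>y. hc y b c d) (at z) a - frechet_derivative (\<lambda>y. hc y a c d) (at z) b
        + frechet_derivative (\<lambda>y. hc y a b d) (at z) c - frechet_derivative (\<lambda>y. hc y a b c) (at z) d = 0" for a b c d
    using hc_closed[OF z] by (simp add: ext3_def)
  show "gc z (sc z u v) w = hc z u v w" for u v w by (rule sc[OF z])
qed

context hkt_chart
begin

text \<open>The torsion term only depends on the value of the field, so \<open>\<nabla>\<^sup>L + s g\<^sup>-\<^sup>1H\<close> is determined by its
  Christoffel symbols as well.\<close>

lemma torsion_conn_local:
  assumes z: "z \<in> Om" and U: "openin (chart_topology A) U" "cinv c z \<in> U" and Y: "smooth_field A U Y"
    and v: "v \<in> tangent_space A (cinv c z)"
  shows "torsion_conn A g nablaL s H (cinv c z) v Y \<in> tangent_space A (cinv c z)"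
    and "torsion_conn A g nablaL s H (cinv c z) v Y c =
      frechet_derivative (\<lambda>z. Y (cinv c z) c) (at z) (v c) + \<Gamma>s s z (v c) (Y (cinv c z) c)"
proof -
  have "sharp A g (cinv c z) (\<lambda>u. H (cinv c z) [v, Y (cinv c z), u]) = ev z (sc z (v c) (Y (cinv c z) c))"
    using sharp_eq_sc[OF z, of "v c" "Y (cinv c z) c"] ev_tvec[OF z v] ev_tvec[OF z smooth_fieldD(1)[OF Y U(2)]] by simp
  then have *: "torsion_conn A g nablaL s H (cinv c z) v Y
      = nablaL (cinv c z) v Y + tscale s (ev z (sc z (v c) (Y (cinv c z) c)))"
    by (simp add: torsion_conn_def)
  show "torsion_conn A g nablaL s H (cinv c z) v Y \<in> tangent_space A (cinv c z)"
    unfolding * by (intro tangent_space_simps connectionD(1)[OF nablaL_connection U(1) Y U(2) v] ev_tangent z)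
  show "torsion_conn A g nablaL s H (cinv c z) v Y c =
      frechet_derivative (\<lambda>z. Y (cinv c z) c) (at z) (v c) + \<Gamma>s s z (v c) (Y (cinv c z) c)"
    unfolding * by (simp add: nablaL_local[OF U Y v z] ev_apply[OF z] \<Gamma>s_def)
qed

lemma I_component: "z \<in> Om \<Longrightarrow> v \<in> tangent_space A (cinv c z) \<Longrightarrow> I (cinv c z) v c = ic z (v c)"
  by (simp add: ic_def ev_tvec)

lemma I_ev: "z \<in> Om \<Longrightarrow> I (cinv c z) (ev z u) = ev z (ic z u)"
  unfolding ic_def by (rule ev_tvec[symmetric, OF _ I_tangent[OF Om(3) ev_tangent]])

lemma coord_I: "(\<lambda>y. I (cinv c y) (coord_field A c u (cinv c y)) c) = (\<lambda>y. ic y u)"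
  by (simp add: ic_def ev_def)

end

sublocale hkt_chart \<subseteq> coord_twistor Om gc Gc hc sc ic
proof (intro coord_twistor.intro coord_complex.intro coord_complex_axioms.intro)
  show "coord_geometry Om gc Gc hc sc" by (rule coord_geometry_axioms)
  note cf = coord_field_smooth[OF c] and Uc = openin_cdom[OF c] and Ic = I_smooth[OF c]
  show "smooth_on Om (\<lambda>z. ic z u)" for u
    using smooth_fieldD(2)[OF Ic c, of u] by (simp add: coord_I Om_def)
  fix z assume z: "z \<in> Om"
  show lin: "linear (ic z)"
    by (rule linear_combinationI) (simp add: ic_def ev_linear[OF z] I_linear[OF Om(3)[OF z] ev_tangent[OF z] ev_tangent[OF z]])
  show "ic z (ic z u) = - u" for u
    using I_compatible(1)[OF Om(3)[OF z] ev_tangent[OF z] ev_tangent[OF z], of u]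
    by (simp add: I_ev[OF z]) (metis ev_apply[OF z] tvec_apply(3))
  show "gc z (ic z u) (ic z v) = gc z u v" for u v
    unfolding gc_def I_ev[OF z, symmetric] by (intro I_compatible Om ev_tangent z)
  show "frechet_derivative (\<lambda>y. ic y w) (at z) u = ic z (\<Gamma>s (1/2) z u w) - \<Gamma>s (1/2) z u (ic z w)" for u w
  proof -
    have "torsion_conn A g nablaL (1/2) H (cinv c z) (ev z u) (\<lambda>q. I q (coord_field A c w q)) c
        = I (cinv c z) (torsion_conn A g nablaL (1/2) H (cinv c z) (ev z u) (coord_field A c w)) c"
      by (rule fun_cong[OF parallelD[OF Uc cf Om(1)[OF z] ev_tangent[OF z]]])
    moreover have "torsion_conn A g nablaL (1/2) H (cinv c z) (ev z u) (coord_field A c w) c = \<Gamma>s (1/2) z u w"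
      by (simp add: torsion_conn_local(2)[OF z Uc Om(1)[OF z] cf ev_tangent[OF z]] frechet_const_on_Om[OF z]
          ev_apply[OF z] coord_field_ev[OF z])
    moreover have "torsion_conn A g nablaL (1/2) H (cinv c z) (ev z u) (\<lambda>q. I q (coord_field A c w q)) c
        = frechet_derivative (\<lambda>y. ic y w) (at z) u + \<Gamma>s (1/2) z u (ic z w)"
      by (simp add: torsion_conn_local(2)[OF z Uc Om(1)[OF z] Ic ev_tangent[OF z]] coord_I ev_apply[OF z]
          coord_field_ev[OF z] I_ev[OF z])
    ultimately show ?thesis
      by (simp add: I_component[OF z torsion_conn_local(1)[OF z Uc Om(1)[OF z] cf ev_tangent[OF z]]] eq_diff_eq)
  qed
  show "frechet_derivative (\<lambda>y. ic y v) (at z) (ic z u) - frechet_derivative (\<lambda>y. ic y u) (at z) (ic z v)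
        + ic z (frechet_derivative (\<lambda>y. ic y u) (at z) v) - ic z (frechet_derivative (\<lambda>y. ic y v) (at z) u) = 0" for u v
  proof -
    let ?u = "coord_field A c u" and ?v = "coord_field A c v"
    let ?Iu = "\<lambda>q. I q (coord_field A c u q)" and ?Iv = "\<lambda>q. I q (coord_field A c v q)"
    have b: "lie_bracket A X Y (cinv c z) c = frechet_derivative (\<lambda>z. Y (cinv c z) c) (at z) (X (cinv c z) c)
        - frechet_derivative (\<lambda>z. X (cinv c z) c) (at z) (Y (cinv c z) c)" for X Y
      using c z by (simp add: lie_bracket_def Om)
    have "0 = (lie_bracket A ?Iu ?Iv (cinv c z) - I (cinv c z) (lie_bracket A ?Iu ?v (cinv c z))
       - I (cinv c z) (lie_bracket A ?u ?Iv (cinv c z)) - lie_bracket A ?u ?v (cinv c z)) c"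
      using fun_cong[OF I_nijenhuis[OF Uc cf cf Om(1)[OF z], of u v], of c] by simp
    also have "\<dots> = lie_bracket A ?Iu ?Iv (cinv c z) c - ic z (lie_bracket A ?Iu ?v (cinv c z) c)
       - ic z (lie_bracket A ?u ?Iv (cinv c z) c) - lie_bracket A ?u ?v (cinv c z) c"
      by (simp add: I_component[OF z lie_bracket_eq(2)[OF Uc Ic cf Om(1)[OF z]]]
          I_component[OF z lie_bracket_eq(2)[OF Uc cf Ic Om(1)[OF z]]])
    also have "\<dots> = frechet_derivative (\<lambda>y. ic y v) (at z) (ic z u) - frechet_derivative (\<lambda>y. ic y u) (at z) (ic z v)
        + ic z (frechet_derivative (\<lambda>y. ic y u) (at z) v) - ic z (frechet_derivative (\<lambda>y. ic y v) (at z) u)"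
      by (simp add: b coord_I frechet_const_on_Om[OF z] coord_field_ev[OF z] I_ev[OF z] ev_apply[OF z]
          linear_neg[OF lin])
    finally show ?thesis by simp
  qed
qed

subsection \<open>Curvature in a chart\<close>

context hkt_chart
begin

abbreviation nablaM :: "('m, real^'n) conn" where "nablaM \<equiv> torsion_conn A g nablaL (- 1/2) H"

lemma lie_bracket_coord_fields: "p \<in> cdom c \<Longrightarrow> lie_bracket A (coord_field A c x) (coord_field A c y) p = 0"
proof -
  assume p: "p \<in> cdom c"
  have "lie_bracket A (coord_field A c x) (coord_field A c y) p c = 0"
    using c p frechet_const_on_Om[OF Om(4)[OF p]] by (simp add: lie_bracket_def)
  then show ?thesis
    by (intro tangent_eqI[OF lie_bracket_eq(2)[OF openin_cdom[OF c] coord_field_smooth[OF c] coord_field_smooth[OF c] p] _ c p]) auto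
qed

lemma nablaM_derivative:
  assumes z: "z \<in> Om" and U: "openin (chart_topology A) U" "cinv c z \<in> U"
    and Y: "smooth_field A U Y" and Z: "smooth_field A U Z"
  defines "y \<equiv> \<lambda>z. Y (cinv c z) c" and "x \<equiv> \<lambda>z. Z (cinv c z) c"
  shows "smooth_field A (U \<inter> cdom c) (\<lambda>q. nablaM q (Y q) Z)"
    and "frechet_derivative (\<lambda>z. nablaM (cinv c z) (Y (cinv c z)) Z c) (at z) u =
      frechet_derivative (\<lambda>t. frechet_derivative x (at t) (y z)) (at z) u
      + frechet_derivative x (at z) (frechet_derivative y (at z) u)
      + (frechet_derivative (\<lambda>t. \<Gamma>m t (y z) (x z)) (at z) u + \<Gamma>m z (y z) (frechet_derivative x (at z) u)
         + \<Gamma>m z (frechet_derivative y (at z) u) (x z))"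
proof -
  let ?V = "U \<inter> cdom c" and ?S = "cmap c ` (U \<inter> cdom c)"
  have S: "open ?S" "z \<in> ?S" "?S \<subseteq> Om" using openin_image[OF U(1) c] U(2) Om(1,2)[OF z] imageI[of "cinv c z" ?V "cmap c"]
    unfolding Om_def by auto
  have in_U: "cinv c t \<in> U" "cinv c t \<in> cdom c" if "t \<in> ?S" for t using that c by auto
  have sy: "smooth_on ?S y" and sx: "smooth_on ?S x"
    unfolding y_def x_def by (rule smooth_fieldD(2)[OF Y c], rule smooth_fieldD(2)[OF Z c])
  have val: "nablaM (cinv c t) (Y (cinv c t)) Z c = frechet_derivative x (at t) (y t) + \<Gamma>m t (y t) (x t)" if t: "t \<in> ?S" for t
    unfolding x_def y_def
    by (rule torsion_conn_local(2)[OF _ U(1) in_U(1)[OF t] Z smooth_fieldD(1)[OF Y in_U(1)[OF t]]]) (use t S in auto)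
  have lx: "linear (frechet_derivative x (at t))" if "t \<in> ?S" for t by (rule smooth_on_linear_frechet[OF sx that])
  have l\<Gamma>: "linear (\<Gamma>m t w)" "linear (\<lambda>v. \<Gamma>m t v w)" if "t \<in> ?S" for t w
    using that S by (auto intro: \<Gamma>s_linear \<Gamma>s_left_linear)
  show "smooth_field A ?V (\<lambda>q. nablaM q (Y q) Z)"
  proof (rule smooth_fieldI[OF c openin_Int_cdom[OF U(1) c]])
    show "?V \<subseteq> cdom c" by simp
    show "nablaM q (Y q) Z \<in> tangent_space A q" if "q \<in> ?V" for q
      using torsion_conn_local(1)[OF Om(4)[of q] U(1) _ Z, of "Y q"] smooth_fieldD(1)[OF Y] that c by simp
    have 1: "smooth_on ?S (\<lambda>t. frechet_derivative x (at t) (y t))"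
      by (rule smooth_on_linear_apply[where f = "\<lambda>t. frechet_derivative x (at t)" and Y = y, OF S(1) lx smooth_on_frechet[OF sx] sy])
    have 2: "smooth_on ?S (\<lambda>t. \<Gamma>m t w (x t))" for w
      by (rule smooth_on_linear_apply[where f = "\<lambda>t. \<Gamma>m t w" and Y = x, OF S(1) l\<Gamma>(1) smooth_on_subset[OF \<Gamma>s_smooth S(3)] sx])
    have 3: "smooth_on ?S (\<lambda>t. \<Gamma>m t (y t) (x t))"
      by (rule smooth_on_linear_apply[where f = "\<lambda>t v. \<Gamma>m t v (x t)" and Y = y, OF S(1) l\<Gamma>(2) 2 sy])
    show "smooth_on ?S (\<lambda>t. nablaM (cinv c t) (Y (cinv c t)) Z c)"
      by (rule smooth_on_cong[OF S(1) _ smooth_on_add[OF S(1) 1 3]]) (simp only: val)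
  qed
  have dy: "(y has_derivative frechet_derivative y (at z)) (at z)" and dx: "(x has_derivative frechet_derivative x (at z)) (at z)"
    by (rule smooth_on_has_derivative[OF sy S(2)], rule smooth_on_has_derivative[OF sx S(2)])
  have 1: "((\<lambda>t. frechet_derivative x (at t) (y t)) has_derivative
     (\<lambda>h. frechet_derivative (\<lambda>t. frechet_derivative x (at t) (y z)) (at z) h + frechet_derivative x (at z) (frechet_derivative y (at z) h))) (at z)"
    by (rule has_derivative_linear_apply[where f = "\<lambda>t. frechet_derivative x (at t)" and Y = y, OF S(1,2) lx
        smooth_on_has_derivative[OF smooth_on_frechet[OF sx] S(2)] dy])
  have 2: "((\<lambda>t. \<Gamma>m t w (x t)) has_derivative
     (\<lambda>h. frechet_derivative (\<lambda>t. \<Gamma>m t w (x z)) (at z) h + \<Gamma>m z w (frechet_derivative x (at z) h))) (at z)" for w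
    by (rule has_derivative_linear_apply[where f = "\<lambda>t. \<Gamma>m t w" and Y = x, OF S(1,2) l\<Gamma>(1)
        smooth_on_has_derivative[OF \<Gamma>s_smooth z] dx])
  have 3: "((\<lambda>t. \<Gamma>m t (y t) (x t)) has_derivative
     (\<lambda>h. (frechet_derivative (\<lambda>t. \<Gamma>m t (y z) (x z)) (at z) h + \<Gamma>m z (y z) (frechet_derivative x (at z) h))
        + \<Gamma>m z (frechet_derivative y (at z) h) (x z))) (at z)"
    by (rule has_derivative_linear_apply[where f = "\<lambda>t v. \<Gamma>m t v (x t)" and Y = y, OF S(1,2) l\<Gamma>(2) 2 dy])
  have "((\<lambda>t. nablaM (cinv c t) (Y (cinv c t)) Z c) has_derivative
     (\<lambda>h. (frechet_derivative (\<lambda>t. frechet_derivative x (at t) (y z)) (at z) h + frechet_derivative x (at z) (frechet_derivative y (at z) h))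
       + ((frechet_derivative (\<lambda>t. \<Gamma>m t (y z) (x z)) (at z) h + \<Gamma>m z (y z) (frechet_derivative x (at z) h))
        + \<Gamma>m z (frechet_derivative y (at z) h) (x z)))) (at z)"
    by (rule has_derivative_transform_within_open[OF has_derivative_add[OF 1 3] S(1,2)]) (simp only: val)
  then show "frechet_derivative (\<lambda>z. nablaM (cinv c z) (Y (cinv c z)) Z c) (at z) u =
      frechet_derivative (\<lambda>t. frechet_derivative x (at t) (y z)) (at z) u
      + frechet_derivative x (at z) (frechet_derivative y (at z) u)
      + (frechet_derivative (\<lambda>t. \<Gamma>m t (y z) (x z)) (at z) u + \<Gamma>m z (y z) (frechet_derivative x (at z) u)
         + \<Gamma>m z (frechet_derivative y (at z) u) (x z))"
    by (simp add: frechet_derivative_eqI)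
qed

text \<open>Curvature is tensorial: for commuting fields the second derivatives of \<open>Z\<close> cancel by symmetry, and
  the derivatives of \<open>X\<close> and \<open>Y\<close> cancel because their bracket vanishes.\<close>

lemma curvature_fields_local:
  assumes z: "z \<in> Om" and U: "openin (chart_topology A) U" "cinv c z \<in> U"
    and X: "smooth_field A U X" and Y: "smooth_field A U Y" and Z: "smooth_field A U Z"
    and br: "lie_bracket A X Y (cinv c z) = 0"
  shows "curvature_fields A nablaM X Y Z (cinv c z) \<in> tangent_space A (cinv c z)"
    and "curvature_fields A nablaM X Y Z (cinv c z) c
      = curv_coord \<Gamma>m z (X (cinv c z) c) (Y (cinv c z) c) (Z (cinv c z) c)"
proof -
  let ?p = "cinv c z" and ?V = "U \<inter> cdom c"
  let ?S = "cmap c ` ?V"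
  have V: "openin (chart_topology A) ?V" "?p \<in> ?V" using openin_Int_cdom[OF U(1) c] U(2) Om(1)[OF z] by auto
  have S: "open ?S" "z \<in> ?S" using openin_image[OF U(1) c] V(2) Om(2)[OF z] imageI[of "cinv c z" ?V "cmap c"] by simp_all
  note T = smooth_fieldD(1)[OF X U(2)] smooth_fieldD(1)[OF Y U(2)]
  note D = nablaM_derivative[OF z U]
  note t = torsion_conn_local[OF z V]
  have T0: "(0 :: ('m, real^'n) tvec) \<in> tangent_space A ?p" by simp
  have 0: "nablaM ?p 0 Z \<in> tangent_space A ?p" by (rule torsion_conn_local(1)[OF z U Z T0])
  show "curvature_fields A nablaM X Y Z ?p \<in> tangent_space A ?p"
    unfolding curvature_fields_def br
    by (intro tangent_space_simps t(1)[OF D(1)[OF Y Z] T(1)] t(1)[OF D(1)[OF X Z] T(2)] 0)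
  define x y w where "x = (\<lambda>z. X (cinv c z) c)" and "y = (\<lambda>z. Y (cinv c z) c)" and "w = (\<lambda>z. Z (cinv c z) c)"
  have sw: "smooth_on ?S w" unfolding w_def by (rule smooth_fieldD(2)[OF Z c])
  have sym: "frechet_derivative (\<lambda>t. frechet_derivative w (at t) u) (at z) v = frechet_derivative (\<lambda>t. frechet_derivative w (at t) v) (at z) u" for u v
    by (rule second_derivative_symmetric[OF S sw])
  have b: "frechet_derivative y (at z) (x z) = frechet_derivative x (at z) (y z)"
    using fun_cong[OF br, of c] c z by (simp add: lie_bracket_def Om x_def y_def)
  have 0: "nablaM ?p 0 Z c = 0"
    using torsion_conn_local(2)[OF z U Z T0, of "- 1/2"] linear_0[OF smooth_on_linear_frechet[OF sw S(2)]]
    by (simp add: \<Gamma>s_simps[OF z] w_def)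
  have "curvature_fields A nablaM X Y Z ?p c =
      frechet_derivative (\<lambda>z. nablaM (cinv c z) (Y (cinv c z)) Z c) (at z) (x z) + \<Gamma>m z (x z) (nablaM ?p (Y ?p) Z c)
    - (frechet_derivative (\<lambda>z. nablaM (cinv c z) (X (cinv c z)) Z c) (at z) (y z) + \<Gamma>m z (y z) (nablaM ?p (X ?p) Z c))"
    unfolding curvature_fields_def br
    by (simp only: tvec_apply 0 t(2)[OF D(1)[OF Y Z] T(1)] t(2)[OF D(1)[OF X Z] T(2)] diff_zero x_def y_def)
  also have "\<dots> = curv_coord \<Gamma>m z (x z) (y z) (w z)"
    unfolding D(2)[OF Y Z] D(2)[OF X Z] torsion_conn_local(2)[OF z U Z T(1)] torsion_conn_local(2)[OF z U Z T(2)]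
    unfolding x_def[symmetric] y_def[symmetric] w_def[symmetric] fun_cong[OF x_def, symmetric] fun_cong[OF y_def, symmetric]
      fun_cong[OF w_def, symmetric] b sym[of "y z" "x z"]
    by (simp add: curv_coord_def \<Gamma>s_simps[OF z])
  finally show "curvature_fields A nablaM X Y Z ?p c = curv_coord \<Gamma>m z (X ?p c) (Y ?p c) (Z ?p c)"
    by (simp add: x_def y_def w_def)
qed

text \<open>The fields in the definition of curvature have constant components in some chart around the point,
  which may differ from \<open>c\<close>.\<close>

lemma curvature_local:
  assumes z: "z \<in> Om" and u: "u \<in> tangent_space A (cinv c z)" and v: "v \<in> tangent_space A (cinv c z)"
    and w: "w \<in> tangent_space A (cinv c z)"
  shows "curvature A nablaM (cinv c z) u v w \<in> tangent_space A (cinv c z)"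
    and "curvature A nablaM (cinv c z) u v w c = Rmat z (u c) (v c) *v (w c)"
proof -
  let ?p = "cinv c z"
  define c0 where "c0 = chart_at A ?p"
  have c0: "c0 \<in> A" "?p \<in> cdom c0" using chart_at[OF Om(3)[OF z]] by (simp_all add: c0_def)
  interpret c0: hkt_chart A g I H nablaL c0 by unfold_locales (rule c0)
  have *: "curvature A nablaM ?p u v w = curvature_fields A nablaM
     (coord_field A c0 (u c0)) (coord_field A c0 (v c0)) (coord_field A c0 (w c0)) ?p"
    using w by (simp add: curvature_def Let_def c0_def)
  note f = curvature_fields_local[OF z openin_cdom[OF c0(1)] c0(2) coord_field_smooth[OF c0(1)] coord_field_smooth[OF c0(1)]
      coord_field_smooth[OF c0(1)] c0.lie_bracket_coord_fields[OF c0(2)]]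
  show "curvature A nablaM ?p u v w \<in> tangent_space A ?p" unfolding * by (rule f(1))
  show "curvature A nablaM ?p u v w c = Rmat z (u c) (v c) *v (w c)"
    unfolding * f(2) Rmat_apply[OF z] using c0 u v w by simp
qed

end

section \<open>The endomorphism bundle\<close>

locale vec_atlas = atlas A for A :: "('m, real^'n) chart set"
begin

text \<open>The endomorphism with matrix \<open>M\<close> in the chart \<open>c\<close>.\<close>

definition mk_end :: "('m, real^'n) chart \<Rightarrow> 'm \<Rightarrow> real^'n^'n \<Rightarrow> ('m, real^'n) tend" where
  "mk_end c p M = (\<lambda>v. if v \<in> tangent_space A p then coord_field A c (M *v v c) p else 0)"

lemma tangent_endD:
  assumes "L \<in> tangent_end A p"
  shows "v \<in> tangent_space A p \<Longrightarrow> L v \<in> tangent_space A p" "v \<notin> tangent_space A p \<Longrightarrow> L v = 0"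
    "u \<in> tangent_space A p \<Longrightarrow> v \<in> tangent_space A p \<Longrightarrow>
      L (tscale a u + tscale b v) = tscale a (L u) + tscale b (L v)" "L 0 = 0"
proof -
  show 1: "u \<in> tangent_space A p \<Longrightarrow> v \<in> tangent_space A p \<Longrightarrow>
      L (tscale a u + tscale b v) = tscale a (L u) + tscale b (L v)" for a b u v
    using assms by (simp add: tangent_end_def)
  show "v \<in> tangent_space A p \<Longrightarrow> L v \<in> tangent_space A p" "v \<notin> tangent_space A p \<Longrightarrow> L v = 0"
    using assms by (simp_all add: tangent_end_def)
  have "tscale 0 0 + tscale 0 0 = (0 :: ('m, real^'n) tvec)" "tscale 0 (L 0) + tscale 0 (L 0) = 0"
    by (rule ext, simp)+
  then show "L 0 = 0" using 1[of 0 0 0 0] by simp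
qed

lemma linear_end_component:
  assumes L: "L \<in> tangent_end A p" and c: "c \<in> A" "p \<in> cdom c"
  shows "linear (\<lambda>x. L (coord_field A c x p) c)"
proof -
  have "L (coord_field A c (a *\<^sub>R x + b *\<^sub>R y) p) c = a *\<^sub>R L (coord_field A c x p) c + b *\<^sub>R L (coord_field A c y p) c"
    for a b x y
    unfolding coord_field_linear[OF c] by (subst tangent_endD(3)[OF L]) (use c in auto)
  from this[of 1 _ 1] this[of _ _ 0] show ?thesis by (intro linearI) auto
qed

lemma end_coord_apply:
  assumes "L \<in> tangent_end A p" "c \<in> A" "p \<in> cdom c" "v \<in> tangent_space A p"
  shows "L v c = end_coord A c p L *v v c"
  unfolding end_coord_def matrix_apply[OF linear_end_component[OF assms(1-3)]] using assms by simp

lemma end_coordI: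
  assumes "c \<in> A" "p \<in> cdom c" "\<And>v. v \<in> tangent_space A p \<Longrightarrow> L v c = M *v v c"
  shows "end_coord A c p L = M"
proof -
  have "(\<lambda>x. L (coord_field A c x p) c) = (*v) M" using assms by (auto simp: fun_eq_iff)
  then show ?thesis by (simp add: end_coord_def)
qed

lemma tangent_end_eqI:
  assumes L: "L \<in> tangent_end A p" "L' \<in> tangent_end A p" and c: "c \<in> A" "p \<in> cdom c"
    and eq: "end_coord A c p L = end_coord A c p L'"
  shows "L = L'"
proof
  fix v
  show "L v = L' v"
  proof (cases "v \<in> tangent_space A p")
    case True
    show ?thesis
      by (rule tangent_eqI[OF tangent_endD(1)[OF L(1) True] tangent_endD(1)[OF L(2) True] c])
        (simp add: end_coord_apply[OF _ c True] L eq)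
  next
    case False
    then show ?thesis by (simp add: tangent_endD(2)[OF L(1)] tangent_endD(2)[OF L(2)])
  qed
qed

lemma mk_end:
  assumes c: "c \<in> A" "p \<in> cdom c"
  shows "mk_end c p M \<in> tangent_end A p" "end_coord A c p (mk_end c p M) = M"
proof -
  show "mk_end c p M \<in> tangent_end A p"
    unfolding tangent_end_def mem_Collect_eq
  proof (intro conjI ballI allI impI)
    fix u v a b assume uv: "u \<in> tangent_space A p" "v \<in> tangent_space A p"
    show "mk_end c p M (tscale a u + tscale b v) = tscale a (mk_end c p M u) + tscale b (mk_end c p M v)"
      using uv tangent_space_combination[OF uv, of a b]
      by (simp add: mk_end_def mat_vec_simps coord_field_linear[OF c])
  qed (use c in \<open>simp_all add: mk_end_def\<close>)
  show "end_coord A c p (mk_end c p M) = M" by (rule end_coordI[OF c]) (use c in \<open>simp add: mk_end_def\<close>)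
qed

lemma mk_end_coord: "L \<in> tangent_end A p \<Longrightarrow> c \<in> A \<Longrightarrow> p \<in> cdom c \<Longrightarrow> mk_end c p (end_coord A c p L) = L"
  by (rule tangent_end_eqI[of _ p _ c]) (simp_all add: mk_end)

lemma tangent_end_ops:
  assumes L: "L \<in> tangent_end A p" "B \<in> tangent_end A p"
  shows "(\<lambda>v. L v + tscale t (B v)) \<in> tangent_end A p" "L \<circ> B \<in> tangent_end A p" "commutator L B \<in> tangent_end A p"
proof -
  note * = tangent_endD[OF L(1)] tangent_endD[OF L(2)]
  show "(\<lambda>v. L v + tscale t (B v)) \<in> tangent_end A p" "L \<circ> B \<in> tangent_end A p" "commutator L B \<in> tangent_end A p"
    unfolding tangent_end_def commutator_def
    by (auto simp: *(1,2,4-6,8) *(3) *(7) fun_eq_iff algebra_simps)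
qed

lemma end_coord_ops:
  assumes L: "L \<in> tangent_end A p" "B \<in> tangent_end A p" and c: "c \<in> A" "p \<in> cdom c"
  shows "end_coord A c p (\<lambda>v. L v + tscale t (B v)) = end_coord A c p L + t *\<^sub>R end_coord A c p B"
    "end_coord A c p (L \<circ> B) = end_coord A c p L ** end_coord A c p B"
    "end_coord A c p (commutator L B) = end_coord A c p L ** end_coord A c p B - end_coord A c p B ** end_coord A c p L"
  by (rule end_coordI[OF c];
      simp add: end_coord_apply[OF L(1) c] end_coord_apply[OF L(2) c] tangent_endD(1)[OF L(1)] tangent_endD(1)[OF L(2)]
        commutator_def mat_vec_simps)+

definition dmat :: "('m, real^'n) chart \<Rightarrow> ('m, real^'n) chart \<Rightarrow> 'm \<Rightarrow> real^'n^'n" where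
  "dmat c d p = matrix (dtr c d p)"

lemma dmat_apply: "c \<in> A \<Longrightarrow> d \<in> A \<Longrightarrow> p \<in> cdom c \<Longrightarrow> p \<in> cdom d \<Longrightarrow> dmat c d p *v x = dtr c d p x"
  unfolding dmat_def by (rule matrix_apply[OF dtr_linear])

lemma dmat_inverse: "c \<in> A \<Longrightarrow> d \<in> A \<Longrightarrow> p \<in> cdom c \<Longrightarrow> p \<in> cdom d \<Longrightarrow> dmat c d p ** dmat d c p = mat 1"
  by (rule matrix_eqI) (simp add: mat_vec_simps dmat_apply dtr_dtr dtr_same)

lemma end_coord_change:
  assumes L: "L \<in> tangent_end A p" and c: "c \<in> A" "d \<in> A" "p \<in> cdom c" "p \<in> cdom d"
  shows "end_coord A d p L = dmat c d p ** end_coord A c p L ** dmat d c p"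
proof (rule end_coordI[OF c(2,4)])
  fix v assume v: "v \<in> tangent_space A p"
  have "L v d = dtr c d p (L v c)" by (rule tangent_transform[OF tangent_endD(1)[OF L v] c])
  also have "\<dots> = (dmat c d p ** end_coord A c p L ** dmat d c p) *v v d"
    using tangent_transform[OF v c(2,1,4,3)]
    by (simp add: mat_vec_simps dmat_apply c end_coord_apply[OF L c(1,3) v])
  finally show "L v d = (dmat c d p ** end_coord A c p L ** dmat d c p) *v v d" .
qed

text \<open>The matrices in two charts are conjugate.\<close>

lemma end_trace_chart:
  assumes L: "L \<in> tangent_end A p" and c: "c \<in> A" "p \<in> cdom c"
  shows "end_trace A p L = trace (end_coord A c p L)"
proof -
  define d where "d = chart_at A p"
  have d: "d \<in> A" "p \<in> cdom d" using chart_at[of p] c by (auto simp: d_def carrier_of_def)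
  have "end_trace A p L = trace (dmat c d p ** (end_coord A c p L ** dmat d c p))"
    unfolding end_trace_def d_def[symmetric] end_coord_change[OF L c(1) d(1) c(2) d(2)] matrix_mul_assoc ..
  also have "\<dots> = trace (end_coord A c p L ** (dmat d c p ** dmat c d p))"
    by (subst trace_mul_sym) (simp add: matrix_mul_assoc)
  finally show ?thesis by (simp add: dmat_inverse c d)
qed

subsection \<open>Charts of the bundle\<close>

lemma end_chart_dom: "(p, L) \<in> cdom (end_chart A c) \<longleftrightarrow> p \<in> cdom c \<and> L \<in> tangent_end A p"
  by (simp add: end_chart_def)

lemma end_chart_map: "cmap (end_chart A c) (p, L) = (cmap c p, end_coord A c p L)"
  by (simp add: end_chart_def)

lemma end_chart_inj: assumes c: "c \<in> A" shows "inj_on (cmap (end_chart A c)) (cdom (end_chart A c))"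
proof (rule inj_onI, clarify)
  fix p L p' L'
  assume "(p, L) \<in> cdom (end_chart A c)" "(p', L') \<in> cdom (end_chart A c)"
    and eq: "cmap (end_chart A c) (p, L) = cmap (end_chart A c) (p', L')"
  then have *: "p \<in> cdom c" "L \<in> tangent_end A p" "p' \<in> cdom c" "L' \<in> tangent_end A p'" by (auto simp: end_chart_dom)
  then have p: "p = p'" using eq inj_onD[OF chart_inj[OF c]] by (simp add: end_chart_map)
  then show "p = p' \<and> L = L'"
    using eq * tangent_end_eqI[of L p L' c] c by (simp add: end_chart_map)
qed

lemma end_chart_image:
  assumes c: "c \<in> A" "d \<in> A"
  shows "cmap (end_chart A c) ` (cdom (end_chart A c) \<inter> cdom (end_chart A d)) = (cmap c ` (cdom c \<inter> cdom d)) \<times> UNIV"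
proof (intro set_eqI iffI)
  fix y assume "y \<in> cmap (end_chart A c) ` (cdom (end_chart A c) \<inter> cdom (end_chart A d))"
  then show "y \<in> (cmap c ` (cdom c \<inter> cdom d)) \<times> UNIV" by (auto simp: end_chart_dom end_chart_map)
next
  fix y :: "(real^'n) \<times> (real^'n^'n)" assume "y \<in> (cmap c ` (cdom c \<inter> cdom d)) \<times> UNIV"
  then obtain p M where p: "p \<in> cdom c" "p \<in> cdom d" "y = (cmap c p, M)" by auto
  then have "y = cmap (end_chart A c) (p, mk_end c p M)" "(p, mk_end c p M) \<in> cdom (end_chart A c) \<inter> cdom (end_chart A d)"
    using c mk_end[OF c(1) p(1)] by (auto simp: end_chart_map end_chart_dom)
  then show "y \<in> cmap (end_chart A c) ` (cdom (end_chart A c) \<inter> cdom (end_chart A d))" by blast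
qed

lemma end_chart_inv:
  assumes c: "c \<in> A" and z: "z \<in> cmap c ` cdom c"
  shows "cinv (end_chart A c) (z, M) = (cinv c z, mk_end c (cinv c z) M)"
proof (rule inv_into_f_eq[OF end_chart_inj[OF c]])
  have p: "cinv c z \<in> cdom c" "cmap c (cinv c z) = z" using chart_image[OF c order_refl z] by auto
  show "(cinv c z, mk_end c (cinv c z) M) \<in> cdom (end_chart A c)" using mk_end[OF c p(1)] p by (simp add: end_chart_dom)
  show "cmap (end_chart A c) (cinv c z, mk_end c (cinv c z) M) = (z, M)" using mk_end[OF c p(1)] p by (simp add: end_chart_map)
qed

lemma dmat_smooth:
  assumes c: "c \<in> A" "d \<in> A"
  shows "smooth_on (cmap c ` (cdom c \<inter> cdom d)) (\<lambda>z. dmat c d (cinv c z))"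
    "smooth_on (cmap c ` (cdom c \<inter> cdom d)) (\<lambda>z. dmat d c (cinv c z))"
proof -
  let ?S = "cmap c ` (cdom c \<inter> cdom d)"
  have S: "open ?S" by (rule overlap_open[OF c])
  have in_S: "cinv c z \<in> cdom c" "cinv c z \<in> cdom d" "cmap c (cinv c z) = z" if "z \<in> ?S" for z
    using that c by auto
  show "smooth_on ?S (\<lambda>z. dmat c d (cinv c z))"
    unfolding dmat_def
  proof (rule smooth_on_matrix[OF S])
    fix u show "smooth_on ?S (\<lambda>z. dtr c d (cinv c z) u)"
      by (rule smooth_on_cong[OF S _ smooth_on_frechet[OF transition_smooth[OF c]]]) (simp add: dtr_def in_S)
  qed
  show "smooth_on ?S (\<lambda>z. dmat d c (cinv c z))"
    unfolding dmat_def
  proof (rule smooth_on_matrix[OF S])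
    fix u
    have "smooth_on ?S (\<lambda>z. coord_field A d u (cinv c z) c)"
      using smooth_fieldD(2)[OF coord_field_smooth[OF c(2)] c(1)] by (simp add: Int_commute)
    then show "smooth_on ?S (\<lambda>z. dtr d c (cinv c z) u)"
      by (rule smooth_on_cong[OF S, rotated]) (simp add: coord_field_apply c in_S)
  qed
qed

lemma end_transition:
  assumes c: "c \<in> A" "d \<in> A" and z: "z \<in> cmap c ` (cdom c \<inter> cdom d)"
  shows "(cmap (end_chart A d) \<circ> cinv (end_chart A c)) (z, M)
    = ((cmap d \<circ> cinv c) z, dmat c d (cinv c z) ** M ** dmat d c (cinv c z))"
proof -
  have p: "cinv c z \<in> cdom c" "cinv c z \<in> cdom d" using z c by auto
  have "z \<in> cmap c ` cdom c" using z by auto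
  then show ?thesis
    using end_coord_change[OF mk_end(1)[OF c(1) p(1)] c p] mk_end(2)[OF c(1) p(1)]
    by (simp add: end_chart_inv[OF c(1)] end_chart_map)
qed

end

sublocale vec_atlas \<subseteq> eb: atlas "end_bundle A"
proof
  fix C assume "C \<in> end_bundle A"
  then show "inj_on (cmap C) (cdom C)" by (auto simp: end_bundle_def end_chart_inj)
  fix D assume "D \<in> end_bundle A"
  with \<open>C \<in> end_bundle A\<close> obtain c d where c: "c \<in> A" "d \<in> A" and C: "C = end_chart A c" "D = end_chart A d"
    by (auto simp: end_bundle_def)
  let ?S = "cmap c ` (cdom c \<inter> cdom d)"
  have S: "open (?S \<times> (UNIV :: (real^'n^'n) set))" by (intro open_Times overlap_open c open_UNIV)
  show "open (cmap C ` (cdom C \<inter> cdom D))" unfolding C end_chart_image[OF c] by (rule S)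
  have fst: "smooth_on (?S \<times> (UNIV :: (real^'n^'n) set)) fst"
    and snd: "smooth_on (?S \<times> (UNIV :: (real^'n^'n) set)) snd"
    by (intro smooth_on_linear[OF S] linear_fst linear_snd)+
  have "smooth_on (?S \<times> (UNIV :: (real^'n^'n) set))
     (\<lambda>y. ((cmap d \<circ> cinv c) (fst y), dmat c d (cinv c (fst y)) ** snd y ** dmat d c (cinv c (fst y))))"
    by (intro smooth_on_Pair smooth_on_matrix_mult S snd
        smooth_on_compose[OF S transition_smooth[OF c] fst] smooth_on_compose[OF S dmat_smooth(1)[OF c] fst]
        smooth_on_compose[OF S dmat_smooth(2)[OF c] fst]) auto
  then show "smooth_on (cmap C ` (cdom C \<inter> cdom D)) (cmap D \<circ> cinv C)"
    unfolding C end_chart_image[OF c]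
    by (rule smooth_on_cong[OF S, rotated]) (use end_transition[OF c] in auto)
qed

context vec_atlas
begin

lemma end_chart_in: "c \<in> A \<Longrightarrow> end_chart A c \<in> end_bundle A"
  by (simp add: end_bundle_def)

lemma fst_end_transition:
  assumes c: "c \<in> A" "d \<in> A" "p \<in> cdom c" "p \<in> cdom d" and L: "L \<in> tangent_end A p"
  shows "fst (eb.dtr (end_chart A c) (end_chart A d) (p, L) x) = dtr c d p (fst x)"
proof -
  let ?C = "end_chart A c" and ?D = "end_chart A d"
  have q: "(p, L) \<in> cdom ?C" "(p, L) \<in> cdom ?D" using c L by (simp_all add: end_chart_dom)
  have 1: "((\<lambda>y. fst ((cmap ?D \<circ> cinv ?C) y)) has_derivative (\<lambda>x. fst (eb.dtr ?C ?D (p, L) x))) (at (cmap ?C (p, L)))"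
    by (rule bounded_linear.has_derivative[OF bounded_linear_fst
          eb.dtr_has_derivative[OF end_chart_in[OF c(1)] end_chart_in[OF c(2)] q]])
  have "((\<lambda>y. (cmap d \<circ> cinv c) (fst y)) has_derivative (\<lambda>x. dtr c d p (fst x))) (at (cmap ?C (p, L)))"
  proof -
    have "(cmap d \<circ> cinv c has_derivative dtr c d p) (at (fst (cmap ?C (p, L))))"
      using dtr_has_derivative[OF c] by (simp add: end_chart_map)
    from diff_chain_at[OF bounded_linear_imp_has_derivative[OF bounded_linear_fst] this]
    show ?thesis by (simp add: o_def)
  qed
  then have 2: "((\<lambda>y. fst ((cmap ?D \<circ> cinv ?C) y)) has_derivative (\<lambda>x. dtr c d p (fst x))) (at (cmap ?C (p, L)))"
  proof (rule has_derivative_transform_within_open)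
    show "open (cmap ?C ` (cdom ?C \<inter> cdom ?D))" by (rule eb.overlap_open) (simp_all add: end_chart_in c)
    show "cmap ?C (p, L) \<in> cmap ?C ` (cdom ?C \<inter> cdom ?D)" using q by blast
    show "(cmap d \<circ> cinv c) (fst y) = fst ((cmap ?D \<circ> cinv ?C) y)" if "y \<in> cmap ?C ` (cdom ?C \<inter> cdom ?D)" for y
      using that end_transition[OF c(1,2)] unfolding end_chart_image[OF c(1,2)] by auto
  qed
  show ?thesis using fun_cong[OF has_derivative_unique[OF 1 2]] .
qed

text \<open>The first component of a coordinate change of the bundle is the coordinate change of the base.\<close>

lemma end_proj_chart:
  assumes c: "c \<in> A" "p \<in> cdom c" and L: "L \<in> tangent_end A p" and X: "X \<in> tangent_space (end_bundle A) (p, L)"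
  shows "end_proj A (p, L) X = coord_field A c (fst (X (end_chart A c))) p"
proof -
  define C where "C = chart_at (end_bundle A) (p, L)"
  have q: "(p, L) \<in> cdom (end_chart A c)" using c L by (simp add: end_chart_dom)
  have "(p, L) \<in> carrier_of (end_bundle A)" using q end_chart_in[OF c(1)] by (auto simp: carrier_of_def)
  from eb.chart_at[OF this] obtain d where d: "d \<in> A" "C = end_chart A d" and qC: "(p, L) \<in> cdom C"
    by (auto simp: C_def end_bundle_def)
  have pd: "p \<in> cdom d" using qC d by (simp add: end_chart_dom)
  have "end_proj A (p, L) X = coord_field A d (fst (X C)) p"
  proof
    fix e
    show "end_proj A (p, L) X e = coord_field A d (fst (X C)) p e"
    proof (cases "e \<in> A \<and> p \<in> cdom e")
      case True
      have "((cmap e \<circ> cinv d) \<circ> fst has_derivative dtr d e p \<circ> fst) (at (cmap C (p, L)))"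
      proof (rule diff_chain_at[OF bounded_linear_imp_has_derivative[OF bounded_linear_fst]])
        show "(cmap e \<circ> cinv d has_derivative dtr d e p) (at (fst (cmap C (p, L))))"
          using dtr_has_derivative[OF d(1) _ pd, of e] True by (simp add: d(2) end_chart_map)
      qed
      then have "(cmap e \<circ> fst \<circ> cinv C has_derivative dtr d e p \<circ> fst) (at (cmap C (p, L)))"
      proof (rule has_derivative_transform_within_open)
        show "open (cmap C ` cdom C)" unfolding d(2) by (rule eb.chart_dom_open[OF end_chart_in[OF d(1)]])
        show "cmap C (p, L) \<in> cmap C ` cdom C" using qC by blast
        show "((cmap e \<circ> cinv d) \<circ> fst) y = (cmap e \<circ> fst \<circ> cinv C) y" if "y \<in> cmap C ` cdom C" for y
        proof -
          have "cmap C ` cdom C = (cmap d ` cdom d) \<times> UNIV" using end_chart_image[OF d(1) d(1)] by (simp add: d(2))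
          then show ?thesis using that end_chart_inv[OF d(1)] by (auto simp: d(2))
        qed
      qed
      then show ?thesis
        using True by (simp add: end_proj_def pushforward_def Let_def C_def[symmetric] frechet_derivative_eqI coord_field_apply)
    next
      case False
      then show ?thesis by (auto simp: end_proj_def pushforward_def coord_field_def)
    qed
  qed
  also have "fst (X C) = dtr c d p (fst (X (end_chart A c)))"
    using eb.tangent_transform[OF X end_chart_in[OF c(1)] end_chart_in[OF d(1)] q] qC
      fst_end_transition[OF c(1) d(1) c(2) pd L] by (simp add: d(2))
  also have "coord_field A d (dtr c d p (fst (X (end_chart A c)))) p = coord_field A c (fst (X (end_chart A c))) p"
    by (rule tangent_eqI[of _ p _ d]) (use c d pd in \<open>simp_all add: coord_field_apply\<close>)
  finally show ?thesis .
qed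

lemma end_proj_tangent:
  assumes "c \<in> A" "p \<in> cdom c" "L \<in> tangent_end A p" "X \<in> tangent_space (end_bundle A) (p, L)"
  shows "end_proj A (p, L) X \<in> tangent_space A p" "end_proj A (p, L) X c = fst (X (end_chart A c))"
  using assms by (simp_all add: end_proj_chart)

lemma end_curve:
  assumes c: "c \<in> A" and e: "e > 0" and z: "\<gamma> ` {-e<..<e} \<subseteq> cmap c ` cdom c"
    and sm: "smooth_on {-e<..<e} \<gamma>" "smooth_on {-e<..<e} L"
  defines "\<Gamma> \<equiv> \<lambda>t. cinv (end_chart A c) (\<gamma> t, L t)"
  shows "smooth_curve (end_bundle A) e \<Gamma>"
    "t \<in> {-e<..<e} \<Longrightarrow> \<Gamma> t = (cinv c (\<gamma> t), mk_end c (cinv c (\<gamma> t)) (L t))"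
    "t \<in> {-e<..<e} \<Longrightarrow> \<Gamma> t \<in> cdom (end_chart A c)"
    "t \<in> {-e<..<e} \<Longrightarrow> cmap (end_chart A c) (\<Gamma> t) = (\<gamma> t, L t)"
proof -
  have z: "\<gamma> t \<in> cmap c ` cdom c" if "t \<in> {-e<..<e}" for t using z that by blast
  have im: "cmap (end_chart A c) ` cdom (end_chart A c) = (cmap c ` cdom c) \<times> UNIV"
    using end_chart_image[OF c c] by simp
  show 1: "\<Gamma> t = (cinv c (\<gamma> t), mk_end c (cinv c (\<gamma> t)) (L t))" if "t \<in> {-e<..<e}" for t
    unfolding \<Gamma>_def by (rule end_chart_inv[OF c z[OF that]])
  have in_im: "(\<gamma> t, L t) \<in> cmap (end_chart A c) ` cdom (end_chart A c)" if "t \<in> {-e<..<e}" for t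
    unfolding im using z[OF that] by simp
  show 2: "\<Gamma> t \<in> cdom (end_chart A c)" "cmap (end_chart A c) (\<Gamma> t) = (\<gamma> t, L t)" if "t \<in> {-e<..<e}" for t
    unfolding \<Gamma>_def using eb.chart_image[OF end_chart_in[OF c] order_refl in_im[OF that]] by auto
  show "smooth_curve (end_bundle A) e \<Gamma>"
  proof (rule eb.smooth_curveI[OF end_chart_in[OF c] e 2(1)])
    show "smooth_on {-e<..<e} (\<lambda>t. cmap (end_chart A c) (\<Gamma> t))"
      by (rule smooth_on_cong[OF _ _ smooth_on_Pair[OF _ sm]]) (simp_all add: 2(2))
  qed
qed

lemma end_bundle_carrier:
  "q \<in> carrier_of (end_bundle A) \<Longrightarrow> fst q \<in> carrier_of A \<and> snd q \<in> tangent_end A (fst q)"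
  by (cases q) (auto simp: carrier_of_def end_bundle_def end_chart_dom)

lemma curve_end: "smooth_curve (end_bundle A) e \<Gamma> \<Longrightarrow> t \<in> {-e<..<e} \<Longrightarrow> snd (\<Gamma> t) \<in> tangent_end A (fst (\<Gamma> t))"
  by (simp add: smooth_curve_def end_bundle_carrier)

lemma curve_fst:
  assumes \<Gamma>: "smooth_curve (end_bundle A) e \<Gamma>"
  shows "smooth_curve A e (\<lambda>t. fst (\<Gamma> t))"
  unfolding smooth_curve_def
proof (intro conjI ballI)
  show "e > 0" using \<Gamma> by (simp add: smooth_curve_def)
  show "fst (\<Gamma> t) \<in> carrier_of A" if "t \<in> {-e<..<e}" for t
    using \<Gamma> that by (simp add: smooth_curve_def end_bundle_carrier)
  fix d assume d: "d \<in> A"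
  have T: "{t \<in> {-e<..<e}. fst (\<Gamma> t) \<in> cdom d} = {t \<in> {-e<..<e}. \<Gamma> t \<in> cdom (end_chart A d)}"
    using curve_end[OF \<Gamma>] by (auto simp: end_chart_def case_prod_beta)
  have *: "open {t \<in> {-e<..<e}. \<Gamma> t \<in> cdom (end_chart A d)}"
    "smooth_on {t \<in> {-e<..<e}. \<Gamma> t \<in> cdom (end_chart A d)} (cmap (end_chart A d) \<circ> \<Gamma>)"
    using \<Gamma> end_chart_in[OF d] by (simp_all add: smooth_curve_def)
  show "open {t \<in> {-e<..<e}. fst (\<Gamma> t) \<in> cdom d}" unfolding T by (rule *)
  have "(\<lambda>t. fst ((cmap (end_chart A d) \<circ> \<Gamma>) t)) = cmap d \<circ> (\<lambda>t. fst (\<Gamma> t))"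
    by (simp add: fun_eq_iff end_chart_def case_prod_beta)
  with smooth_on_bounded_linear[OF *(1) bounded_linear_fst *(2)]
  show "smooth_on {t \<in> {-e<..<e}. fst (\<Gamma> t) \<in> cdom d} (cmap d \<circ> (\<lambda>t. fst (\<Gamma> t)))"
    unfolding T by simp
qed

lemma fibre_vec_chart:
  assumes c: "c \<in> A" "p \<in> cdom c" and L: "L \<in> tangent_end A p" and B: "B \<in> tangent_end A p"
  shows "fibre_vec A (p, L) B \<in> tangent_space (end_bundle A) (p, L)"
    "fibre_vec A (p, L) B (end_chart A c) = (0, end_coord A c p B)"
proof -
  let ?C = "end_chart A c" and ?\<Gamma> = "\<lambda>t. (p, \<lambda>v. L v + tscale t (B v))"
  have 0: "?\<Gamma> 0 = (p, L)" by (simp add: fun_eq_iff)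
  have in_C: "?\<Gamma> t \<in> cdom ?C" for t using tangent_end_ops(1)[OF L B] c by (simp add: end_chart_dom)
  have val: "cmap ?C (?\<Gamma> t) = (cmap c p, end_coord A c p L + t *\<^sub>R end_coord A c p B)" for t
    by (simp add: end_chart_map end_coord_ops[OF L B c])
  have "smooth_curve (end_bundle A) 1 ?\<Gamma>"
  proof (rule eb.smooth_curveI[OF end_chart_in[OF c(1)] zero_less_one in_C])
    show "smooth_on {-1<..<1} (\<lambda>t. cmap ?C (?\<Gamma> t))"
      unfolding val by (intro smooth_on_Pair smooth_on_add smooth_on_const smooth_on_scaleR smooth_on_id) auto
  qed
  from eb.velocity_tangent[OF this, of 0] show "fibre_vec A (p, L) B \<in> tangent_space (end_bundle A) (p, L)"
    unfolding 0 by (simp add: fibre_vec_def)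
  have "((\<lambda>t. cmap ?C (?\<Gamma> t)) has_vector_derivative (0, end_coord A c p B)) (at 0)"
    unfolding val by (auto intro!: derivative_eq_intros has_vector_derivative_Pair)
  from eb.velocity_apply[OF end_chart_in[OF c(1)] in_C this]
  show "fibre_vec A (p, L) B ?C = (0, end_coord A c p B)" by (simp add: fibre_vec_def)
qed

end

sublocale hkt \<subseteq> vec_atlas A by unfold_locales

section \<open>The twistor space in a chart\<close>

context hkt_chart
begin

abbreviation CC :: "(('m, 'n) endpt, (real^'n) \<times> (real^'n^'n)) chart" where "CC \<equiv> end_chart A c"

lemma CC: "CC \<in> end_bundle A"
  by (rule end_chart_in[OF c])

text \<open>The covariant derivative along a curve is defined chart by chart. If \<open>E\<close> denotes the field that has
  constant components in \<open>c\<close> and agrees with \<open>V\<close> at time \<open>t\<close>, it equals the vector with \<open>c\<close>-components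
  \<open>V'\<close> plus the derivative of \<open>E\<close> along the velocity, and this description is independent of the chart.\<close>

lemma cov_deriv_along_chart:
  assumes \<gamma>: "smooth_curve A e \<gamma>" "t \<in> {-e<..<e}" and p: "\<gamma> t \<in> cdom c"
    and V: "\<forall>s\<in>{-e<..<e}. V s \<in> tangent_space A (\<gamma> s)"
    and dV: "((\<lambda>s. V s c) has_vector_derivative y) (at t)"
  shows "cov_deriv_along A nablaM \<gamma> V t \<in> tangent_space A (\<gamma> t)"
    and "cov_deriv_along A nablaM \<gamma> V t c = y + \<Gamma>m (cmap c (\<gamma> t)) (velocity A \<gamma> t c) (V t c)"
proof -
  define p where "p = \<gamma> t"
  define z where "z = cmap c p"
  define vel where "vel = velocity A \<gamma> t"
  define w where "w = V t c"
  define E where "E = coord_field A c w"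
  have pc: "p \<in> cdom c" using p by (simp add: p_def)
  have z: "z \<in> Om" "cinv c z = p" using pc c by (simp_all add: z_def Om)
  have vel: "vel \<in> tangent_space A p" unfolding vel_def p_def by (rule velocity_tangent[OF \<gamma>])
  have Vt: "V t \<in> tangent_space A p" unfolding p_def using V \<gamma>(2) by blast
  have Ep: "E p = V t" using Vt c pc by (simp add: E_def w_def)
  note cU = openin_cdom[OF c] and cE = coord_field_smooth[OF c, of w, folded E_def]
  define R where "R = coord_field A c y p + nablaM p vel E"
  have DE: "nablaM p vel E \<in> tangent_space A p"
    using torsion_conn_local(1)[OF z(1) cU _ cE, of vel] z pc vel by simp
  have R: "R \<in> tangent_space A p" unfolding R_def using DE c pc by simp
  have Rc: "R c = y + \<Gamma>m z (vel c) w"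
    using torsion_conn_local(2)[OF z(1) cU _ cE, of vel "- 1/2"] z pc vel c frechet_const_on_Om[OF z(1), of w]
    by (simp add: R_def E_def)
  have "cov_deriv_along A nablaM \<gamma> V t = R"
  proof
    fix d
    show "cov_deriv_along A nablaM \<gamma> V t d = R d"
    proof (cases "d \<in> A \<and> p \<in> cdom d")
      case False
      then have "\<not> (d \<in> A \<and> \<gamma> t \<in> cdom d)" by (simp add: p_def)
      then show ?thesis unfolding tangent_outside[OF R False] by (simp only: cov_deriv_along_def if_False)
    next
      case True
      then have d: "d \<in> A" "p \<in> cdom d" by auto
      interpret d: hkt_chart A g I H nablaL d by unfold_locales (rule d)
      define zd where "zd = cmap d p"
      have zd: "zd \<in> d.Om" "cinv d zd = p" using d by (simp_all add: zd_def d.Om)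
      define T where "T = {s \<in> {-e<..<e}. \<gamma> s \<in> cdom c} \<inter> {s \<in> {-e<..<e}. \<gamma> s \<in> cdom d}"
      have T: "open T" "t \<in> T"
        using \<gamma> c d pc by (auto simp: T_def smooth_curve_def p_def)
      have in_T: "s \<in> {-e<..<e}" "\<gamma> s \<in> cdom c" "\<gamma> s \<in> cdom d" if "s \<in> T" for s using that by (auto simp: T_def)
      have sm: "smooth_on (cmap d ` (cdom c \<inter> cdom d)) (\<lambda>x. coord_field A c u (cinv d x) d)" for u
        by (rule smooth_fieldD(2)[OF coord_field_smooth[OF c] d(1)])
      have dE: "((\<lambda>s. coord_field A c u (\<gamma> s) d) has_derivative
          (\<lambda>h. frechet_derivative (\<lambda>x. coord_field A c u (cinv d x) d) (at zd) (h *\<^sub>R vel d))) (at t)" for u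
      proof -
        have 1: "((\<lambda>s. cmap d (\<gamma> s)) has_derivative (\<lambda>h. h *\<^sub>R vel d)) (at t)"
          using smooth_curve_derivative[OF \<gamma> d(1)] d(2) by (simp add: p_def vel_def has_vector_derivative_def)
        have 2: "((\<lambda>x. coord_field A c u (cinv d x) d) has_derivative
            frechet_derivative (\<lambda>x. coord_field A c u (cinv d x) d) (at zd)) (at (cmap d (\<gamma> t)))"
          using smooth_on_has_derivative[OF sm, of zd] pc d by (simp add: zd_def p_def)
        have "((\<lambda>s. coord_field A c u (cinv d (cmap d (\<gamma> s))) d) has_derivative
          (\<lambda>h. frechet_derivative (\<lambda>x. coord_field A c u (cinv d x) d) (at zd) (h *\<^sub>R vel d))) (at t)"
          using diff_chain_at[OF 1 2] by (simp add: o_def)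
        then show ?thesis
          by (rule has_derivative_transform_within_open[OF _ T]) (use in_T d in simp)
      qed
      have lin: "linear (\<lambda>u. coord_field A c u (\<gamma> s) d)" if "s \<in> T" for s
        using dtr_linear[OF c d(1) in_T(2,3)[OF that]] d in_T(3)[OF that] by (simp add: coord_field_apply)
      have "((\<lambda>s. coord_field A c (V s c) (\<gamma> s) d) has_derivative
          (\<lambda>h. frechet_derivative (\<lambda>x. coord_field A c (V t c) (cinv d x) d) (at zd) (h *\<^sub>R vel d)
            + coord_field A c (h *\<^sub>R y) (\<gamma> t) d)) (at t)"
        by (rule has_derivative_linear_apply[where f = "\<lambda>s u. coord_field A c u (\<gamma> s) d" and Y = "\<lambda>s. V s c",
              OF T lin dE dV[unfolded has_vector_derivative_def]])
      then have "((\<lambda>s. V s d) has_derivative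
          (\<lambda>h. frechet_derivative (\<lambda>x. E (cinv d x) d) (at zd) (h *\<^sub>R vel d)
            + coord_field A c (h *\<^sub>R y) p d)) (at t)"
        unfolding E_def w_def p_def
        by (rule has_derivative_transform_within_open[OF _ T]) (use in_T c V in simp)
      moreover have "linear (frechet_derivative (\<lambda>x. E (cinv d x) d) (at zd))"
        unfolding E_def by (rule smooth_on_linear_frechet[OF sm]) (use pc d in \<open>auto simp: zd_def\<close>)
      moreover have "coord_field A c (h *\<^sub>R y) p d = h *\<^sub>R coord_field A c y p d" for h
        using linear_scale[OF lin[OF T(2)]] by (simp add: p_def)
      ultimately have "((\<lambda>s. V s d) has_vector_derivative
          frechet_derivative (\<lambda>x. E (cinv d x) d) (at zd) (vel d) + coord_field A c y p d) (at t)"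
        unfolding has_vector_derivative_def by (simp add: linear_scale scaleR_right_distrib)
      then have vd: "vector_derivative (\<lambda>s. V s d) (at t)
          = frechet_derivative (\<lambda>x. E (cinv d x) d) (at zd) (vel d) + coord_field A c y p d"
        by (rule vector_derivative_at)
      have 1: "nablaM p vel E d = frechet_derivative (\<lambda>x. E (cinv d x) d) (at zd) (vel d) + d.\<Gamma>s (- 1/2) zd (vel d) (V t d)"
        using d.torsion_conn_local(2)[OF zd(1) cU _ cE, of vel "- 1/2"] zd pc vel Ep by simp
      have 2: "nablaM p vel (coord_field A d (V t d)) d = d.\<Gamma>s (- 1/2) zd (vel d) (V t d)"
        using d.torsion_conn_local(2)[OF zd(1) openin_cdom[OF d(1)] _ coord_field_smooth[OF d(1)], of vel "- 1/2" "V t d"]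
          zd d vel d.frechet_const_on_Om[OF zd(1), of "V t d"] by simp
      have "cov_deriv_along A nablaM \<gamma> V t d = vector_derivative (\<lambda>s. V s d) (at t) + nablaM p vel (coord_field A d (V t d)) d"
        using True by (simp add: cov_deriv_along_def p_def vel_def)
      also have "\<dots> = R d" unfolding vd 2 R_def tvec_apply 1 by simp
      finally show ?thesis .
    qed
  qed
  then show "cov_deriv_along A nablaM \<gamma> V t \<in> tangent_space A (\<gamma> t)"
    "cov_deriv_along A nablaM \<gamma> V t c = y + \<Gamma>m (cmap c (\<gamma> t)) (velocity A \<gamma> t c) (V t c)"
    using R Rc by (simp_all add: p_def z_def vel_def w_def)
qed

lemma CC_curve_components:
  assumes \<Gamma>: "smooth_curve (end_bundle A) e \<Gamma>" "t \<in> {-e<..<e}" and q: "fst (\<Gamma> t) \<in> cdom c"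
  shows "((\<lambda>s. cmap c (fst (\<Gamma> s))) has_vector_derivative fst (velocity (end_bundle A) \<Gamma> t CC)) (at t)"
    "((\<lambda>s. end_coord A c (fst (\<Gamma> s)) (snd (\<Gamma> s))) has_vector_derivative snd (velocity (end_bundle A) \<Gamma> t CC)) (at t)"
proof -
  have "\<Gamma> t \<in> carrier_of (end_bundle A)" using \<Gamma> by (simp add: smooth_curve_def)
  then have "snd (\<Gamma> t) \<in> tangent_end A (fst (\<Gamma> t))"
    by (simp add: end_bundle_carrier)
  then have "\<Gamma> t \<in> cdom CC" using q by (cases "\<Gamma> t") (simp add: end_chart_dom)
  from eb.smooth_curve_derivative[OF \<Gamma> CC this]
  have "((\<lambda>s. (cmap c (fst (\<Gamma> s)), end_coord A c (fst (\<Gamma> s)) (snd (\<Gamma> s)))) has_vector_derivative velocity (end_bundle A) \<Gamma> t CC) (at t)"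
    by (simp add: end_chart_def case_prod_beta)
  from bounded_linear.has_vector_derivative[OF bounded_linear_fst this] bounded_linear.has_vector_derivative[OF bounded_linear_snd this]
  show "((\<lambda>s. cmap c (fst (\<Gamma> s))) has_vector_derivative fst (velocity (end_bundle A) \<Gamma> t CC)) (at t)"
    "((\<lambda>s. end_coord A c (fst (\<Gamma> s)) (snd (\<Gamma> s))) has_vector_derivative snd (velocity (end_bundle A) \<Gamma> t CC)) (at t)"
    by simp_all
qed

subsection \<open>Horizontal vectors\<close>

text \<open>Parallelism is tested on fields along the curve with constant components in \<open>c\<close>.\<close>

lemma horizontal_component:
  assumes L: "L \<in> tangent_end A p" and p: "p \<in> cdom c" and X: "X \<in> horizontal_space A nablaM (p, L)"
  shows "X \<in> tangent_space (end_bundle A) (p, L)"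
    "snd (X CC) = hor (cmap c p) (fst (X CC)) (end_coord A c p L)"
proof -
  obtain \<Gamma> e where \<Gamma>: "smooth_curve (end_bundle A) e \<Gamma>" and X: "X = velocity (end_bundle A) \<Gamma> 0" and \<Gamma>0: "\<Gamma> 0 = (p, L)"
    and par: "parallel_along A nablaM e (\<lambda>t. fst (\<Gamma> t)) (\<lambda>t. snd (\<Gamma> t))"
    using X unfolding horizontal_space_def by blast
  have e: "0 \<in> {-e<..<e}" using \<Gamma> by (simp add: smooth_curve_def)
  show "X \<in> tangent_space (end_bundle A) (p, L)"
    using eb.velocity_tangent[OF \<Gamma> e] by (simp add: X \<Gamma>0)
  define \<gamma> where "\<gamma> t = fst (\<Gamma> t)" for t
  define z where "z = cmap c p"
  define M where "M = end_coord A c p L"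
  have z: "z \<in> Om" using p by (simp add: z_def Om)
  have \<gamma>: "smooth_curve A e \<gamma>" unfolding \<gamma>_def by (rule curve_fst[OF \<Gamma>])
  have \<gamma>e: "\<gamma> = (\<lambda>t. fst (\<Gamma> t))" by (rule ext) (rule \<gamma>_def)
  have \<gamma>0: "\<gamma> 0 = p" by (simp add: \<gamma>_def \<Gamma>0)
  note comp = CC_curve_components[OF \<Gamma> e, folded X, unfolded \<Gamma>0 fst_conv, OF p]
  have vel: "velocity A \<gamma> 0 c = fst (X CC)"
    by (rule velocity_apply[where \<gamma> = \<gamma>, OF c]) (use p comp(1) in \<open>simp_all add: \<gamma>0, simp add: \<gamma>_def\<close>)
  define T where "T = {t \<in> {-e<..<e}. \<gamma> t \<in> cdom c}"
  have T: "open T" "0 \<in> T" using \<gamma> c e p by (auto simp: T_def smooth_curve_def \<gamma>0)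
  have "snd (X CC) *v w = hor z (fst (X CC)) M *v w" for w
  proof -
    \<comment> \<open>Outside the chart the test field is continued by 0, so that it is tangent along the whole curve.\<close>
    define V where "V s = (if \<gamma> s \<in> cdom c then coord_field A c w (\<gamma> s) else 0)" for s
    have V: "V s \<in> tangent_space A (\<gamma> s)" for s using c by (simp add: V_def)
    have Vb: "\<forall>s\<in>{-e<..<e}. V s \<in> tangent_space A (\<gamma> s)" using V by blast
    have LV: "\<forall>s\<in>{-e<..<e}. snd (\<Gamma> s) (V s) \<in> tangent_space A (\<gamma> s)"
      using tangent_endD(1)[OF curve_end[OF \<Gamma>]] V by (simp add: \<gamma>_def)
    have V0: "V 0 c = w" using p c by (simp add: V_def \<gamma>0)
    have dV: "((\<lambda>s. V s c) has_vector_derivative 0) (at 0)"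
      by (rule has_vector_derivative_transform_within_open[OF has_vector_derivative_const[of w] T])
        (use c in \<open>simp add: T_def V_def\<close>)
    have dLV: "((\<lambda>s. snd (\<Gamma> s) (V s) c) has_vector_derivative snd (X CC) *v w) (at 0)"
    proof (rule has_vector_derivative_transform_within_open[OF _ T])
      show "((\<lambda>s. end_coord A c (\<gamma> s) (snd (\<Gamma> s)) *v w) has_vector_derivative snd (X CC) *v w) (at 0)"
        unfolding \<gamma>_def by (rule bounded_linear.has_vector_derivative[OF mv.bounded_linear_left comp(2)])
      show "end_coord A c (\<gamma> s) (snd (\<Gamma> s)) *v w = snd (\<Gamma> s) (V s) c" if "s \<in> T" for s
        using end_coord_apply[OF curve_end[OF \<Gamma>, of s] c, of "V s"] V[of s] that c by (simp add: T_def V_def \<gamma>_def)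
    qed
    have diff: "(\<lambda>s. V s d) differentiable (at 0)" if "d \<in> A" "\<gamma> 0 \<in> cdom d" for d
    proof -
      define T' where "T' = T \<inter> {t \<in> {-e<..<e}. \<gamma> t \<in> cdom d}"
      have T': "open T'" "0 \<in> T'" using T \<gamma> that e by (auto simp: T'_def smooth_curve_def)
      have "smooth_on (cmap d ` (cdom c \<inter> cdom d)) (\<lambda>x. coord_field A c w (cinv d x) d)"
        by (rule smooth_fieldD(2)[OF coord_field_smooth[OF c] that(1)])
      from smooth_on_has_derivative[OF this, of "cmap d (\<gamma> 0)"]
      have 1: "((\<lambda>x. coord_field A c w (cinv d x) d) has_derivative
          frechet_derivative (\<lambda>x. coord_field A c w (cinv d x) d) (at (cmap d (\<gamma> 0)))) (at (cmap d (\<gamma> 0)))"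
        using that p \<gamma>0 by auto
      have "((\<lambda>x. coord_field A c w (cinv d x) d) \<circ> (\<lambda>s. cmap d (\<gamma> s)) has_derivative
          frechet_derivative (\<lambda>x. coord_field A c w (cinv d x) d) (at (cmap d (\<gamma> 0))) \<circ> (\<lambda>h. h *\<^sub>R velocity A \<gamma> 0 d)) (at 0)"
        by (rule diff_chain_at[OF smooth_curve_derivative[OF \<gamma> e that, unfolded has_vector_derivative_def] 1])
      then have "((\<lambda>s. V s d) has_derivative
          frechet_derivative (\<lambda>x. coord_field A c w (cinv d x) d) (at (cmap d (\<gamma> 0))) \<circ> (\<lambda>h. h *\<^sub>R velocity A \<gamma> 0 d)) (at 0)"
        by (rule has_derivative_transform_within_open[OF _ T']) (use that in \<open>auto simp: T'_def T_def V_def\<close>)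
      then show ?thesis by (rule differentiableI)
    qed
    have eq: "cov_deriv_along A nablaM \<gamma> (\<lambda>s. snd (\<Gamma> s) (V s)) 0 = L (cov_deriv_along A nablaM \<gamma> V 0)"
      using par[folded \<gamma>e, unfolded parallel_along_def, rule_format, OF e, of V] V diff by (simp add: \<Gamma>0)
    have 1: "cov_deriv_along A nablaM \<gamma> V 0 \<in> tangent_space A p"
      "cov_deriv_along A nablaM \<gamma> V 0 c = 0 + \<Gamma>m z (fst (X CC)) w"
      using cov_deriv_along_chart[OF \<gamma> e _ Vb dV] p by (simp_all add: \<gamma>0 vel V0 z_def)
    have 2: "cov_deriv_along A nablaM \<gamma> (\<lambda>s. snd (\<Gamma> s) (V s)) 0 c = snd (X CC) *v w + \<Gamma>m z (fst (X CC)) (M *v w)"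
      using cov_deriv_along_chart(2)[where V = "\<lambda>s. snd (\<Gamma> s) (V s)", OF \<gamma> e _ LV dLV] p
        end_coord_apply[OF L c p, of "V 0"] V[of 0] by (simp add: \<gamma>0 vel V0 z_def \<Gamma>0 M_def)
    have "snd (X CC) *v w + \<Gamma>m z (fst (X CC)) (M *v w) = M *v (\<Gamma>m z (fst (X CC)) w)"
      using fun_cong[OF eq, of c] end_coord_apply[OF L c p 1(1)] 1(2) 2 by (simp add: M_def)
    then show ?thesis by (simp add: hor_def mat_vec_simps gam_apply[OF z] eq_diff_eq)
  qed
  then show "snd (X CC) = hor (cmap c p) (fst (X CC)) (end_coord A c p L)"
    unfolding z_def M_def by (rule matrix_eqI)
qed

text \<open>Conversely, parallel translation along a coordinate line is conjugation by a parallel frame.\<close>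

lemma horizontalI:
  assumes L: "L \<in> tangent_end A p" and p: "p \<in> cdom c" and X: "X \<in> tangent_space (end_bundle A) (p, L)"
    and h: "snd (X CC) = hor (cmap c p) (fst (X CC)) (end_coord A c p L)"
  shows "X \<in> horizontal_space A nablaM (p, L)"
proof -
  define z where "z = cmap c p"
  define M where "M = end_coord A c p L"
  define v where "v = fst (X CC)"
  have z: "z \<in> Om" "cinv c z = p" using p c by (simp_all add: z_def Om)
  obtain e E Z where e: "0 < e" and E0: "E 0 = mat 1" "Z 0 = mat 1"
    and sm: "smooth_on {-e<..<e} E" "smooth_on {-e<..<e} Z"
    and E: "\<And>t. t \<in> {-e<..<e} \<Longrightarrow> z + t *\<^sub>R v \<in> Om \<and>
       (E has_vector_derivative - (gam (z + t *\<^sub>R v) v ** E t)) (at t) \<and>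
       (Z has_vector_derivative Z t ** gam (z + t *\<^sub>R v) v) (at t)"
    using parallel_frame[OF z(1), of v] by blast
  have e0: "0 \<in> {-e<..<e}" using e by simp
  define Lt where "Lt t = E t ** M ** Z t" for t
  define \<Gamma> where "\<Gamma> t = cinv CC (z + t *\<^sub>R v, Lt t)" for t
  have smL: "smooth_on {-e<..<e} Lt" unfolding Lt_def
    by (intro smooth_on_matrix_mult sm smooth_on_const) auto
  have dom: "(\<lambda>t. z + t *\<^sub>R v) ` {-e<..<e} \<subseteq> cmap c ` cdom c" using E by (auto simp: Om_def)
  have line: "smooth_on {-e<..<e} (\<lambda>t. z + t *\<^sub>R v)" by (rule smooth_on_line) simp
  note \<Gamma> = end_curve[OF c e dom line smL, folded \<Gamma>_def]
  have \<Gamma>0: "\<Gamma> 0 = (p, L)"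
    using \<Gamma>(2)[OF e0] mk_end_coord[OF L c p] by (simp add: z Lt_def E0 M_def)
  have dL: "(Lt has_vector_derivative hor (z + t *\<^sub>R v) v (Lt t)) (at t)" if t: "t \<in> {-e<..<e}" for t
  proof -
    have "((\<lambda>t. E t ** M) has_vector_derivative - (gam (z + t *\<^sub>R v) v ** E t) ** M) (at t)"
      using E[OF t] by (intro bounded_linear.has_vector_derivative[OF mm.bounded_linear_left]) auto
    from mm.has_vector_derivative[OF this, of Z "Z t ** gam (z + t *\<^sub>R v) v"] E[OF t]
    have "(Lt has_vector_derivative (E t ** M) ** (Z t ** gam (z + t *\<^sub>R v) v) + (- (gam (z + t *\<^sub>R v) v ** E t) ** M) ** Z t) (at t)"
      by (simp add: Lt_def[abs_def])
    then show ?thesis by (simp add: hor_def Lt_def mat_simps)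
  qed
  have dC: "((\<lambda>t. cmap CC (\<Gamma> t)) has_vector_derivative (v, hor (z + t *\<^sub>R v) v (Lt t))) (at t)" if t: "t \<in> {-e<..<e}" for t
    by (rule has_vector_derivative_transform_within_open[OF has_vector_derivative_Pair[OF line_derivative dL[OF t]], of "{-e<..<e}"])
      (use \<Gamma>(4) t in auto)
  have velX: "velocity (end_bundle A) \<Gamma> 0 = X"
  proof (rule eb.tangent_eqI[OF _ X CC])
    show "velocity (end_bundle A) \<Gamma> 0 \<in> tangent_space (end_bundle A) (p, L)"
      using eb.velocity_tangent[OF \<Gamma>(1) e0] by (simp add: \<Gamma>0)
    show "(p, L) \<in> cdom CC" using L p by (simp add: end_chart_dom)
    show "velocity (end_bundle A) \<Gamma> 0 CC = X CC"
      using eb.velocity_apply[OF CC \<Gamma>(3)[OF e0] dC[OF e0]] h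
      by (simp add: prod_eq_iff v_def Lt_def E0 M_def z_def)
  qed
  have fst\<Gamma>: "fst (\<Gamma> t) = cinv c (z + t *\<^sub>R v)" "snd (\<Gamma> t) = mk_end c (fst (\<Gamma> t)) (Lt t)" "fst (\<Gamma> t) \<in> cdom c"
    "cmap c (fst (\<Gamma> t)) = z + t *\<^sub>R v" "end_coord A c (fst (\<Gamma> t)) (snd (\<Gamma> t)) = Lt t" "snd (\<Gamma> t) \<in> tangent_end A (fst (\<Gamma> t))"
    if t: "t \<in> {-e<..<e}" for t
  proof -
    show "fst (\<Gamma> t) = cinv c (z + t *\<^sub>R v)" "snd (\<Gamma> t) = mk_end c (fst (\<Gamma> t)) (Lt t)" using \<Gamma>(2)[OF t] by simp_all
    show "fst (\<Gamma> t) \<in> cdom c" "snd (\<Gamma> t) \<in> tangent_end A (fst (\<Gamma> t))" using \<Gamma>(3)[OF t] by (simp_all add: end_chart_def case_prod_beta)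
    show "cmap c (fst (\<Gamma> t)) = z + t *\<^sub>R v" "end_coord A c (fst (\<Gamma> t)) (snd (\<Gamma> t)) = Lt t"
      using \<Gamma>(4)[OF t] by (simp_all add: end_chart_def case_prod_beta)
  qed
  have fstc: "smooth_curve A e (\<lambda>t. fst (\<Gamma> t))" by (rule curve_fst[OF \<Gamma>(1)])
  have "parallel_along A nablaM e (\<lambda>t. fst (\<Gamma> t)) (\<lambda>t. snd (\<Gamma> t))"
    unfolding parallel_along_def
  proof (intro ballI allI impI, elim conjE)
    fix t V assume t: "t \<in> {-e<..<e}" and V: "\<forall>s\<in>{-e<..<e}. V s \<in> tangent_space A (fst (\<Gamma> s))"
      and diff: "\<forall>d\<in>A. fst (\<Gamma> t) \<in> cdom d \<longrightarrow> (\<lambda>s. V s d) differentiable (at t)"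
    note f = fst\<Gamma>[OF t]
    have zt: "z + t *\<^sub>R v \<in> Om" using E[OF t] by simp
    have Vs: "V s \<in> tangent_space A (fst (\<Gamma> s))" if "s \<in> {-e<..<e}" for s using V that by blast
    have LVs: "\<forall>s\<in>{-e<..<e}. snd (\<Gamma> s) (V s) \<in> tangent_space A (fst (\<Gamma> s))"
      using tangent_endD(1)[OF fst\<Gamma>(6) Vs] by blast
    define y where "y = vector_derivative (\<lambda>s. V s c) (at t)"
    have dV: "((\<lambda>s. V s c) has_vector_derivative y) (at t)"
      using diff c f(3) by (simp add: y_def vector_derivative_works)
    have dLV: "((\<lambda>s. snd (\<Gamma> s) (V s) c) has_vector_derivative (Lt t *v y + hor (z + t *\<^sub>R v) v (Lt t) *v V t c)) (at t)"
      by (rule has_vector_derivative_transform_within_open[OF mv.has_vector_derivative[OF dL[OF t] dV], of "{-e<..<e}"])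
        (use t end_coord_apply[OF fst\<Gamma>(6) c fst\<Gamma>(3) Vs] fst\<Gamma>(5) in auto)
    have vel: "velocity A (\<lambda>t. fst (\<Gamma> t)) t c = v"
    proof (rule velocity_apply[where \<gamma> = "\<lambda>t. fst (\<Gamma> t)", OF c f(3)])
      show "((\<lambda>s. cmap c (fst (\<Gamma> s))) has_vector_derivative v) (at t)"
        by (rule has_vector_derivative_transform_within_open[OF line_derivative, of "{-e<..<e}"]) (use t fst\<Gamma>(4) in auto)
    qed
    note c1 = cov_deriv_along_chart[OF fstc t f(3) V dV]
    note c2 = cov_deriv_along_chart[where V = "\<lambda>s. snd (\<Gamma> s) (V s)", OF fstc t f(3) LVs dLV]
    have LV: "snd (\<Gamma> t) (V t) c = Lt t *v V t c"
      using end_coord_apply[OF f(6) c f(3) Vs[OF t]] f(5) by simp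
    show "cov_deriv_along A nablaM (\<lambda>t. fst (\<Gamma> t)) (\<lambda>s. snd (\<Gamma> s) (V s)) t
        = snd (\<Gamma> t) (cov_deriv_along A nablaM (\<lambda>t. fst (\<Gamma> t)) V t)"
    proof (rule tangent_eqI[OF c2(1) tangent_endD(1)[OF f(6) c1(1)] c f(3)])
      show "cov_deriv_along A nablaM (\<lambda>t. fst (\<Gamma> t)) (\<lambda>s. snd (\<Gamma> s) (V s)) t c
        = snd (\<Gamma> t) (cov_deriv_along A nablaM (\<lambda>t. fst (\<Gamma> t)) V t) c"
        unfolding end_coord_apply[OF f(6) c f(3) c1(1)] f(5) c1(2) c2(2) f(4) vel LV
          gam_apply[OF zt, symmetric]
        by (simp add: hor_def mat_vec_simps)
    qed
  qed
  then have "velocity (end_bundle A) \<Gamma> 0 \<in> horizontal_space A nablaM (p, L)"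
    unfolding horizontal_space_def using \<Gamma>(1) \<Gamma>0 by blast
  then show ?thesis by (simp only: velX)
qed

subsection \<open>Points, vertical vectors and tangent vectors\<close>

lemma end_ev:
  assumes L: "L \<in> tangent_end A p" and p: "p \<in> cdom c"
  shows "L (ev (cmap c p) u) = ev (cmap c p) (end_coord A c p L *v u)"
proof -
  have z: "cmap c p \<in> Om" "cinv c (cmap c p) = p" using p c by (simp_all add: Om)
  have e: "ev (cmap c p) u \<in> tangent_space A p" for u using ev_tangent[OF z(1)] z(2) by simp
  show ?thesis
    by (rule tangent_eqI[OF tangent_endD(1)[OF L e] e c p])
      (simp add: end_coord_apply[OF L c p e] ev_apply[OF z(1)])
qed

lemma tangent_as_ev: "p \<in> cdom c \<Longrightarrow> v \<in> tangent_space A p \<Longrightarrow> v = ev (cmap c p) (v c)"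
  using c by (simp add: ev_def)

lemma g_as_gc: "p \<in> cdom c \<Longrightarrow> g p (ev (cmap c p) u) (ev (cmap c p) v) = gc (cmap c p) u v"
  using c by (simp add: gc_def)

lemma ev_tangent': "p \<in> cdom c \<Longrightarrow> ev (cmap c p) u \<in> tangent_space A p"
  using c by (simp add: ev_def)

lemma twistor_space_chart:
  assumes L: "L \<in> tangent_end A p" and p: "p \<in> cdom c"
  shows "(p, L) \<in> twistor_space A g \<longleftrightarrow> end_coord A c p L \<in> tw (cmap c p)"
proof -
  let ?z = "cmap c p" and ?M = "end_coord A c p L"
  have z: "?z \<in> Om" using p by (simp add: Om)
  have 1: "(\<forall>v\<in>tangent_space A p. L (L v) = - v) \<longleftrightarrow> ?M ** ?M = - mat 1"
  proof
    assume *: "\<forall>v\<in>tangent_space A p. L (L v) = - v"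
    show "?M ** ?M = - mat 1"
    proof (rule matrix_eqI)
      fix x
      have "ev ?z (?M *v (?M *v x)) = ev ?z (- x)"
        using *[rule_format, OF ev_tangent'[OF p, of x]] by (simp add: end_ev[OF L p] ev_simps[OF z])
      then have "ev ?z (?M *v (?M *v x)) c = ev ?z (- x) c" by simp
      then show "?M ** ?M *v x = - mat 1 *v x" by (simp add: ev_apply[OF z] mat_vec_simps)
    qed
  next
    assume *: "?M ** ?M = - mat 1"
    show "\<forall>v\<in>tangent_space A p. L (L v) = - v"
    proof
      fix v assume v: "v \<in> tangent_space A p"
      have "L (L v) = L (L (ev ?z (v c)))"
        by (simp only: tangent_as_ev[OF p v, symmetric])
      also have "\<dots> = ev ?z (?M ** ?M *v v c)"
        by (simp only: end_ev[OF L p] matrix_vector_mul_assoc)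
      also have "\<dots> = - ev ?z (v c)" unfolding * by (simp add: mat_vec_simps ev_simps[OF z])
      finally show "L (L v) = - v" using tangent_as_ev[OF p v] by simp
    qed
  qed
  have 2: "(\<forall>u\<in>tangent_space A p. \<forall>v\<in>tangent_space A p. g p (L u) (L v) = g p u v)
      \<longleftrightarrow> (\<forall>u w. gc ?z (?M *v u) (?M *v w) = gc ?z u w)"
  proof
    assume *: "\<forall>u\<in>tangent_space A p. \<forall>v\<in>tangent_space A p. g p (L u) (L v) = g p u v"
    show "\<forall>u w. gc ?z (?M *v u) (?M *v w) = gc ?z u w"
      using *[rule_format, OF ev_tangent'[OF p] ev_tangent'[OF p]] by (simp add: end_ev[OF L p] g_as_gc[OF p])
  next
    assume *: "\<forall>u w. gc ?z (?M *v u) (?M *v w) = gc ?z u w"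
    have "g p (L (ev ?z u)) (L (ev ?z v)) = g p (ev ?z u) (ev ?z v)" for u v
      using * by (simp add: end_ev[OF L p] g_as_gc[OF p])
    then show "\<forall>u\<in>tangent_space A p. \<forall>v\<in>tangent_space A p. g p (L u) (L v) = g p u v"
      using tangent_as_ev[OF p] by metis
  qed
  show ?thesis using 1 2 L Om(5)[OF p] by (simp add: twistor_space_def tw_def)
qed

lemma vertical_space_chart:
  assumes L: "L \<in> tangent_end A p" and B: "B \<in> tangent_end A p" and p: "p \<in> cdom c"
  shows "B \<in> vertical_space A g (p, L) \<longleftrightarrow> end_coord A c p B \<in> vert (cmap c p) (end_coord A c p L)"
proof -
  let ?z = "cmap c p" and ?M = "end_coord A c p L" and ?B = "end_coord A c p B"
  have z: "?z \<in> Om" using p by (simp add: Om)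
  have 1: "(\<forall>v\<in>tangent_space A p. B (L v) + L (B v) = 0) \<longleftrightarrow> ?B ** ?M + ?M ** ?B = 0"
  proof
    assume *: "\<forall>v\<in>tangent_space A p. B (L v) + L (B v) = 0"
    show "?B ** ?M + ?M ** ?B = 0"
    proof (rule matrix_eqI)
      fix x
      have "ev ?z (?B *v (?M *v x)) + ev ?z (?M *v (?B *v x)) = 0"
        using *[rule_format, OF ev_tangent'[OF p, of x]] by (simp add: end_ev[OF L p] end_ev[OF B p])
      from fun_cong[OF this, of c]
      show "(?B ** ?M + ?M ** ?B) *v x = 0 *v x" by (simp add: ev_apply[OF z] mat_vec_simps)
    qed
  next
    assume *: "?B ** ?M + ?M ** ?B = 0"
    show "\<forall>v\<in>tangent_space A p. B (L v) + L (B v) = 0"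
    proof
      fix v assume v: "v \<in> tangent_space A p"
      have "B (L v) + L (B v) = B (L (ev ?z (v c))) + L (B (ev ?z (v c)))"
        by (simp only: tangent_as_ev[OF p v, symmetric])
      also have "\<dots> = ev ?z ((?B ** ?M + ?M ** ?B) *v v c)"
        by (simp only: end_ev[OF L p] end_ev[OF B p] ev_simps(1)[OF z, symmetric] matrix_vector_mul_assoc mv.add_left)
      also have "\<dots> = ev ?z (0 *\<^sub>R 0)" unfolding * by simp
      also have "\<dots> = 0" unfolding ev_simps(2)[OF z] by (rule ext) simp
      finally show "B (L v) + L (B v) = 0" .
    qed
  qed
  have 2: "(\<forall>u\<in>tangent_space A p. \<forall>v\<in>tangent_space A p. g p (B u) v = - g p u (B v))
      \<longleftrightarrow> (\<forall>u w. gc ?z (?B *v u) w = - gc ?z u (?B *v w))"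
  proof
    assume *: "\<forall>u\<in>tangent_space A p. \<forall>v\<in>tangent_space A p. g p (B u) v = - g p u (B v)"
    show "\<forall>u w. gc ?z (?B *v u) w = - gc ?z u (?B *v w)"
      using *[rule_format, OF ev_tangent'[OF p] ev_tangent'[OF p]] by (simp add: end_ev[OF B p] g_as_gc[OF p])
  next
    assume *: "\<forall>u w. gc ?z (?B *v u) w = - gc ?z u (?B *v w)"
    have "g p (B (ev ?z u)) (ev ?z v) = - g p (ev ?z u) (B (ev ?z v))" for u v
      using * by (simp add: end_ev[OF B p] g_as_gc[OF p])
    then show "\<forall>u\<in>tangent_space A p. \<forall>v\<in>tangent_space A p. g p (B u) v = - g p u (B v)"
      using tangent_as_ev[OF p] by metis
  qed
  show ?thesis using 1 2 B by (simp add: vertical_space_def vert_def)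
qed

text \<open>The matrix in the chart \<open>c\<close> of the vertical part of a tangent vector of the endomorphism bundle.\<close>

definition vpart :: "('m, 'n) endpt \<Rightarrow> ('m, 'n) endvec \<Rightarrow> real^'n^'n" where
  "vpart q X = snd (X CC) - hor (cmap c (fst q)) (fst (X CC)) (end_coord A c (fst q) (snd q))"

text \<open>Curves in the twistor space have vertical deviation by \<open>velocity_vertical_part\<close>; the frames of
  \<open>twistor_frame\<close> realise every such tangent vector by a curve.\<close>

lemma twistor_tangent_chart:
  assumes q: "(p, L) \<in> twistor_space A g" and p: "p \<in> cdom c"
  shows "X \<in> twistor_tangent A g (p, L) \<longleftrightarrow> X \<in> tangent_space (end_bundle A) (p, L) \<and>
    vpart (p, L) X \<in> vert (cmap c p) (end_coord A c p L)"
proof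
  have L: "L \<in> tangent_end A p" using q by (simp add: twistor_space_def)
  have z: "cmap c p \<in> Om" "cinv c (cmap c p) = p" using p c by (simp_all add: Om)
  have M: "end_coord A c p L \<in> tw (cmap c p)" using q twistor_space_chart[OF L p] by simp
  show "X \<in> tangent_space (end_bundle A) (p, L) \<and> vpart (p, L) X \<in> vert (cmap c p) (end_coord A c p L)"
    if X: "X \<in> twistor_tangent A g (p, L)"
  proof -
    obtain \<Gamma> e where \<Gamma>: "smooth_curve (end_bundle A) e \<Gamma>" and X: "X = velocity (end_bundle A) \<Gamma> 0" and \<Gamma>0: "\<Gamma> 0 = (p, L)"
      and N: "\<forall>t\<in>{-e<..<e}. \<Gamma> t \<in> twistor_space A g"
      using X unfolding twistor_tangent_def tangent_sub_def by blast
    have e: "0 \<in> {-e<..<e}" using \<Gamma> by (simp add: smooth_curve_def)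
    have XT: "X \<in> tangent_space (end_bundle A) (p, L)"
      using eb.velocity_tangent[OF \<Gamma> e] by (simp add: X \<Gamma>0)
    define S where "S = {t \<in> {-e<..<e}. fst (\<Gamma> t) \<in> cdom c}"
    have S: "open S" "0 \<in> S" using curve_fst[OF \<Gamma>] c e p by (auto simp: S_def smooth_curve_def \<Gamma>0)
    note comp = CC_curve_components[OF \<Gamma> e, folded X, unfolded \<Gamma>0 fst_conv, OF p]
    have "snd (X CC) - hor (cmap c (fst (\<Gamma> 0))) (fst (X CC)) (end_coord A c (fst (\<Gamma> 0)) (snd (\<Gamma> 0)))
        \<in> vert (cmap c (fst (\<Gamma> 0))) (end_coord A c (fst (\<Gamma> 0)) (snd (\<Gamma> 0)))"
    proof (rule velocity_vertical_part[where \<gamma> = "\<lambda>s. cmap c (fst (\<Gamma> s))" and L = "\<lambda>s. end_coord A c (fst (\<Gamma> s)) (snd (\<Gamma> s))", OF S _ comp(1) _ comp(2)])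
      show "cmap c (fst (\<Gamma> s)) \<in> Om" if "s \<in> S" for s using that by (simp add: S_def Om)
      show "end_coord A c (fst (\<Gamma> s)) (snd (\<Gamma> s)) \<in> tw (cmap c (fst (\<Gamma> s)))" if "s \<in> S" for s
        using that twistor_space_chart[OF curve_end[OF \<Gamma>, of s], of] N by (simp add: S_def)
    qed
    then show ?thesis using XT by (simp add: vpart_def \<Gamma>0)
  qed
  show "X \<in> twistor_tangent A g (p, L)"
    if X: "X \<in> tangent_space (end_bundle A) (p, L) \<and> vpart (p, L) X \<in> vert (cmap c p) (end_coord A c p L)"
  proof -
    define z0 where "z0 = cmap c p"
    define M where "M = end_coord A c p L"
    define v where "v = fst (X CC)"
    define B where "B = vpart (p, L) X"
    have B: "B \<in> vert z0 M" and M': "M \<in> tw z0" and z0: "z0 \<in> Om" "cinv c z0 = p"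
      using X M z by (simp_all add: B_def z0_def M_def)
    obtain e F Fi where e: "0 < e" and F0: "F 0 = mat 1" "Fi 0 = mat 1"
      and sm: "smooth_on {-e<..<e} F" "smooth_on {-e<..<e} Fi"
      and F: "\<And>t. t \<in> {-e<..<e} \<Longrightarrow> z0 + t *\<^sub>R v \<in> Om \<and> Fi t ** F t = mat 1 \<and> F t ** Fi t = mat 1 \<and>
         (\<forall>a b. gc (z0 + t *\<^sub>R v) (F t *v a) (F t *v b) = gc z0 a b)"
      and dF: "(F has_vector_derivative - gam z0 v - (1/2) *\<^sub>R (B ** M)) (at 0)"
        "(Fi has_vector_derivative gam z0 v + (1/2) *\<^sub>R (B ** M)) (at 0)"
      using twistor_frame[OF z0(1) M' B, of v] by blast
    have e0: "0 \<in> {-e<..<e}" using e by simp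
    define Lt where "Lt t = F t ** M ** Fi t" for t
    define \<Gamma> where "\<Gamma> t = cinv CC (z0 + t *\<^sub>R v, Lt t)" for t
    have smL: "smooth_on {-e<..<e} Lt" unfolding Lt_def
      by (intro smooth_on_matrix_mult sm smooth_on_const) auto
    have dom: "(\<lambda>t. z0 + t *\<^sub>R v) ` {-e<..<e} \<subseteq> cmap c ` cdom c" using F by (auto simp: Om_def)
    have line: "smooth_on {-e<..<e} (\<lambda>t. z0 + t *\<^sub>R v)" by (rule smooth_on_line) simp
    note \<Gamma> = end_curve[OF c e dom line smL, folded \<Gamma>_def]
    have \<Gamma>0: "\<Gamma> 0 = (p, L)"
      using \<Gamma>(2)[OF e0] mk_end_coord[OF L c p] by (simp add: z0 Lt_def F0 M_def)
    have N: "\<Gamma> t \<in> twistor_space A g" if t: "t \<in> {-e<..<e}" for t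
    proof -
      have f: "fst (\<Gamma> t) \<in> cdom c" "snd (\<Gamma> t) \<in> tangent_end A (fst (\<Gamma> t))" "cmap c (fst (\<Gamma> t)) = z0 + t *\<^sub>R v"
        "end_coord A c (fst (\<Gamma> t)) (snd (\<Gamma> t)) = Lt t"
        using \<Gamma>(3,4)[OF t] by (simp_all add: end_chart_def case_prod_beta)
      have "Lt t \<in> tw (z0 + t *\<^sub>R v)" unfolding Lt_def
        by (rule isometry_conjugate(1)[OF _ _ _ M']) (use F[OF t] in auto)
      then show ?thesis using twistor_space_chart[OF f(2,1)] f(3,4) by simp
    qed
    have dL: "(Lt has_vector_derivative hor z0 v M + B) (at 0)"
      unfolding Lt_def[abs_def] by (rule conjugate_derivative[OF M' B F0 dF])
    have dC: "((\<lambda>t. cmap CC (\<Gamma> t)) has_vector_derivative (v, hor z0 v M + B)) (at 0)"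
      by (rule has_vector_derivative_transform_within_open[OF has_vector_derivative_Pair[OF line_derivative dL], of "{-e<..<e}"])
        (use \<Gamma>(4) e0 in auto)
    have "velocity (end_bundle A) \<Gamma> 0 = X"
    proof (rule eb.tangent_eqI[OF _ conjunct1[OF X] CC])
      show "velocity (end_bundle A) \<Gamma> 0 \<in> tangent_space (end_bundle A) (p, L)"
        using eb.velocity_tangent[OF \<Gamma>(1) e0] by (simp add: \<Gamma>0)
      show "(p, L) \<in> cdom CC" using L p by (simp add: end_chart_dom)
      show "velocity (end_bundle A) \<Gamma> 0 CC = X CC"
        using eb.velocity_apply[OF CC \<Gamma>(3)[OF e0] dC]
        by (simp add: prod_eq_iff v_def B_def vpart_def M_def z0_def)
    qed
    then show ?thesis
      unfolding twistor_tangent_def tangent_sub_def using \<Gamma>(1) \<Gamma>0 N by blast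
  qed
qed

end

text \<open>A point of the twistor space over the domain of the chart \<open>c\<close>.\<close>

locale hkt_twistor = hkt_chart A g I H nablaL c
  for A :: "('m, real^'n) chart set" and g I H nablaL c +
  fixes p :: 'm and L :: "('m, real^'n) tend"
  assumes pc: "p \<in> cdom c" and tw_pt: "(p, L) \<in> twistor_space A g"
begin

definition "z0 = cmap c p"
definition "M0 = end_coord A c p L"

lemma L: "L \<in> tangent_end A p"
  using tw_pt by (simp add: twistor_space_def)

lemma z0: "z0 \<in> Om" "cinv c z0 = p"
  using pc c by (simp_all add: z0_def Om)

lemma M0: "M0 \<in> tw z0"
  using tw_pt twistor_space_chart[OF L pc] by (simp add: z0_def M0_def)

lemma q_CC: "(p, L) \<in> cdom CC" "cmap CC (p, L) = (z0, M0)"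
  using L pc by (simp_all add: end_chart_dom end_chart_map z0_def M0_def)

lemma vpart: "vpart (p, L) X = snd (X CC) - hor z0 (fst (X CC)) M0"
  by (simp add: vpart_def z0_def M0_def)

lemma CC_component: "X CC = (fst (X CC), hor z0 (fst (X CC)) M0 + vpart (p, L) X)"
  by (simp add: vpart)

lemma tangent_iff:
  "X \<in> twistor_tangent A g (p, L) \<longleftrightarrow> X \<in> tangent_space (end_bundle A) (p, L) \<and> vpart (p, L) X \<in> vert z0 M0"
  using twistor_tangent_chart[OF tw_pt pc] by (simp add: z0_def M0_def)

lemma horizontal_iff:
  "X \<in> horizontal_space A nablaM (p, L) \<longleftrightarrow> X \<in> tangent_space (end_bundle A) (p, L) \<and> vpart (p, L) X = 0"
  using horizontal_component[OF L pc] horizontalI[OF L pc] by (auto simp: vpart_def)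

lemma vertical_iff: "B \<in> vertical_space A g (p, L) \<longleftrightarrow> B \<in> tangent_end A p \<and> end_coord A c p B \<in> vert z0 M0"
  using vertical_space_chart[OF L _ pc] by (auto simp: z0_def M0_def vertical_space_def)

lemma fibre_CC: "B \<in> tangent_end A p \<Longrightarrow> fibre_vec A (p, L) B \<in> tangent_space (end_bundle A) (p, L)"
  "B \<in> tangent_end A p \<Longrightarrow> fibre_vec A (p, L) B CC = (0, end_coord A c p B)"
  by (rule fibre_vec_chart[OF c pc L]; assumption)+

lemma vpart_minus_fibre:
  "B \<in> tangent_end A p \<Longrightarrow> vpart (p, L) (X - fibre_vec A (p, L) B) = vpart (p, L) X - end_coord A c p B"
  by (simp add: vpart fibre_CC(2))

lemma vertical_proj_eq:
  assumes X: "X \<in> twistor_tangent A g (p, L)"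
  shows "vertical_proj A g nablaM (p, L) X = mk_end c p (vpart (p, L) X)"
  unfolding vertical_proj_def
proof (rule the_equality)
  have XT: "X \<in> tangent_space (end_bundle A) (p, L)" and Xv: "vpart (p, L) X \<in> vert z0 M0" using X tangent_iff by auto
  let ?B = "mk_end c p (vpart (p, L) X)"
  note B = mk_end[OF c pc, of "vpart (p, L) X"]
  have "vpart (p, L) (X - fibre_vec A (p, L) ?B) = 0"
    by (simp add: vpart_minus_fibre[OF B(1)] B(2))
  then show "?B \<in> vertical_space A g (p, L) \<and> X - fibre_vec A (p, L) ?B \<in> horizontal_space A nablaM (p, L)"
    unfolding vertical_iff horizontal_iff using Xv XT B fibre_CC(1)[OF B(1)] by simp
  fix B' assume B': "B' \<in> vertical_space A g (p, L) \<and> X - fibre_vec A (p, L) B' \<in> horizontal_space A nablaM (p, L)"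
  then have Bt: "B' \<in> tangent_end A p" by (simp add: vertical_iff)
  have "vpart (p, L) (X - fibre_vec A (p, L) B') = 0" using B' horizontal_iff by simp
  then have "end_coord A c p B' = vpart (p, L) X"
    by (simp add: vpart_minus_fibre[OF Bt])
  then show "B' = ?B" using mk_end_coord[OF Bt c pc] by simp
qed

lemma horizontal_lift_eq:
  assumes v: "v \<in> tangent_space A p"
  shows "horizontal_lift A nablaM (p, L) v = coord_field (end_bundle A) CC (v c, hor z0 (v c) M0) (p, L)" (is "_ = ?X")
  unfolding horizontal_lift_def
proof (rule the_equality)
  have XT: "?X \<in> tangent_space (end_bundle A) (p, L)" and XC: "?X CC = (v c, hor z0 (v c) M0)"
    using CC q_CC by simp_all
  show "?X \<in> horizontal_space A nablaM (p, L) \<and> end_proj A (p, L) ?X = v"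
    unfolding horizontal_iff end_proj_chart[OF c pc L XT] using XT v c pc by (simp add: vpart XC)
  fix Y assume Y: "Y \<in> horizontal_space A nablaM (p, L) \<and> end_proj A (p, L) Y = v"
  then have YT: "Y \<in> tangent_space (end_bundle A) (p, L)" and Y0: "vpart (p, L) Y = 0" using horizontal_iff by auto
  have "fst (Y CC) = v c" using end_proj_tangent(2)[OF c pc L YT] Y by simp
  then have "Y CC = ?X CC" using Y0 CC_component[of Y] by (simp add: XC)
  then show "Y = ?X" by (rule eb.tangent_eqI[OF YT XT CC q_CC(1)])
qed

lemma twistor_J_CC:
  assumes X: "X \<in> twistor_tangent A g (p, L)"
  defines "v \<equiv> fst (X CC)"
  shows "twistor_J A g nablaM I (p, L) X CC = (ic z0 v, hor z0 (ic z0 v) M0 + M0 ** vpart (p, L) X)"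
    and "vpart (p, L) (twistor_J A g nablaM I (p, L) X) = M0 ** vpart (p, L) X"
    and "twistor_J A g nablaM I (p, L) X \<in> twistor_tangent A g (p, L)"
proof -
  have XT: "X \<in> tangent_space (end_bundle A) (p, L)" and Xv: "vpart (p, L) X \<in> vert z0 M0" using X tangent_iff by auto
  let ?B = "mk_end c p (vpart (p, L) X)"
  note B = mk_end[OF c pc, of "vpart (p, L) X"]
  have LB: "L \<circ> ?B \<in> tangent_end A p" "end_coord A c p (L \<circ> ?B) = M0 ** vpart (p, L) X"
    using tangent_end_ops(2)[OF L B(1)] end_coord_ops(2)[OF L B(1) c pc] by (simp_all add: B M0_def)
  have ep: "end_proj A (p, L) X = ev z0 v" using end_proj_chart[OF c pc L XT] by (simp add: ev_def z0 v_def)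
  have Iep: "I p (end_proj A (p, L) X) = ev z0 (ic z0 v)" unfolding ep using I_ev[OF z0(1), of v] by (simp add: z0)
  have IT: "ev z0 (ic z0 v) \<in> tangent_space A p" using ev_tangent[OF z0(1)] by (simp add: z0)
  have *: "twistor_J A g nablaM I (p, L) X = fibre_vec A (p, L) (L \<circ> ?B)
     + coord_field (end_bundle A) CC (ic z0 v, hor z0 (ic z0 v) M0) (p, L)"
    unfolding twistor_J_def snd_conv fst_conv vertical_proj_eq[OF X] Iep horizontal_lift_eq[OF IT]
    by (simp add: ev_apply[OF z0(1)])
  show 1: "twistor_J A g nablaM I (p, L) X CC = (ic z0 v, hor z0 (ic z0 v) M0 + M0 ** vpart (p, L) X)"
    unfolding * tvec_apply fibre_CC(2)[OF LB(1)] LB(2) using CC q_CC by (simp add: add.commute)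
  then show 2: "vpart (p, L) (twistor_J A g nablaM I (p, L) X) = M0 ** vpart (p, L) X" by (simp add: vpart)
  show "twistor_J A g nablaM I (p, L) X \<in> twistor_tangent A g (p, L)"
    unfolding tangent_iff 2 unfolding * using fibre_CC(1)[OF LB(1)] CC q_CC vert_tw_mult[OF z0(1) M0 Xv] by simp
qed

lemma twistor_form_CC:
  assumes X: "X \<in> twistor_tangent A g (p, L)" and Y: "Y \<in> twistor_tangent A g (p, L)"
  shows "twistor_form A g nablaM I (p, L) [X, Y]
    = - trace (M0 ** vpart (p, L) X ** vpart (p, L) Y) + om z0 (fst (X CC)) (fst (Y CC))"
proof -
  let ?JX = "twistor_J A g nablaM I (p, L) X"
  note J = twistor_J_CC[OF X]
  have T: "?JX \<in> tangent_space (end_bundle A) (p, L)" "Y \<in> tangent_space (end_bundle A) (p, L)"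
    using J(3) Y tangent_iff by auto
  note mk = mk_end[OF c pc]
  have "end_trace A p (mk_end c p (M0 ** vpart (p, L) X) \<circ> mk_end c p (vpart (p, L) Y))
      = trace (M0 ** vpart (p, L) X ** vpart (p, L) Y)"
    using end_trace_chart[OF tangent_end_ops(2)[OF mk(1) mk(1)] c pc] end_coord_ops(2)[OF mk(1) mk(1) c pc] by (simp add: mk)
  moreover have "end_proj A (p, L) ?JX = ev z0 (ic z0 (fst (X CC)))" "end_proj A (p, L) Y = ev z0 (fst (Y CC))"
    using end_proj_chart[OF c pc L T(1)] end_proj_chart[OF c pc L T(2)] J(1) by (simp_all add: ev_def z0)
  moreover have "twistor_form A g nablaM I (p, L) [X, Y] = twistor_metric A g nablaM (p, L) ?JX Y"
    by (simp only: twistor_form_def nth_Cons_0 nth_Cons_Suc One_nat_def)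
  ultimately show ?thesis
    unfolding twistor_metric_def vertical_proj_eq[OF J(3)] vertical_proj_eq[OF Y] J(2) fst_conv
    by (simp add: om_def gc_def z0)
qed

end

section \<open>The exterior derivative of the fundamental form\<close>

lemma diff_form_2:
  assumes "diff_form A 2 U \<eta>" "q \<in> U" "X \<in> tangent_space A q" "Y \<in> tangent_space A q" "Z \<in> tangent_space A q"
  shows "\<eta> q [Z, tscale a X + tscale b Y] = a * \<eta> q [Z, X] + b * \<eta> q [Z, Y]"
    "\<eta> q [tscale a X + tscale b Y, Z] = a * \<eta> q [X, Z] + b * \<eta> q [Y, Z]"
    "\<eta> q [Z, Z] = 0"
proof -
  have *: "(\<forall>i<2. \<forall>u\<in>tangent_space A q. \<forall>v\<in>tangent_space A q. \<forall>a b.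
           \<eta> q (vs[i := tscale a u + tscale b v]) = a * \<eta> q (vs[i := u]) + b * \<eta> q (vs[i := v])) \<and>
        (\<not> distinct vs \<longrightarrow> \<eta> q vs = 0)" if "length vs = 2 \<and> set vs \<subseteq> tangent_space A q" for vs
    by (rule assms(1)[unfolded diff_form_def, THEN conjunct1, THEN bspec, OF assms(2), THEN spec, THEN mp, OF that])
  have Z: "length [Z, Z] = 2 \<and> set [Z, Z] \<subseteq> tangent_space A q" using assms(5) by simp
  show "\<eta> q [Z, tscale a X + tscale b Y] = a * \<eta> q [Z, X] + b * \<eta> q [Z, Y]"
    using *[OF Z, THEN conjunct1, rule_format, of 1 X Y a b] assms(3,4) by simp
  show "\<eta> q [tscale a X + tscale b Y, Z] = a * \<eta> q [X, Z] + b * \<eta> q [Y, Z]"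
    using *[OF Z, THEN conjunct1, rule_format, of 0 X Y a b] assms(3,4) by simp
  show "\<eta> q [Z, Z] = 0" using *[OF Z] by simp
qed

context hkt_chart
begin

definition vert_comp :: "(real^'n) \<times> (real^'n^'n) \<Rightarrow> (real^'n) \<times> (real^'n^'n) \<Rightarrow> real^'n^'n" where
  "vert_comp y X = snd X - hor (fst y) (fst X) (snd y)"

text \<open>An extension of the fundamental form to the whole bundle, in coordinates: the expression
  \<open>- tr (L B B')\<close> is antisymmetrised, which does not change it on vertical \<open>B\<close> and \<open>B'\<close>.\<close>

definition form_coord :: "(real^'n) \<times> (real^'n^'n) \<Rightarrow> (real^'n) \<times> (real^'n^'n) \<Rightarrow> (real^'n) \<times> (real^'n^'n) \<Rightarrow> real" where
  "form_coord y X Y = (trace (snd y ** vert_comp y Y ** vert_comp y X) - trace (snd y ** vert_comp y X ** vert_comp y Y)) / 2 + om (fst y) (fst X) (fst Y)"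

lemma vert_comp_linear: assumes y: "fst y \<in> Om" shows "linear (vert_comp y)"
proof -
  note g = linear_add[OF gam_linear[OF y]] linear_scale[OF gam_linear[OF y]]
  show ?thesis by (rule linearI) (simp_all add: vert_comp_def hor_def g mat_simps scaleR_right_diff_distrib)
qed

lemma form_coord_skew: assumes y: "fst y \<in> Om" shows "form_coord y X Y = - form_coord y Y X"
  using om_skew[OF y, of "fst X" "fst Y"] unfolding form_coord_def by (simp add: diff_divide_distrib)

lemma form_coord_linear: assumes y: "fst y \<in> Om" shows "linear (form_coord y X)"
proof -
  note t = linear_add[OF vert_comp_linear[OF y]] linear_scale[OF vert_comp_linear[OF y]]
  note o = linear_add[OF om_linear[OF y]] linear_scale[OF om_linear[OF y]]
  show ?thesis
    by (rule linearI) (simp_all add: form_coord_def t o mat_simps trace_simps field_simps)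
qed

lemma form_coord_left_linear: assumes y: "fst y \<in> Om" shows "linear (\<lambda>X. form_coord y X Y)"
proof -
  have "(\<lambda>X. form_coord y X Y) = (\<lambda>X. - form_coord y Y X)" using form_coord_skew[OF y] by blast
  then show ?thesis using linear_compose_neg[OF form_coord_linear[OF y]] by simp
qed

lemma form_coord_smooth: "smooth_on (Om \<times> UNIV) (\<lambda>y. form_coord y X Y)"
proof -
  let ?S = "Om \<times> (UNIV :: (real^'n^'n) set)"
  have S: "open ?S" by (intro open_Times open_Om open_UNIV)
  have fst: "smooth_on ?S fst" and snd: "smooth_on ?S snd"
    by (intro smooth_on_linear[OF S] linear_fst linear_snd)+
  have g: "smooth_on ?S (\<lambda>y. gam (fst y) v)" for v
    by (rule smooth_on_compose[OF S gam_smooth fst]) auto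
  have vert_comp: "smooth_on ?S (\<lambda>y. vert_comp y X)" for X
    unfolding vert_comp_def hor_def by (intro smooth_on_diff smooth_on_const smooth_on_matrix_mult S g snd)
  have o: "smooth_on ?S (\<lambda>y. om (fst y) u v)" for u v
    by (rule smooth_on_compose[OF S om_smooth fst]) auto
  show ?thesis
    unfolding form_coord_def divide_inverse
    by (intro smooth_on_add smooth_on_mult smooth_on_diff smooth_on_trace smooth_on_matrix_mult S snd vert_comp o smooth_on_const)
qed

lemma form_coord_value:
  assumes z: "z \<in> Om" and M: "M \<in> tw z" and B: "B \<in> vert z M" "B' \<in> vert z M"
  shows "form_coord (z, M) (v, hor z v M + B) (v', hor z v' M + B') = - trace (M ** B ** B') + om z v v'"
proof -
  have "trace (M ** B' ** B) = - trace (B' ** (M ** B))"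
    by (simp add: vert_anticommute[OF M B(2)] mat_simps trace_simps)
  also have "\<dots> = - trace (M ** B ** B')" by (simp add: trace_mul_sym[of B'])
  finally show ?thesis by (simp add: form_coord_def vert_comp_def)
qed

definition ambient_form :: "('m, 'n) endpt \<Rightarrow> ('m, 'n) endvec list \<Rightarrow> real" where
  "ambient_form q Xs = form_coord (cmap CC q) ((Xs ! 0) CC) ((Xs ! 1) CC)"

lemma CC_image: "cmap CC ` cdom CC = Om \<times> UNIV"
  using end_chart_image[OF c c] by (simp add: Om_def)

lemma diff_form_ambient_form: "diff_form (end_bundle A) 2 (cdom CC) ambient_form"
  unfolding diff_form_def
proof (intro conjI ballI allI impI; (elim conjE)?)
  fix q :: "('m, 'n) endpt" and vs :: "('m, 'n) endvec list"
  assume q: "q \<in> cdom CC" and vs: "length vs = 2"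
  obtain X Y where XY: "vs = [X, Y]" using vs by (auto simp: length_Suc_conv numeral_2_eq_2)
  have y: "fst (cmap CC q) \<in> Om"
  proof -
    have "cmap CC q \<in> Om \<times> UNIV" unfolding CC_image[symmetric] using q by (rule imageI)
    then show ?thesis by (simp add: mem_Times_iff)
  qed
  note lin = linear_add[OF form_coord_linear[OF y]] linear_scale[OF form_coord_linear[OF y]]
    linear_add[OF form_coord_left_linear[OF y]] linear_scale[OF form_coord_left_linear[OF y]]
  show "ambient_form q (vs[i := tscale a u + tscale b v]) = a * ambient_form q (vs[i := u]) + b * ambient_form q (vs[i := v])"
    if i: "i < 2" for i u v a b
  proof -
    consider "i = 0" | "i = 1" using i by linarith
    then show ?thesis
    proof cases
      case 1
      show ?thesis unfolding 1 XY ambient_form_def by (simp add: lin)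
    next
      case 2
      show ?thesis unfolding 2 XY ambient_form_def by (simp add: lin)
    qed
  qed
  show "ambient_form q vs = 0" if "\<not> distinct vs"
    using that form_coord_skew[OF y, of "X CC" "X CC"] by (auto simp: XY ambient_form_def)
next
  fix C :: "(('m, 'n) endpt, (real^'n) \<times> (real^'n^'n)) chart" and xs :: "((real^'n) \<times> (real^'n^'n)) list"
  assume C: "C \<in> end_bundle A" and xs: "length xs = 2"
  obtain x y where xy: "xs = [x, y]" using xs by (auto simp: length_Suc_conv numeral_2_eq_2)
  let ?U = "cdom CC \<inter> cdom C"
  have U: "openin (chart_topology (end_bundle A)) ?U" by (rule eb.openin_Int_cdom[OF eb.openin_cdom[OF CC] C])
  let ?S = "cmap CC ` ?U"
  have S: "open ?S" by (rule eb.overlap_open[OF CC C])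
  have sub: "?S \<subseteq> Om \<times> UNIV" using CC_image by blast
  have in_Om: "fst t \<in> Om" if "t \<in> ?S" for t using that sub by auto
  have f: "smooth_on ?S (\<lambda>t. coord_field (end_bundle A) C x (cinv CC t) CC)" for x
    using eb.smooth_fieldD(2)[OF eb.coord_field_smooth[OF C] CC] by (simp add: Int_commute)
  have 1: "smooth_on ?S (\<lambda>t. form_coord t X (coord_field (end_bundle A) C y (cinv CC t) CC))" for X
    by (rule smooth_on_linear_apply[where f = "\<lambda>t. form_coord t X", OF S form_coord_linear[OF in_Om]
          smooth_on_subset[OF form_coord_smooth sub] f])
  have 2: "smooth_on ?S (\<lambda>t. form_coord t (coord_field (end_bundle A) C x (cinv CC t) CC) (coord_field (end_bundle A) C y (cinv CC t) CC))"
    by (rule smooth_on_linear_apply[where f = "\<lambda>t X. form_coord t X (coord_field (end_bundle A) C y (cinv CC t) CC)", OF S form_coord_left_linear[OF in_Om] 1 f])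
  show "smooth_fun (end_bundle A) ?U (\<lambda>q. ambient_form q (map (\<lambda>x. coord_field (end_bundle A) C x q) xs))"
  proof (rule eb.smooth_funI[OF CC U])
    show "smooth_on ?S (\<lambda>t. ambient_form (cinv CC t) (map (\<lambda>x. coord_field (end_bundle A) C x (cinv CC t)) xs))"
    proof (rule smooth_on_cong[OF S _ 2])
      fix t assume "t \<in> ?S"
      then have "cmap CC (cinv CC t) = t" using eb.chart_image(3)[OF CC, of ?U t] by simp
      then show "form_coord t (coord_field (end_bundle A) C x (cinv CC t) CC) (coord_field (end_bundle A) C y (cinv CC t) CC)
         = ambient_form (cinv CC t) (map (\<lambda>x. coord_field (end_bundle A) C x (cinv CC t)) xs)" by (simp add: xy ambient_form_def)
    qed
  qed simp
qed

end

context hkt_twistor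
begin

abbreviation "B \<equiv> end_bundle A"
abbreviation "Kc u v \<equiv> Rmat z0 u v ** M0 - M0 ** Rmat z0 u v"

text \<open>The right-hand side of the main formula in the chart \<open>c\<close>.\<close>

definition dc_value :: "('m, 'n) endvec \<Rightarrow> ('m, 'n) endvec \<Rightarrow> ('m, 'n) endvec \<Rightarrow> real" where
  "dc_value X1 X2 X3 =
     trace (Kc (fst (X1 CC)) (fst (X2 CC)) ** vpart (p, L) X3) + trace (Kc (fst (X2 CC)) (fst (X3 CC)) ** vpart (p, L) X1)
   + trace (Kc (fst (X3 CC)) (fst (X1 CC)) ** vpart (p, L) X2) - hc z0 (fst (X1 CC)) (fst (X2 CC)) (fst (X3 CC))"

text \<open>In the bundle chart, every extension \<open>\<eta>\<close> satisfies the hypotheses of \<open>dc_on_twistor\<close>.\<close>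

lemma ext_deriv_value:
  assumes at: "chart_at B (p, L) = CC"
    and U: "openin (chart_topology B) U" "(p, L) \<in> U" and \<eta>: "diff_form B 2 U \<eta>"
    and restr: "\<forall>q\<in>U \<inter> twistor_space A g. \<forall>ws. length ws = 2 \<and> set ws \<subseteq> tangent_sub B (twistor_space A g) q
        \<longrightarrow> \<eta> q ws = twistor_form A g nablaM I q ws"
    and X: "X1 \<in> twistor_tangent A g (p, L)" "X2 \<in> twistor_tangent A g (p, L)" "X3 \<in> twistor_tangent A g (p, L)"
  defines "J \<equiv> twistor_J A g nablaM I (p, L)"
  shows "ext_deriv B \<eta> (p, L) [J X1, J X2, J X3] = - dc_value X1 X2 X3"
proof -
  define \<beta> where "\<beta> y X Y = \<eta> (cinv CC y) [coord_field B CC X (cinv CC y), coord_field B CC Y (cinv CC y)]" for y X Y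
  define W where "W = cmap CC ` (U \<inter> cdom CC)"
  have W: "open W" "W \<subseteq> Om \<times> UNIV"
    unfolding W_def using eb.openin_image[OF U(1) CC] CC_image by auto
  have qW: "(z0, M0) \<in> W" unfolding W_def q_CC(2)[symmetric] using U(2) q_CC(1) by blast
  have qinv: "cinv CC (z0, M0) = (p, L)" using eb.cinv_cmap[OF CC q_CC(1)] by (simp add: q_CC)
  have in_W: "cinv CC y \<in> U" "cinv CC y \<in> cdom CC" "cmap CC (cinv CC y) = y" if "y \<in> W" for y
    using eb.chart_image[OF CC, of "U \<inter> cdom CC" y] that by (auto simp: W_def)
  have cft: "coord_field B CC X (cinv CC y) \<in> tangent_space B (cinv CC y)" if "y \<in> W" for X y
    by (rule eb.coord_field_tangent[OF CC in_W(2)[OF that]])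
  have \<beta>_comb: "\<beta> y X (a *\<^sub>R Y + b *\<^sub>R Z) = a *\<^sub>R \<beta> y X Y + b *\<^sub>R \<beta> y X Z" if y: "y \<in> W" for y X Y Z a b
    unfolding \<beta>_def eb.coord_field_linear[OF CC in_W(2)[OF y]]
    by (subst diff_form_2(1)[OF \<eta> in_W(1)[OF y] cft[OF y] cft[OF y] cft[OF y]]) simp
  have lin: "linear (\<beta> y X)" if "y \<in> W" for y X
    by (rule linear_combinationI) (rule \<beta>_comb[OF that])
  have skew: "\<beta> y X Y = - \<beta> y Y X" if y: "y \<in> W" for y X Y
  proof -
    have c2: "\<beta> y (a *\<^sub>R X + b *\<^sub>R Y) Z = a * \<beta> y X Z + b * \<beta> y Y Z" for X Y Z a b
      unfolding \<beta>_def eb.coord_field_linear[OF CC in_W(2)[OF y]]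
      by (rule diff_form_2(2)[OF \<eta> in_W(1)[OF y] cft[OF y] cft[OF y] cft[OF y]])
    have 0: "\<beta> y Z Z = 0" for Z
      unfolding \<beta>_def by (rule diff_form_2(3)[OF \<eta> in_W(1)[OF y] cft[OF y] cft[OF y] cft[OF y]])
    have "\<beta> y (1 *\<^sub>R X + 1 *\<^sub>R Y) (1 *\<^sub>R X + 1 *\<^sub>R Y) = 0" by (rule 0)
    then show ?thesis unfolding c2 \<beta>_comb[OF y] by (simp add: 0)
  qed
  have diff: "(\<lambda>y. \<beta> y X Y) differentiable (at (z0, M0))" for X Y
  proof -
    have "smooth_fun B (U \<inter> cdom CC) (\<lambda>q. \<eta> q (map (\<lambda>x. coord_field B CC x q) [X, Y]))"
      by (rule \<eta>[unfolded diff_form_def, THEN conjunct2, THEN bspec, OF CC, THEN spec, THEN mp]) simp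
    from this[unfolded smooth_fun_def, THEN bspec, OF CC]
    have "smooth_on W (\<lambda>y. \<beta> y X Y)" by (simp add: W_def \<beta>_def o_def)
    from smooth_on_has_derivative[OF this qW] show ?thesis by (rule differentiableI)
  qed
  have val: "\<beta> (z, M) (v, hor z v M + C) (v', hor z v' M + C') = - trace (M ** C ** C') + om z v v'"
    if zM: "(z, M) \<in> W" and M: "M \<in> tw z" and C: "C \<in> vert z M" "C' \<in> vert z M" for z M v v' C C'
  proof -
    obtain p' L' where q': "cinv CC (z, M) = (p', L')" by (cases "cinv CC (z, M)")
    note iW = in_W[OF zM, unfolded q']
    have p': "p' \<in> cdom c" "L' \<in> tangent_end A p'" "cmap c p' = z" "end_coord A c p' L' = M"
      using iW by (simp_all add: end_chart_dom end_chart_map)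
    have tp: "(p', L') \<in> twistor_space A g" using twistor_space_chart[OF p'(2,1)] M p' by simp
    interpret t: hkt_twistor A g I H nablaL c p' L' by unfold_locales (rule p'(1), rule tp)
    have t0: "t.z0 = z" "t.M0 = M" using p' by (simp_all add: t.z0_def t.M0_def)
    let ?X = "coord_field B CC (v, hor z v M + C) (p', L')" and ?Y = "coord_field B CC (v', hor z v' M + C') (p', L')"
    have XC: "?X CC = (v, hor z v M + C)" "?Y CC = (v', hor z v' M + C')" using CC iW by simp_all
    have vp: "vpart (p', L') ?X = C" "vpart (p', L') ?Y = C'" by (simp_all add: t.vpart XC t0)
    have XT: "?X \<in> twistor_tangent A g (p', L')" "?Y \<in> twistor_tangent A g (p', L')"
      unfolding t.tangent_iff vp using C CC iW by (simp_all add: t0)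
    have "\<eta> (p', L') [?X, ?Y] = twistor_form A g nablaM I (p', L') [?X, ?Y]"
      by (rule restr[THEN bspec, THEN spec, THEN mp]) (use iW tp XT in \<open>simp_all add: twistor_tangent_def\<close>)
    also have "\<dots> = - trace (M ** C ** C') + om z v v'"
      using t.twistor_form_CC[OF XT] by (simp add: XC vp t0)
    finally show ?thesis by (simp add: \<beta>_def q')
  qed
  have v: "vpart (p, L) X1 \<in> vert z0 M0" "vpart (p, L) X2 \<in> vert z0 M0" "vpart (p, L) X3 \<in> vert z0 M0"
    using X tangent_iff by auto
  have JC: "J X1 CC = (ic z0 (fst (X1 CC)), hor z0 (ic z0 (fst (X1 CC))) M0 + M0 ** vpart (p, L) X1)"
    "J X2 CC = (ic z0 (fst (X2 CC)), hor z0 (ic z0 (fst (X2 CC))) M0 + M0 ** vpart (p, L) X2)"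
    "J X3 CC = (ic z0 (fst (X3 CC)), hor z0 (ic z0 (fst (X3 CC))) M0 + M0 ** vpart (p, L) X3)"
    unfolding J_def by (rule twistor_J_CC(1), fact)+
  have n3: "{..<3::nat} = {0, 1, 2}" by auto
  have "ext_deriv B \<eta> (p, L) [J X1, J X2, J X3] =
      frechet_derivative (\<lambda>y. \<beta> y (J X2 CC) (J X3 CC)) (at (z0, M0)) (J X1 CC)
    - frechet_derivative (\<lambda>y. \<beta> y (J X1 CC) (J X3 CC)) (at (z0, M0)) (J X2 CC)
    + frechet_derivative (\<lambda>y. \<beta> y (J X1 CC) (J X2 CC)) (at (z0, M0)) (J X3 CC)"
    unfolding ext_deriv_def Let_def at dir_deriv_def q_CC(2)
    by (simp add: n3 \<beta>_def o_def numeral_2_eq_2)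
  also have "\<dots> = - dc_value X1 X2 X3"
  proof -
    have "- (frechet_derivative (\<lambda>y. \<beta> y (J X2 CC) (J X3 CC)) (at (z0, M0)) (J X1 CC)
      - frechet_derivative (\<lambda>y. \<beta> y (J X1 CC) (J X3 CC)) (at (z0, M0)) (J X2 CC)
      + frechet_derivative (\<lambda>y. \<beta> y (J X1 CC) (J X2 CC)) (at (z0, M0)) (J X3 CC)) = dc_value X1 X2 X3"
      unfolding JC dc_value_def by (rule dc_on_twistor[where \<beta> = \<beta>, OF W(1) qW W(2) lin skew diff val M0 v])
    then show ?thesis by simp
  qed
  finally show ?thesis .
qed

text \<open>All extensions give the same value by the previous lemma, and \<open>ambient_form\<close> is one.\<close>

lemma twistor_dc_form_value:
  assumes at: "chart_at B (p, L) = CC"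
    and X: "X1 \<in> twistor_tangent A g (p, L)" "X2 \<in> twistor_tangent A g (p, L)" "X3 \<in> twistor_tangent A g (p, L)"
  shows "twistor_dc_form A g nablaM I (p, L) X1 X2 X3 = dc_value X1 X2 X3"
proof -
  let ?J = "twistor_J A g nablaM I (p, L)"
  have ambient_form: "\<forall>q\<in>cdom CC \<inter> twistor_space A g. \<forall>ws. length ws = 2 \<and> set ws \<subseteq> tangent_sub B (twistor_space A g) q
        \<longrightarrow> ambient_form q ws = twistor_form A g nablaM I q ws"
  proof (intro ballI allI impI, elim conjE)
    fix q ws assume q: "q \<in> cdom CC \<inter> twistor_space A g" and ws: "length ws = 2" "set ws \<subseteq> tangent_sub B (twistor_space A g) q"
    obtain p' L' where q': "q = (p', L')" by (cases q)
    obtain X Y where XY: "ws = [X, Y]" using ws(1) by (auto simp: length_Suc_conv numeral_2_eq_2)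
    have p': "p' \<in> cdom c" "(p', L') \<in> twistor_space A g" using q by (simp_all add: q' end_chart_dom)
    interpret t: hkt_twistor A g I H nablaL c p' L' by unfold_locales (rule p')+
    have T: "X \<in> twistor_tangent A g (p', L')" "Y \<in> twistor_tangent A g (p', L')"
      using ws(2) by (simp_all add: XY twistor_tangent_def q')
    have v: "vpart (p', L') X \<in> vert t.z0 t.M0" "vpart (p', L') Y \<in> vert t.z0 t.M0" using T t.tangent_iff by auto
    have "ambient_form q ws = form_coord (t.z0, t.M0) (X CC) (Y CC)" by (simp add: ambient_form_def XY q' t.q_CC)
    also have "\<dots> = form_coord (t.z0, t.M0) (fst (X CC), hor t.z0 (fst (X CC)) t.M0 + vpart (p', L') X)
        (fst (Y CC), hor t.z0 (fst (Y CC)) t.M0 + vpart (p', L') Y)"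
      using t.CC_component[of X] t.CC_component[of Y] by metis
    also have "\<dots> = twistor_form A g nablaM I q ws"
      unfolding form_coord_value[OF t.z0(1) t.M0 v] XY q' t.twistor_form_CC[OF T] ..
    finally show "ambient_form q ws = twistor_form A g nablaM I q ws" .
  qed
  have "sub_ext_deriv B (twistor_space A g) 2 (twistor_form A g nablaM I) (p, L) [?J X1, ?J X2, ?J X3] = - dc_value X1 X2 X3"
    unfolding sub_ext_deriv_def
  proof (rule the_equality)
    show "\<exists>U \<eta>. openin (chart_topology B) U \<and> (p, L) \<in> U \<and> diff_form B 2 U \<eta> \<and>
       (\<forall>q'\<in>U \<inter> twistor_space A g. \<forall>ws. length ws = 2 \<and> set ws \<subseteq> tangent_sub B (twistor_space A g) q'
          \<longrightarrow> \<eta> q' ws = twistor_form A g nablaM I q' ws) \<and>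
       - dc_value X1 X2 X3 = ext_deriv B \<eta> (p, L) [?J X1, ?J X2, ?J X3]"
      using eb.openin_cdom[OF CC] q_CC(1) diff_form_ambient_form ambient_form
        ext_deriv_value[OF at eb.openin_cdom[OF CC] q_CC(1) diff_form_ambient_form ambient_form X, symmetric]
      by (intro exI[of _ "cdom CC"] exI[of _ ambient_form] conjI)
    fix r
    assume "\<exists>U \<eta>. openin (chart_topology B) U \<and> (p, L) \<in> U \<and> diff_form B 2 U \<eta> \<and>
       (\<forall>q'\<in>U \<inter> twistor_space A g. \<forall>ws. length ws = 2 \<and> set ws \<subseteq> tangent_sub B (twistor_space A g) q'
          \<longrightarrow> \<eta> q' ws = twistor_form A g nablaM I q' ws) \<and>
       r = ext_deriv B \<eta> (p, L) [?J X1, ?J X2, ?J X3]"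
    then show "r = - dc_value X1 X2 X3"
      by (elim exE conjE) (simp only: ext_deriv_value[OF at _ _ _ _ X])
  qed
  then show ?thesis unfolding twistor_dc_form_def by simp
qed

lemma dc_value_invariant:
  assumes X: "X1 \<in> twistor_tangent A g (p, L)" "X2 \<in> twistor_tangent A g (p, L)" "X3 \<in> twistor_tangent A g (p, L)"
    and v: "end_proj A (p, L) X1 = v1" "end_proj A (p, L) X2 = v2" "end_proj A (p, L) X3 = v3"
  shows "dc_value X1 X2 X3 =
        (end_trace A p (commutator (curvature A nablaM p v1 v2) L \<circ> vertical_proj A g nablaM (p, L) X3)
       + end_trace A p (commutator (curvature A nablaM p v2 v3) L \<circ> vertical_proj A g nablaM (p, L) X1)
       + end_trace A p (commutator (curvature A nablaM p v3 v1) L \<circ> vertical_proj A g nablaM (p, L) X2))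
       - H p [v1, v2, v3]"
proof -
  have XT: "X1 \<in> tangent_space B (p, L)" "X2 \<in> tangent_space B (p, L)" "X3 \<in> tangent_space B (p, L)"
    using X tangent_iff by auto
  note ep = end_proj_tangent[OF c pc L]
  have vT: "v1 \<in> tangent_space A p" "v2 \<in> tangent_space A p" "v3 \<in> tangent_space A p"
    and vc: "v1 c = fst (X1 CC)" "v2 c = fst (X2 CC)" "v3 c = fst (X3 CC)"
    using ep[OF XT(1)] ep[OF XT(2)] ep[OF XT(3)] v by simp_all
  have tr: "end_trace A p (commutator (curvature A nablaM p u v) L \<circ> vertical_proj A g nablaM (p, L) X)
      = trace (Kc (u c) (v c) ** vpart (p, L) X)"
    if uv: "u \<in> tangent_space A p" "v \<in> tangent_space A p" and X: "X \<in> twistor_tangent A g (p, L)" for u v X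
  proof -
    have R: "curvature A nablaM p u v w \<in> tangent_space A p" "curvature A nablaM p u v w c = Rmat z0 (u c) (v c) *v w c"
      if "w \<in> tangent_space A p" for w
      using curvature_local[OF z0(1), unfolded z0(2), OF uv that] .
    have RT: "curvature A nablaM p u v \<in> tangent_end A p"
      unfolding tangent_end_def mem_Collect_eq
    proof (intro conjI ballI allI impI)
      show "curvature A nablaM p u v w \<in> tangent_space A p" if "w \<in> tangent_space A p" for w by (rule R(1)[OF that])
      show "curvature A nablaM p u v w = 0" if "w \<notin> tangent_space A p" for w using that by (simp add: curvature_def)
      fix x y a b assume xy: "x \<in> tangent_space A p" "y \<in> tangent_space A p"
      note xyT = tangent_space_combination[OF xy, of a b]
      show "curvature A nablaM p u v (tscale a x + tscale b y)
          = tscale a (curvature A nablaM p u v x) + tscale b (curvature A nablaM p u v y)"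
        by (rule tangent_eqI[OF R(1)[OF xyT] tangent_space_combination[OF R(1)[OF xy(1)] R(1)[OF xy(2)]] c pc])
          (simp only: tvec_apply R(2)[OF xyT] R(2)[OF xy(1)] R(2)[OF xy(2)] mat_vec_simps)
    qed
    have Rc: "end_coord A c p (curvature A nablaM p u v) = Rmat z0 (u c) (v c)"
      by (rule end_coordI[OF c pc], rule R(2))
    note mk = mk_end[OF c pc, of "vpart (p, L) X"] and cm = tangent_end_ops(3)[OF RT L]
    show ?thesis
      unfolding vertical_proj_eq[OF X] end_trace_chart[OF tangent_end_ops(2)[OF cm mk(1)] c pc]
        end_coord_ops(2)[OF cm mk(1) c pc] end_coord_ops(3)[OF RT L c pc] mk(2) Rc M0_def ..
  qed
  have "H p [v1, v2, v3] = hc z0 (v1 c) (v2 c) (v3 c)"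
    using vT ev_tvec[OF z0(1)] by (simp add: hc_def z0)
  then show ?thesis
    unfolding tr[OF vT(1,2) X(3)] tr[OF vT(2,3) X(1)] tr[OF vT(3,1) X(2)] dc_value_def vc by simp
qed

end

lemma (in hkt) twistor_dc_form_eq:
  fixes p :: 'm and L :: "('m, real^'n) tend"
  defines "nablaM \<equiv> torsion_conn A g nablaL (- 1/2) H"
  assumes q: "(p, L) \<in> twistor_space A g"
    and X: "X1 \<in> twistor_tangent A g (p, L)" "X2 \<in> twistor_tangent A g (p, L)" "X3 \<in> twistor_tangent A g (p, L)"
    and v: "end_proj A (p, L) X1 = v1" "end_proj A (p, L) X2 = v2" "end_proj A (p, L) X3 = v3"
  shows "twistor_dc_form A g nablaM I (p, L) X1 X2 X3 =
        (end_trace A p (commutator (curvature A nablaM p v1 v2) L \<circ> vertical_proj A g nablaM (p, L) X3)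
       + end_trace A p (commutator (curvature A nablaM p v2 v3) L \<circ> vertical_proj A g nablaM (p, L) X1)
       + end_trace A p (commutator (curvature A nablaM p v3 v1) L \<circ> vertical_proj A g nablaM (p, L) X2))
       - H p [v1, v2, v3]"
proof -
  have "p \<in> carrier_of A" "L \<in> tangent_end A p" using q by (simp_all add: twistor_space_def)
  then have "(p, L) \<in> carrier_of (end_bundle A)"
    by (auto simp: carrier_of_def end_bundle_def end_chart_dom)
  from eb.chart_at[OF this] obtain c where cA: "c \<in> A" "chart_at (end_bundle A) (p, L) = end_chart A c"
    and pc: "p \<in> cdom c" by (auto simp: end_bundle_def end_chart_dom)
  interpret hkt_twistor A g I H nablaL c p L by unfold_locales (rule cA pc q)+
  show ?thesis
    unfolding nablaM_def twistor_dc_form_value[OF cA(2) X] by (rule dc_value_invariant[OF X v])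
qed

theorem theorem4p10:
  fixes A :: "('m, real^'n) chart set"
    and g :: "'m \<Rightarrow> ('m, real^'n) tvec \<Rightarrow> ('m, real^'n) tvec \<Rightarrow> real"
    and I J K :: "'m \<Rightarrow> ('m, real^'n) tend"
    and H :: "'m \<Rightarrow> ('m, real^'n) tvec list \<Rightarrow> real"
    and nablaL nablaM :: "('m, real^'n) conn"
    and p :: 'm and K' :: "('m, real^'n) tend"
    and X1 X2 X3 :: "('m, 'n) endvec" and v1 v2 v3 :: "('m, real^'n) tvec"
  assumes "strong_HKT A g I J K H nablaL"
    and "nablaM = torsion_conn A g nablaL (- 1/2) H"
    and "(p, K') \<in> twistor_space A g"
    and "X1 \<in> twistor_tangent A g (p, K')"
    and "X2 \<in> twistor_tangent A g (p, K')"
    and "X3 \<in> twistor_tangent A g (p, K')"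
    and "end_proj A (p, K') X1 = v1"
    and "end_proj A (p, K') X2 = v2"
    and "end_proj A (p, K') X3 = v3"
  shows "(twistor_dc_form A g nablaM I (p, K') X1 X2 X3 = twistor_dc_form A g nablaM J (p, K') X1 X2 X3
        \<and> twistor_dc_form A g nablaM J (p, K') X1 X2 X3 = twistor_dc_form A g nablaM K (p, K') X1 X2 X3)
    \<and> twistor_dc_form A g nablaM I (p, K') X1 X2 X3 =
        (end_trace A p (commutator (curvature A nablaM p v1 v2) K' \<circ> vertical_proj A g nablaM (p, K') X3)
       + end_trace A p (commutator (curvature A nablaM p v2 v3) K' \<circ> vertical_proj A g nablaM (p, K') X1)
       + end_trace A p (commutator (curvature A nablaM p v3 v1) K' \<circ> vertical_proj A g nablaM (p, K') X2))
       - H p [v1, v2, v3]"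
proof -
  have "hkt A g I H nablaL" "hkt A g J H nablaL" "hkt A g K H nablaL"
    using assms(1) unfolding strong_HKT_def by (blast intro: hkt.intro)+
  note eq = this[THEN hkt.twistor_dc_form_eq[OF _ assms(3-9)]]
  show ?thesis unfolding assms(2) eq by (intro conjI refl)
qed

end
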